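(* Let $N=1$ and $\alpha\in(0,1]$. There exist $L_1,L_2>0$, $\delta^*\in(-1,0)$ and $\vartheta^*>0$ such that the following holds. Let $\mathbf A^+,\mathbf A^-\in\mathbb S^2$ and let $\vartheta$ be the angle between them. If $0<\vartheta\le\vartheta^*$, then there exists a solution $\mathbf m$ of (LLG$_\alpha$) with initial condition $\mathbf m^0_{\mathbf A^\pm}$. Moreover, there exists $0<c<\frac{\sqrt\alpha}{2\sqrt\pi}$ such that $\mathbf m$ coincides up to a rotation with the self-similar solution $\mathbf m_{c,\alpha}$, i.e. there exists $\mathcal R\in SO(3)$, depending only on $\mathbf A^+$, $\mathbf A^-$, $\alpha$ and $c$, such that $$\mathbf m=\mathcal R\mathbf m_{c,\alpha},$$ and $\mathbf m$ is the unique solution satisfying $$\inf_{x\in\mathbb R,\,t>0}m_3(x,t)\ge\delta^*\quad\text{and}\quad[\mathbf m]_X\le L_1+L_2c.$$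
   Context: $\mathbb R^+=(0,\infty)$, $\mathbb R^-=(-\infty,0)$; $\mathbb S^2\subset\mathbb R^3$ is the unit sphere; $\chi_E$ is the characteristic function of $E$; $\mathbf m=(m_1,m_2,m_3)$. Set $\beta=\sqrt{1-\alpha^2}$. In dimension one, (LLG$_\alpha$) is $\partial_t\mathbf m=\beta\,\mathbf m\times\partial_{xx}\mathbf m-\alpha\,\mathbf m\times(\mathbf m\times\partial_{xx}\mathbf m)$ for $\mathbf m:\mathbb R\times\mathbb R^+\to\mathbb S^2$. For $\mathbf A^\pm\in\mathbb S^2$, $\mathbf m^0_{\mathbf A^\pm}:=\mathbf A^+\chi_{\mathbb R^+}+\mathbf A^-\chi_{\mathbb R^-}$. Uniqueness is among solutions with this initial condition. For $v:\mathbb R\times\mathbb R^+\to\mathbb R^3$ with $v,\partial_xv\in L^1_{loc}$, $$[v]_X=\sup_{t>0}\sqrt t\|\partial_xv(t)\|_{L^\infty}+\sup_{x\in\mathbb R,\,r>0}\Big(\frac1r\int_{(x-r,x+r)\times[0,r^2]}|\partial_yv(y,t)|^2\,dt\,dy\Big)^{1/2}.$$ Self-similar solutions: for $c>0$ let $(\mathbf f,\mathbf p,\mathbf q)$ be the solution on $\mathbb R$ of the Serret--Frenet system $$\mathbf f'=ce^{-\alpha s^2/4}\mathbf p,\qquad \mathbf p'=-ce^{-\alpha s^2/4}\mathbf f+\tfrac{\beta s}2\mathbf q,\qquad\mathbf q'=-\tfrac{\beta s}2\mathbf p,$$ with $\mathbf f(0)=(1,0,0)$, $\mathbf p(0)=(0,1,0)$,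 $\mathbf q(0)=(0,0,1)$, and put $\mathbf m_{c,\alpha}(x,t):=\mathbf f(x/\sqrt t)$; this is a smooth solution of (LLG$_\alpha$) on $\mathbb R\times\mathbb R^+$. Solution: $\mathbf m\in L^\infty_{loc}((0,\infty),H^1_{loc}(\mathbb R;\mathbb S^2))$ is a (weak) solution of (LLG$_\alpha$) with initial condition $\mathbf m^0$ if $\partial_t\mathbf m=\beta\,\partial_x(\mathbf m\times\partial_x\mathbf m)+\alpha\,\partial_{xx}\mathbf m+\alpha|\partial_x\mathbf m|^2\mathbf m$ in the sense of distributions on $\mathbb R\times(0,\infty)$, and $\|(\mathbf m(t)-\mathbf m^0)\varphi\|_{L^1}\to0$ as $t\to0^+$ for all $\varphi\in C_0^\infty(\mathbb R)$.
   Formalization: The bound inf m_3 ≥ δ* for m itself is claimed only if A^+ and A^- have nonnegative third components, since it fails for e.g. A^+=(0,0,-1); existence, m=R m_{c,α}, the bound on [m]_X and uniqueness hold for all A^±. *)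

theory Defs
  imports "HOL-Analysis.Analysis" "HOL-Probability.Essential_Supremum"
begin

text \<open>
  Space-time points are pairs \<open>(x, t)\<close>. All functions on the half-plane \<open>t > 0\<close> are total
  functions on \<open>real \<times> real\<close>; their values for \<open>t \<le> 0\<close> never matter.
\<close>

definition half_plane :: "(real \<times> real) set" where
  "half_plane = UNIV \<times> {0<..}"


section \<open>Test functions\<close>

definition dx :: "(real \<times> real \<Rightarrow> real) \<Rightarrow> real \<times> real \<Rightarrow> real" where
  "dx \<phi> = (\<lambda>(x, t). deriv (\<lambda>y. \<phi> (y, t)) x)"

definition dt :: "(real \<times> real \<Rightarrow> real) \<Rightarrow> real \<times> real \<Rightarrow> real" where
  "dt \<phi> = (\<lambda>(x, t). deriv (\<lambda>s. \<phi> (x, s)) t)"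

text \<open>
  Smoothness in the plane: all iterated partial derivatives are (Frechet) differentiable. In
  particular they are continuous, and mixed partials commute, so only one order of
  differentiation has to be listed.
\<close>

definition test_function :: "(real \<times> real \<Rightarrow> real) \<Rightarrow> bool" where
  "test_function \<phi> \<longleftrightarrow>
     (\<forall>i j. (dx ^^ i) ((dt ^^ j) \<phi>) differentiable_on UNIV) \<and>
     compact (closure {z. \<phi> z \<noteq> 0}) \<and> closure {z. \<phi> z \<noteq> 0} \<subseteq> half_plane"

definition test_function_line :: "(real \<Rightarrow> real) \<Rightarrow> bool" where
  "test_function_line \<phi> \<longleftrightarrow>
     (\<forall>i. (deriv ^^ i) \<phi> differentiable_on UNIV) \<and> compact (closure {x. \<phi> x \<noteq> 0})"


section \<open>The space X\<close>

definition L1_loc :: "(real \<times> real \<Rightarrow> real^3) \<Rightarrow> bool" where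
  "L1_loc v \<longleftrightarrow> (\<forall>K. compact K \<longrightarrow> K \<subseteq> half_plane \<longrightarrow> set_integrable lborel K v)"

definition weak_dx :: "(real \<times> real \<Rightarrow> real^3) \<Rightarrow> (real \<times> real \<Rightarrow> real^3) \<Rightarrow> bool" where
  "weak_dx v w \<longleftrightarrow> L1_loc v \<and> L1_loc w \<and>
     (\<forall>\<phi>. test_function \<phi> \<longrightarrow>
        (LINT z:half_plane|lborel. dx \<phi> z *\<^sub>R v z) = - (LINT z:half_plane|lborel. \<phi> z *\<^sub>R w z))"

definition ennsqrt :: "ennreal \<Rightarrow> ennreal" where
  "ennsqrt a = (if a = \<infinity> then \<infinity> else ennreal (sqrt (enn2real a)))"

text \<open>
  A weak derivative is only determined almost everywhere, whereas the supremum over \<open>t\<close> below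
  sees individual times. The infimum over all versions \<open>w\<close> of \<open>\<partial>\<^sub>x v\<close> makes this supremum the
  usual \<open>L\<^sup>\<infinity>\<close> one; the second summand is the same for all versions. If \<open>v\<close> has no weak
  derivative, the value is \<open>\<infinity>\<close>.
\<close>

definition X_seminorm :: "(real \<times> real \<Rightarrow> real^3) \<Rightarrow> ennreal" where
  "X_seminorm v = (INF w\<in>{w. weak_dx v w}.
     (SUP t\<in>{0<..}. ennreal (sqrt t) * esssup lborel (\<lambda>x. ennreal (norm (w (x, t))))) +
     (SUP x. SUP r\<in>{0<..}. ennsqrt (ennreal (1 / r) *
        (\<integral>\<^sup>+ z \<in> {x - r<..<x + r} \<times> {0..r\<^sup>2}. ennreal ((norm (w z))\<^sup>2) \<partial>lborel))))"


section \<open>Weak solutions\<close>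

text \<open>
  The second and third conditions say that \<open>m\<close> belongs to
  \<open>L\<^sup>\<infinity>\<^sub>l\<^sub>o\<^sub>c((0,\<infinity>), H\<^sup>1\<^sub>l\<^sub>o\<^sub>c(\<real>; S\<^sup>2))\<close>, with \<open>w = \<partial>\<^sub>x m\<close>. The fourth is the equation
  \<open>\<partial>\<^sub>t m = \<beta> \<partial>\<^sub>x(m \<times> \<partial>\<^sub>x m) + \<alpha> \<partial>\<^sub>x\<^sub>x m + \<alpha> |\<partial>\<^sub>x m|\<^sup>2 m\<close> tested against \<open>\<phi>\<close>.
\<close>

definition llg_solution ::
  "real \<Rightarrow> (real \<Rightarrow> real^3) \<Rightarrow> (real \<times> real \<Rightarrow> real^3) \<Rightarrow> bool" where
  "llg_solution \<alpha> m0 m \<longleftrightarrow>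
     set_borel_measurable lborel half_plane m \<and>
     (AE z in lborel. z \<in> half_plane \<longrightarrow> norm (m z) = 1) \<and>
     (\<exists>w. weak_dx m w \<and>
        (\<forall>a b r. 0 < a \<longrightarrow> (\<exists>C::real. AE t in lborel. a \<le> t \<and> t \<le> b \<longrightarrow>
           (\<integral>\<^sup>+ x \<in> {-r..r}. ennreal ((norm (m (x, t)))\<^sup>2 + (norm (w (x, t)))\<^sup>2) \<partial>lborel)
             \<le> ennreal C)) \<and>
        (\<forall>\<phi>. test_function \<phi> \<longrightarrow>
           - (LINT z:half_plane|lborel. dt \<phi> z *\<^sub>R m z) =
             - sqrt (1 - \<alpha>\<^sup>2) *\<^sub>R (LINT z:half_plane|lborel. dx \<phi> z *\<^sub>R cross3 (m z) (w z))
             + \<alpha> *\<^sub>R (LINT z:half_plane|lborel. dx (dx \<phi>) z *\<^sub>R m z)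
             + \<alpha> *\<^sub>R (LINT z:half_plane|lborel. \<phi> z *\<^sub>R ((norm (w z))\<^sup>2 *\<^sub>R m z)))) \<and>
     (\<forall>\<phi>. test_function_line \<phi> \<longrightarrow>
        ((\<lambda>t. \<integral>\<^sup>+ x. ennreal (norm (\<phi> x *\<^sub>R (m (x, t) - m0 x))) \<partial>lborel) \<longlongrightarrow> 0) (at_right 0))"

definition step_data :: "real^3 \<Rightarrow> real^3 \<Rightarrow> real \<Rightarrow> real^3" where
  "step_data Ap Am x = indicator {0<..} x *\<^sub>R Ap + indicator {..<0} x *\<^sub>R Am"

definition sphere_angle :: "real^3 \<Rightarrow> real^3 \<Rightarrow> real" where
  "sphere_angle A B = arccos (A \<bullet> B)"


section \<open>Self-similar solutions\<close>

definition serret_frenet ::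
  "real \<Rightarrow> real \<Rightarrow> (real \<Rightarrow> real^3) \<Rightarrow> (real \<Rightarrow> real^3) \<Rightarrow> (real \<Rightarrow> real^3) \<Rightarrow> bool" where
  "serret_frenet \<alpha> c f p q \<longleftrightarrow>
     f 0 = vector [1, 0, 0] \<and> p 0 = vector [0, 1, 0] \<and> q 0 = vector [0, 0, 1] \<and>
     (\<forall>s. (f has_vector_derivative (c * exp (- \<alpha> * s\<^sup>2 / 4)) *\<^sub>R p s) (at s) \<and>
          (p has_vector_derivative (- (c * exp (- \<alpha> * s\<^sup>2 / 4)) *\<^sub>R f s
              + (sqrt (1 - \<alpha>\<^sup>2) * s / 2) *\<^sub>R q s)) (at s) \<and>
          (q has_vector_derivative (- (sqrt (1 - \<alpha>\<^sup>2) * s / 2)) *\<^sub>R p s) (at s))"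

text \<open>
  The linear system has exactly one solution on the whole line, so the description is proper.
\<close>

definition profile :: "real \<Rightarrow> real \<Rightarrow> real \<Rightarrow> real^3" where
  "profile \<alpha> c = (THE f. \<exists>p q. serret_frenet \<alpha> c f p q)"

definition self_similar :: "real \<Rightarrow> real \<Rightarrow> real \<times> real \<Rightarrow> real^3" where
  "self_similar \<alpha> c = (\<lambda>(x, t). profile \<alpha> c (x / sqrt t))"


section \<open>The uniqueness class\<close>

text \<open>
  Functions on the half-plane are identified almost everywhere, so the infimum of the third
  component is the essential one.
\<close>

definition third_component_ge :: "real \<Rightarrow> (real \<times> real \<Rightarrow> real^3) \<Rightarrow> bool" where
  "third_component_ge \<delta> m \<longleftrightarrow> (AE z in lborel. z \<in> half_plane \<longrightarrow> \<delta> \<le> m z $ 3)"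

end

theory Submission
  imports Defs
begin

text \<open>
  Write \<open>s = x / sqrt t\<close>. The profile \<open>f\<close> stays within \<open>O(c exp(- \<bar>s\<bar>))\<close> of its two ends, which gives the
  seminorm bound and the initial condition; the angle between the ends is continuous in \<open>c\<close>, so
  by the intermediate value theorem every small angle is attained, and a rotation adjusts the ends.

  Uniqueness is a weak-strong argument. For constant \<open>A\<close>, the density \<open>1 - A \<bullet> M\<close> of a solution \<open>M\<close> has the source
  \<open>- \<alpha> (A \<bullet> M) \<bar>M\<^sub>x\<bar>\<^sup>2\<close>. Small seminorm keeps \<open>M\<close> within a right angle of both ends, so the source has a sign and \<open>M\<close>
  approaches its initial value at rate \<open>sqrt t\<close> in integral mean. Comparing \<open>M\<close> with the self-similar solution \<open>n\<close>, the growth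
  rate of the localised integral of \<open>1 - n \<bullet> M\<close> is at most a small multiple of \<open>1 / t\<close>, which cannot build up from data
  of size \<open>sqrt t\<close>. The same comparison with a constant map shows that the ends are distinct when \<open>c > 0\<close>.
\<close>

section \<open>Smooth functions\<close>

text \<open>The obstacle is the quasilinear term \<beta> (m x m_x)_x: it does not vanish when two
  rough solutions are subtracted, and it costs a derivative. Here one of the two is smooth and
  explicit. In the density 1 - n . M the cross products collapse to terms linear in n_x - W, and the
  exchange energy supplies the negative square of the same quantity, so they can be absorbed. What
  is left has a coefficient of critical size 1 / t, which is not integrable at t = 0, so a Gronwall
  argument cannot start from the initial value alone. A coefficient of at most 1 / (4 t) is undone
  exactly by the weight t^(-1/4), and data of size sqrt t still vanish after that weight. The sqrt t
  rate needs the sign of the source, hence pointwise closeness to both ends. That comes from the two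
  halves of the seminorm: the integral half bounds the source on a parabolic cylinder before any
  sign is known, and the sup half makes M Lipschitz at scale sqrt t, which turns averages into
  pointwise bounds. No decay at infinity is assumed of M, so everything is localised at scale R,
  with an error of order 1 / R.\<close>

primrec Dk :: "nat \<Rightarrow> real set \<Rightarrow> (real \<Rightarrow> real) \<Rightarrow> bool" where
  "Dk 0 S f \<longleftrightarrow> True"
| "Dk (Suc k) S f \<longleftrightarrow> (\<forall>x\<in>S. f differentiable (at x)) \<and> Dk k S (deriv f)"

text \<open>Order \<open>0\<close> of \<open>Dk\<close> asserts nothing and each further order asks
  only for pointwise derivatives, so closure properties are plain inductions on \<open>k\<close>
  with no continuity to carry along. Demanding every order gives continuity of all derivatives
  back.\<close>

definition smooth1 :: "real set \<Rightarrow> (real \<Rightarrow> real) \<Rightarrow> bool" where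
  "smooth1 S f \<longleftrightarrow> (\<forall>k. Dk k S f)"

text \<open>On an open set both differentiability and the value of \<open>deriv\<close> depend only
  on values inside the set. This is what allows \<open>deriv f\<close> to be replaced by an explicit
  formula valid only on \<open>S\<close>, as \<open>Dk_SucI\<close> does.\<close>

lemma Dk_cong:
  assumes "open S" "\<And>x. x \<in> S \<Longrightarrow> f x = g x" "Dk k S f"
  shows "Dk k S g"
  using assms(2,3)
proof (induction k arbitrary: f g)
  case (Suc k)
  have "(g has_field_derivative deriv f x) (at x)" if "x \<in> S" for x
  proof -
    have "(f has_field_derivative deriv f x) (at x)"
      using Suc.prems that by (simp add: DERIV_deriv_iff_real_differentiable)
    then show ?thesis
      using Suc.prems(1) assms(1) that
      by (metis has_field_derivative_transform_within_open)
  qed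
  then show ?case
    using Suc.IH[of "deriv f" "deriv g"] Suc.prems
    by (auto simp: real_differentiable_def intro: DERIV_imp_deriv[symmetric])
qed simp

lemma Dk_SucI:
  assumes "open S" "\<And>x. x \<in> S \<Longrightarrow> (f has_real_derivative f' x) (at x)" "Dk k S f'"
  shows "Dk (Suc k) S f"
proof -
  have "Dk k S (deriv f)"
    by (rule Dk_cong[OF assms(1) _ assms(3)]) (metis DERIV_imp_deriv assms(2))
  then show ?thesis using assms(2) by (auto simp: real_differentiable_def)
qed

lemma Dk_SucD:
  assumes "Dk (Suc k) S f" "x \<in> S"
  shows "(f has_real_derivative deriv f x) (at x)"
  using assms by (simp add: DERIV_deriv_iff_real_differentiable)

lemma Dk_mono: "Dk (Suc k) S f \<Longrightarrow> Dk k S f"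
  by (induction k arbitrary: f) auto

lemma Dk_const: "open S \<Longrightarrow> Dk k S (\<lambda>x. c)"
proof (induction k arbitrary: c)
  case (Suc k) then show ?case by (intro Dk_SucI[where f'="\<lambda>x. 0"]) auto
qed simp

lemma Dk_id: "open S \<Longrightarrow> Dk k S (\<lambda>x. x)"
proof (cases k)
  case (Suc n) assume "open S" then show ?thesis unfolding Suc
    by (intro Dk_SucI[where f'="\<lambda>x. 1"] Dk_const) auto
qed simp

lemma Dk_add: "open S \<Longrightarrow> Dk k S f \<Longrightarrow> Dk k S g \<Longrightarrow> Dk k S (\<lambda>x. f x + g x)"
proof (induction k arbitrary: f g)
  case (Suc k)
  show ?case
    by (rule Dk_SucI[where f'="\<lambda>x. deriv f x + deriv g x"])
      (use Suc in \<open>auto intro!: derivative_eq_intros Dk_SucD\<close>)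
qed simp

lemma Dk_mult: "open S \<Longrightarrow> Dk k S f \<Longrightarrow> Dk k S g \<Longrightarrow> Dk k S (\<lambda>x. f x * g x)"
proof (induction k arbitrary: f g)
  case (Suc k)
  have "((\<lambda>x. f x * g x) has_real_derivative deriv f x * g x + f x * deriv g x) (at x)" if "x \<in> S" for x
    using Dk_SucD[OF Suc.prems(2) that] Dk_SucD[OF Suc.prems(3) that]
    by (auto intro!: derivative_eq_intros)
  then show ?case
    using Suc.prems Dk_mono[OF Suc.prems(2)] Dk_mono[OF Suc.prems(3)]
    by (intro Dk_SucI[where f'="\<lambda>x. deriv f x * g x + f x * deriv g x"] Dk_add Suc.IH) auto
qed simp

lemma Dk_inverse:
  assumes S: "open S" and nz: "\<And>x. x \<in> S \<Longrightarrow> f x \<noteq> 0"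
  shows "Dk k S f \<Longrightarrow> Dk k S (\<lambda>x. inverse (f x))"
proof (induction k)
  case (Suc k)
  have "((\<lambda>x. inverse (f x)) has_real_derivative (-1) * (deriv f x * (inverse (f x) * inverse (f x)))) (at x)" if "x \<in> S" for x
    using Dk_SucD[OF Suc.prems that] nz[OF that]
    by (auto intro!: derivative_eq_intros)
  then show ?case
    using Suc.prems Suc.IH Dk_mono[OF Suc.prems]
    by (intro Dk_SucI[OF S, where f'="\<lambda>x. (-1) * (deriv f x * (inverse (f x) * inverse (f x)))"] Dk_mult Dk_const S) auto
qed simp

lemma Dk_comp:
  assumes S: "open S" "open T" and fS: "\<And>x. x \<in> S \<Longrightarrow> f x \<in> T"
  shows "Dk k T g \<Longrightarrow> Dk k S f \<Longrightarrow> Dk k S (\<lambda>x. g (f x))"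
proof (induction k arbitrary: g)
  case (Suc k)
  have "((\<lambda>x. g (f x)) has_real_derivative deriv g (f x) * deriv f x) (at x)" if "x \<in> S" for x
    by (rule DERIV_chain2[OF Dk_SucD[OF Suc.prems(1) fS[OF that]] Dk_SucD[OF Suc.prems(2) that]])
  then show ?case
    using Suc.prems Dk_mono[OF Suc.prems(2)]
    by (intro Dk_SucI[OF S(1), where f'="\<lambda>x. deriv g (f x) * deriv f x"] Dk_mult[OF S(1)] Suc.IH[of "deriv g"]) auto
qed simp

lemma smooth1I:
  assumes "open S" "\<And>x. x \<in> S \<Longrightarrow> (f has_real_derivative f' x) (at x)" "smooth1 S f'"
  shows "smooth1 S f"
  unfolding smooth1_def
proof
  fix k show "Dk k S f"
  proof (cases k)
    case (Suc n)
    then show ?thesis using Dk_SucI[OF assms(1,2), of n] assms(3) by (simp add: smooth1_def del: Dk.simps(2))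
  qed simp
qed

lemma smooth1D:
  assumes "smooth1 S f"
  shows "x \<in> S \<Longrightarrow> (f has_real_derivative deriv f x) (at x)" "smooth1 S (deriv f)"
  using assms unfolding smooth1_def by (metis Dk_SucD, metis Dk.simps(2))

lemma smooth1_intros:
  assumes "open S"
  shows "smooth1 S (\<lambda>x. c)" "smooth1 S (\<lambda>x. x)"
    "smooth1 S f \<Longrightarrow> smooth1 S g \<Longrightarrow> smooth1 S (\<lambda>x. f x + g x)"
    "smooth1 S f \<Longrightarrow> smooth1 S g \<Longrightarrow> smooth1 S (\<lambda>x. f x * g x)"
  using assms by (auto simp: smooth1_def Dk_const Dk_id Dk_add Dk_mult)

lemma smooth1_inverse: "open S \<Longrightarrow> (\<And>x. x \<in> S \<Longrightarrow> f x \<noteq> 0) \<Longrightarrow> smooth1 S f \<Longrightarrow> smooth1 S (\<lambda>x. inverse (f x))"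
  by (simp add: smooth1_def Dk_inverse)

lemma smooth1_comp: "open S \<Longrightarrow> open T \<Longrightarrow> (\<And>x. x \<in> S \<Longrightarrow> f x \<in> T) \<Longrightarrow> smooth1 T g \<Longrightarrow> smooth1 S f \<Longrightarrow> smooth1 S (\<lambda>x. g (f x))"
  by (simp add: smooth1_def Dk_comp)

lemma smooth1_subset:
  assumes "S \<subseteq> T" "smooth1 T f" shows "smooth1 S f"
proof -
  have "Dk k T f \<Longrightarrow> Dk k S f" for k using assms(1) by (induction k arbitrary: f) auto
  then show ?thesis using assms(2) by (auto simp: smooth1_def)
qed

lemma smooth1_continuous: "smooth1 S f \<Longrightarrow> continuous_on S f"
  using smooth1D(1) by (meson DERIV_isCont continuous_at_imp_continuous_on)

lemma smooth1_exp: "smooth1 UNIV exp"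
  unfolding smooth1_def
proof
  fix k show "Dk k UNIV (exp::real\<Rightarrow>real)"
    by (induction k) (simp, auto intro: Dk_SucI[where f'=exp] simp del: Dk.simps(2))
qed

lemma smooth1_ln: "smooth1 {0<..} (ln :: real \<Rightarrow> real)"
proof (rule smooth1I)
  show "(ln has_real_derivative inverse x) (at x)" if "x \<in> {0<..}" for x :: real
    using that DERIV_ln by auto
qed (auto intro!: smooth1_inverse smooth1_intros)

lemma smooth1_powr: "smooth1 {0<..} (\<lambda>t::real. t powr a)"
proof -
  have "smooth1 {0<..} (\<lambda>t::real. exp (a * ln t))"
    by (intro smooth1_comp[OF _ open_UNIV _ smooth1_exp] smooth1_intros smooth1_ln) auto
  then show ?thesis unfolding smooth1_def
    using Dk_cong[of "{0<..}" "\<lambda>t. exp (a * ln t)" "\<lambda>t. t powr a"] by (auto simp: powr_def)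
qed

lemma smooth1_iterated_deriv:
  "smooth1 UNIV f \<Longrightarrow> (deriv ^^ i) f differentiable_on UNIV"
proof (induction i arbitrary: f)
  case 0
  then have "Dk (Suc 0) UNIV f" by (auto simp: smooth1_def)
  then show ?case by (auto simp: differentiable_on_def)
next
  case (Suc i)
  show ?case using Suc.IH[OF smooth1D(2)[OF Suc.prems]] by (simp only: funpow_Suc_right o_def)
qed

section \<open>Smooth functions of two variables\<close>

primrec Ck :: "nat \<Rightarrow> (real \<times> real) set \<Rightarrow> (real \<times> real \<Rightarrow> real) \<Rightarrow> bool" where
  "Ck 0 U f \<longleftrightarrow> True"
| "Ck (Suc k) U f \<longleftrightarrow> (\<forall>z\<in>U. f differentiable (at z)) \<and> Ck k U (dx f) \<and> Ck k U (dt f)"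

definition smooth2 :: "(real \<times> real) set \<Rightarrow> (real \<times> real \<Rightarrow> real) \<Rightarrow> bool" where
  "smooth2 U f \<longleftrightarrow> (\<forall>k. Ck k U f)"

abbreviation has_grad :: "(real \<times> real \<Rightarrow> real) \<Rightarrow> real \<Rightarrow> real \<Rightarrow> real \<times> real \<Rightarrow> bool" where
  "has_grad f a b z \<equiv> (f has_derivative (\<lambda>h. a * fst h + b * snd h)) (at z)"

lemma has_grad_partial:
  assumes "has_grad f a b (x, t)"
  shows "((\<lambda>y. f (y, t)) has_real_derivative a) (at x)" "((\<lambda>s. f (x, s)) has_real_derivative b) (at t)"
proof -
  have "((\<lambda>y. (y, t)) has_derivative (\<lambda>h. (h, 0))) (at x)" by (auto intro!: derivative_eq_intros)
  from has_derivative_compose[OF this assms]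
  show "((\<lambda>y. f (y, t)) has_real_derivative a) (at x)" by (simp add: has_field_derivative_def mult_commute_abs)
  have "((\<lambda>s. (x, s)) has_derivative (\<lambda>h. (0, h))) (at t)" by (auto intro!: derivative_eq_intros)
  from has_derivative_compose[OF this assms]
  show "((\<lambda>y. f (x, y)) has_real_derivative b) (at t)" by (simp add: has_field_derivative_def mult_commute_abs)
qed

lemma has_grad_dx_dt:
  assumes "has_grad f a b z" shows "dx f z = a" "dt f z = b"
  using has_grad_partial[of f a b "fst z" "snd z"] assms
  by (auto simp: dx_def dt_def split_beta intro!: DERIV_imp_deriv)

lemma differentiable_has_grad:
  assumes "f differentiable (at z)" shows "has_grad f (dx f z) (dt f z) z"
proof -
  obtain D where D: "(f has_derivative D) (at z)" using assms by (auto simp: differentiable_def)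
  interpret bounded_linear D using D by (rule has_derivative_bounded_linear)
  have "D h = D (1, 0) * fst h + D (0, 1) * snd h" for h
  proof -
    have "h = fst h *\<^sub>R (1, 0) + snd h *\<^sub>R (0, 1)" by (cases h) simp
    then have "D h = fst h *\<^sub>R D (1, 0) + snd h *\<^sub>R D (0, 1)" by (metis add scaleR)
    then show ?thesis by simp
  qed
  then have "D = (\<lambda>h. D (1, 0) * fst h + D (0, 1) * snd h)" by (rule ext)
  with D have "has_grad f (D (1, 0)) (D (0, 1)) z" by (rule has_derivative_eq_rhs)
  then show ?thesis unfolding has_grad_dx_dt[OF \<open>has_grad f (D (1, 0)) (D (0, 1)) z\<close>] .
qed

lemma Ck_SucD: "Ck (Suc k) U f \<Longrightarrow> z \<in> U \<Longrightarrow> has_grad f (dx f z) (dt f z) z"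
  by (rule differentiable_has_grad) simp

lemma Ck_cong:
  assumes "open U" "\<And>z. z \<in> U \<Longrightarrow> f z = g z" "Ck k U f"
  shows "Ck k U g"
  using assms(2,3)
proof (induction k arbitrary: f g)
  case (Suc k)
  have g: "has_grad g (dx f z) (dt f z) z" if "z \<in> U" for z
    by (rule has_derivative_transform_within_open[OF Ck_SucD[OF Suc.prems(2) that] assms(1) that])
      (rule Suc.prems(1))
  have "dx f z = dx g z" "dt f z = dt g z" if "z \<in> U" for z
    using has_grad_dx_dt[OF g[OF that]] by simp_all
  then have "Ck k U (dx g)" "Ck k U (dt g)"
    using Suc.IH[of "dx f" "dx g"] Suc.IH[of "dt f" "dt g"] Suc.prems(2) by simp_all
  moreover have "g differentiable (at z)" if "z \<in> U" for z
    using g[OF that] unfolding differentiable_def by blast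
  ultimately show ?case by simp
qed simp

lemma Ck_SucI:
  assumes "open U" "\<And>z. z \<in> U \<Longrightarrow> has_grad f (fx z) (ft z) z" "Ck k U fx" "Ck k U ft"
  shows "Ck (Suc k) U f"
proof -
  have "Ck k U (dx f)"
    by (rule Ck_cong[OF assms(1) _ assms(3)]) (rule has_grad_dx_dt(1)[OF assms(2), symmetric])
  moreover have "Ck k U (dt f)"
    by (rule Ck_cong[OF assms(1) _ assms(4)]) (rule has_grad_dx_dt(2)[OF assms(2), symmetric])
  moreover have "f differentiable (at z)" if "z \<in> U" for z
    using assms(2)[OF that] unfolding differentiable_def by blast
  ultimately show ?thesis by simp
qed

lemma Ck_Suc_iff:
  "Ck (Suc k) U f \<longleftrightarrow> (\<forall>z\<in>U. f differentiable (at z)) \<and> Ck k U (dx f) \<and> Ck k U (dt f)"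
  by simp

lemmas [simp del] = Ck.simps(2)

lemma Ck_mono: "Ck (Suc k) U f \<Longrightarrow> Ck k U f"
proof (induction k arbitrary: f)
  case (Suc k)
  then show ?case unfolding Ck_Suc_iff[of "Suc k"] Ck_Suc_iff[of k U f] by blast
qed simp

lemma Ck_const: "open U \<Longrightarrow> Ck k U (\<lambda>x. c)"
proof (induction k arbitrary: c)
  case (Suc k)
  have "has_grad (\<lambda>x. c) 0 0 z" for z :: "real \<times> real" by simp
  from Ck_SucI[OF Suc.prems this Suc.IH[OF Suc.prems] Suc.IH[OF Suc.prems]] show ?case .
qed simp

lemma Ck_fst: assumes "open U" shows "Ck k U fst"
proof (cases k)
  case (Suc n)
  have "has_grad fst 1 0 z" for z :: "real \<times> real" by (auto intro!: derivative_eq_intros)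
  from Ck_SucI[OF assms this Ck_const[OF assms] Ck_const[OF assms]] show ?thesis unfolding Suc .
qed simp

lemma Ck_snd: assumes "open U" shows "Ck k U snd"
proof (cases k)
  case (Suc n)
  have "has_grad snd 0 1 z" for z :: "real \<times> real" by (auto intro!: derivative_eq_intros)
  from Ck_SucI[OF assms this Ck_const[OF assms] Ck_const[OF assms]] show ?thesis unfolding Suc .
qed simp

lemma Ck_add: "open U \<Longrightarrow> Ck k U f \<Longrightarrow> Ck k U g \<Longrightarrow> Ck k U (\<lambda>x. f x + g x)"
proof (induction k arbitrary: f g)
  case (Suc k)
  have "has_grad (\<lambda>x. f x + g x) (dx f z + dx g z) (dt f z + dt g z) z" if "z \<in> U" for z
    by (rule has_derivative_eq_rhs[OF has_derivative_add[OF Ck_SucD[OF Suc.prems(2) that] Ck_SucD[OF Suc.prems(3) that]]])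
      (simp add: algebra_simps)
  then show ?case
    using Suc.prems by (intro Ck_SucI[where fx="\<lambda>z. dx f z + dx g z" and ft="\<lambda>z. dt f z + dt g z"] Suc.IH) (auto simp: Ck_Suc_iff)
qed simp

lemma has_grad_mult:
  assumes "has_grad f a b z" "has_grad g c d z"
  shows "has_grad (\<lambda>x. f x * g x) (a * g z + f z * c) (b * g z + f z * d) z"
  by (rule has_derivative_eq_rhs[OF has_derivative_mult[OF assms]]) (simp add: algebra_simps)

lemma Ck_mult: "open U \<Longrightarrow> Ck k U f \<Longrightarrow> Ck k U g \<Longrightarrow> Ck k U (\<lambda>x. f x * g x)"
proof (induction k arbitrary: f g)
  case (Suc k)
  have "has_grad (\<lambda>x. f x * g x) (dx f z * g z + f z * dx g z) (dt f z * g z + f z * dt g z) z" if "z \<in> U" for z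
    using has_grad_mult[OF Ck_SucD[OF Suc.prems(2) that] Ck_SucD[OF Suc.prems(3) that]] .
  then show ?case
    using Suc.prems Ck_mono[OF Suc.prems(2)] Ck_mono[OF Suc.prems(3)]
    by (intro Ck_SucI[where fx="\<lambda>z. dx f z * g z + f z * dx g z" and ft="\<lambda>z. dt f z * g z + f z * dt g z"] Ck_add Suc.IH) (auto simp: Ck_Suc_iff)
qed simp

lemma has_grad_comp:
  assumes "has_grad f a b z" "(g has_real_derivative g') (at (f z))"
  shows "has_grad (\<lambda>x. g (f x)) (g' * a) (g' * b) z"
  by (rule has_derivative_eq_rhs[OF has_derivative_compose[OF assms(1) assms(2)[unfolded has_field_derivative_def]]])
    (simp add: algebra_simps)

lemma Ck_comp:
  assumes S: "open U" "open T" and fS: "\<And>x. x \<in> U \<Longrightarrow> f x \<in> T"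
  shows "Dk k T g \<Longrightarrow> Ck k U f \<Longrightarrow> Ck k U (\<lambda>x. g (f x))"
proof (induction k arbitrary: g)
  case (Suc k)
  have "has_grad (\<lambda>x. g (f x)) (deriv g (f z) * dx f z) (deriv g (f z) * dt f z) z" if "z \<in> U" for z
    using has_grad_comp[OF Ck_SucD[OF Suc.prems(2) that] Dk_SucD[OF Suc.prems(1) fS[OF that]]] .
  then show ?case
    using Suc.prems Ck_mono[OF Suc.prems(2)]
    by (intro Ck_SucI[OF S(1), where fx="\<lambda>z. deriv g (f z) * dx f z" and ft="\<lambda>z. deriv g (f z) * dt f z"]
      Ck_mult[OF S(1)] Suc.IH[of "deriv g"]) (auto simp: Ck_Suc_iff)
qed simp

text \<open>Differentiability is taken with respect to the full neighbourhood filter of each point,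
  so it does not refer to the set at all and gluing is free.\<close>

lemma Ck_Un: "Ck k U f \<Longrightarrow> Ck k V f \<Longrightarrow> Ck k (U \<union> V) f"
  by (induction k arbitrary: f) (auto simp: Ck_Suc_iff)

lemma smooth2D:
  assumes "smooth2 U f"
  shows "z \<in> U \<Longrightarrow> has_grad f (dx f z) (dt f z) z" "smooth2 U (dx f)" "smooth2 U (dt f)"
  using assms unfolding smooth2_def by (metis Ck_SucD, metis Ck_Suc_iff, metis Ck_Suc_iff)

lemma smooth2_intros:
  assumes "open U"
  shows "smooth2 U (\<lambda>x. c)" "smooth2 U fst" "smooth2 U snd"
    "smooth2 U f \<Longrightarrow> smooth2 U g \<Longrightarrow> smooth2 U (\<lambda>x. f x + g x)"
    "smooth2 U f \<Longrightarrow> smooth2 U g \<Longrightarrow> smooth2 U (\<lambda>x. f x * g x)"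
  using assms by (auto simp: smooth2_def Ck_const Ck_fst Ck_snd Ck_add Ck_mult)

lemma smooth2_comp: "open U \<Longrightarrow> open T \<Longrightarrow> (\<And>x. x \<in> U \<Longrightarrow> f x \<in> T) \<Longrightarrow> smooth1 T g \<Longrightarrow> smooth2 U f \<Longrightarrow> smooth2 U (\<lambda>x. g (f x))"
  by (simp add: smooth1_def smooth2_def Ck_comp)

lemma smooth2_subset:
  assumes "S \<subseteq> T" "smooth2 T f" shows "smooth2 S f"
proof -
  have "Ck k T f \<Longrightarrow> Ck k S f" for k
    using assms(1) by (induction k arbitrary: f) (auto simp: Ck_Suc_iff)
  then show ?thesis using assms(2) by (auto simp: smooth2_def)
qed

lemma smooth2_continuous: "smooth2 U f \<Longrightarrow> continuous_on U f"
  using smooth2D(1) by (meson has_derivative_continuous continuous_at_imp_continuous_on)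

lemma open_half_plane: "open half_plane"
  unfolding half_plane_def by (intro open_Times) auto

lemma half_plane_iff [simp]: "(x, t) \<in> half_plane \<longleftrightarrow> 0 < t" "z \<in> half_plane \<longleftrightarrow> 0 < snd z"
  by (auto simp: half_plane_def mem_Times_iff)

text \<open>Functions on the half-plane have arbitrary values for t <= 0. A function that vanishes
  below a positive time is smooth on two overlapping open sets that cover the plane.\<close>

lemma smooth2_extend:
  assumes "smooth2 half_plane f" "0 < a" "\<And>z. snd z < a \<Longrightarrow> f z = 0"
  shows "smooth2 UNIV f"
proof -
  have o: "open {z::real\<times>real. snd z < a}" by (intro open_Collect_less continuous_intros)
  have "Ck k {z. snd z < a} f" for k
    by (rule Ck_cong[OF o _ Ck_const[OF o, of k 0]]) (simp add: assms(3))
  with assms(1) have "Ck k ({z. snd z < a} \<union> half_plane) f" for k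
    by (intro Ck_Un) (auto simp: smooth2_def)
  moreover have "{z. snd z < a} \<union> half_plane = UNIV" using assms(2) by auto
  ultimately show ?thesis by (simp add: smooth2_def)
qed

section \<open>Test functions with support in a rectangle\<close>

text \<open>Support in a rectangle rather than in a compact set, for Fubini.\<close>

definition supp_box :: "real \<Rightarrow> real \<Rightarrow> real \<Rightarrow> real \<Rightarrow> (real \<times> real \<Rightarrow> real) \<Rightarrow> bool" where
  "supp_box a b c d f \<longleftrightarrow> 0 < c \<and> (\<forall>x t. f (x, t) \<noteq> 0 \<longrightarrow> a \<le> x \<and> x \<le> b \<and> c \<le> t \<and> t \<le> d)"

definition test_fun :: "(real \<times> real \<Rightarrow> real) \<Rightarrow> bool" where
  "test_fun \<phi> \<longleftrightarrow> smooth2 UNIV \<phi> \<and> (\<exists>a b c d. supp_box a b c d \<phi>)"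

lemma supp_box_dx:
  assumes "supp_box a b c d f" shows "supp_box a b c d (dx f)" "supp_box a b c d (dt f)"
proof -
  have o: "open (- (cbox (a, c) (b, d)))" by (intro open_Compl closed_cbox)
  have "has_grad f 0 0 z" if "z \<notin> cbox (a, c) (b, d)" for z
  proof (rule has_derivative_transform_within_open[OF _ o])
    show "((\<lambda>x. 0) has_derivative (\<lambda>h. 0 * fst h + 0 * snd h)) (at z)" by simp
  qed (use that assms in \<open>auto simp: supp_box_def cbox_Pair_eq\<close>)
  then have "dx f z = 0 \<and> dt f z = 0" if "z \<notin> cbox (a, c) (b, d)" for z
    using has_grad_dx_dt[of f 0 0 z] that by auto
  from this[of "(_, _)"] have "dx f (x, t) = 0 \<and> dt f (x, t) = 0" if "\<not> (a \<le> x \<and> x \<le> b \<and> c \<le> t \<and> t \<le> d)" for x t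
    using that by (auto simp: cbox_Pair_eq)
  then show "supp_box a b c d (dx f)" "supp_box a b c d (dt f)"
    using assms unfolding supp_box_def by blast+
qed

lemma smooth2_iterated:
  "smooth2 UNIV f \<Longrightarrow> (dx ^^ i) ((dt ^^ j) f) differentiable_on UNIV"
proof -
  assume "smooth2 UNIV f"
  then have "smooth2 UNIV ((dt ^^ j) f)" by (induction j) (auto simp: smooth2D)
  then have "smooth2 UNIV ((dx ^^ i) ((dt ^^ j) f))" by (induction i) (auto simp: smooth2D)
  from smooth2D(1)[OF this] show ?thesis by (auto simp: differentiable_on_def differentiable_def)
qed

lemma test_fun_test_function:
  assumes "test_fun \<phi>" shows "test_function \<phi>"
proof -
  obtain a b c d where s: "supp_box a b c d \<phi>" using assms by (auto simp: test_fun_def)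
  have "{z. \<phi> z \<noteq> 0} \<subseteq> cbox (a, c) (b, d)" using s by (auto simp: supp_box_def cbox_Pair_eq)
  then have c: "closure {z. \<phi> z \<noteq> 0} \<subseteq> cbox (a, c) (b, d)" by (intro closure_minimal) auto
  moreover have "cbox (a, c) (b, d) \<subseteq> half_plane" using s by (auto simp: supp_box_def cbox_Pair_eq)
  moreover have "compact (closure {z. \<phi> z \<noteq> 0})"
    using c by (meson bounded_cbox bounded_closure bounded_subset closed_closure compact_eq_bounded_closed)
  ultimately show ?thesis
    using assms by (auto simp: test_function_def test_fun_def smooth2_iterated)
qed

lemma test_fun_dx: assumes "test_fun \<phi>" shows "test_fun (dx \<phi>)" "test_fun (dt \<phi>)"
  using assms supp_box_dx unfolding test_fun_def by (meson smooth2D)+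

text \<open>The multiplier has to be smooth for t > 0 only. This admits the components of a smooth
  solution, which are singular at the origin, as factors of a test function.\<close>

lemma test_fun_mult:
  assumes "test_fun \<phi>" "smooth2 half_plane g" shows "test_fun (\<lambda>z. \<phi> z * g z)"
proof -
  obtain a b c d where s: "supp_box a b c d \<phi>" using assms by (auto simp: test_fun_def)
  have "smooth2 UNIV (\<lambda>z. \<phi> z * g z)"
  proof (rule smooth2_extend)
    show "smooth2 half_plane (\<lambda>z. \<phi> z * g z)"
      using assms smooth2_subset[of half_plane UNIV]
      by (intro smooth2_intros open_half_plane) (auto simp: test_fun_def)
    show "0 < c" using s by (simp add: supp_box_def)
    show "\<phi> z * g z = 0" if "snd z < c" for z
      using s that by (cases z) (force simp: supp_box_def)
  qed
  moreover have "supp_box a b c d (\<lambda>z. \<phi> z * g z)" using s by (auto simp: supp_box_def)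
  ultimately show ?thesis unfolding test_fun_def by blast
qed

lemma test_fun_product:
  assumes "smooth1 UNIV \<psi>" "\<And>x. \<psi> x \<noteq> 0 \<Longrightarrow> a \<le> x \<and> x \<le> b"
    "smooth1 {0<..} \<eta>" "0 < c" "\<And>t. \<eta> t \<noteq> 0 \<Longrightarrow> c \<le> t \<and> t \<le> d"
  shows "test_fun (\<lambda>(x, t). \<psi> x * \<eta> t)"
    "dx (\<lambda>(x, t). \<psi> x * \<eta> t) = (\<lambda>(x, t). deriv \<psi> x * \<eta> t)"
    "0 < t \<Longrightarrow> dt (\<lambda>(x, t). \<psi> x * \<eta> t) (x, t) = \<psi> x * deriv \<eta> t"
proof -
  let ?f = "\<lambda>z. \<psi> (fst z) * \<eta> (snd z)"
  have eq: "(\<lambda>(x, t). \<psi> x * \<eta> t) = ?f" by auto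
  have "smooth2 half_plane ?f"
    by (intro smooth2_intros open_half_plane smooth2_comp[OF open_half_plane open_UNIV _ assms(1)]
      smooth2_comp[OF open_half_plane _ _ assms(3)]) auto
  moreover have "?f z = 0" if "snd z < c" for z using assms(5) that by force
  ultimately have "smooth2 UNIV ?f" using smooth2_extend[OF _ assms(4)] by blast
  moreover have "supp_box a b c d ?f"
    using assms(2,4,5) by (auto simp: supp_box_def)
  ultimately show "test_fun (\<lambda>(x, t). \<psi> x * \<eta> t)" unfolding test_fun_def eq by blast
  have "((\<lambda>y. \<psi> y * \<eta> t) has_real_derivative deriv \<psi> x * \<eta> t) (at x)" for x t
    by (auto intro!: derivative_eq_intros smooth1D[OF assms(1)])
  then show "dx (\<lambda>(x, t). \<psi> x * \<eta> t) = (\<lambda>(x, t). deriv \<psi> x * \<eta> t)"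
    by (auto simp: dx_def intro!: DERIV_imp_deriv)
  assume "0 < t"
  then have "(\<eta> has_real_derivative deriv \<eta> t) (at t)" using smooth1D(1)[OF assms(3)] by simp
  then have "((\<lambda>s. \<psi> x * \<eta> s) has_real_derivative \<psi> x * deriv \<eta> t) (at t)"
    by (auto intro!: derivative_eq_intros)
  then show "dt (\<lambda>(x, t). \<psi> x * \<eta> t) (x, t) = \<psi> x * deriv \<eta> t"
    by (auto simp: dt_def intro!: DERIV_imp_deriv)
qed

text \<open>The primitive based at 0 is split by the sign of \<open>s\<close>. Near each point it
  differs by a constant from the primitive based at a far left endpoint, to which the fundamental
  theorem on an interval applies.\<close>

lemma antiderivative:
  fixes g :: "real \<Rightarrow> 'a::banach"
  assumes "continuous_on UNIV g"
  obtains G where "\<And>s. (G has_vector_derivative g s) (at s)" "G 0 = 0"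
proof -
  define G where "G s = (if 0 \<le> s then integral {0..s} g else - integral {s..0} g)" for s
  have int: "g integrable_on {a..b}" for a b
    by (rule integrable_continuous_real) (use assms continuous_on_subset in blast)
  have "(G has_vector_derivative g s) (at s)" for s
  proof -
    define N where "N = \<bar>s\<bar> + 1"
    have eq: "G u = integral {-N..u} g - integral {-N..0} g" if "u \<in> {-N<..<N}" for u
    proof (cases "0 \<le> u")
      case True
      have "integral {-N..0} g + integral {0..u} g = integral {-N..u} g"
        by (rule Henstock_Kurzweil_Integration.integral_combine) (use True in \<open>auto simp: N_def int\<close>)
      then show ?thesis using True by (simp add: G_def algebra_simps)
    next
      case False
      have "integral {-N..u} g + integral {u..0} g = integral {-N..0} g"
        by (rule Henstock_Kurzweil_Integration.integral_combine) (use False that in \<open>auto simp: int\<close>)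
      then show ?thesis using False by (simp add: G_def algebra_simps)
    qed
    have sN: "s \<in> {-N<..<N}" by (auto simp: N_def)
    have "((\<lambda>u. integral {-N..u} g) has_vector_derivative g s) (at s within {-N..N})"
    proof (rule integral_has_vector_derivative)
      show "continuous_on {-N..N} g" using assms continuous_on_subset by blast
    qed (use sN in auto)
    then have "((\<lambda>u. integral {-N..u} g) has_vector_derivative g s) (at s)"
      using sN by (simp add: at_within_Icc_at)
    then have "((\<lambda>u. integral {-N..u} g - integral {-N..0} g) has_vector_derivative g s) (at s)"
      by (auto intro!: derivative_eq_intros)
    then show ?thesis
      by (rule has_vector_derivative_transform_within_open[OF _ open_greaterThanLessThan sN]) (simp add: eq)
  qed
  moreover have "G 0 = 0" by (simp add: G_def)
  ultimately show ?thesis using that by blast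
qed

definition supp1 :: "real \<Rightarrow> real \<Rightarrow> (real \<Rightarrow> real) \<Rightarrow> bool" where
  "supp1 a b f \<longleftrightarrow> (\<forall>x. x \<notin> {a..b} \<longrightarrow> f x = 0)"

lemma supp1D: "supp1 a b f \<Longrightarrow> x \<notin> {a..b} \<Longrightarrow> f x = 0"
  by (simp add: supp1_def)

lemma supp1I: "(\<And>x. x \<notin> {a..b} \<Longrightarrow> f x = 0) \<Longrightarrow> supp1 a b f"
  by (simp add: supp1_def)

lemma smooth1_deriv_outside:
  assumes "smooth1 UNIV f" "\<And>x. x \<notin> {a..b} \<Longrightarrow> f x = c" "x \<notin> {a..b}"
  shows "deriv f x = 0"
proof -
  have "(f has_real_derivative 0) (at x)"
    by (rule has_field_derivative_transform_within_open[of "\<lambda>_. c" _ _ "- {a..b}"]) (use assms in auto)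
  then show ?thesis by (rule DERIV_imp_deriv)
qed

lemma supp1_deriv: "smooth1 UNIV f \<Longrightarrow> supp1 a b f \<Longrightarrow> supp1 a b (deriv f)"
  using smooth1_deriv_outside[of f a b 0] unfolding supp1_def by blast

lemma smooth1_bounded:
  assumes "smooth1 UNIV f" "\<And>x. x \<notin> {a..b} \<Longrightarrow> f x = 0"
  obtains K where "0 < K" "\<And>x. \<bar>f x\<bar> \<le> K"
proof -
  have "compact (f ` {a..b})"
    using smooth1_continuous[OF assms(1)] continuous_on_subset by (intro compact_continuous_image) blast+
  then obtain K where K: "\<And>x. x \<in> {a..b} \<Longrightarrow> \<bar>f x\<bar> \<le> K"
    by (metis compact_imp_bounded bounded_iff imageI real_norm_def)
  have "\<bar>f x\<bar> \<le> max K 1" for x using K[of x] assms(2)[of x] by (cases "x \<in> {a..b}") auto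
  then show ?thesis using that[of "max K 1"] by auto
qed

section \<open>Smooth steps and cutoffs\<close>

definition flat_exp :: "real poly \<Rightarrow> real \<Rightarrow> real" where
  "flat_exp p x = (if 0 < x then poly p (1 / x) * exp (- (1 / x)) else 0)"

text \<open>Since \<open>pCons a p\<close> contributes a constant plus a further factor y, the
  induction on the polynomial has to run for all powers y^n at once. The single powers are
  controlled by y / n <= exp (y / n), raised to the n-th power.\<close>

lemma poly_exp_bounded:
  fixes p :: "real poly"
  shows "\<exists>C. \<forall>y>0. \<bar>y ^ n * poly p y\<bar> * exp (- y) \<le> C"
proof (induction p arbitrary: n)
  case (pCons a p)
  have pw: "y ^ n * exp (- y) \<le> real n ^ n" if "0 < y" for y :: real
  proof (cases "n = 0")
    case False
    have "y / real n \<le> exp (y / real n)" using exp_ge_add_one_self[of "y / real n"] by linarith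
    then have "(y / real n) ^ n \<le> exp (y / real n) ^ n" using that by (intro power_mono) auto
    also have "\<dots> = exp y" using False by (simp flip: exp_of_nat_mult)
    finally show ?thesis using False by (simp add: power_divide field_simps exp_minus)
  qed (use that in simp)
  obtain C where C: "\<And>y. 0 < y \<Longrightarrow> \<bar>y ^ Suc n * poly p y\<bar> * exp (- y) \<le> C"
    using pCons.IH[of "Suc n"] by blast
  have "\<bar>y ^ n * poly (pCons a p) y\<bar> * exp (- y) \<le> \<bar>a\<bar> * real n ^ n + C" if "0 < y" for y
  proof -
    have "\<bar>y ^ n * poly (pCons a p) y\<bar> \<le> \<bar>a\<bar> * y ^ n + \<bar>y ^ Suc n * poly p y\<bar>"
      using that abs_triangle_ineq[of "y ^ n * a" "y ^ n * (y * poly p y)"]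
      by (simp add: algebra_simps abs_mult)
    then have "\<bar>y ^ n * poly (pCons a p) y\<bar> * exp (- y) \<le> (\<bar>a\<bar> * y ^ n + \<bar>y ^ Suc n * poly p y\<bar>) * exp (- y)"
      by (rule mult_right_mono) simp
    also have "\<dots> = \<bar>a\<bar> * (y ^ n * exp (- y)) + \<bar>y ^ Suc n * poly p y\<bar> * exp (- y)"
      by (simp add: algebra_simps)
    also have "\<dots> \<le> \<bar>a\<bar> * real n ^ n + C"
      using pw[OF that] C[OF that] by (intro add_mono mult_left_mono) auto
    finally show ?thesis .
  qed
  then show ?case by blast
qed auto

text \<open>The family p(1/x) exp(-1/x) is closed under differentiation; this is the reason for
  carrying the polynomial \<open>p\<close>, and smoothness becomes an induction. In the variable y =
  1/x the derivative is y^2 (p - p'). At 0 the boundedness of y^2 p(y) exp(-y) makes the difference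
  quotient at most C |h|.\<close>

lemma flat_exp_deriv:
  "(flat_exp p has_real_derivative flat_exp (monom 1 2 * (p - pderiv p)) x) (at x)"
proof -
  consider "0 < x" | "x < 0" | "x = 0" by linarith
  then show ?thesis
  proof cases
    case 1
    have "((\<lambda>x. poly p (1 / x) * exp (- (1 / x))) has_real_derivative
       poly (pderiv p) (1 / x) * (- (1 / x\<^sup>2)) * exp (- (1 / x)) + poly p (1 / x) * (exp (- (1 / x)) * (1 / x\<^sup>2))) (at x)"
      using 1 by (auto intro!: derivative_eq_intros DERIV_chain2[OF poly_DERIV] simp: power2_eq_square field_simps)
    also have "poly (pderiv p) (1 / x) * (- (1 / x\<^sup>2)) * exp (- (1 / x)) + poly p (1 / x) * (exp (- (1 / x)) * (1 / x\<^sup>2))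
      = flat_exp (monom 1 2 * (p - pderiv p)) x"
      using 1 by (simp add: flat_exp_def poly_monom field_simps power2_eq_square)
    finally show ?thesis
      by (rule has_field_derivative_transform_within_open[OF _ open_greaterThan[of 0]]) (use 1 in \<open>auto simp: flat_exp_def\<close>)
  next
    case 2
    show ?thesis
      by (rule has_field_derivative_transform_within_open[of "\<lambda>_. 0" _ _ "{..<0}"]) (use 2 in \<open>auto simp: flat_exp_def\<close>)
  next
    case 3
    obtain C where C: "\<And>y. 0 < y \<Longrightarrow> \<bar>y ^ 2 * poly p y\<bar> * exp (- y) \<le> C"
      using poly_exp_bounded[of 2 p] by blast
    have C0: "0 \<le> C" using C[of 1] by (meson abs_ge_zero exp_ge_zero mult_nonneg_nonneg order_trans zero_less_one)
    have bd: "\<bar>flat_exp p h / h\<bar> \<le> C * \<bar>h\<bar>" for h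
    proof (cases "0 < h")
      case True
      then have "\<bar>flat_exp p h / h\<bar> = h * (\<bar>(1 / h)\<^sup>2 * poly p (1 / h)\<bar> * exp (- (1 / h)))"
        by (simp add: flat_exp_def abs_mult power2_eq_square field_simps)
      also have "\<dots> \<le> h * C" using C[of "1 / h"] True by (intro mult_left_mono) auto
      finally show ?thesis using True by (simp add: mult.commute)
    qed (use C0 in \<open>auto simp: flat_exp_def intro: mult_nonneg_nonpos\<close>)
    have "((\<lambda>h. flat_exp p h / h) \<longlongrightarrow> 0) (at 0)"
    proof (rule Lim_null_comparison)
      show "\<forall>\<^sub>F h in at 0. norm (flat_exp p h / h) \<le> C * \<bar>h\<bar>" using bd by auto
      show "((\<lambda>h. C * \<bar>h\<bar>) \<longlongrightarrow> 0) (at 0)" by (auto intro!: tendsto_eq_intros)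
    qed
    then show ?thesis using 3 by (simp add: has_field_derivative_iff flat_exp_def)
  qed
qed

lemma smooth1_flat_exp: "smooth1 UNIV (flat_exp p)"
  unfolding smooth1_def
proof
  fix k show "Dk k UNIV (flat_exp p)"
  proof (induction k arbitrary: p)
    case (Suc k)
    show ?case by (rule Dk_SucI[OF open_UNIV flat_exp_deriv Suc.IH])
  qed simp
qed

abbreviation flat :: "real \<Rightarrow> real" where "flat \<equiv> flat_exp 1"

lemma flat_pos: "0 < x \<Longrightarrow> 0 < flat x" "x \<le> 0 \<Longrightarrow> flat x = 0" "0 \<le> flat x"
  by (auto simp: flat_exp_def)

lemma flat_deriv_nonneg: "0 \<le> deriv flat x"
proof -
  have "deriv flat x = flat_exp (monom 1 2 * (1 - pderiv 1)) x" by (rule DERIV_imp_deriv[OF flat_exp_deriv])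
  also have "\<dots> \<ge> 0" by (simp add: flat_exp_def poly_monom)
  finally show ?thesis .
qed

definition sstep :: "real \<Rightarrow> real" where
  "sstep x = flat x * inverse (flat x + flat (1 - x))"

lemma flat_sum_pos: "0 < flat x + flat (1 - x)"
  using flat_pos[of x] flat_pos[of "1 - x"] by (cases "0 < x") (auto intro: add_pos_nonneg add_nonneg_pos)

lemma smooth1_affine: "smooth1 UNIV f \<Longrightarrow> smooth1 UNIV (\<lambda>x. f (a + b * x))"
  by (rule smooth1_comp[of UNIV UNIV]) (auto intro!: smooth1_intros)

lemma smooth1_sstep: "smooth1 UNIV sstep"
proof -
  have "smooth1 UNIV (\<lambda>x. flat x * inverse (flat x + flat (1 + (-1) * x)))"
  proof (intro smooth1_intros smooth1_inverse smooth1_affine smooth1_flat_exp open_UNIV)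
    show "flat x + flat (1 + (-1) * x) \<noteq> 0" for x using flat_sum_pos[of x] by simp
  qed
  then show ?thesis by (simp add: sstep_def[abs_def])
qed

lemma sstep_simps: "x \<le> 0 \<Longrightarrow> sstep x = 0" "1 \<le> x \<Longrightarrow> sstep x = 1" "0 \<le> sstep x" "sstep x \<le> 1" "0 < x \<Longrightarrow> 0 < sstep x"
  using flat_pos[of x] flat_pos[of "1 - x"] flat_sum_pos[of x]
  by (auto simp: sstep_def field_simps)

lemma sstep_deriv: "(sstep has_real_derivative deriv sstep x) (at x)" "0 \<le> deriv sstep x"
proof -
  show s: "(sstep has_real_derivative deriv sstep x) (at x)" using smooth1D(1)[OF smooth1_sstep] by simp
  have d1: "(flat has_real_derivative deriv flat x) (at x)" using smooth1D(1)[OF smooth1_flat_exp] by simp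
  have "(flat has_real_derivative deriv flat (1 - x)) (at (1 - x))" using smooth1D(1)[OF smooth1_flat_exp] by simp
  moreover have "((\<lambda>x. 1 - x) has_real_derivative - 1) (at x)" by (auto intro!: derivative_eq_intros)
  ultimately have d2: "((\<lambda>x. flat (1 - x)) has_real_derivative - deriv flat (1 - x)) (at x)"
    using DERIV_chain2[of flat "deriv flat (1 - x)" "\<lambda>x. 1 - x" x "-1"] by simp
  have nz: "flat x + flat (1 - x) \<noteq> 0" using flat_sum_pos[of x] by simp
  let ?D = "flat x + flat (1 - x)"
  have "(sstep has_real_derivative (deriv flat x * flat (1 - x) + flat x * deriv flat (1 - x)) / ?D\<^sup>2) (at x)"
    unfolding sstep_def[abs_def] divide_inverse[symmetric]
    by (rule DERIV_cong[OF DERIV_divide[OF d1 DERIV_add[OF d1 d2] nz]])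
      (simp add: power2_eq_square algebra_simps)
  then have "deriv sstep x = (deriv flat x * flat (1 - x) + flat x * deriv flat (1 - x)) / ?D\<^sup>2"
    by (rule DERIV_imp_deriv)
  also have "\<dots> \<ge> 0" by (intro divide_nonneg_nonneg add_nonneg_nonneg mult_nonneg_nonneg flat_deriv_nonneg flat_pos(3)) auto
  finally show "0 \<le> deriv sstep x" .
qed

text \<open>The square is there for the estimate |cutoff'|^2 <= K cutoff, which holds because (u^2)'
  = 2 u u'. In the relative energy this is what lets a term with the derivative of the cutoff be
  absorbed by one with the cutoff itself.\<close>

definition cutoff :: "real \<Rightarrow> real" where
  "cutoff x = (sstep (2 - x) * sstep (2 + x))\<^sup>2"

lemma smooth1_cutoff: "smooth1 UNIV cutoff"
proof -
  have "smooth1 UNIV (\<lambda>x. (sstep (2 + (-1) * x) * sstep (2 + 1 * x)) * (sstep (2 + (-1) * x) * sstep (2 + 1 * x)))"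
    by (intro smooth1_intros smooth1_affine smooth1_sstep open_UNIV)
  then show ?thesis by (simp add: cutoff_def[abs_def] power2_eq_square)
qed

lemma cutoff_simps: "\<bar>x\<bar> \<le> 1 \<Longrightarrow> cutoff x = 1" "x \<notin> {-2..2} \<Longrightarrow> cutoff x = 0" "0 \<le> cutoff x" "cutoff x \<le> 1"
proof -
  show "cutoff x \<le> 1" unfolding cutoff_def
    by (intro power_le_one mult_nonneg_nonneg mult_le_one sstep_simps)
qed (auto simp: cutoff_def sstep_simps abs_le_iff)

lemma cutoff_bounds:
  obtains K where "0 < K" "\<And>x. (deriv cutoff x)\<^sup>2 \<le> K * cutoff x" "\<And>x. \<bar>deriv cutoff x\<bar> \<le> K" "\<And>x. \<bar>deriv (deriv cutoff) x\<bar> \<le> K"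
proof -
  define u where "u x = sstep (2 - x) * sstep (2 + x)" for x
  have "smooth1 UNIV (\<lambda>x. sstep (2 + (-1) * x) * sstep (2 + 1 * x))"
    by (intro smooth1_intros smooth1_affine smooth1_sstep open_UNIV)
  then have u: "smooth1 UNIV u" by (simp add: u_def[abs_def])
  have u0: "x \<notin> {-2..2} \<Longrightarrow> u x = 0" for x by (auto simp: u_def sstep_simps)
  obtain K1 where K1: "0 < K1" "\<And>x. \<bar>deriv u x\<bar> \<le> K1"
    using smooth1_bounded[OF smooth1D(2)[OF u], of "-2" 2] smooth1_deriv_outside[OF u u0] by metis
  have c0: "x \<notin> {-2..2} \<Longrightarrow> deriv cutoff x = 0" for x
    using smooth1_deriv_outside[OF smooth1_cutoff cutoff_simps(2)] by metis
  obtain K2 where K2: "0 < K2" "\<And>x. \<bar>deriv cutoff x\<bar> \<le> K2"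
    using smooth1_bounded[OF smooth1D(2)[OF smooth1_cutoff], of "-2" 2] c0 by metis
  obtain K3 where K3: "0 < K3" "\<And>x. \<bar>deriv (deriv cutoff) x\<bar> \<le> K3"
    using smooth1_bounded[OF smooth1D(2)[OF smooth1D(2)[OF smooth1_cutoff]], of "-2" 2]
      smooth1_deriv_outside[OF smooth1D(2)[OF smooth1_cutoff] c0] by metis
  have d: "deriv cutoff x = 2 * u x * deriv u x" for x
  proof -
    have "(u has_real_derivative deriv u x) (at x)" using smooth1D(1)[OF u] by simp
    then have "((\<lambda>x. (u x)\<^sup>2) has_real_derivative 2 * u x * deriv u x) (at x)"
      by (auto intro!: derivative_eq_intros)
    then show ?thesis unfolding cutoff_def[abs_def] u_def[symmetric] by (rule DERIV_imp_deriv)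
  qed
  let ?K = "max (4 * K1\<^sup>2) (max K2 K3)"
  have "(deriv cutoff x)\<^sup>2 \<le> ?K * cutoff x" for x
  proof -
    have "(deriv cutoff x)\<^sup>2 = (4 * (deriv u x)\<^sup>2) * (u x)\<^sup>2" by (simp add: d power_mult_distrib)
    also have "\<dots> \<le> ?K * (u x)\<^sup>2"
    proof (rule mult_right_mono)
      have "(deriv u x)\<^sup>2 \<le> K1\<^sup>2" using K1(1) K1(2)[of x] abs_le_square_iff[of "deriv u x" K1] by simp
      then show "4 * (deriv u x)\<^sup>2 \<le> ?K" by linarith
    qed simp
    finally show ?thesis by (simp add: cutoff_def u_def)
  qed
  moreover have "0 < ?K" using K2(1) by linarith
  moreover have "\<bar>deriv cutoff x\<bar> \<le> ?K" "\<bar>deriv (deriv cutoff) x\<bar> \<le> ?K" for x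
    using K2(2)[of x] K3(2)[of x] by linarith+
  ultimately show ?thesis using that by blast
qed

section \<open>Integration lemmas\<close>

lemma integrable_compact_mult:
  fixes e :: "'a::euclidean_space \<Rightarrow> 'b::{banach, second_countable_topology}"
  assumes "continuous_on UNIV f" "compact S" "\<And>x. x \<notin> S \<Longrightarrow> f x = 0"
    "e \<in> borel_measurable borel" "\<And>x. x \<in> S \<Longrightarrow> norm (e x) \<le> B"
  shows "integrable lborel (\<lambda>x. f x *\<^sub>R e x)"
proof -
  have "compact (f ` S)"
    using assms(1,2) continuous_on_subset by (intro compact_continuous_image) blast+
  then obtain K where K: "\<And>x. x \<in> S \<Longrightarrow> norm (f x) \<le> K"
    by (metis compact_imp_bounded bounded_iff imageI)
  show ?thesis
  proof (rule integrableI_bounded_set[where A=S and B="K * B"])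
    show "S \<in> sets lborel" using assms(2) by (simp add: borel_compact)
    show "(\<lambda>x. f x *\<^sub>R e x) \<in> borel_measurable lborel"
      using borel_measurable_continuous_onI[OF assms(1)] assms(4) by simp
    show "emeasure lborel S < \<infinity>" using emeasure_bounded_finite compact_imp_bounded assms(2) by blast
    have "norm (f x *\<^sub>R e x) \<le> K * B" if "x \<in> S" for x
      unfolding norm_scaleR using K[OF that] assms(5)[OF that] by (intro mult_mono) (auto intro: order_trans[OF norm_ge_zero])
    then show "AE x in lborel. x \<in> S \<longrightarrow> norm (f x *\<^sub>R e x) \<le> K * B" by auto
  qed (use assms(3) in auto)
qed

lemma integral_deriv:
  assumes "\<And>x. (F has_real_derivative f x) (at x)" "continuous_on UNIV f" "\<And>x. x \<notin> {a..b} \<Longrightarrow> f x = 0" "a \<le> b"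
  shows "integral\<^sup>L lborel f = F b - F a"
proof -
  have "integral\<^sup>L lborel f = (\<integral>x. f x * indicator {a..b} x \<partial>lborel)"
  proof (rule Bochner_Integration.integral_cong[OF refl])
    show "f x = f x * indicator {a..b} x" for x using assms(3)[of x] by (cases "x \<in> {a..b}") simp_all
  qed
  also have "\<dots> = F b - F a"
  proof (rule integral_FTC_Icc_real)
    show "isCont f x" for x using assms(2) continuous_on_eq_continuous_at[OF open_UNIV] by blast
  qed (use assms in auto)
  finally show ?thesis .
qed

text \<open>By Lebesgue differentiation the averages of \<open>g\<close> over small boxes with
  corner x converge to g(x) almost everywhere, and each average is nonpositive. The open set is
  exhausted by countably many boxes so that only local integrability is used.\<close>

lemma AE_nonpos_boxes:
  fixes g :: "'a::euclidean_space \<Rightarrow> real"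
  assumes U: "open U"
    and loc: "\<And>a b. cbox a b \<subseteq> U \<Longrightarrow> set_integrable lborel (cbox a b) g"
    and le: "\<And>a b. cbox a b \<subseteq> U \<Longrightarrow> (LINT x:box a b|lborel. g x) \<le> 0"
  shows "AE x in lborel. x \<in> U \<longrightarrow> g x \<le> 0"
proof -
  have sub: "integral (cbox a b) g \<le> 0" if "cbox a b \<subseteq> U" for a b
  proof -
    have "set_integrable lborel (box a b) g"
      by (rule set_integrable_subset[OF loc[OF that]]) (auto simp: box_subset_cbox)
    then have "(LINT x:box a b|lborel. g x) = integral (box a b) g" by (rule set_borel_integral_eq_integral(2))
    then show ?thesis using le[OF that] by (simp add: integral_open_interval)
  qed
  have one: "AE x in lborel. x \<in> box c d \<longrightarrow> g x \<le> 0" if cd: "cbox c d \<subseteq> U" for c d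
  proof -
    \<comment> \<open>The differentiation result wants integrability on every box of the space, so
      \<open>g\<close> is cut off outside one box.\<close>
    define f where "f x = (if x \<in> cbox c d then g x else 0)" for x
    have int: "f integrable_on cbox a b" for a b
    proof -
      have "set_integrable lborel (cbox a b \<inter> cbox c d) g"
        by (rule set_integrable_subset[OF loc[OF cd]]) auto
      from set_borel_integral_eq_integral(1)[OF this] show ?thesis
        unfolding f_def by (simp add: integrable_restrict_Int Int_commute)
    qed
    obtain N where N: "negligible N" and lim: "\<And>x e. \<lbrakk>x \<notin> N; 0 < e\<rbrakk> \<Longrightarrow>
        \<exists>d>0. \<forall>h. 0 < h \<and> h < d \<longrightarrow> norm (integral (cbox x (x + h *\<^sub>R One)) f /\<^sub>R h ^ DIM('a) - f x) < e"
      using integrable_ccontinuous_explicit[of f] int by blast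
    have "g x \<le> 0" if x: "x \<in> box c d" "x \<notin> N" for x
    proof (rule ccontr)
      assume "\<not> g x \<le> 0"
      then have pos: "0 < g x" by simp
      obtain r where r: "r > 0" "\<And>h. 0 < h \<and> h < r \<Longrightarrow> norm (integral (cbox x (x + h *\<^sub>R One)) f /\<^sub>R h ^ DIM('a) - f x) < g x"
        using lim[OF x(2) pos] by blast
      obtain \<epsilon> where e: "0 < \<epsilon>" "ball x \<epsilon> \<subseteq> box c d" using open_box x(1) openE by blast
      \<comment> \<open>A box of side h has l1 diameter DIM * h, so the factor 2 * DIM keeps it
        strictly inside the ball of radius \<open>\<epsilon>\<close>.\<close>
      define h where "h = min (r / 2) (\<epsilon> / (2 * DIM('a)))"
      have h: "0 < h" "h < r" using r(1) e(1) by (auto simp: h_def min_less_iff_disj)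
      have "cbox x (x + h *\<^sub>R One) \<subseteq> ball x \<epsilon>"
      proof
        fix y assume y: "y \<in> cbox x (x + h *\<^sub>R One)"
        have "norm (y - x) \<le> (\<Sum>b\<in>Basis. \<bar>(y - x) \<bullet> b\<bar>)" by (rule norm_le_l1)
        also have "\<dots> \<le> (\<Sum>b\<in>(Basis::'a set). h)"
        proof (rule sum_mono)
          fix b :: 'a assume b: "b \<in> Basis"
          have "x \<bullet> b \<le> y \<bullet> b" "y \<bullet> b \<le> x \<bullet> b + h * (One \<bullet> b)"
            using y b unfolding mem_box by (auto simp: inner_add_left)
          moreover have "One \<bullet> b = 1" using b by simp
          ultimately show "\<bar>(y - x) \<bullet> b\<bar> \<le> h" by (simp add: inner_diff_left)
        qed
        also have "\<dots> = DIM('a) * h" by simp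
        also have "\<dots> \<le> DIM('a) * (\<epsilon> / (2 * DIM('a)))" unfolding h_def by (intro mult_left_mono) auto
        also have "\<dots> < \<epsilon>" using e(1) by simp
        finally show "y \<in> ball x \<epsilon>" by (simp add: dist_norm norm_minus_commute)
      qed
      then have s: "cbox x (x + h *\<^sub>R One) \<subseteq> cbox c d" using e(2) box_subset_cbox by blast
      then have "integral (cbox x (x + h *\<^sub>R One)) f = integral (cbox x (x + h *\<^sub>R One)) g"
        by (intro Henstock_Kurzweil_Integration.integral_cong) (auto simp: f_def)
      also have "\<dots> \<le> 0" using sub s cd by blast
      finally have "integral (cbox x (x + h *\<^sub>R One)) f /\<^sub>R h ^ DIM('a) \<le> 0"
        using h(1) by (simp add: mult_nonneg_nonpos)
      moreover have "f x = g x" using x(1) box_subset_cbox by (auto simp: f_def)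
      ultimately show False using r(2)[of h] h pos by (auto simp: abs_if split: if_splits)
    qed
    moreover have "AE x in lebesgue. x \<notin> N"
      using N by (simp add: negligible_iff_null_sets AE_not_in)
    ultimately have "AE x in lebesgue. x \<in> box c d \<longrightarrow> g x \<le> 0" by auto
    then show ?thesis by (simp add: AE_completion_iff)
  qed
  obtain \<D> where D: "countable \<D>" "\<D> \<subseteq> Pow U" "\<And>X. X \<in> \<D> \<Longrightarrow> \<exists>a b. X = cbox a b" "\<Union>\<D> = U"
    using open_countable_Union_open_cbox[OF U] by metis
  have "AE x in lborel. x \<in> X \<longrightarrow> g x \<le> 0" if X: "X \<in> \<D>" for X
  proof -
    obtain a b where ab: "X = cbox a b" using D(3) X by blast
    \<comment> \<open>The countable cover consists of closed boxes while the pointwise argument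
      needs room around x. The boundary of a box is a null set, so nothing is lost.\<close>
    have "negligible (cbox a b - box a b)" by (rule negligible_frontier_interval)
    then have "AE x in lebesgue. x \<notin> cbox a b - box a b" unfolding negligible_iff_null_sets by (rule AE_not_in)
    then have "AE x in lborel. x \<notin> cbox a b - box a b" by (simp add: AE_completion_iff)
    moreover have "AE x in lborel. x \<in> box a b \<longrightarrow> g x \<le> 0" using one D(2) X ab by blast
    ultimately show ?thesis unfolding ab by eventually_elim auto
  qed
  then have "AE x in lborel. \<forall>X\<in>\<D>. x \<in> X \<longrightarrow> g x \<le> 0" using D(1) by (intro AE_ball_countable') auto
  then show ?thesis by eventually_elim (use D(4) in blast)
qed

text \<open>A sequence of smooth functions with values in [0, 1] that converges to the indicator of
  the open interval from inside. Dominated convergence then upgrades an inequality tested against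
  smooth functions to one on intervals, and in products to one on boxes.\<close>

definition bump :: "real \<Rightarrow> real \<Rightarrow> nat \<Rightarrow> real \<Rightarrow> real" where
  "bump a b k t = sstep (real k * (t - a)) * sstep (real k * (b - t))"

lemma bump_props:
  "smooth1 UNIV (bump a b k)" "0 \<le> bump a b k t" "bump a b k t \<le> 1" "t \<notin> {a..b} \<Longrightarrow> bump a b k t = 0"
  "(\<lambda>k. bump a b k t) \<longlonglongrightarrow> indicator {a<..<b} t"
proof -
  have "smooth1 UNIV (\<lambda>t. sstep (- real k * a + real k * t) * sstep (real k * b + (- real k) * t))"
    by (intro smooth1_intros smooth1_affine smooth1_sstep open_UNIV)
  then show "smooth1 UNIV (bump a b k)" by (simp add: bump_def[abs_def] algebra_simps)
  show "0 \<le> bump a b k t" "bump a b k t \<le> 1" by (auto simp: bump_def sstep_simps mult_le_one)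
  have out: "bump a b k t = 0" if "t \<notin> {a<..<b}" for k
    using that by (auto simp: bump_def sstep_simps mult_nonneg_nonpos not_less)
  then show "t \<notin> {a..b} \<Longrightarrow> bump a b k t = 0" by auto
  show "(\<lambda>k. bump a b k t) \<longlonglongrightarrow> indicator {a<..<b} t"
  proof (cases "t \<in> {a<..<b}")
    case True
    obtain n where n: "1 / (t - a) < real n" "1 / (b - t) < real n"
      using reals_Archimedean2[of "max (1 / (t - a)) (1 / (b - t))"] by auto
    have "\<forall>\<^sub>F k in sequentially. bump a b k t = indicator {a<..<b} t"
      using eventually_ge_at_top[of n]
    proof eventually_elim
      case (elim k)
      have "1 \<le> real k * (t - a)" "1 \<le> real k * (b - t)"
      proof -
        have "1 / (t - a) < real k" "1 / (b - t) < real k" using n elim by linarith+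
        then show "1 \<le> real k * (t - a)" "1 \<le> real k * (b - t)" using True by (auto simp: field_simps)
      qed
      then show ?case using True by (simp add: bump_def sstep_simps)
    qed
    then show ?thesis by (rule tendsto_eventually)
  next
    case False
    then show ?thesis using out[OF False] by simp
  qed
qed

lemma AE_nonpos_line:
  fixes g :: "real \<Rightarrow> real"
  assumes U: "open U" and loc: "\<And>a b. {a..b} \<subseteq> U \<Longrightarrow> set_integrable lborel {a..b} g"
    and le: "\<And>\<eta> a b. smooth1 UNIV \<eta> \<Longrightarrow> (\<And>t. 0 \<le> \<eta> t) \<Longrightarrow> (\<And>t. \<eta> t \<le> 1) \<Longrightarrow> (\<And>t. t \<notin> {a..b} \<Longrightarrow> \<eta> t = 0) \<Longrightarrow> a \<le> b \<Longrightarrow> {a..b} \<subseteq> U \<Longrightarrow>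
       (\<integral>t. \<eta> t * g t \<partial>lborel) \<le> 0"
  shows "AE t in lborel. t \<in> U \<longrightarrow> g t \<le> 0"
proof (rule AE_nonpos_boxes[OF U])
  fix a b :: real assume ab: "cbox a b \<subseteq> U"
  then have i: "set_integrable lborel {a..b} g" by (intro loc) simp
  then show "set_integrable lborel (cbox a b) g" by simp
  show "(LINT x:box a b|lborel. g x) \<le> 0"
  proof (cases "a \<le> b")
    case True
    have gm: "(\<lambda>t. indicator {a..b} t * g t) \<in> borel_measurable lborel" and gi: "integrable lborel (\<lambda>t. \<bar>indicator {a..b} t * g t\<bar>)"
      using i by (auto simp: set_integrable_def)
    have eqb: "bump a b k t * g t = bump a b k t * (indicator {a..b} t * g t)" for k t
      using bump_props(4)[of t a b k] by (auto simp: indicator_def)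
    have "(\<lambda>k. \<integral>t. bump a b k t * g t \<partial>lborel) \<longlonglongrightarrow> (\<integral>t. indicator {a<..<b} t * (indicator {a..b} t * g t) \<partial>lborel)"
      unfolding eqb
    proof (rule integral_dominated_convergence[where w="\<lambda>t. \<bar>indicator {a..b} t * g t\<bar>"])
      show "(\<lambda>t. indicator {a<..<b} t * (indicator {a..b} t * g t)) \<in> borel_measurable lborel" using gm by measurable
      show "(\<lambda>t. bump a b k t * (indicator {a..b} t * g t)) \<in> borel_measurable lborel" for k
        using gm borel_measurable_continuous_onI[OF smooth1_continuous[OF bump_props(1)]] by simp
      show "AE t in lborel. (\<lambda>k. bump a b k t * (indicator {a..b} t * g t)) \<longlonglongrightarrow> indicator {a<..<b} t * (indicator {a..b} t * g t)"
        by (intro AE_I2 tendsto_mult bump_props tendsto_const)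
      have "norm (bump a b k t * (indicator {a..b} t * g t)) \<le> \<bar>indicator {a..b} t * g t\<bar>" for k t
        using bump_props(2,3)[of a b k t] by (auto simp: abs_mult mult_left_le_one_le)
      then show "AE t in lborel. norm (bump a b k t * (indicator {a..b} t * g t)) \<le> \<bar>indicator {a..b} t * g t\<bar>" for k by simp
    qed (rule gi)
    moreover have "(\<integral>t. bump a b k t * g t \<partial>lborel) \<le> 0" for k
      using le[of "bump a b k" a b] True ab bump_props by (simp add: bump_props)
    ultimately have "(\<integral>t. indicator {a<..<b} t * (indicator {a..b} t * g t) \<partial>lborel) \<le> 0"
      by (intro LIMSEQ_le_const2) auto
    moreover have "(\<lambda>t. indicator {a<..<b} t * (indicator {a..b} t * g t)) = (\<lambda>t. indicator (box a b) t *\<^sub>R g t)"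
      by (auto simp: indicator_def)
    ultimately show ?thesis by (simp add: set_lebesgue_integral_def)
  next
    case False then show ?thesis by (simp add: set_lebesgue_integral_def)
  qed
qed

lemma AE_nonpos_half_plane:
  fixes g :: "real \<times> real \<Rightarrow> real"
  assumes loc: "\<And>a b c d. 0 < c \<Longrightarrow> set_integrable lborel ({a..b} \<times> {c..d}) g"
    and le: "\<And>\<psi> \<eta> a b c d. smooth1 UNIV \<psi> \<Longrightarrow> (\<And>t. 0 \<le> \<psi> t) \<Longrightarrow> (\<And>t. t \<notin> {a..b} \<Longrightarrow> \<psi> t = 0) \<Longrightarrow> a \<le> b \<Longrightarrow>
      smooth1 UNIV \<eta> \<Longrightarrow> (\<And>t. 0 \<le> \<eta> t) \<Longrightarrow> (\<And>t. t \<notin> {c..d} \<Longrightarrow> \<eta> t = 0) \<Longrightarrow> c \<le> d \<Longrightarrow> 0 < c \<Longrightarrow>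
       (\<integral>z. (\<psi> (fst z) * \<eta> (snd z)) * g z \<partial>lborel) \<le> 0"
  shows "AE z in lborel. 0 < snd z \<longrightarrow> g z \<le> 0"
proof -
  have "AE z in lborel. z \<in> half_plane \<longrightarrow> g z \<le> 0"
  proof (rule AE_nonpos_boxes[OF open_half_plane])
    fix p q :: "real \<times> real" assume pq: "cbox p q \<subseteq> half_plane"
    obtain a c b d where p: "p = (a, c)" "q = (b, d)" by (cases p, cases q) auto
    have cb: "cbox p q = {a..b} \<times> {c..d}" by (simp add: p cbox_Pair_eq)
    have bx: "box p q = {a<..<b} \<times> {c<..<d}"
      by (auto simp: p box_def Basis_prod_def)
    show i: "set_integrable lborel (cbox p q) g"
    proof (cases "a \<le> b \<and> c \<le> d")
      case True
      then have "(a, c) \<in> cbox p q" by (simp add: cb)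
      with pq have "0 < c" by auto
      then show ?thesis unfolding cb by (rule loc)
    qed (auto simp: cb set_integrable_def)
    show "(LINT z:box p q|lborel. g z) \<le> 0"
    proof (cases "a \<le> b \<and> c \<le> d")
      case True
      then have "(a, c) \<in> cbox p q" by (simp add: cb)
      with pq have c: "0 < c" by auto
      let ?I = "\<lambda>z. indicator (cbox p q) z * g z"
      have gm: "?I \<in> borel_measurable lborel" and gi: "integrable lborel (\<lambda>z. \<bar>?I z\<bar>)"
        using i by (auto simp: set_integrable_def)
      let ?b = "\<lambda>k z. bump a b k (fst z) * bump c d k (snd z)"
      have eqb: "?b k z * g z = ?b k z * ?I z" for k z
        using bump_props(4)[of "fst z" a b k] bump_props(4)[of "snd z" c d k] by (auto simp: indicator_def cb mem_Times_iff)
      have lim: "(\<lambda>k. \<integral>z. ?b k z * g z \<partial>lborel) \<longlonglongrightarrow> (\<integral>z. (indicator {a<..<b} (fst z) * indicator {c<..<d} (snd z)) * ?I z \<partial>lborel)"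
        unfolding eqb
      proof (rule integral_dominated_convergence[where w="\<lambda>z. \<bar>?I z\<bar>"])
        have "(\<lambda>z. indicator {a<..<b} (fst z) * indicator {c<..<d} (snd z)) = (indicator (box p q) :: real \<times> real \<Rightarrow> real)"
          by (auto simp: bx indicator_def)
        then have "(\<lambda>z. indicator {a<..<b} (fst z) * indicator {c<..<d} (snd z) :: real) \<in> borel_measurable lborel" by simp
        then show "(\<lambda>z. (indicator {a<..<b} (fst z) * indicator {c<..<d} (snd z)) * ?I z) \<in> borel_measurable lborel"
          using gm by (rule borel_measurable_times)
        have "continuous_on UNIV (?b k)" for k
          by (intro continuous_intros continuous_on_compose2[OF smooth1_continuous[OF bump_props(1)]]) auto
        then have "?b k \<in> borel_measurable lborel" for k
          by (simp add: borel_measurable_continuous_onI)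
        then show "(\<lambda>z. ?b k z * ?I z) \<in> borel_measurable lborel" for k
          using gm by (rule borel_measurable_times)
        show "AE z in lborel. (\<lambda>k. ?b k z * ?I z) \<longlonglongrightarrow> (indicator {a<..<b} (fst z) * indicator {c<..<d} (snd z)) * ?I z"
          by (intro AE_I2 tendsto_mult bump_props tendsto_const)
        have "norm (?b k z * ?I z) \<le> \<bar>?I z\<bar>" for k z
        proof -
          have b: "\<bar>?b k z\<bar> \<le> 1" by (auto simp: abs_mult bump_props intro!: mult_le_one)
          show ?thesis
            using mult_right_mono[OF b abs_ge_zero[of "?I z"]]
            by (simp only: real_norm_def abs_mult[of "?b k z" "?I z"] mult_1_left)
        qed
        then show "AE z in lborel. norm (?b k z * ?I z) \<le> \<bar>?I z\<bar>" for k by simp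
      qed (rule gi)
      have "(\<integral>z. ?b k z * g z \<partial>lborel) \<le> 0" for k
        using le[of "bump a b k" a b "bump c d k" c d] True c by (simp add: bump_props)
      with lim have "(\<integral>z. (indicator {a<..<b} (fst z) * indicator {c<..<d} (snd z)) * ?I z \<partial>lborel) \<le> 0"
        by (intro LIMSEQ_le_const2) auto
      moreover have "(\<lambda>z. (indicator {a<..<b} (fst z) * indicator {c<..<d} (snd z)) * ?I z) = (\<lambda>z. indicator (box p q) z *\<^sub>R g z)"
        by (auto simp: indicator_def bx cb fun_eq_iff of_bool_def)
      ultimately show ?thesis by (simp add: set_lebesgue_integral_def)
    next
      case False
      then have "box p q = {}" unfolding bx by auto
      then show ?thesis by (simp add: set_lebesgue_integral_def)
    qed
  qed
  then show ?thesis by simp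
qed

text \<open>
  An integral inequality tested against cutoffs in time controls the values at almost every time.
  The hypothesis on all bounds \<open>M\<close> avoids normalising the cutoffs.
\<close>

lemma time_lemma:
  fixes e :: "real \<Rightarrow> real"
  assumes meas: "e \<in> borel_measurable borel"
    and bdd: "\<And>s. 0 < s \<Longrightarrow> \<exists>B. \<forall>t. s \<le> t \<and> t < T \<longrightarrow> \<bar>e t\<bar> \<le> B"
    and hyp: "\<And>\<eta> M c d. smooth1 UNIV \<eta> \<Longrightarrow> (\<And>t. 0 \<le> \<eta> t) \<Longrightarrow> (\<And>t. \<eta> t \<le> M) \<Longrightarrow>
       supp1 c d \<eta> \<Longrightarrow> 0 < c \<Longrightarrow> c \<le> d \<Longrightarrow> d < T \<Longrightarrow> - (\<integral>t. deriv \<eta> t * e t \<partial>lborel) \<le> M * K"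
    and lim: "\<And>\<delta>. 0 < \<delta> \<Longrightarrow> \<exists>s0>0. AE s in lborel. 0 < s \<and> s < s0 \<longrightarrow> e s \<le> e0 + \<delta>"
  shows "AE t in lborel. 0 < t \<and> t < T \<longrightarrow> e t \<le> e0 + K"
proof -
  have "AE t in lborel. t \<in> {0<..<T} \<longrightarrow> e t - (e0 + K) \<le> 0"
  proof (rule AE_nonpos_line)
    fix a b :: real assume ab: "{a..b} \<subseteq> {0<..<T}"
    show "set_integrable lborel {a..b} (\<lambda>t. e t - (e0 + K))"
    proof (cases "a \<le> b")
      case True
      then have "0 < a" "b < T" using ab by auto
      with bdd[of a] obtain B where B: "\<And>t. a \<le> t \<Longrightarrow> t < T \<Longrightarrow> \<bar>e t\<bar> \<le> B" by auto
      show ?thesis unfolding set_integrable_def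
      proof (rule integrableI_bounded_set_indicator[where B="B + \<bar>e0 + K\<bar>"])
        have "norm (e t - (e0 + K)) \<le> B + \<bar>e0 + K\<bar>" if "t \<in> {a..b}" for t
          using B[of t] that \<open>b < T\<close> abs_triangle_ineq4[of "e t" "e0 + K"] by auto
        then show "AE t in lborel. t \<in> {a..b} \<longrightarrow> norm (e t - (e0 + K)) \<le> B + \<bar>e0 + K\<bar>" by auto
      qed (use meas in \<open>auto simp: emeasure_lborel_Icc_eq\<close>)
    qed (auto simp: set_integrable_def)
  next
    fix \<eta> a b assume \<eta>: "smooth1 UNIV \<eta>" "\<And>t. 0 \<le> \<eta> t" "\<And>t. \<eta> t \<le> (1::real)" "\<And>t. t \<notin> {a..b} \<Longrightarrow> \<eta> t = 0"
      and ab: "a \<le> b" "{a..b} \<subseteq> {0<..<T}"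
    have a0: "0 < a" and bT: "b < T" using ab by auto
    have cont: "continuous_on UNIV \<eta>" by (rule smooth1_continuous[OF \<eta>(1)])
    \<comment> \<open>\<open>\<eta>\<close> plays the role of a density in time; its primitive
      \<open>G\<close> is nondecreasing and constant outside the support, with total increase
      \<open>N\<close>.\<close>
    obtain G where G: "\<And>t. (G has_real_derivative \<eta> t) (at t)"
      using antiderivative[OF cont] by (metis has_real_derivative_iff_has_vector_derivative)
    define N where "N = G b - G a"
    have mono: "s \<le> t \<Longrightarrow> G s \<le> G t" for s t
      using DERIV_nonneg_imp_nondecreasing[of s t G] G \<eta>(2) by blast
    have N0: "0 \<le> N" using mono[OF ab(1)] by (simp add: N_def)
    have Gl: "G t = G a" if "t \<le> a" for t
    proof (rule antisym[OF mono[OF that]])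
      show "G a \<le> G t"
      proof (cases "t = a")
        case False
        then have "t < a" using that by simp
        then obtain z where "t < z" "z < a" "G a - G t = (a - t) * \<eta> z" using MVT2[of t a G \<eta>] G by blast
        then show ?thesis using \<eta>(4)[of z] by simp
      qed simp
    qed
    have Gr: "G t = G b" if "b \<le> t" for t
    proof (rule antisym[OF _ mono[OF that]])
      show "G t \<le> G b"
      proof (cases "t = b")
        case False
        then have "b < t" using that by simp
        then obtain z where "b < z" "z < t" "G t - G b = (t - b) * \<eta> z" using MVT2[of b t G \<eta>] G by blast
        then show ?thesis using \<eta>(4)[of z] by simp
      qed simp
    qed
    have intN: "(\<integral>t. \<eta> t \<partial>lborel) = N" unfolding N_def by (rule integral_deriv[OF G cont \<eta>(4) ab(1)])
    have sG: "smooth1 UNIV G" by (rule smooth1I[OF open_UNIV _ \<eta>(1)]) (rule G)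
    obtain B where B: "\<And>t. a / 4 \<le> t \<Longrightarrow> t < T \<Longrightarrow> \<bar>e t\<bar> \<le> B" using bdd[of "a / 4"] a0 by auto
    have i\<eta>: "integrable lborel (\<lambda>t. \<eta> t * e t)"
      using integrable_compact_mult[OF cont compact_Icc[of a b] _ meas, of B] \<eta>(4) B a0 bT by simp
    have main: "(\<integral>t. \<eta> t * e t \<partial>lborel) \<le> N * (e0 + \<delta> + K)" if d: "0 < \<delta>" for \<delta>
    proof -
      obtain s0 where s0: "0 < s0" "AE s in lborel. 0 < s \<and> s < s0 \<longrightarrow> e s \<le> e0 + \<delta>" using lim[OF d] by blast
      \<comment> \<open>The switch-on interval [s, 2 s] has to lie in the region where
        \<open>e\<close> is controlled by the initial value and also strictly before the support of
        \<open>\<eta>\<close>.\<close>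
      define s where "s = min (s0 / 4) (a / 4)"
      have s: "0 < s" "2 * s < s0" "2 * s < a" using s0(1) a0 by (auto simp: s_def)
      obtain B' where B': "\<And>t. s \<le> t \<Longrightarrow> t < T \<Longrightarrow> \<bar>e t\<bar> \<le> B'" using bdd[OF s(1)] by auto
      define S where "S t = sstep (- 1 + (1 / s) * t)" for t
      have sS: "smooth1 UNIV S" unfolding S_def[abs_def] by (intro smooth1_affine smooth1_sstep)
      have dS: "(S has_real_derivative deriv S t) (at t)" for t using smooth1D(1)[OF sS] by simp
      have dS_eq: "deriv S t = deriv sstep (- 1 + (1 / s) * t) * (1 / s)" for t
      proof (rule DERIV_imp_deriv)
        have "((\<lambda>t. - 1 + (1 / s) * t) has_real_derivative (1 / s)) (at t)" using s(1) by (auto intro!: derivative_eq_intros)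
        from DERIV_chain2[OF sstep_deriv(1) this]
        show "(S has_real_derivative deriv sstep (- 1 + (1 / s) * t) * (1 / s)) (at t)" by (simp add: S_def[abs_def])
      qed
      have dS0: "0 \<le> deriv S t" for t using s(1) by (simp add: dS_eq sstep_deriv)
      have S0: "S t = 0" if "t \<le> s" for t using that s(1) by (simp add: S_def sstep_simps field_simps)
      have S1: "S t = 1" if "2 * s \<le> t" for t using that s(1) by (simp add: S_def sstep_simps field_simps)
      have dSout: "deriv S t = 0" if "t \<notin> {s..2 * s}" for t
      proof (cases "t < s")
        case True
        have "(S has_real_derivative 0) (at t)"
          by (rule has_field_derivative_transform_within_open[of "\<lambda>_. 0" _ _ "{..<s}"]) (use True S0 in auto)
        then show ?thesis by (rule DERIV_imp_deriv)
      next
        case False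
        have "(S has_real_derivative 0) (at t)"
          by (rule has_field_derivative_transform_within_open[of "\<lambda>_. 1" _ _ "{2 * s<..}"]) (use False that S1 in auto)
        then show ?thesis by (rule DERIV_imp_deriv)
      qed
      have contS: "continuous_on UNIV (deriv S)" by (rule smooth1_continuous[OF smooth1D(2)[OF sS]])
      have intS: "(\<integral>t. deriv S t \<partial>lborel) = 1"
        using integral_deriv[OF dS contS dSout] s S0[of s] S1[of "2 * s"] by simp
      \<comment> \<open>This cutoff rises from 0 to \<open>N\<close> on [s, 2 s] and then descends
        with slope \<open>- \<eta>\<close>. Its derivative is
        \<open>N * deriv S t - \<eta> t\<close>, so the hypothesis compares the integral of \<eta> e
        with \<open>N\<close> times an average of \<open>e\<close> over [s, 2 s], plus
        \<open>N * K\<close>.\<close>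
      define \<xi> where "\<xi> t = (G b + (- 1) * G t) * S t" for t
      have "smooth1 UNIV \<xi>" unfolding \<xi>_def[abs_def] by (intro smooth1_intros sG sS open_UNIV)
      moreover have "0 \<le> \<xi> t" "\<xi> t \<le> N" for t
      proof -
        have "G t \<le> G b" using mono[of t b] Gr[of t] by linarith
        moreover have "G a \<le> G t" using mono[of a t] Gl[of t] by linarith
        moreover have "0 \<le> S t" "S t \<le> 1" by (auto simp: S_def sstep_simps)
        ultimately show "0 \<le> \<xi> t" "\<xi> t \<le> N"
          using mult_mono[of "G b - G t" N "S t" 1] N0 by (auto simp: \<xi>_def N_def)
      qed
      moreover have "supp1 s b \<xi>"
      proof (rule supp1I)
        show "\<xi> t = 0" if "t \<notin> {s..b}" for t using that S0[of t] Gr[of t] by (auto simp: \<xi>_def)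
      qed
      moreover have "s \<le> b" using s ab a0 by auto
      ultimately have h: "- (\<integral>t. deriv \<xi> t * e t \<partial>lborel) \<le> N * K" using s(1) bT by (intro hyp[of \<xi> N s b])
      have deq: "deriv \<xi> t = N * deriv S t - \<eta> t" for t
      proof -
        have "(\<xi> has_real_derivative (- \<eta> t) * S t + (G b + (- 1) * G t) * deriv S t) (at t)"
          unfolding \<xi>_def[abs_def] by (auto intro!: derivative_eq_intros G dS)
        then have "deriv \<xi> t = (- \<eta> t) * S t + (G b + (- 1) * G t) * deriv S t" by (rule DERIV_imp_deriv)
        moreover have "\<eta> t * S t = \<eta> t" using S1[of t] \<eta>(4)[of t] s by (cases "2 * s \<le> t") auto
        moreover have "(G b + (- 1) * G t) * deriv S t = N * deriv S t"
          using dSout[of t] Gl[of t] s by (cases "t \<in> {s..2 * s}") (auto simp: N_def)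
        ultimately show ?thesis by simp
      qed
      have iS: "integrable lborel (\<lambda>t. deriv S t * e t)"
        using integrable_compact_mult[OF contS compact_Icc[of s "2 * s"] _ meas, of B'] dSout B' s ab a0 bT by simp
      have iSc: "integrable lborel (\<lambda>t. deriv S t * (e0 + \<delta>))"
        using integrable_compact_mult[OF contS compact_Icc[of s "2 * s"], of "\<lambda>_. e0 + \<delta>" "\<bar>e0 + \<delta>\<bar>"] dSout by simp
      have "(\<integral>t. deriv \<xi> t * e t \<partial>lborel) = (\<integral>t. N * (deriv S t * e t) - \<eta> t * e t \<partial>lborel)"
        by (simp add: deq algebra_simps)
      also have "\<dots> = N * (\<integral>t. deriv S t * e t \<partial>lborel) - (\<integral>t. \<eta> t * e t \<partial>lborel)"
        using iS i\<eta> by simp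
      finally have e1: "(\<integral>t. \<eta> t * e t \<partial>lborel) \<le> N * (\<integral>t. deriv S t * e t \<partial>lborel) + N * K" using h by simp
      have "(\<integral>t. deriv S t * e t \<partial>lborel) \<le> (\<integral>t. deriv S t * (e0 + \<delta>) \<partial>lborel)"
      proof (rule integral_mono_AE[OF iS iSc])
        show "AE t in lborel. deriv S t * e t \<le> deriv S t * (e0 + \<delta>)"
          using s0(2)
        proof eventually_elim
          case (elim t)
          then show ?case using dSout[of t] dS0[of t] s by (cases "t \<in> {s..2 * s}") (auto intro!: mult_left_mono)
        qed
      qed
      also have "\<dots> = e0 + \<delta>" using intS by simp
      finally have "N * (\<integral>t. deriv S t * e t \<partial>lborel) \<le> N * (e0 + \<delta>)" using N0 by (rule mult_left_mono)
      with e1 show ?thesis by (simp add: algebra_simps)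
    qed
    have "(\<integral>t. \<eta> t * e t \<partial>lborel) \<le> N * (e0 + K)"
    proof (rule field_le_epsilon)
      fix r :: real assume r: "0 < r"
      \<comment> \<open>Dividing by \<open>N + 1\<close> instead of \<open>N\<close> keeps the
        choice valid when \<open>N\<close> is 0.\<close>
      have "(\<integral>t. \<eta> t * e t \<partial>lborel) \<le> N * (e0 + r / (N + 1) + K)" using main[of "r / (N + 1)"] r N0 by simp
      also have "\<dots> = N * (e0 + K) + r * (N / (N + 1))" by (simp add: algebra_simps)
      also have "\<dots> \<le> N * (e0 + K) + r" using r N0 by (simp add: field_simps)
      finally show "(\<integral>t. \<eta> t * e t \<partial>lborel) \<le> N * (e0 + K) + r" .
    qed
    moreover have "integrable lborel (\<lambda>t. \<eta> t * (e0 + K))"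
      using integrable_compact_mult[OF cont compact_Icc[of a b], of "\<lambda>_. e0 + K" "\<bar>e0 + K\<bar>"] \<eta>(4) by simp
    then have "(\<integral>t. \<eta> t * (e t - (e0 + K)) \<partial>lborel) = (\<integral>t. \<eta> t * e t \<partial>lborel) - N * (e0 + K)"
      using i\<eta> intN by (simp add: right_diff_distrib)
    ultimately show "(\<integral>t. \<eta> t * (e t - (e0 + K)) \<partial>lborel) \<le> 0" by simp
  qed auto
  then show ?thesis by eventually_elim auto
qed

lemma smooth1_extend:
  assumes "smooth1 {0<..} f" "0 < c" "\<And>t. t < c \<Longrightarrow> f t = 0"
  shows "smooth1 UNIV f"
proof -
  have 1: "Dk k {..<c} f" for k
    by (rule Dk_cong[OF open_lessThan _ Dk_const[OF open_lessThan, where c="0::real"]]) (simp add: assms(3))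
  have 2: "Dk k S f \<Longrightarrow> Dk k T f \<Longrightarrow> Dk k (S \<union> T) f" for k S T
    by (induction k arbitrary: f) auto
  have 3: "{..<c} \<union> {0<..} = (UNIV :: real set)" using assms(2) by auto
  show ?thesis using 2[OF 1] assms(1) unfolding smooth1_def 3[symmetric] by blast
qed

section \<open>Time slices, products and translations of integrals\<close>

lemma fubini_time:
  fixes f :: "real \<times> real \<Rightarrow> 'b::{banach, second_countable_topology}"
  assumes "integrable lborel f"
  shows "integral\<^sup>L lborel f = (\<integral>t. (\<integral>x. f (x, t) \<partial>lborel) \<partial>lborel)"
    "AE t in lborel. integrable lborel (\<lambda>x. f (x, t))"
    "integrable lborel (\<lambda>t. \<integral>x. f (x, t) \<partial>lborel)"
proof -
  have f: "integrable (lborel \<Otimes>\<^sub>M lborel) (\<lambda>(x, y). f (x, y))"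
    using assms by (simp add: lborel_prod)
  show "integral\<^sup>L lborel f = (\<integral>t. (\<integral>x. f (x, t) \<partial>lborel) \<partial>lborel)"
    using lborel_pair.integral_snd[OF f] by (simp add: lborel_prod)
  show "AE t in lborel. integrable lborel (\<lambda>x. f (x, t))" using lborel_pair.AE_integrable_snd[OF f] .
  show "integrable lborel (\<lambda>t. \<integral>x. f (x, t) \<partial>lborel)" using lborel_pair.integrable_snd[OF f] .
qed

lemma measurable_slice:
  fixes u :: "real \<times> real \<Rightarrow> 'b::topological_space"
  assumes "u \<in> borel_measurable borel"
  shows "(\<lambda>x. u (x, t)) \<in> borel_measurable borel"
  by (rule measurable_compose[OF _ assms]) (auto intro!: borel_measurable_continuous_onI continuous_intros)

lemma measurable_integral_slice:
  fixes u :: "real \<times> real \<Rightarrow> real"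
  assumes "u \<in> borel_measurable borel"
  shows "(\<lambda>t. \<integral>x. u (x, t) \<partial>lborel) \<in> borel_measurable borel"
proof -
  have "(\<lambda>z :: real \<times> real. (snd z, fst z)) \<in> borel_measurable borel"
    by (auto intro!: borel_measurable_continuous_onI continuous_intros)
  from measurable_compose[OF this assms]
  have "(\<lambda>z. u (snd z, fst z)) \<in> borel_measurable (lborel \<Otimes>\<^sub>M lborel)" by (simp add: lborel_prod)
  then have "(\<lambda>(t, x). u (x, t)) \<in> borel_measurable (lborel \<Otimes>\<^sub>M lborel)" by (simp add: case_prod_beta)
  from lborel.borel_measurable_lebesgue_integral[OF this] show ?thesis by simp
qed

lemma integrable_product:
  fixes f g :: "real \<Rightarrow> real"
  assumes f: "integrable lborel f" and g: "integrable lborel g"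
  shows "integrable lborel (\<lambda>z. f (fst z) * g (snd z))"
    "(\<integral>z. f (fst z) * g (snd z) \<partial>lborel) = integral\<^sup>L lborel f * integral\<^sup>L lborel g"
proof -
  have m: "f \<in> borel_measurable borel" "g \<in> borel_measurable borel" using f g by auto
  have "integrable (lborel \<Otimes>\<^sub>M lborel) (\<lambda>z. f (fst z) * g (snd z))"
  proof (rule lborel_pair.Fubini_integrable)
    have "(\<lambda>z::real\<times>real. f (fst z) * g (snd z)) \<in> borel_measurable borel"
      by (intro borel_measurable_times measurable_compose[OF _ m(1)] measurable_compose[OF _ m(2)])
        (auto intro!: borel_measurable_continuous_onI continuous_intros)
    then show "(\<lambda>z. f (fst z) * g (snd z)) \<in> borel_measurable (lborel \<Otimes>\<^sub>M lborel)" by (simp add: lborel_prod)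
    show "integrable lborel (\<lambda>x. \<integral>y. norm (f (fst (x, y)) * g (snd (x, y))) \<partial>lborel)"
      using f by (simp add: abs_mult)
    show "AE x in lborel. integrable lborel (\<lambda>y. f (fst (x, y)) * g (snd (x, y)))" using g by simp
  qed
  then show i: "integrable lborel (\<lambda>z. f (fst z) * g (snd z))" by (simp add: lborel_prod)
  show "(\<integral>z. f (fst z) * g (snd z) \<partial>lborel) = integral\<^sup>L lborel f * integral\<^sup>L lborel g"
    using fubini_time(1)[OF i] by simp
qed

lemma integral_powr:
  fixes a T :: real
  assumes "- 1 < a" "0 \<le> T"
  shows "integrable lborel (\<lambda>t. indicator {0<..<T} t * t powr a)"
    "(\<integral>t. indicator {0<..<T} t * t powr a \<partial>lborel) = T powr (a + 1) / (a + 1)"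
proof -
  have "((\<lambda>x. x powr a) has_integral (T powr (a + 1) / (a + 1))) {0<..<T}"
    using has_integral_powr_from_0[OF assms] has_integral_open_interval[of "\<lambda>x. x powr a" _ 0 T] by simp
  then have "((\<lambda>t. indicator {0<..<T} t * t powr a) has_integral (T powr (a + 1) / (a + 1))) UNIV"
  proof (subst (asm) has_integral_restrict_UNIV[symmetric])
    have "(\<lambda>x. if x \<in> {0<..<T} then x powr a else 0) = (\<lambda>t. indicator {0<..<T} t * t powr a)"
      by (auto simp: indicator_def fun_eq_iff)
    then show "((\<lambda>x. if x \<in> {0<..<T} then x powr a else 0) has_integral (T powr (a + 1) / (a + 1))) UNIV \<Longrightarrow> ?thesis"
      by simp
  qed
  moreover have "(\<lambda>t. indicator {0<..<T} t * t powr a) \<in> borel_measurable borel" by measurable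
  ultimately have "has_bochner_integral lborel (\<lambda>t. indicator {0<..<T} t * t powr a) (T powr (a + 1) / (a + 1))"
    using assms by (intro has_bochner_integral_nn_integral) (auto intro!: nn_integral_has_integral_lborel)
  then show "integrable lborel (\<lambda>t. indicator {0<..<T} t * t powr a)"
    "(\<integral>t. indicator {0<..<T} t * t powr a \<partial>lborel) = T powr (a + 1) / (a + 1)"
    by (auto simp: has_bochner_integral_iff)
qed

lemma integral_translate:
  fixes f :: "'a::euclidean_space \<Rightarrow> real"
  assumes "f \<in> borel_measurable borel"
  shows "(\<integral>x. f (c + x) \<partial>lborel) = (\<integral>x. f x \<partial>lborel)"
proof -
  have "(\<integral>x. f x \<partial>distr lborel borel ((+) c)) = (\<integral>x. f (c + x) \<partial>lborel)"
    by (rule integral_distr) (use assms in auto)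
  then show ?thesis by (simp add: lborel_distr_plus)
qed

section \<open>Functions bounded away from the initial time\<close>

definition lbdd :: "(real \<times> real \<Rightarrow> 'a::real_normed_vector) \<Rightarrow> bool" where
  "lbdd u \<longleftrightarrow> u \<in> borel_measurable borel \<and> (\<forall>c>0. \<exists>B. \<forall>x t. c \<le> t \<longrightarrow> norm (u (x, t)) \<le> B)"

lemma lbdd_const: "lbdd (\<lambda>z. c)" by (auto simp: lbdd_def)

lemma lbdd_add:
  fixes u v :: "real \<times> real \<Rightarrow> 'a::{real_normed_vector, second_countable_topology}"
  assumes "lbdd u" "lbdd v" shows "lbdd (\<lambda>z. u z + v z)"
  unfolding lbdd_def
proof (intro conjI allI impI)
  show "(\<lambda>z. u z + v z) \<in> borel_measurable borel" using assms by (auto simp: lbdd_def)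
  fix c :: real assume "0 < c"
  then obtain B B' where "\<And>x t. c \<le> t \<Longrightarrow> norm (u (x, t)) \<le> B" "\<And>x t. c \<le> t \<Longrightarrow> norm (v (x, t)) \<le> B'"
    using assms unfolding lbdd_def by meson
  then have "\<And>x t. c \<le> t \<Longrightarrow> norm (u (x, t) + v (x, t)) \<le> B + B'" by (meson add_mono norm_triangle_ineq order_trans)
  then show "\<exists>B. \<forall>x t. c \<le> t \<longrightarrow> norm (u (x, t) + v (x, t)) \<le> B" by blast
qed

lemma lbdd_bilinear:
  fixes u :: "real \<times> real \<Rightarrow> 'a::{real_normed_vector, second_countable_topology}"
    and v :: "real \<times> real \<Rightarrow> 'b::{real_normed_vector, second_countable_topology}"
    and h :: "'a \<Rightarrow> 'b \<Rightarrow> 'c::real_normed_vector"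
  assumes h: "bounded_bilinear h" and "lbdd u" "lbdd v" shows "lbdd (\<lambda>z. h (u z) (v z))"
  unfolding lbdd_def
proof (intro conjI allI impI)
  interpret bounded_bilinear h by (rule h)
  have c: "continuous_on UNIV (\<lambda>x. h (fst x) (snd x))" by (intro continuous_on continuous_intros)
  show "(\<lambda>z. h (u z) (v z)) \<in> borel_measurable borel"
    using assms by (intro borel_measurable_continuous_Pair[OF _ _ c]) (auto simp: lbdd_def)
  fix d :: real assume "0 < d"
  then obtain B B' where B: "\<And>x t. d \<le> t \<Longrightarrow> norm (u (x, t)) \<le> B" "\<And>x t. d \<le> t \<Longrightarrow> norm (v (x, t)) \<le> B'"
    using assms unfolding lbdd_def by meson
  obtain K where K: "0 < K" "\<And>a b. norm (h a b) \<le> norm a * norm b * K" using pos_bounded by blast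
  have "norm (h (u (x, t)) (v (x, t))) \<le> B * B' * K" if "d \<le> t" for x t
  proof -
    have "norm (u (x, t)) * norm (v (x, t)) * K \<le> B * B' * K"
      using B[OF that] K(1) by (intro mult_right_mono mult_mono) (auto intro: order_trans[OF norm_ge_zero])
    then show ?thesis using K(2) by (meson order_trans)
  qed
  then show "\<exists>B. \<forall>x t. d \<le> t \<longrightarrow> norm (h (u (x, t)) (v (x, t))) \<le> B" by blast
qed

lemma bounded_bilinear_cross3: "bounded_bilinear cross3"
  using bilinear_cross by (simp add: bilinear_conv_bounded_bilinear)

lemmas lbdd_inner = lbdd_bilinear[OF bounded_bilinear_inner]
lemmas lbdd_scaleR = lbdd_bilinear[OF bounded_bilinear_scaleR]
lemmas lbdd_mult = lbdd_bilinear[OF bounded_bilinear_mult]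
lemmas lbdd_cross = lbdd_bilinear[OF bounded_bilinear_cross3]

lemma lbdd_norm2:
  fixes u :: "real \<times> real \<Rightarrow> 'a::{real_inner, second_countable_topology}"
  shows "lbdd u \<Longrightarrow> lbdd (\<lambda>z. (norm (u z))\<^sup>2)"
  using lbdd_inner[of u u] by (simp add: power2_norm_eq_inner)

lemma lbdd_minus:
  fixes u :: "real \<times> real \<Rightarrow> 'a::{real_normed_vector, second_countable_topology}"
  shows "lbdd u \<Longrightarrow> lbdd (\<lambda>z. - u z)"
  using lbdd_scaleR[OF lbdd_const[of "-1"], of u] by simp

lemma lbdd_diff:
  fixes u v :: "real \<times> real \<Rightarrow> 'a::{real_normed_vector, second_countable_topology}"
  shows "lbdd u \<Longrightarrow> lbdd v \<Longrightarrow> lbdd (\<lambda>z. u z - v z)"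
  using lbdd_add[OF _ lbdd_minus, of u v] by simp

lemmas lbdd_intros = lbdd_const lbdd_add lbdd_diff lbdd_minus lbdd_inner lbdd_scaleR lbdd_mult lbdd_cross lbdd_norm2

text \<open>A test function lives on times t >= c > 0, where \<open>u\<close> is bounded uniformly
  in x. All integrands of the weak formulation are of this shape, so integrability reduces to the
  closure rules for \<open>lbdd\<close>.\<close>

lemma integrable_test:
  fixes u :: "real \<times> real \<Rightarrow> 'a::{banach, second_countable_topology}"
  assumes "test_fun \<phi>" "lbdd u"
  shows "integrable lborel (\<lambda>z. \<phi> z *\<^sub>R u z)"
proof -
  obtain a b c d where s: "supp_box a b c d \<phi>" using assms by (auto simp: test_fun_def)
  then have "0 < c" by (simp add: supp_box_def)
  then obtain B where B: "\<And>x t. c \<le> t \<Longrightarrow> norm (u (x, t)) \<le> B" using assms(2) unfolding lbdd_def by meson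
  show ?thesis
  proof (rule integrable_compact_mult)
    show "continuous_on UNIV \<phi>" using assms(1) smooth2_continuous by (auto simp: test_fun_def)
    show "compact ({a..b} \<times> {c..d})" by (intro compact_Times compact_Icc)
    show "\<phi> z = 0" if "z \<notin> {a..b} \<times> {c..d}" for z using s that by (cases z) (force simp: supp_box_def)
    show "u \<in> borel_measurable borel" using assms(2) by (simp add: lbdd_def)
    show "norm (u z) \<le> B" if "z \<in> {a..b} \<times> {c..d}" for z using B that by (cases z) auto
  qed
qed

lemmas integrable_test_real = integrable_test[where 'a = real, unfolded real_scaleR_def]

text \<open>These vanishing integrals allow A . M to be exchanged for 1 - A . M under a derivative
  of the test function.\<close>

lemma integral_dt_zero:
  assumes "test_fun \<phi>" shows "(\<integral>z. dt \<phi> z \<partial>lborel) = 0" "(\<integral>z. dx \<phi> z \<partial>lborel) = 0"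
proof -
  obtain a b c d where s: "supp_box a b c d \<phi>" using assms by (auto simp: test_fun_def)
  have sm: "smooth2 UNIV \<phi>" using assms by (simp add: test_fun_def)
  have g: "((\<lambda>y. \<phi> (y, t)) has_real_derivative dx \<phi> (x, t)) (at x)"
    "((\<lambda>r. \<phi> (x, r)) has_real_derivative dt \<phi> (x, t)) (at t)" for x t
    using has_grad_partial[OF smooth2D(1)[OF sm UNIV_I, of "(x, t)"]] by auto
  have c: "continuous_on UNIV (\<lambda>x. dx \<phi> (x, t))" "continuous_on UNIV (\<lambda>t. dt \<phi> (x, t))" for x t
    by (rule continuous_on_compose2[OF smooth2_continuous[OF smooth2D(2)[OF sm]]]
        continuous_on_compose2[OF smooth2_continuous[OF smooth2D(3)[OF sm]]]; auto intro!: continuous_intros)+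
  have i: "integrable lborel (dt \<phi>)" "integrable lborel (dx \<phi>)"
    using integrable_test_real[OF test_fun_dx(2)[OF assms] lbdd_const[of 1]]
      integrable_test_real[OF test_fun_dx(1)[OF assms] lbdd_const[of 1]] by auto
  have "(\<integral>x. dx \<phi> (x, t) \<partial>lborel) = 0" for t
  proof -
    have "(\<integral>x. dx \<phi> (x, t) \<partial>lborel) = \<phi> (max a b + 1, t) - \<phi> (min a b - 1, t)"
      by (rule integral_deriv[OF g(1) c(1)]) (use supp_box_dx(1)[OF s] in \<open>force simp: supp_box_def\<close>)+
    then show ?thesis using s unfolding supp_box_def by (smt (verit))
  qed
  then show "(\<integral>z. dx \<phi> z \<partial>lborel) = 0" using fubini_time(1)[OF i(2)] by simp
  have "(\<integral>t. dt \<phi> (x, t) \<partial>lborel) = 0" for x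
  proof -
    have "(\<integral>t. dt \<phi> (x, t) \<partial>lborel) = \<phi> (x, max c d + 1) - \<phi> (x, min c d - 1)"
      by (rule integral_deriv[OF g(2) c(2)]) (use supp_box_dx(2)[OF s] in \<open>force simp: supp_box_def\<close>)+
    then show ?thesis using s unfolding supp_box_def by (smt (verit))
  qed
  moreover have "integrable (lborel \<Otimes>\<^sub>M lborel) (\<lambda>(x, y). dt \<phi> (x, y))" using i(1) by (simp add: lborel_prod)
  ultimately show "(\<integral>z. dt \<phi> z \<partial>lborel) = 0"
    using lborel_pair.integral_fst[of "\<lambda>x t. dt \<phi> (x, t)"] by (simp add: lborel_prod)
qed

section \<open>Weak solutions compared with constant maps\<close>

text \<open>
  A weak solution with small seminorm, after modification on a null set: all bounds hold everywhere.
\<close>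

locale tame =
  fixes \<alpha> \<beta> \<epsilon> :: real and Ap Am :: "real^3" and M W :: "real \<times> real \<Rightarrow> real^3"
  assumes \<alpha>: "0 < \<alpha>" "\<alpha> \<le> 1" and \<beta>: "\<beta> = sqrt (1 - \<alpha>\<^sup>2)" and \<epsilon>: "0 \<le> \<epsilon>"
    and nA: "norm Ap = 1" "norm Am = 1"
    and M_meas: "M \<in> borel_measurable borel" and W_meas: "W \<in> borel_measurable borel"
    and M_norm: "\<And>z. norm (M z) = 1"
    and W_bound: "\<And>x t. 0 < t \<Longrightarrow> norm (W (x, t)) \<le> \<epsilon> / sqrt t"
    and weak: "\<And>\<phi>. test_fun \<phi> \<Longrightarrow> (\<integral>z. dx \<phi> z *\<^sub>R M z \<partial>lborel) = - (\<integral>z. \<phi> z *\<^sub>R W z \<partial>lborel)"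
    and eqn: "\<And>\<phi>. test_fun \<phi> \<Longrightarrow> - (\<integral>z. dt \<phi> z *\<^sub>R M z \<partial>lborel) =
       - \<beta> *\<^sub>R (\<integral>z. dx \<phi> z *\<^sub>R cross3 (M z) (W z) \<partial>lborel)
       + \<alpha> *\<^sub>R (\<integral>z. dx (dx \<phi>) z *\<^sub>R M z \<partial>lborel)
       + \<alpha> *\<^sub>R (\<integral>z. \<phi> z *\<^sub>R ((norm (W z))\<^sup>2 *\<^sub>R M z) \<partial>lborel)"
    and carleson: "\<And>x r. 0 < r \<Longrightarrow> integrable lborel (\<lambda>z. indicator ({x - r<..<x + r} \<times> {0<..<r\<^sup>2}) z * (norm (W z))\<^sup>2)"
      "\<And>x r. 0 < r \<Longrightarrow> (\<integral>z. indicator ({x - r<..<x + r} \<times> {0<..<r\<^sup>2}) z * (norm (W z))\<^sup>2 \<partial>lborel) \<le> \<epsilon>\<^sup>2 * r"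
    and init: "\<And>\<psi> a b \<delta>. smooth1 UNIV \<psi> \<Longrightarrow> supp1 a b \<psi> \<Longrightarrow> 0 < \<delta> \<Longrightarrow>
       \<exists>s0>0. AE t in lborel. 0 < t \<and> t < s0 \<longrightarrow> (\<integral>x. \<bar>\<psi> x\<bar> * norm (M (x, t) - step_data Ap Am x) \<partial>lborel) \<le> \<delta>"
begin

lemma \<beta>01: "0 \<le> \<beta>" "\<beta> \<le> 1" "\<beta>\<^sup>2 = 1 - \<alpha>\<^sup>2"
proof -
  have "0 \<le> 1 - \<alpha>\<^sup>2" using \<alpha> by (simp add: power_le_one)
  then show "0 \<le> \<beta>" "\<beta> \<le> 1" "\<beta>\<^sup>2 = 1 - \<alpha>\<^sup>2" by (auto simp: \<beta>)
qed

lemma lbdd_M: "lbdd M" using M_meas M_norm by (auto simp: lbdd_def intro!: exI[of _ 1])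

lemma lbdd_W: "lbdd W"
  unfolding lbdd_def
proof (intro conjI allI impI W_meas)
  fix c :: real assume c: "0 < c"
  have "norm (W (x, t)) \<le> \<epsilon> / sqrt c" if "c \<le> t" for x t
  proof -
    have "norm (W (x, t)) \<le> \<epsilon> / sqrt t" using W_bound c that by simp
    also have "\<dots> \<le> \<epsilon> / sqrt c" using c that \<epsilon> by (intro divide_left_mono) auto
    finally show ?thesis .
  qed
  then show "\<exists>B. \<forall>x t. c \<le> t \<longrightarrow> norm (W (x, t)) \<le> B" by blast
qed

lemma AM_bound: "norm A = 1 \<Longrightarrow> \<bar>A \<bullet> M z\<bar> \<le> 1"
  using Cauchy_Schwarz_ineq2[of A "M z"] M_norm by simp

lemma weak_inner:
  assumes "test_fun \<phi>"
  shows "(\<integral>z. dx \<phi> z * (A \<bullet> M z) \<partial>lborel) = - (\<integral>z. \<phi> z * (A \<bullet> W z) \<partial>lborel)"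
proof -
  have "(\<integral>z. dx \<phi> z * (A \<bullet> M z) \<partial>lborel) = (\<integral>z. A \<bullet> (dx \<phi> z *\<^sub>R M z) \<partial>lborel)" by simp
  also have "\<dots> = A \<bullet> (\<integral>z. dx \<phi> z *\<^sub>R M z \<partial>lborel)"
    by (intro integral_inner_right integrable_test test_fun_dx assms lbdd_M)
  also have "\<dots> = - (A \<bullet> (\<integral>z. \<phi> z *\<^sub>R W z \<partial>lborel))" by (simp add: weak[OF assms])
  also have "A \<bullet> (\<integral>z. \<phi> z *\<^sub>R W z \<partial>lborel) = (\<integral>z. A \<bullet> (\<phi> z *\<^sub>R W z) \<partial>lborel)"
    by (intro integral_inner_right[symmetric] integrable_test assms lbdd_W)
  finally show ?thesis by simp
qed

text \<open>The weak derivative replaces the second derivative of the test function by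
  \<open>W\<close>, so that only one derivative of \<open>\<phi>\<close> is left and the estimates
  depend on the total variation of the cutoff alone.\<close>

lemma eqn_inner:
  assumes "test_fun \<phi>"
  shows "(\<integral>z. dt \<phi> z * (A \<bullet> M z) \<partial>lborel) =
     \<beta> * (\<integral>z. dx \<phi> z * (A \<bullet> cross3 (M z) (W z)) \<partial>lborel)
     + \<alpha> * (\<integral>z. dx \<phi> z * (A \<bullet> W z) \<partial>lborel)
     - \<alpha> * (\<integral>z. \<phi> z * ((norm (W z))\<^sup>2 * (A \<bullet> M z)) \<partial>lborel)"
proof -
  note i = integral_inner_right[symmetric] integrable_test test_fun_dx assms lbdd_intros lbdd_M lbdd_W
  have 1: "A \<bullet> (\<integral>z. dt \<phi> z *\<^sub>R M z \<partial>lborel) = (\<integral>z. A \<bullet> (dt \<phi> z *\<^sub>R M z) \<partial>lborel)" by (intro i)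
  have 2: "A \<bullet> (\<integral>z. dx \<phi> z *\<^sub>R cross3 (M z) (W z) \<partial>lborel) = (\<integral>z. A \<bullet> (dx \<phi> z *\<^sub>R cross3 (M z) (W z)) \<partial>lborel)" by (intro i)
  have 3: "A \<bullet> (\<integral>z. dx (dx \<phi>) z *\<^sub>R M z \<partial>lborel) = (\<integral>z. A \<bullet> (dx (dx \<phi>) z *\<^sub>R M z) \<partial>lborel)" by (intro i)
  have 4: "A \<bullet> (\<integral>z. \<phi> z *\<^sub>R ((norm (W z))\<^sup>2 *\<^sub>R M z) \<partial>lborel) = (\<integral>z. A \<bullet> (\<phi> z *\<^sub>R ((norm (W z))\<^sup>2 *\<^sub>R M z)) \<partial>lborel)" by (intro i)
  have "A \<bullet> (- (\<integral>z. dt \<phi> z *\<^sub>R M z \<partial>lborel)) = A \<bullet> (- \<beta> *\<^sub>R (\<integral>z. dx \<phi> z *\<^sub>R cross3 (M z) (W z) \<partial>lborel)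
       + \<alpha> *\<^sub>R (\<integral>z. dx (dx \<phi>) z *\<^sub>R M z \<partial>lborel)
       + \<alpha> *\<^sub>R (\<integral>z. \<phi> z *\<^sub>R ((norm (W z))\<^sup>2 *\<^sub>R M z) \<partial>lborel))"
    by (simp only: eqn[OF assms])
  then have "- (\<integral>z. dt \<phi> z * (A \<bullet> M z) \<partial>lborel) =
     - \<beta> * (\<integral>z. dx \<phi> z * (A \<bullet> cross3 (M z) (W z)) \<partial>lborel)
     + \<alpha> * (\<integral>z. dx (dx \<phi>) z * (A \<bullet> M z) \<partial>lborel)
     + \<alpha> * (\<integral>z. \<phi> z * ((norm (W z))\<^sup>2 * (A \<bullet> M z)) \<partial>lborel)"
    unfolding inner_add_right inner_minus_right inner_scaleR_right 1 2 3 4 by simp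
  then show ?thesis using weak_inner[OF test_fun_dx(1)[OF assms], of A] by simp
qed

text \<open>With a constant \<open>A\<close> all derivatives fall on the test function. Each of the
  two flux terms costs at most |\<phi>_x| |W|, because \<alpha> and \<beta> are at most 1 and |M x
  W| <= |W|; this is the factor 2. The source is kept with its sign, since a bound in one place and
  positivity in another are used.\<close>

lemma const_ineq:
  assumes \<phi>: "test_fun \<phi>" and pos: "\<And>z. 0 \<le> \<phi> z" and A: "norm A = 1"
  shows "- (\<integral>z. dt \<phi> z * (1 - A \<bullet> M z) \<partial>lborel) \<le>
     (\<integral>z. \<alpha> * (\<phi> z * ((norm (W z))\<^sup>2 * (- (A \<bullet> M z)))) + 2 * (\<bar>dx \<phi> z\<bar> * norm (W z)) \<partial>lborel)"
proof -
  note i = integrable_test_real test_fun_dx \<phi> lbdd_intros lbdd_M lbdd_W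
  have i1: "integrable lborel (\<lambda>z. dt \<phi> z * (A \<bullet> M z))" by (intro i)
  have i1': "integrable lborel (\<lambda>z. dt \<phi> z)" using integrable_test_real[OF test_fun_dx(2)[OF \<phi>] lbdd_const[of 1]] by simp
  have i2: "integrable lborel (\<lambda>z. dx \<phi> z * (A \<bullet> cross3 (M z) (W z)))" by (intro i)
  have i3: "integrable lborel (\<lambda>z. dx \<phi> z * (A \<bullet> W z))" by (intro i)
  have i4: "integrable lborel (\<lambda>z. \<phi> z * ((norm (W z))\<^sup>2 * (A \<bullet> M z)))" by (intro i)
  have i5: "integrable lborel (\<lambda>z. \<bar>dx \<phi> z\<bar> * norm (W z))"
    using integrable_norm[OF integrable_test[OF test_fun_dx(1)[OF \<phi>] lbdd_W]] by simp
  have i6: "integrable lborel (\<lambda>z. \<alpha> * (\<phi> z * ((norm (W z))\<^sup>2 * (- (A \<bullet> M z)))) + 2 * (\<bar>dx \<phi> z\<bar> * norm (W z)))"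
    using i4 i5 by simp
  have "- (\<integral>z. dt \<phi> z * (1 - A \<bullet> M z) \<partial>lborel) = (\<integral>z. dt \<phi> z * (A \<bullet> M z) \<partial>lborel)"
    using i1 i1' integral_dt_zero(1)[OF \<phi>] by (simp add: right_diff_distrib)
  also have "\<dots> = (\<integral>z. \<beta> * (dx \<phi> z * (A \<bullet> cross3 (M z) (W z))) + \<alpha> * (dx \<phi> z * (A \<bullet> W z)) - \<alpha> * (\<phi> z * ((norm (W z))\<^sup>2 * (A \<bullet> M z))) \<partial>lborel)"
    using i2 i3 i4 by (simp add: eqn_inner[OF \<phi>])
  also have "\<dots> \<le> (\<integral>z. \<alpha> * (\<phi> z * ((norm (W z))\<^sup>2 * (- (A \<bullet> M z)))) + 2 * (\<bar>dx \<phi> z\<bar> * norm (W z)) \<partial>lborel)"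
  proof (rule integral_mono)
    show "integrable lborel (\<lambda>z. \<beta> * (dx \<phi> z * (A \<bullet> cross3 (M z) (W z))) + \<alpha> * (dx \<phi> z * (A \<bullet> W z)) - \<alpha> * (\<phi> z * ((norm (W z))\<^sup>2 * (A \<bullet> M z))))"
      using i2 i3 i4 by simp
    fix z
    have nc: "norm (cross3 (M z) (W z)) \<le> norm (W z)"
    proof (rule power2_le_imp_le)
      show "(norm (cross3 (M z) (W z)))\<^sup>2 \<le> (norm (W z))\<^sup>2"
        using norm_cross_dot[of "M z" "W z"] zero_le_power2[of "M z \<bullet> W z"] unfolding M_norm mult_1_left by linarith
    qed simp
    have "\<bar>A \<bullet> cross3 (M z) (W z)\<bar> \<le> norm (W z)" "\<bar>A \<bullet> W z\<bar> \<le> norm (W z)"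
      using Cauchy_Schwarz_ineq2[of A "cross3 (M z) (W z)"] Cauchy_Schwarz_ineq2[of A "W z"] nc A by auto
    then have b: "\<bar>dx \<phi> z * (A \<bullet> cross3 (M z) (W z))\<bar> \<le> \<bar>dx \<phi> z\<bar> * norm (W z)" "\<bar>dx \<phi> z * (A \<bullet> W z)\<bar> \<le> \<bar>dx \<phi> z\<bar> * norm (W z)"
      by (auto simp: abs_mult intro!: mult_left_mono)
    have "\<beta> * (dx \<phi> z * (A \<bullet> cross3 (M z) (W z))) \<le> 1 * (\<bar>dx \<phi> z\<bar> * norm (W z))"
      using b(1) \<beta>01 by (intro order_trans[OF mult_left_mono[OF abs_le_D1[OF b(1)]]] mult_right_mono) auto
    moreover have "\<alpha> * (dx \<phi> z * (A \<bullet> W z)) \<le> 1 * (\<bar>dx \<phi> z\<bar> * norm (W z))"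
      using b(2) \<alpha> by (intro order_trans[OF mult_left_mono[OF abs_le_D1[OF b(2)]]] mult_right_mono) auto
    ultimately show "\<beta> * (dx \<phi> z * (A \<bullet> cross3 (M z) (W z))) + \<alpha> * (dx \<phi> z * (A \<bullet> W z)) - \<alpha> * (\<phi> z * ((norm (W z))\<^sup>2 * (A \<bullet> M z)))
      \<le> \<alpha> * (\<phi> z * ((norm (W z))\<^sup>2 * (- (A \<bullet> M z)))) + 2 * (\<bar>dx \<phi> z\<bar> * norm (W z))" by simp
  qed (rule i6)
  finally show ?thesis .
qed

definition slice :: "(real \<Rightarrow> real) \<Rightarrow> real^3 \<Rightarrow> real \<Rightarrow> real" where
  "slice \<psi> A t = (\<integral>x. \<psi> x * (1 - A \<bullet> M (x, t)) \<partial>lborel)"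

end

lemma test_fun_product':
  assumes "smooth1 UNIV \<psi>" "supp1 a b \<psi>" "smooth1 UNIV \<eta>" "0 < c" "supp1 c d \<eta>"
  shows "test_fun (\<lambda>(x, t). \<psi> x * \<eta> t)"
    "dx (\<lambda>(x, t). \<psi> x * \<eta> t) = (\<lambda>(x, t). deriv \<psi> x * \<eta> t)"
    "dt (\<lambda>(x, t). \<psi> x * \<eta> t) = (\<lambda>(x, t). \<psi> x * deriv \<eta> t)"
proof -
  note p = test_fun_product[of \<psi> a b \<eta> c d]
  have s: "smooth1 {0<..} \<eta>" by (rule smooth1_subset[OF _ assms(3)]) simp
  show "test_fun (\<lambda>(x, t). \<psi> x * \<eta> t)" "dx (\<lambda>(x, t). \<psi> x * \<eta> t) = (\<lambda>(x, t). deriv \<psi> x * \<eta> t)"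
    by (rule p(1) p(2); use assms s in \<open>force simp: supp1_def\<close>)+
  have "((\<lambda>s. \<psi> x * \<eta> s) has_real_derivative \<psi> x * deriv \<eta> t) (at t)" for x t
    by (auto intro!: derivative_eq_intros smooth1D(1)[OF assms(3)])
  then show "dt (\<lambda>(x, t). \<psi> x * \<eta> t) = (\<lambda>(x, t). \<psi> x * deriv \<eta> t)"
    by (auto simp: dt_def intro!: DERIV_imp_deriv)
qed

lemma integrable_smooth1:
  assumes "smooth1 UNIV \<psi>" "supp1 a b \<psi>"
  shows "integrable lborel \<psi>" "integrable lborel (\<lambda>x. \<bar>\<psi> x\<bar>)"
    "integrable lborel (deriv \<psi>)" "integrable lborel (\<lambda>x. \<bar>deriv \<psi> x\<bar>)"
proof -
  note d = supp1D[OF supp1_deriv[OF assms]] and o = supp1D[OF assms(2)]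
  show 1: "integrable lborel \<psi>"
    using integrable_compact_mult[OF smooth1_continuous[OF assms(1)] compact_Icc[of a b], of "\<lambda>_. 1::real" 1] o by simp
  show 2: "integrable lborel (deriv \<psi>)"
    using integrable_compact_mult[OF smooth1_continuous[OF smooth1D(2)[OF assms(1)]] compact_Icc[of a b], of "\<lambda>_. 1::real" 1] d by simp
  show "integrable lborel (\<lambda>x. \<bar>\<psi> x\<bar>)" "integrable lborel (\<lambda>x. \<bar>deriv \<psi> x\<bar>)" using 1 2 by auto
qed

context tame begin

lemma slice_int:
  assumes "smooth1 UNIV \<psi>" "supp1 a b \<psi>" "norm A = 1"
  shows "integrable lborel (\<lambda>x. \<psi> x * (1 - A \<bullet> M (x, t)))"
    "\<bar>slice \<psi> A t\<bar> \<le> 2 * (\<integral>x. \<bar>\<psi> x\<bar> \<partial>lborel)"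
    "slice \<psi> A \<in> borel_measurable borel"
proof -
  have m: "(\<lambda>z. 1 - A \<bullet> M z) \<in> borel_measurable borel" using M_meas by measurable
  have b: "norm (1 - A \<bullet> M z) \<le> 2" for z using AM_bound[OF assms(3), of z] by auto
  show i: "integrable lborel (\<lambda>x. \<psi> x * (1 - A \<bullet> M (x, t)))"
    using integrable_compact_mult[OF smooth1_continuous[OF assms(1)] compact_Icc[of a b] _ measurable_slice[OF m], where B=2]
      supp1D[OF assms(2)] b by simp
  have "\<bar>slice \<psi> A t\<bar> \<le> (\<integral>x. \<bar>\<psi> x * (1 - A \<bullet> M (x, t))\<bar> \<partial>lborel)"
    unfolding slice_def using integral_norm_bound[of lborel "\<lambda>x. \<psi> x * (1 - A \<bullet> M (x, t))"] by simp
  also have "\<dots> \<le> (\<integral>x. 2 * \<bar>\<psi> x\<bar> \<partial>lborel)"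
  proof (rule integral_mono)
    show "\<bar>\<psi> x * (1 - A \<bullet> M (x, t))\<bar> \<le> 2 * \<bar>\<psi> x\<bar>" for x
      using mult_left_mono[OF b[of "(x, t)"] abs_ge_zero[of "\<psi> x"]] by (simp add: abs_mult mult.commute)
  qed (use i integrable_smooth1[OF assms(1,2)] in auto)
  finally show "\<bar>slice \<psi> A t\<bar> \<le> 2 * (\<integral>x. \<bar>\<psi> x\<bar> \<partial>lborel)" by simp
  have "(\<lambda>z. \<psi> (fst z)) \<in> borel_measurable borel"
    by (intro borel_measurable_continuous_onI continuous_on_compose2[OF smooth1_continuous[OF assms(1)]] continuous_intros) auto
  then have "(\<lambda>z. \<psi> (fst z) * (1 - A \<bullet> M z)) \<in> borel_measurable borel" using m by (rule borel_measurable_times)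
  from measurable_integral_slice[OF this] show "slice \<psi> A \<in> borel_measurable borel" by (simp add: slice_def[abs_def])
qed

lemma slice_tested:
  assumes "smooth1 UNIV \<psi>" "supp1 a b \<psi>"
    "smooth1 UNIV \<eta>" "0 < c" "supp1 c d \<eta>"
  shows "(\<integral>z. dt (\<lambda>(x, t). \<psi> x * \<eta> t) z * (1 - A \<bullet> M z) \<partial>lborel) = (\<integral>t. deriv \<eta> t * slice \<psi> A t \<partial>lborel)"
proof -
  note p = test_fun_product'[OF assms]
  have "integrable lborel (\<lambda>z. dt (\<lambda>(x, t). \<psi> x * \<eta> t) z * (1 - A \<bullet> M z))"
    by (intro integrable_test_real test_fun_dx p lbdd_intros lbdd_M)
  from fubini_time(1)[OF this]
  have "(\<integral>z. dt (\<lambda>(x, t). \<psi> x * \<eta> t) z * (1 - A \<bullet> M z) \<partial>lborel)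
    = (\<integral>t. (\<integral>x. deriv \<eta> t * (\<psi> x * (1 - A \<bullet> M (x, t))) \<partial>lborel) \<partial>lborel)"
    unfolding p(3) by (simp add: mult_ac)
  then show ?thesis by (simp add: slice_def)
qed

definition slice0 :: "(real \<Rightarrow> real) \<Rightarrow> real^3 \<Rightarrow> real" where
  "slice0 \<psi> A = (\<integral>x. \<psi> x * (1 - A \<bullet> step_data Ap Am x) \<partial>lborel)"

lemma step_data_meas: "step_data Ap Am \<in> borel_measurable borel"
  unfolding step_data_def[abs_def] by measurable

lemma step_data_norm: "norm (step_data Ap Am x) \<le> 1"
  using nA by (auto simp: step_data_def indicator_def)

lemma slice0_int:
  assumes "smooth1 UNIV \<psi>" "supp1 a b \<psi>" "norm A = 1"
  shows "integrable lborel (\<lambda>x. \<psi> x * (1 - A \<bullet> step_data Ap Am x))"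
proof -
  have m: "(\<lambda>x. 1 - A \<bullet> step_data Ap Am x) \<in> borel_measurable borel" using step_data_meas by measurable
  have "\<bar>A \<bullet> step_data Ap Am x\<bar> \<le> 1" for x
    using Cauchy_Schwarz_ineq2[of A "step_data Ap Am x"] step_data_norm[of x] assms(3) by simp
  then have "norm (1 - A \<bullet> step_data Ap Am x) \<le> 2" for x
    unfolding real_norm_def using order_trans[OF abs_triangle_ineq4 add_left_mono, of "A \<bullet> step_data Ap Am x" 1 1] by simp
  then show ?thesis
    using integrable_compact_mult[OF smooth1_continuous[OF assms(1)] compact_Icc[of a b] _ m, of 2] supp1D[OF assms(2)] by simp
qed

lemma slice_init:
  assumes "smooth1 UNIV \<psi>" "supp1 a b \<psi>" "norm A = 1" "0 < \<delta>"
  shows "\<exists>s0>0. AE s in lborel. 0 < s \<and> s < s0 \<longrightarrow> slice \<psi> A s \<le> slice0 \<psi> A + \<delta>"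
proof -
  obtain s0 where s0: "0 < s0" "AE t in lborel. 0 < t \<and> t < s0 \<longrightarrow> (\<integral>x. \<bar>\<psi> x\<bar> * norm (M (x, t) - step_data Ap Am x) \<partial>lborel) \<le> \<delta>"
    using init[OF assms(1,2,4)] by blast
  have le: "slice \<psi> A t - slice0 \<psi> A \<le> (\<integral>x. \<bar>\<psi> x\<bar> * norm (M (x, t) - step_data Ap Am x) \<partial>lborel)" for t
  proof -
    have m: "(\<lambda>x. norm (M (x, t) - step_data Ap Am x)) \<in> borel_measurable borel"
      using measurable_slice[OF M_meas] step_data_meas by measurable
    have b: "norm (norm (M (x, t) - step_data Ap Am x)) \<le> 2" for x
      using norm_triangle_ineq4[of "M (x, t)" "step_data Ap Am x"] step_data_norm[of x] M_norm[of "(x, t)"] by simp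
    have "slice \<psi> A t - slice0 \<psi> A = (\<integral>x. \<psi> x * (1 - A \<bullet> M (x, t)) - \<psi> x * (1 - A \<bullet> step_data Ap Am x) \<partial>lborel)"
      unfolding slice_def slice0_def using slice_int(1)[OF assms(1-3)] slice0_int[OF assms(1-3)] by simp
    also have "\<dots> \<le> (\<integral>x. \<bar>\<psi> x\<bar> * norm (M (x, t) - step_data Ap Am x) \<partial>lborel)"
    proof (rule integral_mono)
      show "integrable lborel (\<lambda>x. \<psi> x * (1 - A \<bullet> M (x, t)) - \<psi> x * (1 - A \<bullet> step_data Ap Am x))"
        using slice_int(1)[OF assms(1-3)] slice0_int[OF assms(1-3)] by simp
      have "integrable lborel (\<lambda>x. \<psi> x * norm (M (x, t) - step_data Ap Am x))"
        using integrable_compact_mult[OF smooth1_continuous[OF assms(1)] compact_Icc[of a b] _ m, of 2] supp1D[OF assms(2)] b by simp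
      from integrable_abs[OF this] show "integrable lborel (\<lambda>x. \<bar>\<psi> x\<bar> * norm (M (x, t) - step_data Ap Am x))"
        by (simp add: abs_mult)
      fix x
      have "\<psi> x * (1 - A \<bullet> M (x, t)) - \<psi> x * (1 - A \<bullet> step_data Ap Am x) = - (\<psi> x * (A \<bullet> (M (x, t) - step_data Ap Am x)))"
        by (simp add: algebra_simps inner_diff_right)
      also have "\<dots> \<le> \<bar>\<psi> x\<bar> * \<bar>A \<bullet> (M (x, t) - step_data Ap Am x)\<bar>" by (metis abs_ge_minus_self abs_mult)
      also have "\<dots> \<le> \<bar>\<psi> x\<bar> * norm (M (x, t) - step_data Ap Am x)"
        using Cauchy_Schwarz_ineq2[of A "M (x, t) - step_data Ap Am x"] assms(3) by (intro mult_left_mono) auto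
      finally show "\<psi> x * (1 - A \<bullet> M (x, t)) - \<psi> x * (1 - A \<bullet> step_data Ap Am x) \<le> \<bar>\<psi> x\<bar> * norm (M (x, t) - step_data Ap Am x)" .
    qed
    finally show ?thesis .
  qed
  have "AE s in lborel. 0 < s \<and> s < s0 \<longrightarrow> slice \<psi> A s \<le> slice0 \<psi> A + \<delta>"
    using s0(2)
  proof eventually_elim
    case (elim s)
    show ?case
    proof
      assume "0 < s \<and> s < s0"
      with elim le[of s] show "slice \<psi> A s \<le> slice0 \<psi> A + \<delta>" by linarith
    qed
  qed
  then show ?thesis using s0(1) by blast
qed

text \<open>This combines \<open>time_lemma\<close> with the L1 convergence to the initial data. The
  constant \<open>K\<close> is the total growth that a time cutoff of height 1 would see.\<close>

lemma slice_bound: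
  assumes \<psi>: "smooth1 UNIV \<psi>" "supp1 a b \<psi>" and A: "norm A = 1"
    and hyp: "\<And>\<eta> N c d. smooth1 UNIV \<eta> \<Longrightarrow> (\<And>t. 0 \<le> \<eta> t) \<Longrightarrow> (\<And>t. \<eta> t \<le> N) \<Longrightarrow>
       supp1 c d \<eta> \<Longrightarrow> 0 < c \<Longrightarrow> c \<le> d \<Longrightarrow> d < T \<Longrightarrow>
       - (\<integral>z. dt (\<lambda>(x, t). \<psi> x * \<eta> t) z * (1 - A \<bullet> M z) \<partial>lborel) \<le> N * K"
  shows "AE t in lborel. 0 < t \<and> t < T \<longrightarrow> slice \<psi> A t \<le> slice0 \<psi> A + K"
proof (rule time_lemma[OF slice_int(3)[OF \<psi> A]])
  show "\<exists>B. \<forall>t. s \<le> t \<and> t < T \<longrightarrow> \<bar>slice \<psi> A t\<bar> \<le> B" for s using slice_int(2)[OF \<psi> A] by blast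
  show "\<exists>s0>0. AE s in lborel. 0 < s \<and> s < s0 \<longrightarrow> slice \<psi> A s \<le> slice0 \<psi> A + \<delta>" if "0 < \<delta>" for \<delta>
    by (rule slice_init[OF \<psi> A that])
  show "- (\<integral>t. deriv \<eta> t * slice \<psi> A t \<partial>lborel) \<le> N * K"
    if "smooth1 UNIV \<eta>" "\<And>t. 0 \<le> \<eta> t" "\<And>t. \<eta> t \<le> N" "supp1 c d \<eta>" "0 < c" "c \<le> d" "d < T" for \<eta> N c d
    using hyp[OF that] slice_tested[OF \<psi> that(1,5,4)] by simp
qed

text \<open>The bound |W| <= \<epsilon> / sqrt t is integrable up to t = 0, with integral 2
  \<epsilon> sqrt T. The spatial factor enters only through the total variation \<open>V\<close> of
  the cutoff, so neither its width nor its slope matters.\<close>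

lemma flux_bound:
  assumes \<psi>: "smooth1 UNIV \<psi>" "supp1 a b \<psi>"
    and \<eta>: "smooth1 UNIV \<eta>" "\<And>t. 0 \<le> \<eta> t" "\<And>t. \<eta> t \<le> N" "supp1 c d \<eta>" "0 < c" "d < T" "c \<le> d"
    and V: "(\<integral>x. \<bar>deriv \<psi> x\<bar> \<partial>lborel) \<le> V"
  shows "integrable lborel (\<lambda>z. \<bar>dx (\<lambda>(x, t). \<psi> x * \<eta> t) z\<bar> * norm (W z))"
    "(\<integral>z. \<bar>dx (\<lambda>(x, t). \<psi> x * \<eta> t) z\<bar> * norm (W z) \<partial>lborel) \<le> N * (2 * \<epsilon> * V * sqrt T)"
proof -
  note p = test_fun_product'[OF \<psi> \<eta>(1,5,4)]
  show i: "integrable lborel (\<lambda>z. \<bar>dx (\<lambda>(x, t). \<psi> x * \<eta> t) z\<bar> * norm (W z))"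
    using integrable_norm[OF integrable_test[OF test_fun_dx(1)[OF p(1)] lbdd_W]] by simp
  have "0 \<le> (\<integral>x. \<bar>deriv \<psi> x\<bar> \<partial>lborel)" by (rule Bochner_Integration.integral_nonneg) simp
  then have V0: "0 \<le> V" using V by linarith
  have N0: "0 \<le> N" using \<eta>(2)[of 0] \<eta>(3)[of 0] by linarith
  show "(\<integral>z. \<bar>dx (\<lambda>(x, t). \<psi> x * \<eta> t) z\<bar> * norm (W z) \<partial>lborel) \<le> N * (2 * \<epsilon> * V * sqrt T)"
  proof -
    have T0: "0 \<le> T" using \<eta>(5,6,7) by simp
    let ?g = "\<lambda>t. (N * \<epsilon>) * (indicator {0<..<T} t * t powr (- 1 / 2))"
    have ip: "integrable lborel (\<lambda>z. \<bar>deriv \<psi> (fst z)\<bar> * ?g (snd z))"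
      by (rule integrable_product) (use integrable_smooth1[OF \<psi>] integral_powr(1)[of "-1/2" T] T0 in auto)
    have "(\<integral>z. \<bar>dx (\<lambda>(x, t). \<psi> x * \<eta> t) z\<bar> * norm (W z) \<partial>lborel) \<le> (\<integral>z. \<bar>deriv \<psi> (fst z)\<bar> * ?g (snd z) \<partial>lborel)"
    proof (rule integral_mono[OF i ip])
      fix z :: "real \<times> real"
      obtain x t where z: "z = (x, t)" by (cases z)
      show "\<bar>dx (\<lambda>(x, t). \<psi> x * \<eta> t) z\<bar> * norm (W z) \<le> \<bar>deriv \<psi> (fst z)\<bar> * ?g (snd z)"
      proof (cases "t \<in> {c..d}")
        case True
        then have t: "0 < t" "t < T" using \<eta>(5,6) by auto
        have "\<eta> t * norm (W (x, t)) \<le> N * (\<epsilon> / sqrt t)"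
          using \<eta>(2,3)[of t] W_bound[OF t(1)] N0 by (intro mult_mono) auto
        also have "\<dots> = ?g t"
        proof -
          have "t powr (- 1 / 2) = inverse (sqrt t)" using t powr_minus[of t "1 / 2"] by (simp add: powr_half_sqrt)
          then show ?thesis using t by (simp add: inverse_eq_divide)
        qed
        finally have "\<bar>deriv \<psi> x\<bar> * (\<eta> t * norm (W (x, t))) \<le> \<bar>deriv \<psi> x\<bar> * ?g t" by (rule mult_left_mono) simp
        then show ?thesis using \<eta>(2)[of t] by (simp add: z p(2) abs_mult mult.assoc)
      next
        case False
        then show ?thesis using supp1D[OF \<eta>(4)] N0 \<epsilon> by (simp add: z p(2))
      qed
    qed
    also have "\<dots> = (\<integral>x. \<bar>deriv \<psi> x\<bar> \<partial>lborel) * (\<integral>t. ?g t \<partial>lborel)"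
      by (rule integrable_product(2)) (use integrable_smooth1[OF \<psi>] integral_powr(1)[of "-1/2" T] T0 in auto)
    also have "(\<integral>t. ?g t \<partial>lborel) = N * \<epsilon> * (2 * sqrt T)"
      using integral_powr(2)[of "-1/2" T] T0 by (simp add: powr_half_sqrt)
    also have "(\<integral>x. \<bar>deriv \<psi> x\<bar> \<partial>lborel) * (N * \<epsilon> * (2 * sqrt T)) \<le> V * (N * \<epsilon> * (2 * sqrt T))"
      using V N0 \<epsilon> T0 by (intro mult_right_mono) auto
    finally show ?thesis by (simp add: algebra_simps)
  qed
qed

end

section \<open>Lipschitz bound in space and pointwise closeness to the ends\<close>

lemma lbdd_set_integrable:
  fixes u :: "real \<times> real \<Rightarrow> 'a::{banach, second_countable_topology}"
  assumes "lbdd u" "0 < c"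
  shows "set_integrable lborel ({a..b} \<times> {c..d}) u"
proof -
  from assms obtain B where B: "\<forall>x t. c \<le> t \<longrightarrow> norm (u (x, t)) \<le> B" unfolding lbdd_def by blast
  show ?thesis unfolding set_integrable_def
  proof (rule integrableI_bounded_set_indicator[where B=B])
    show "emeasure lborel ({a..b} \<times> {c..d}) < \<infinity>" by (intro emeasure_bounded_finite bounded_Times) auto
    have "norm (u z) \<le> B" if "z \<in> {a..b} \<times> {c..d}" for z using B that by (cases z) auto
    then show "AE z in lborel. z \<in> {a..b} \<times> {c..d} \<longrightarrow> norm (u z) \<le> B" by blast
    show "u \<in> borel_measurable lborel" using assms(1) by (simp add: lbdd_def)
    have "compact ({a..b} \<times> {c..d})" by (intro compact_Times compact_Icc)
    then show "{a..b} \<times> {c..d} \<in> sets lborel" by (simp add: borel_compact)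
  qed
qed

lemma bump_antiderivative:
  assumes "smooth1 UNIV \<psi>" "supp1 a b \<psi>" "\<And>x. 0 \<le> \<psi> x"
  obtains G where "\<And>t. (G has_real_derivative \<psi> t) (at t)" "smooth1 UNIV G" "\<And>s t. s \<le> t \<Longrightarrow> G s \<le> G t"
    "\<And>t. t \<le> a \<Longrightarrow> G t = G a" "\<And>t. b \<le> t \<Longrightarrow> G t = G b"
proof -
  obtain G where G: "\<And>t. (G has_real_derivative \<psi> t) (at t)"
    using antiderivative[OF smooth1_continuous[OF assms(1)]] by (metis has_real_derivative_iff_has_vector_derivative)
  have mono: "s \<le> t \<Longrightarrow> G s \<le> G t" for s t
    by (rule DERIV_nonneg_imp_nondecreasing) (use G assms(3) in blast)+
  have flat: "G s = G t" if "s < t" "\<And>z. s < z \<Longrightarrow> z < t \<Longrightarrow> \<psi> z = 0" for s t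
  proof -
    from MVT2[OF that(1) G] obtain z where "s < z" "z < t" "G t - G s = (t - s) * \<psi> z" by blast
    then show ?thesis using that(2) by simp
  qed
  have "G t = G a" if "t \<le> a" for t
    using flat[of t a] that supp1D[OF assms(2)] by (cases "t = a") auto
  moreover have "G t = G b" if "b \<le> t" for t
    using flat[of b t] that supp1D[OF assms(2)] by (cases "t = b") auto
  moreover have "smooth1 UNIV G" by (rule smooth1I[OF open_UNIV _ assms(1)]) (rule G)
  ultimately show ?thesis using that G mono by blast
qed

text \<open>A translation of a bump is a derivative: with a primitive \<open>G\<close> of
  \<open>\<psi>\<close>, the function G(x - h) - G(x) has derivative \<psi>(x - h) - \<psi>(x) and
  again has compact support. Monotonicity of \<open>G\<close> gives it a constant sign, so its L1
  norm is the absolute value of its integral.\<close>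

lemma shift_kernel:
  assumes \<psi>: "smooth1 UNIV \<psi>" "supp1 a b \<psi>" "\<And>x. 0 \<le> \<psi> x" and ab: "a \<le> b"
  obtains \<Psi> where "smooth1 UNIV \<Psi>" "supp1 (a - \<bar>h\<bar>) (b + \<bar>h\<bar>) \<Psi>" "\<And>x. deriv \<Psi> x = \<psi> (x - h) - \<psi> x"
    "(\<integral>x. \<bar>\<Psi> x\<bar> \<partial>lborel) = \<bar>h\<bar> * (\<integral>x. \<psi> x \<partial>lborel)"
proof -
  obtain G where G: "\<And>t. (G has_real_derivative \<psi> t) (at t)" "smooth1 UNIV G" "\<And>s t. s \<le> t \<Longrightarrow> G s \<le> G t"
    "\<And>t. t \<le> a \<Longrightarrow> G t = G a" "\<And>t. b \<le> t \<Longrightarrow> G t = G b" using bump_antiderivative[OF \<psi>] by metis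
  define \<Psi> where "\<Psi> x = G (- h + 1 * x) + (- 1) * G x" for x
  have s: "smooth1 UNIV \<Psi>" unfolding \<Psi>_def[abs_def] by (intro smooth1_intros smooth1_affine G open_UNIV)
  have supp: "supp1 (a - \<bar>h\<bar>) (b + \<bar>h\<bar>) \<Psi>"
  proof (rule supp1I)
    fix x assume x: "x \<notin> {a - \<bar>h\<bar>..b + \<bar>h\<bar>}"
    then have "x < a - \<bar>h\<bar> \<or> b + \<bar>h\<bar> < x" by auto
    then show "\<Psi> x = 0"
    proof
      assume "x < a - \<bar>h\<bar>"
      then have "x \<le> a" "- h + 1 * x \<le> a" by linarith+
      then show "\<Psi> x = 0" unfolding \<Psi>_def using G(4)[of x] G(4)[of "- h + 1 * x"] by linarith
    next
      assume "b + \<bar>h\<bar> < x"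
      then have "b \<le> x" "b \<le> - h + 1 * x" by linarith+
      then show "\<Psi> x = 0" unfolding \<Psi>_def using G(5)[of x] G(5)[of "- h + 1 * x"] by linarith
    qed
  qed
  have d: "(\<Psi> has_real_derivative \<psi> (x - h) - \<psi> x) (at x)" for x
  proof -
    have "((\<lambda>x. - h + 1 * x) has_real_derivative 1) (at x)" by (auto intro!: derivative_eq_intros)
    from DERIV_chain2[OF G(1) this] have "((\<lambda>x. G (- h + 1 * x)) has_real_derivative \<psi> (x - h)) (at x)" by simp
    from DERIV_diff[OF this G(1)] show ?thesis by (simp add: \<Psi>_def[abs_def])
  qed
  have deq: "deriv \<Psi> x = \<psi> (x - h) - \<psi> x" for x using d by (rule DERIV_imp_deriv)
  have i\<psi>: "integrable lborel \<psi>" by (rule integrable_smooth1[OF \<psi>(1,2)])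
  have i\<Psi>: "integrable lborel \<Psi>" by (rule integrable_smooth1[OF s supp])
  have s1: "smooth1 UNIV (\<lambda>x. x * \<psi> x)" "smooth1 UNIV (\<lambda>x. x * \<Psi> x)" by (intro smooth1_intros open_UNIV \<psi>(1) s)+
  have supp1': "supp1 a b (\<lambda>x. x * \<psi> x)" "supp1 (a - \<bar>h\<bar>) (b + \<bar>h\<bar>) (\<lambda>x. x * \<Psi> x)" using \<psi>(2) supp by (auto simp: supp1_def)
  have ix: "integrable lborel (\<lambda>x. x * \<psi> x)" by (rule integrable_smooth1[OF s1(1) supp1'(1)])
  have dx: "((\<lambda>x. x * \<Psi> x) has_real_derivative \<Psi> x + x * (\<psi> (x - h) - \<psi> x)) (at x)" for x
    using DERIV_mult[OF DERIV_ident d] by (simp add: algebra_simps)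
  have m\<psi>: "\<psi> \<in> borel_measurable borel" using i\<psi> by simp
  \<comment> \<open>Integrating the derivative of the compactly supported function x \<Psi>(x)
    expresses the integral of \<open>\<Psi>\<close> through first moments of \<open>\<psi>\<close>
    and its translate, which differ by h times the mass.\<close>
  have "0 = (\<integral>x. \<Psi> x + x * (\<psi> (x - h) - \<psi> x) \<partial>lborel)"
  proof -
    have dd: "deriv (\<lambda>x. x * \<Psi> x) = (\<lambda>x. \<Psi> x + x * (\<psi> (x - h) - \<psi> x))" using DERIV_imp_deriv[OF dx] by (rule ext)
    have "(\<integral>x. deriv (\<lambda>x. x * \<Psi> x) x \<partial>lborel) = (b + \<bar>h\<bar> + 1) * \<Psi> (b + \<bar>h\<bar> + 1) - (a - \<bar>h\<bar> - 1) * \<Psi> (a - \<bar>h\<bar> - 1)"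
    proof (rule integral_deriv[of "\<lambda>x. x * \<Psi> x" "deriv (\<lambda>x. x * \<Psi> x)" "a - \<bar>h\<bar> - 1" "b + \<bar>h\<bar> + 1"])
      show "((\<lambda>x. x * \<Psi> x) has_real_derivative deriv (\<lambda>x. x * \<Psi> x) x) (at x)" for x using smooth1D(1)[OF s1(2)] by simp
      show "continuous_on UNIV (deriv (\<lambda>x. x * \<Psi> x))" by (rule smooth1_continuous[OF smooth1D(2)[OF s1(2)]])
      show "deriv (\<lambda>x. x * \<Psi> x) x = 0" if "x \<notin> {a - \<bar>h\<bar> - 1..b + \<bar>h\<bar> + 1}" for x
        using supp1D[OF supp1_deriv[OF s1(2) supp1'(2)], of x] that by auto
    qed (use ab in auto)
    then show ?thesis using supp1D[OF supp, of "b + \<bar>h\<bar> + 1"] supp1D[OF supp, of "a - \<bar>h\<bar> - 1"] by (simp add: dd)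
  qed
  also have "\<dots> = (\<integral>x. \<Psi> x \<partial>lborel) + (\<integral>x. ((- h + x) * \<psi> (- h + x) + h * \<psi> (- h + x)) - x * \<psi> x \<partial>lborel)"
  proof -
    have "integrable lborel (\<lambda>x. (- h + x) * \<psi> (- h + x))" "integrable lborel (\<lambda>x. \<psi> (- h + x))"
      using lborel_integrable_real_affine[of "\<lambda>x. x * \<psi> x" 1 "-h"] lborel_integrable_real_affine[of \<psi> 1 "-h"] ix i\<psi> by simp_all
    then have "integrable lborel (\<lambda>x. ((- h + x) * \<psi> (- h + x) + h * \<psi> (- h + x)) - x * \<psi> x)"
      using ix by (intro Bochner_Integration.integrable_diff Bochner_Integration.integrable_add) auto
    from Bochner_Integration.integral_add[OF i\<Psi> this, symmetric] show ?thesis by (simp add: algebra_simps)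
  qed
  also have "(\<integral>x. ((- h + x) * \<psi> (- h + x) + h * \<psi> (- h + x)) - x * \<psi> x \<partial>lborel) = h * (\<integral>x. \<psi> x \<partial>lborel)"
  proof -
    have i: "integrable lborel (\<lambda>x. (- h + x) * \<psi> (- h + x))" "integrable lborel (\<lambda>x. h * \<psi> (- h + x))"
      using lborel_integrable_real_affine[of "\<lambda>x. x * \<psi> x" 1 "-h"] lborel_integrable_real_affine[of \<psi> 1 "-h"] ix i\<psi> by simp_all
    have "(\<integral>x. (- h + x) * \<psi> (- h + x) \<partial>lborel) = (\<integral>x. x * \<psi> x \<partial>lborel)" "(\<integral>x. \<psi> (- h + x) \<partial>lborel) = (\<integral>x. \<psi> x \<partial>lborel)"
      using integral_translate[of "\<lambda>x. x * \<psi> x" "-h"] integral_translate[of \<psi> "-h"] m\<psi> ix by simp_all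
    then show ?thesis using i ix by (simp add: Bochner_Integration.integral_diff Bochner_Integration.integral_add)
  qed
  finally have int: "(\<integral>x. \<Psi> x \<partial>lborel) = - h * (\<integral>x. \<psi> x \<partial>lborel)" by simp
  have "(\<integral>x. \<bar>\<Psi> x\<bar> \<partial>lborel) = \<bar>h\<bar> * (\<integral>x. \<psi> x \<partial>lborel)"
  proof (cases "0 \<le> h")
    case True
    then have "\<bar>\<Psi> x\<bar> = - \<Psi> x" for x using G(3)[of "- h + x" x] by (simp add: \<Psi>_def)
    then show ?thesis using int True by simp
  next
    case False
    then have "\<bar>\<Psi> x\<bar> = \<Psi> x" for x using G(3)[of x "- h + x"] by (simp add: \<Psi>_def)
    then show ?thesis using int False by simp
  qed
  with s supp deq show ?thesis using that by blast
qed

lemma AE_snd_lborel: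
  assumes "AE t in (lborel :: real measure). P t"
  shows "AE z in (lborel :: (real \<times> real) measure). P (snd z)"
proof -
  obtain N where N: "N \<in> null_sets lborel" "{t. \<not> P t} \<subseteq> N" using assms by (auto simp: eventually_ae_filter)
  have "AE z in (lborel :: real measure) \<Otimes>\<^sub>M lborel. snd z \<notin> N"
  proof (rule lborel_pair.AE_pair_measure)
    have "(UNIV :: real set) \<times> (UNIV - N) \<in> sets ((lborel :: real measure) \<Otimes>\<^sub>M lborel)" using N(1) by (intro pair_measureI) auto
    moreover have "{x \<in> space ((lborel :: real measure) \<Otimes>\<^sub>M lborel). snd x \<notin> N} = (UNIV :: real set) \<times> (UNIV - N)" by (auto simp: space_pair_measure)
    ultimately show "{x \<in> space ((lborel :: real measure) \<Otimes>\<^sub>M lborel). snd x \<notin> N} \<in> sets ((lborel :: real measure) \<Otimes>\<^sub>M lborel)" by (simp only:)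
    show "AE x in lborel. AE y in lborel. snd (x, y) \<notin> N" using AE_not_in[OF N(1)] by simp
  qed
  moreover have "(lborel :: real measure) \<Otimes>\<^sub>M (lborel :: real measure) = lborel" by (rule lborel_prod)
  ultimately have "AE z in (lborel :: (real \<times> real) measure). snd z \<notin> N" by (simp only:)
  then show ?thesis by eventually_elim (use N(2) in auto)
qed

context tame begin

text \<open>M has only a weak derivative, so the difference M(x + h) - M(x) is estimated after
  testing: translation moves the difference to the test function, \<open>shift_kernel\<close> writes
  it as an x-derivative, and the definition of the weak derivative brings in \<open>W\<close>. Since
  the mass of the kernel is |h| times the mass of \<open>\<psi>\<close>, the tested bound is exactly
  the integrated Lipschitz bound.\<close>

lemma lipschitz_AE:
  assumes A: "norm A = 1"
  shows "AE z in lborel. 0 < snd z \<longrightarrow> A \<bullet> M (fst z + h, snd z) - A \<bullet> M z - \<epsilon> * \<bar>h\<bar> / sqrt (snd z) \<le> 0"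
proof (rule AE_nonpos_half_plane)
  have Mh_meas: "(\<lambda>z. M (fst z + h, snd z)) \<in> borel_measurable borel"
    by (rule measurable_compose[OF _ M_meas]) (auto intro!: borel_measurable_continuous_onI continuous_intros)
  have lb_h: "lbdd (\<lambda>z. A \<bullet> M (fst z + h, snd z))"
    using Mh_meas by (intro lbdd_intros) (auto simp: lbdd_def M_norm intro!: exI[of _ 1])
  have lb_k: "lbdd (\<lambda>z. \<epsilon> * \<bar>h\<bar> / sqrt (snd z))"
    unfolding lbdd_def
  proof (intro conjI allI impI)
    show "(\<lambda>z::real\<times>real. \<epsilon> * \<bar>h\<bar> / sqrt (snd z)) \<in> borel_measurable borel"
      by (intro borel_measurable_divide borel_measurable_const borel_measurable_continuous_onI continuous_intros)
    show "\<exists>B. \<forall>x t. c \<le> t \<longrightarrow> norm (\<epsilon> * \<bar>h\<bar> / sqrt (snd (x :: real, t))) \<le> B" if "0 < c" for c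
      using that \<epsilon> by (intro exI[of _ "\<epsilon> * \<bar>h\<bar> / sqrt c"]) (auto intro!: divide_left_mono mult_nonneg_nonneg)
  qed
  let ?g = "\<lambda>z. A \<bullet> M (fst z + h, snd z) - A \<bullet> M z - \<epsilon> * \<bar>h\<bar> / sqrt (snd z)"
  have lb_g: "lbdd ?g" by (intro lbdd_diff lb_h lb_k lbdd_inner lbdd_const lbdd_M)
  show "set_integrable lborel ({a..b} \<times> {c..d}) ?g" if "0 < c" for a b c d
    by (rule lbdd_set_integrable[OF lb_g that])
  fix \<psi> \<eta> :: "real \<Rightarrow> real" and a b c d
  assume \<psi>: "smooth1 UNIV \<psi>" "\<And>t. 0 \<le> \<psi> t" "\<And>t. t \<notin> {a..b} \<Longrightarrow> \<psi> t = 0" "a \<le> b"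
    and \<eta>: "smooth1 UNIV \<eta>" "\<And>t. 0 \<le> \<eta> t" "\<And>t. t \<notin> {c..d} \<Longrightarrow> \<eta> t = 0" "c \<le> d" "0 < c"
  have s\<psi>: "supp1 a b \<psi>" and s\<eta>: "supp1 c d \<eta>" by (auto intro: supp1I \<psi>(3) \<eta>(3))
  obtain \<Psi> where \<Psi>: "smooth1 UNIV \<Psi>" "supp1 (a - \<bar>h\<bar>) (b + \<bar>h\<bar>) \<Psi>" "\<And>x. deriv \<Psi> x = \<psi> (x - h) - \<psi> x"
    "(\<integral>x. \<bar>\<Psi> x\<bar> \<partial>lborel) = \<bar>h\<bar> * (\<integral>x. \<psi> x \<partial>lborel)"
    using shift_kernel[OF \<psi>(1) s\<psi> \<psi>(2,4)] by metis
  note p = test_fun_product'[OF \<psi>(1) s\<psi> \<eta>(1,5) s\<eta>]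
  note P = test_fun_product'[OF \<Psi>(1,2) \<eta>(1,5) s\<eta>]
  let ?\<phi> = "\<lambda>z. \<psi> (fst z) * \<eta> (snd z)"
  have phi_eq: "(\<lambda>(x, t). \<psi> x * \<eta> t) = ?\<phi>" by auto
  have PSI_eq: "(\<lambda>(x, t). \<Psi> x * \<eta> t) = (\<lambda>z. \<Psi> (fst z) * \<eta> (snd z))" by auto
  have t\<phi>: "test_fun ?\<phi>" using p(1) by (simp add: phi_eq)
  have i1: "integrable lborel (\<lambda>z. ?\<phi> z * (A \<bullet> M (fst z + h, snd z)))" by (rule integrable_test_real[OF t\<phi> lb_h])
  have i2: "integrable lborel (\<lambda>z. ?\<phi> z * (A \<bullet> M z))" by (intro integrable_test_real[OF t\<phi>] lbdd_inner lbdd_const lbdd_M)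
  have i3: "integrable lborel (\<lambda>z. ?\<phi> z * (\<epsilon> * \<bar>h\<bar> / sqrt (snd z)))" by (rule integrable_test_real[OF t\<phi> lb_k])
  let ?f = "\<lambda>z. \<psi> (fst z - h) * \<eta> (snd z) * (A \<bullet> M z)"
  have fm: "?f \<in> borel_measurable borel"
  proof -
    have c: "continuous_on UNIV (\<lambda>z::real\<times>real. \<psi> (fst z - h) * \<eta> (snd z))"
      by (intro continuous_intros continuous_on_compose2[OF smooth1_continuous[OF \<psi>(1)]] continuous_on_compose2[OF smooth1_continuous[OF \<eta>(1)]]) auto
    have "(\<lambda>z. A \<bullet> M z) \<in> borel_measurable borel" using M_meas by measurable
    with borel_measurable_continuous_onI[OF c] show ?thesis by (rule borel_measurable_times)
  qed
  have sh: "(h, 0) + z = (fst z + h, snd z)" for z :: "real \<times> real" by (cases z) simp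
  \<comment> \<open>The change of variables that moves the shift from M to the test
    function.\<close>
  have tr: "(\<integral>z. ?\<phi> z * (A \<bullet> M (fst z + h, snd z)) \<partial>lborel) = (\<integral>z. ?f z \<partial>lborel)"
    using integral_translate[OF fm, of "(h, 0)"] unfolding sh by simp
  have if': "integrable lborel ?f"
  proof -
    have "integrable (distr lborel borel ((+) (h, 0))) ?f"
    proof (subst integrable_distr_eq)
      show "integrable lborel (\<lambda>z. ?f ((h, 0) + z))" unfolding sh using i1 by simp
    qed (use fm in auto)
    then show ?thesis by (simp add: lborel_distr_plus)
  qed
  have ie: "integrable lborel (\<lambda>t. \<eta> t * (\<epsilon> / sqrt t))"
  proof -
    \<comment> \<open>Replacing t by max t c changes nothing on the support and makes the singular
      factor bounded everywhere.\<close>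
    have "\<eta> t * (\<epsilon> / sqrt t) = \<eta> t * (\<epsilon> / sqrt (max t c))" for t using \<eta>(3)[of t] by (cases "t \<in> {c..d}") auto
    moreover have "integrable lborel (\<lambda>t. \<eta> t * (\<epsilon> / sqrt (max t c)))"
    proof -
      have "integrable lborel (\<lambda>t. \<eta> t *\<^sub>R (\<epsilon> / sqrt (max t c)))"
      proof (rule integrable_compact_mult[OF smooth1_continuous[OF \<eta>(1)] compact_Icc[of c d] \<eta>(3)])
        show "(\<lambda>t. \<epsilon> / sqrt (max t c)) \<in> borel_measurable borel" by measurable
        show "norm (\<epsilon> / sqrt (max t c)) \<le> \<epsilon> / sqrt c" for t using \<eta>(5) \<epsilon> by (auto intro!: divide_left_mono)
      qed
      then show ?thesis by simp
    qed
    ultimately show ?thesis by (simp only:)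
  qed
  have "(\<integral>z. ?\<phi> z * (A \<bullet> M (fst z + h, snd z)) \<partial>lborel) - (\<integral>z. ?\<phi> z * (A \<bullet> M z) \<partial>lborel) = (\<integral>z. ?f z - ?\<phi> z * (A \<bullet> M z) \<partial>lborel)"
    using tr if' i2 by simp
  also have "\<dots> = (\<integral>z. dx (\<lambda>(x, t). \<Psi> x * \<eta> t) z * (A \<bullet> M z) \<partial>lborel)"
    by (rule Bochner_Integration.integral_cong) (auto simp: P(2) \<Psi>(3) algebra_simps)
  also have "\<dots> = - (\<integral>z. (\<Psi> (fst z) * \<eta> (snd z)) * (A \<bullet> W z) \<partial>lborel)"
    using weak_inner[OF P(1), of A] unfolding PSI_eq .
  also have "\<dots> \<le> (\<integral>z. \<bar>\<Psi> (fst z)\<bar> * (\<eta> (snd z) * (\<epsilon> / sqrt (snd z))) \<partial>lborel)"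
  proof -
    have i: "integrable lborel (\<lambda>z. (\<Psi> (fst z) * \<eta> (snd z)) * (A \<bullet> W z))"
      using integrable_test_real[OF P(1), of "\<lambda>z. A \<bullet> W z"] unfolding PSI_eq by (simp add: lbdd_inner lbdd_const lbdd_W)
    have i': "integrable lborel (\<lambda>z. \<bar>\<Psi> (fst z)\<bar> * (\<eta> (snd z) * (\<epsilon> / sqrt (snd z))))"
      using integrable_product(1)[OF integrable_smooth1(2)[OF \<Psi>(1,2)] ie] .
    have "(\<integral>z. - ((\<Psi> (fst z) * \<eta> (snd z)) * (A \<bullet> W z)) \<partial>lborel) \<le> (\<integral>z. \<bar>\<Psi> (fst z)\<bar> * (\<eta> (snd z) * (\<epsilon> / sqrt (snd z))) \<partial>lborel)"
    proof (rule integral_mono)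
      fix z :: "real \<times> real"
      obtain x t where z: "z = (x, t)" by (cases z)
      show "- ((\<Psi> (fst z) * \<eta> (snd z)) * (A \<bullet> W z)) \<le> \<bar>\<Psi> (fst z)\<bar> * (\<eta> (snd z) * (\<epsilon> / sqrt (snd z)))"
      proof (cases "t \<in> {c..d}")
        case True
        then have "\<bar>A \<bullet> W (x, t)\<bar> \<le> \<epsilon> / sqrt t"
          using Cauchy_Schwarz_ineq2[of A "W (x, t)"] W_bound[of t x] A \<eta>(5) by auto
        then have "\<bar>\<Psi> x * \<eta> t * (A \<bullet> W (x, t))\<bar> \<le> \<bar>\<Psi> x\<bar> * \<eta> t * (\<epsilon> / sqrt t)"
          using \<eta>(2)[of t] by (simp only: abs_mult abs_of_nonneg) (intro mult_left_mono, auto)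
        then show ?thesis unfolding z fst_conv snd_conv mult.assoc by linarith
      qed (simp add: z \<eta>(3))
    qed (use i i' in auto)
    then show ?thesis by simp
  qed
  also have "\<dots> = (\<integral>x. \<bar>\<Psi> x\<bar> \<partial>lborel) * (\<integral>t. \<eta> t * (\<epsilon> / sqrt t) \<partial>lborel)"
    by (rule integrable_product(2)[OF integrable_smooth1(2)[OF \<Psi>(1,2)] ie])
  also have "\<dots> = \<bar>h\<bar> * ((\<integral>x. \<psi> x \<partial>lborel) * (\<integral>t. \<eta> t * (\<epsilon> / sqrt t) \<partial>lborel))" by (simp add: \<Psi>(4))
  also have "\<dots> = \<bar>h\<bar> * (\<integral>z. \<psi> (fst z) * (\<eta> (snd z) * (\<epsilon> / sqrt (snd z))) \<partial>lborel)"
    by (simp only: integrable_product(2)[OF integrable_smooth1(1)[OF \<psi>(1) s\<psi>] ie])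
  also have "\<dots> = (\<integral>z. ?\<phi> z * (\<epsilon> * \<bar>h\<bar> / sqrt (snd z)) \<partial>lborel)"
    by (subst Bochner_Integration.integral_mult_right_zero[symmetric]) (simp add: mult_ac)
  finally show "(\<integral>z. (\<psi> (fst z) * \<eta> (snd z)) * ?g z \<partial>lborel) \<le> 0"
    using i1 i2 i3 by (simp add: right_diff_distrib)
qed

end

lemma integral_affine:
  fixes f :: "real \<Rightarrow> real"
  assumes "0 < k"
  shows "(\<integral>x. f (a + k * x) \<partial>lborel) = (\<integral>x. f x \<partial>lborel) / k"
  using lborel_integral_real_affine[of k f a] assms by simp

lemma deriv_affine:
  assumes "smooth1 UNIV f"
  shows "deriv (\<lambda>x. f (a + k * x)) x = deriv f (a + k * x) * k"
proof (rule DERIV_imp_deriv)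
  have f: "(f has_real_derivative deriv f (a + k * x)) (at (a + k * x))" using smooth1D(1)[OF assms] by simp
  have "((\<lambda>x. a + k * x) has_real_derivative k) (at x)" by (auto intro!: derivative_eq_intros)
  from DERIV_chain2[OF f this] show "((\<lambda>x. f (a + k * x)) has_real_derivative deriv f (a + k * x) * k) (at x)" .
qed

lemma variation_affine:
  assumes "smooth1 UNIV f" "0 < k"
  shows "(\<integral>x. \<bar>deriv (\<lambda>x. f (a + k * x)) x\<bar> \<partial>lborel) = (\<integral>x. \<bar>deriv f x\<bar> \<partial>lborel)"
proof -
  have "(\<integral>x. \<bar>deriv (\<lambda>x. f (a + k * x)) x\<bar> \<partial>lborel) = (\<integral>x. \<bar>deriv f (a + k * x)\<bar> * k \<partial>lborel)"
    using assms(2) by (simp add: deriv_affine[OF assms(1)] abs_mult)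
  also have "\<dots> = (\<integral>x. \<bar>deriv f (a + k * x)\<bar> \<partial>lborel) * k" by simp
  also have "(\<integral>x. \<bar>deriv f (a + k * x)\<bar> \<partial>lborel) = (\<integral>x. \<bar>deriv f x\<bar> \<partial>lborel) / k"
    using integral_affine[OF assms(2), of "\<lambda>x. \<bar>deriv f x\<bar>" a] .
  finally show ?thesis using assms(2) by simp
qed

text \<open>Under rescaling the total variation stays fixed while the integral scales with the
  width. Hence flux estimates have one constant at all scales.\<close>

definition cutoff_var :: real where "cutoff_var = (\<integral>x. \<bar>deriv cutoff x\<bar> \<partial>lborel)"
definition cutoff_int :: real where "cutoff_int = (\<integral>x. cutoff x \<partial>lborel)"

text \<open>The parameter \<open>k\<close> is an inverse length: the plateau is |x - x0| <= 1 / k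
  and the support lies in |x - x0| <= 2 / k.\<close>

definition cutoff_at :: "real \<Rightarrow> real \<Rightarrow> real \<Rightarrow> real" where
  "cutoff_at k x0 x = cutoff (- (k * x0) + k * x)"

lemma supp1_cutoff: "supp1 (-2) 2 cutoff"
  by (intro supp1I cutoff_simps)

lemma cutoff_at:
  assumes k: "0 < k"
  shows "smooth1 UNIV (cutoff_at k x0)" "supp1 (x0 - 2 / k) (x0 + 2 / k) (cutoff_at k x0)"
    "0 \<le> cutoff_at k x0 x" "cutoff_at k x0 x \<le> 1"
    "(\<integral>x. cutoff_at k x0 x \<partial>lborel) = cutoff_int / k" "(\<integral>x. \<bar>deriv (cutoff_at k x0) x\<bar> \<partial>lborel) = cutoff_var"
proof -
  show "smooth1 UNIV (cutoff_at k x0)" unfolding cutoff_at_def[abs_def] by (rule smooth1_affine[OF smooth1_cutoff])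
  show "0 \<le> cutoff_at k x0 x" "cutoff_at k x0 x \<le> 1" by (simp_all add: cutoff_at_def cutoff_simps)
  show "supp1 (x0 - 2 / k) (x0 + 2 / k) (cutoff_at k x0)"
  proof (rule supp1I)
    fix x assume "x \<notin> {x0 - 2 / k..x0 + 2 / k}"
    then have "- (k * x0) + k * x \<notin> {-2..2}" using k by (auto simp: field_simps)
    then show "cutoff_at k x0 x = 0" unfolding cutoff_at_def by (rule cutoff_simps(2))
  qed
  show "(\<integral>x. cutoff_at k x0 x \<partial>lborel) = cutoff_int / k"
    unfolding cutoff_at_def[abs_def] cutoff_int_def by (rule integral_affine[OF k])
  show "(\<integral>x. \<bar>deriv (cutoff_at k x0) x\<bar> \<partial>lborel) = cutoff_var"
    unfolding cutoff_at_def[abs_def] cutoff_var_def by (rule variation_affine[OF smooth1_cutoff k])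
qed

lemma cutoff_int_ge: "2 \<le> cutoff_int"
proof -
  have "(2::real) = (\<integral>x. indicator {-1..1} x \<partial>(lborel :: real measure))" by simp
  also have "\<dots> \<le> cutoff_int" unfolding cutoff_int_def
  proof (rule integral_mono)
    show "integrable lborel cutoff" by (rule integrable_smooth1[OF smooth1_cutoff supp1_cutoff])
    show "indicator {-1..1} x \<le> cutoff x" for x using cutoff_simps(1)[of x] cutoff_simps(3)[of x] by (auto simp: indicator_def)
  qed simp
  finally show ?thesis .
qed

lemma cutoff_var_nonneg: "0 \<le> cutoff_var"
  unfolding cutoff_var_def by (rule Bochner_Integration.integral_nonneg) simp

lemma sstep_variation:
  "integrable lborel (deriv sstep)" "(\<integral>x. \<bar>deriv sstep x\<bar> \<partial>lborel) = 1" "supp1 0 1 (deriv sstep)"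
proof -
  have s: "smooth1 UNIV (deriv sstep)" by (rule smooth1D(2)[OF smooth1_sstep])
  show o: "supp1 0 1 (deriv sstep)"
  proof (rule supp1I)
    fix x :: real assume "x \<notin> {0..1}"
    then consider "x < 0" | "1 < x" by force
    then have "(sstep has_real_derivative 0) (at x)"
    proof cases
      case 1 show ?thesis
        by (rule has_field_derivative_transform_within_open[of "\<lambda>_. 0" _ _ "{..<0}"]) (use 1 sstep_simps in auto)
    next
      case 2 show ?thesis
        by (rule has_field_derivative_transform_within_open[of "\<lambda>_. 1" _ _ "{1<..}"]) (use 2 sstep_simps in auto)
    qed
    then show "deriv sstep x = 0" by (rule DERIV_imp_deriv)
  qed
  show "integrable lborel (deriv sstep)" by (rule integrable_smooth1[OF s o])
  have "(\<integral>x. deriv sstep x \<partial>lborel) = sstep 1 - sstep 0"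
    by (rule integral_deriv[OF sstep_deriv(1) smooth1_continuous[OF s] supp1D[OF o]]) simp_all
  then show "(\<integral>x. \<bar>deriv sstep x\<bar> \<partial>lborel) = 1" by (simp add: sstep_deriv(2) sstep_simps)
qed

context tame begin

text \<open>The cutoff at inverse scale 4 / \<rho> is supported in radius \<rho> / 2, so up to time
  \<rho>^2 its product with a time cutoff stays in the parabolic cylinder of radius \<rho>. There
  the source is bounded without any knowledge of its sign by the integral of |W|^2, that is by
  \<epsilon>^2 \<rho>. The flux gives twice 2 \<epsilon> \<open>cutoff_var\<close> \<rho>, since
  sqrt (\<rho>^2) = \<rho>.\<close>

lemma slice_local:
  assumes A: "norm A = 1" and \<rho>: "0 < \<rho>"
  shows "AE t in lborel. 0 < t \<and> t < \<rho>\<^sup>2 \<longrightarrow> slice (cutoff_at (4 / \<rho>) x0) A t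
      \<le> slice0 (cutoff_at (4 / \<rho>) x0) A + (\<epsilon>\<^sup>2 * \<rho> + 4 * cutoff_var * \<epsilon> * \<rho>)"
proof -
  have k: "0 < 4 / \<rho>" using \<rho> by simp
  let ?\<psi> = "cutoff_at (4 / \<rho>) x0"
  note c = cutoff_at[OF k, of x0]
  show ?thesis
  proof (rule slice_bound[OF c(1,2) A])
    fix \<eta> :: "real \<Rightarrow> real" and N c' d
    assume \<eta>: "smooth1 UNIV \<eta>" "\<And>t. 0 \<le> \<eta> t" "\<And>t. \<eta> t \<le> N" "supp1 c' d \<eta>" "0 < c'" "c' \<le> d" "d < \<rho>\<^sup>2"
    let ?\<phi> = "\<lambda>(x, t). ?\<psi> x * \<eta> t"
    have N0: "0 \<le> N" using \<eta>(2)[of 0] \<eta>(3)[of 0] by linarith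
    have t\<phi>: "test_fun ?\<phi>" by (rule test_fun_product'(1)[OF c(1,2) \<eta>(1,5,4)])
    have pos: "0 \<le> ?\<phi> z" for z using c(3) \<eta>(2) by (cases z) simp
    let ?C = "{x0 - \<rho><..<x0 + \<rho>} \<times> {0<..<\<rho>\<^sup>2}"
    note fb = flux_bound[OF c(1,2) \<eta>(1,2,3,4,5,7,6) order_refl]
    have i1: "integrable lborel (\<lambda>z. ?\<phi> z * ((norm (W z))\<^sup>2 * (- (A \<bullet> M z))))"
      by (intro integrable_test_real t\<phi> lbdd_intros lbdd_M lbdd_W)
    have "- (\<integral>z. dt ?\<phi> z * (1 - A \<bullet> M z) \<partial>lborel) \<le>
       (\<integral>z. \<alpha> * (?\<phi> z * ((norm (W z))\<^sup>2 * (- (A \<bullet> M z)))) + 2 * (\<bar>dx ?\<phi> z\<bar> * norm (W z)) \<partial>lborel)"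
      by (rule const_ineq[OF t\<phi> pos A])
    also have "\<dots> = (\<integral>z. \<alpha> * (?\<phi> z * ((norm (W z))\<^sup>2 * (- (A \<bullet> M z)))) \<partial>lborel) + 2 * (\<integral>z. \<bar>dx ?\<phi> z\<bar> * norm (W z) \<partial>lborel)"
      using i1 fb(1) by simp
    also have "(\<integral>z. \<alpha> * (?\<phi> z * ((norm (W z))\<^sup>2 * (- (A \<bullet> M z)))) \<partial>lborel) \<le> (\<integral>z. N * (indicator ?C z * (norm (W z))\<^sup>2) \<partial>lborel)"
    proof (rule integral_mono)
      show "integrable lborel (\<lambda>z. \<alpha> * (?\<phi> z * ((norm (W z))\<^sup>2 * (- (A \<bullet> M z)))))" using i1 by simp
      show "integrable lborel (\<lambda>z. N * (indicator ?C z * (norm (W z))\<^sup>2))" using carleson(1)[OF \<rho>, of x0] by simp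
      fix z :: "real \<times> real"
      obtain x t where z: "z = (x, t)" by (cases z)
      show "\<alpha> * (?\<phi> z * ((norm (W z))\<^sup>2 * (- (A \<bullet> M z)))) \<le> N * (indicator ?C z * (norm (W z))\<^sup>2)"
      proof (cases "z \<in> ?C")
        case True
        have "\<alpha> * (?\<psi> x * \<eta> t) \<le> 1 * (1 * N)"
          using \<alpha> c(3,4)[of x] \<eta>(2,3)[of t] by (intro mult_mono mult_nonneg_nonneg) auto
        then have "\<alpha> * (?\<psi> x * \<eta> t) * ((norm (W z))\<^sup>2 * (- (A \<bullet> M z))) \<le> \<alpha> * (?\<psi> x * \<eta> t) * ((norm (W z))\<^sup>2 * 1)"
          using AM_bound[OF A, of z] \<alpha> c(3)[of x] \<eta>(2)[of t] by (intro mult_left_mono mult_nonneg_nonneg) auto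
        also have "\<dots> \<le> N * ((norm (W z))\<^sup>2 * 1)"
          using \<open>\<alpha> * (?\<psi> x * \<eta> t) \<le> 1 * (1 * N)\<close> by (intro mult_right_mono) auto
        finally show ?thesis using True by (simp add: z mult.assoc)
      next
        case False
        have "?\<psi> x * \<eta> t = 0"
        proof (cases "x \<in> {x0 - \<rho><..<x0 + \<rho>}")
          case True
          then have "t \<notin> {c'..d}" using False \<eta>(5,7) by (auto simp: z)
          then show ?thesis using supp1D[OF \<eta>(4)] by simp
        next
          case False
          then have "x \<notin> {x0 - 2 / (4 / \<rho>)..x0 + 2 / (4 / \<rho>)}" using \<rho> by auto
          then show ?thesis using supp1D[OF c(2)] by simp
        qed
        then show ?thesis using False by (auto simp: z)
      qed
    qed
    also have "(\<integral>z. N * (indicator ?C z * (norm (W z))\<^sup>2) \<partial>lborel) \<le> N * (\<epsilon>\<^sup>2 * \<rho>)"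
      using mult_left_mono[OF carleson(2)[OF \<rho>, of x0] N0] by simp
    also have "(\<integral>z. \<bar>dx ?\<phi> z\<bar> * norm (W z) \<partial>lborel) \<le> N * (2 * \<epsilon> * cutoff_var * \<rho>)"
      using fb(2) \<rho> by (simp add: c(6))
    finally show "- (\<integral>z. dt ?\<phi> z * (1 - A \<bullet> M z) \<partial>lborel) \<le> N * (\<epsilon>\<^sup>2 * \<rho> + 4 * cutoff_var * \<epsilon> * \<rho>)"
      by (simp add: algebra_simps)
  qed
qed

lemma step_data_close:
  assumes "A = Ap \<or> A = Am" "x \<noteq> 0"
  shows "1 - A \<bullet> step_data Ap Am x \<le> norm (Ap - Am)"
proof -
  have "1 - A \<bullet> B \<le> norm (A - B)" if "norm A = 1" for A B :: "real^3"
  proof -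
    have "1 - A \<bullet> B = A \<bullet> (A - B)" using that by (simp add: inner_diff_right dot_square_norm)
    also have "\<dots> \<le> norm (A - B)" using norm_cauchy_schwarz[of A "A - B"] that by simp
    finally show ?thesis .
  qed
  from this[of Ap Am] this[of Am Ap] this[of Ap Ap] this[of Am Am] show ?thesis
    using assms nA by (cases "0 < x") (auto simp: step_data_def norm_minus_commute dot_square_norm)
qed

text \<open>At time t averages at scale \<rho> comparable to sqrt t are controlled by
  \<open>slice_local\<close>, and on that scale M oscillates by at most 2 \<epsilon> by the
  Lipschitz bound. Averaging M(x) - M(x + h) over h against the cutoff therefore gives a bound at
  the point x itself. The division by the mass \<open>cutoff_int * \<rho> / 4\<close> produces the
  coefficients 2 and 8.\<close>

lemma closeness:
  assumes "A = Ap \<or> A = Am"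
  shows "AE z in lborel. 0 < snd z \<longrightarrow> 1 - A \<bullet> M z \<le> norm (Ap - Am) + 2 * \<epsilon>\<^sup>2 + 8 * cutoff_var * \<epsilon> + 2 * \<epsilon>"
proof -
  have A: "norm A = 1" using assms nA by auto
  let ?\<psi> = "\<lambda>\<rho> x0. cutoff_at (4 / \<rho>) x0"
  have s0: "slice0 (?\<psi> \<rho> x0) A \<le> norm (Ap - Am) * (cutoff_int * \<rho> / 4)" if \<rho>: "0 < \<rho>" for \<rho> x0
  proof -
    have k: "0 < 4 / \<rho>" using \<rho> by simp
    note c = cutoff_at[OF k, of x0]
    have "slice0 (?\<psi> \<rho> x0) A \<le> (\<integral>x. ?\<psi> \<rho> x0 x * norm (Ap - Am) \<partial>lborel)"
      unfolding slice0_def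
    proof (rule integral_mono_AE)
      show "AE x in lborel. ?\<psi> \<rho> x0 x * (1 - A \<bullet> step_data Ap Am x) \<le> ?\<psi> \<rho> x0 x * norm (Ap - Am)"
        using AE_lborel_singleton[of 0] by eventually_elim (intro mult_left_mono step_data_close assms c(3))
    qed (use slice0_int[OF c(1,2) A] integrable_smooth1[OF c(1,2)] in auto)
    also have "\<dots> = norm (Ap - Am) * (cutoff_int * \<rho> / 4)" by (simp add: c(5))
    finally show ?thesis .
  qed
  \<comment> \<open>Each centre and scale has its own null set of times. Rational centres and scales
    keep the union null, and rationals are dense enough for the choice below.\<close>
  have "AE t in lborel. \<forall>x0\<in>\<rat>. \<forall>\<rho>\<in>\<rat>. 0 < \<rho> \<longrightarrow> 0 < t \<and> t < \<rho>\<^sup>2 \<longrightarrow> slice (?\<psi> \<rho> x0) A t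
      \<le> slice0 (?\<psi> \<rho> x0) A + (\<epsilon>\<^sup>2 * \<rho> + 4 * cutoff_var * \<epsilon> * \<rho>)"
  proof (rule AE_ball_countable'[OF _ countable_rat], rule AE_ball_countable'[OF _ countable_rat])
    fix x0 \<rho> :: real
    show "AE t in lborel. 0 < \<rho> \<longrightarrow> 0 < t \<and> t < \<rho>\<^sup>2 \<longrightarrow> slice (?\<psi> \<rho> x0) A t
      \<le> slice0 (?\<psi> \<rho> x0) A + (\<epsilon>\<^sup>2 * \<rho> + 4 * cutoff_var * \<epsilon> * \<rho>)"
      using slice_local[OF A, of \<rho> x0] by (cases "0 < \<rho>") auto
  qed
  note 1 = AE_snd_lborel[OF this]
  \<comment> \<open>The Lipschitz bound is known for each fixed h off a null set of points. The
    averaging needs it for a fixed point and almost every h, which is the interchange of null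
    sets.\<close>
  have 2: "AE z in lborel. AE h in lborel. 0 < snd z \<longrightarrow> A \<bullet> M (fst z + h, snd z) - A \<bullet> M z - \<epsilon> * \<bar>h\<bar> / sqrt (snd z) \<le> 0"
  proof -
    let ?P = "\<lambda>h z. 0 < snd z \<longrightarrow> A \<bullet> M (fst z + h, snd z) - A \<bullet> M z - \<epsilon> * \<bar>h\<bar> / sqrt (snd z) \<le> 0"
    have m1: "(\<lambda>w :: real \<times> real \<times> real. M (fst (snd w) + fst w, snd (snd w))) \<in> borel_measurable borel"
      by (rule measurable_compose[OF _ M_meas]) (auto intro!: borel_measurable_continuous_onI continuous_intros)
    have m2: "(\<lambda>w :: real \<times> real \<times> real. M (snd w)) \<in> borel_measurable borel"
      by (rule measurable_compose[OF _ M_meas]) (auto intro!: borel_measurable_continuous_onI continuous_intros)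
    have m3: "(\<lambda>w :: real \<times> real \<times> real. sqrt (snd (snd w))) \<in> borel_measurable borel"
      "(\<lambda>w :: real \<times> real \<times> real. \<epsilon> * \<bar>fst w\<bar>) \<in> borel_measurable borel" "(\<lambda>w :: real \<times> real \<times> real. snd (snd w)) \<in> borel_measurable borel"
      by (intro borel_measurable_continuous_onI continuous_intros)+
    have "{w \<in> space borel. ?P (fst w) (snd w)} \<in> sets (borel :: (real \<times> real \<times> real) measure)"
      using m1 m2 m3 by measurable
    then have "{w \<in> space (lborel \<Otimes>\<^sub>M lborel). ?P (fst w) (snd w)} \<in> sets ((lborel :: real measure) \<Otimes>\<^sub>M (lborel :: (real \<times> real) measure))"
      by (simp only: lborel_prod sets_lborel space_lborel space_borel)
    from lborel_pair.AE_commute[OF this] lipschitz_AE[OF A] show ?thesis by blast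
  qed
  show ?thesis using 1 2
  proof eventually_elim
    case (elim z)
    obtain x t where z: "z = (x, t)" by (cases z)
    show ?case
    proof
      assume "0 < snd z"
      then have t: "0 < t" by (simp add: z)
      \<comment> \<open>The lower bound puts t before \<rho>^2, where \<open>slice_local\<close>
        holds; the upper bound gives |h| <= \<rho> <= 2 sqrt t on the support, hence an oscillation
        of at most 2 \<epsilon>.\<close>
      obtain \<rho> where \<rho>: "\<rho> \<in> \<rat>" "sqrt t < \<rho>" "\<rho> < 2 * sqrt t" using Rats_dense_in_real[of "sqrt t" "2 * sqrt t"] t by auto
      have \<rho>0: "0 < \<rho>" using \<rho>(2) t by (meson order_less_trans real_sqrt_gt_zero)
      have t\<rho>: "t < \<rho>\<^sup>2" using \<rho>(2) t by (metis real_less_rsqrt less_eq_real_def not_less real_sqrt_less_iff real_sqrt_abs abs_of_pos \<rho>0)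
      obtain x0 where x0: "x0 \<in> \<rat>" "x - \<rho> / 2 < x0" "x0 < x + \<rho> / 2" using Rats_dense_in_real[of "x - \<rho> / 2" "x + \<rho> / 2"] \<rho>0 by auto
      have k: "0 < 4 / \<rho>" using \<rho>0 by simp
      note c = cutoff_at[OF k, of x0]
      have sl: "slice (?\<psi> \<rho> x0) A t \<le> norm (Ap - Am) * (cutoff_int * \<rho> / 4) + (\<epsilon>\<^sup>2 * \<rho> + 4 * cutoff_var * \<epsilon> * \<rho>)"
        using elim(1) x0(1) \<rho>(1) \<rho>0 t t\<rho> s0[OF \<rho>0, of x0] by (fastforce simp: z)
      have lip: "AE h in lborel. A \<bullet> M (x + h, t) - A \<bullet> M (x, t) - \<epsilon> * \<bar>h\<bar> / sqrt t \<le> 0" using elim(2) t by (simp add: z)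
      have m: "(\<lambda>y. ?\<psi> \<rho> x0 y * (1 - A \<bullet> M (y, t))) \<in> borel_measurable borel"
        using slice_int(1)[OF c(1,2) A] by auto
      have m': "?\<psi> \<rho> x0 \<in> borel_measurable borel" using integrable_smooth1(1)[OF c(1,2)] by auto
      have ih: "integrable lborel (\<lambda>h. ?\<psi> \<rho> x0 (x + h))"
        using lborel_integrable_real_affine[OF integrable_smooth1(1)[OF c(1,2)], of 1 x] by simp
      have ih': "integrable lborel (\<lambda>h. ?\<psi> \<rho> x0 (x + h) * (1 - A \<bullet> M (x + h, t)))"
        using lborel_integrable_real_affine[OF slice_int(1)[OF c(1,2) A], of 1 x t] by simp
      have "(1 - A \<bullet> M (x, t)) * (cutoff_int * \<rho> / 4) = (\<integral>h. ?\<psi> \<rho> x0 (x + h) * (1 - A \<bullet> M (x, t)) \<partial>lborel)"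
        using integral_translate[OF m', of x] by (simp add: c(5))
      also have "\<dots> \<le> (\<integral>h. ?\<psi> \<rho> x0 (x + h) * (1 - A \<bullet> M (x + h, t)) + ?\<psi> \<rho> x0 (x + h) * (2 * \<epsilon>) \<partial>lborel)"
      proof (rule integral_mono_AE)
        show "AE h in lborel. ?\<psi> \<rho> x0 (x + h) * (1 - A \<bullet> M (x, t)) \<le> ?\<psi> \<rho> x0 (x + h) * (1 - A \<bullet> M (x + h, t)) + ?\<psi> \<rho> x0 (x + h) * (2 * \<epsilon>)"
          using lip
        proof eventually_elim
          case (elim h)
          show ?case
          proof (cases "x + h \<in> {x0 - 2 / (4 / \<rho>)..x0 + 2 / (4 / \<rho>)}")
            case True
            then have "\<bar>h\<bar> \<le> \<rho>" using x0(2,3) by auto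
            then have "\<epsilon> * \<bar>h\<bar> \<le> (2 * \<epsilon>) * sqrt t" using \<epsilon> \<rho>(3) mult_left_mono[of "\<bar>h\<bar>" "2 * sqrt t" \<epsilon>] by simp
            then have "\<epsilon> * \<bar>h\<bar> / sqrt t \<le> 2 * \<epsilon>" using t by (simp add: divide_le_eq)
            with elim have "1 - A \<bullet> M (x, t) \<le> (1 - A \<bullet> M (x + h, t)) + 2 * \<epsilon>" by linarith
            from mult_left_mono[OF this c(3)[of "x + h"]] show ?thesis by (simp add: distrib_left)
          next
            case False
            then show ?thesis using supp1D[OF c(2)] by simp
          qed
        qed
      qed (use ih ih' in auto)
      also have "\<dots> = slice (?\<psi> \<rho> x0) A t + 2 * \<epsilon> * (cutoff_int * \<rho> / 4)"
        using ih ih' integral_translate[OF m', of x] integral_translate[OF m, of x] by (simp add: slice_def c(5))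
      also have "\<dots> \<le> norm (Ap - Am) * (cutoff_int * \<rho> / 4) + (\<epsilon>\<^sup>2 * \<rho> + 4 * cutoff_var * \<epsilon> * \<rho>) + 2 * \<epsilon> * (cutoff_int * \<rho> / 4)"
        using sl by simp
      \<comment> \<open>Here \<open>cutoff_int >= 2\<close> is used, so that \<rho> is at most twice
        the mass \<open>cutoff_int * \<rho> / 4\<close>.\<close>
      also have "\<dots> \<le> norm (Ap - Am) * (cutoff_int * \<rho> / 4) + (2 * \<epsilon>\<^sup>2 + 8 * cutoff_var * \<epsilon>) * (cutoff_int * \<rho> / 4) + 2 * \<epsilon> * (cutoff_int * \<rho> / 4)"
      proof -
        have "(\<epsilon>\<^sup>2 + 4 * cutoff_var * \<epsilon>) * \<rho> * 1 \<le> (\<epsilon>\<^sup>2 + 4 * cutoff_var * \<epsilon>) * \<rho> * (cutoff_int / 2)"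
          using cutoff_int_ge cutoff_var_nonneg \<epsilon> \<rho>0 by (intro mult_left_mono mult_nonneg_nonneg add_nonneg_nonneg) auto
        then show ?thesis by (simp add: algebra_simps)
      qed
      also have "\<dots> = (norm (Ap - Am) + 2 * \<epsilon>\<^sup>2 + 8 * cutoff_var * \<epsilon> + 2 * \<epsilon>) * (cutoff_int * \<rho> / 4)" by (simp add: algebra_simps)
      finally show "1 - A \<bullet> M z \<le> norm (Ap - Am) + 2 * \<epsilon>\<^sup>2 + 8 * cutoff_var * \<epsilon> + 2 * \<epsilon>"
        using cutoff_int_ge \<rho>0 by (simp add: z mult_le_cancel_right)
    qed
  qed
qed

end

section \<open>Rate of approach to the initial data\<close>

text \<open>
  The smallness that keeps the solution within a right angle of the two limit values.
\<close>

locale tame_small = tame +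
  assumes small: "norm (Ap - Am) + 2 * \<epsilon>\<^sup>2 + 8 * cutoff_var * \<epsilon> + 2 * \<epsilon> \<le> 1"
begin

lemma AM_nonneg:
  assumes "A = Ap \<or> A = Am"
  shows "AE z in lborel. 0 < snd z \<longrightarrow> 0 \<le> A \<bullet> M z"
  using closeness[OF assms] by eventually_elim (use small in auto)

text \<open>A cutoff at scale \<open>R\<close> that lives on one side of the origin only, where the
  initial data equal one of the two ends. The switch at the origin has width \<open>h\<close>, yet
  it adds just 1 to the total variation, so both h -> 0 and R -> infinity are harmless in
  \<open>flux_bound\<close>.\<close>

definition side_cutoff :: "real \<Rightarrow> real \<Rightarrow> real \<Rightarrow> real \<Rightarrow> real" where
  "side_cutoff \<sigma> R h x = cutoff_at (1 / R) 0 x * sstep (0 + (\<sigma> / h) * x)"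

lemma side_cutoff:
  assumes \<sigma>: "\<sigma> = 1 \<or> \<sigma> = -1" and R: "0 < R" and h: "0 < h"
  shows "smooth1 UNIV (side_cutoff \<sigma> R h)" "supp1 (- (2 * R)) (2 * R) (side_cutoff \<sigma> R h)"
    "0 \<le> side_cutoff \<sigma> R h x" "side_cutoff \<sigma> R h x \<noteq> 0 \<Longrightarrow> 0 < \<sigma> * x"
    "(\<integral>x. \<bar>deriv (side_cutoff \<sigma> R h) x\<bar> \<partial>lborel) \<le> cutoff_var + 1"
proof -
  have k: "0 < 1 / R" using R by simp
  note c = cutoff_at[OF k, of 0]
  let ?g = "\<lambda>x. sstep (0 + (\<sigma> / h) * x)"
  have g: "smooth1 UNIV ?g" by (rule smooth1_affine[OF smooth1_sstep])
  show s: "smooth1 UNIV (side_cutoff \<sigma> R h)"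
    unfolding side_cutoff_def[abs_def] by (intro smooth1_intros c g open_UNIV)
  show supp: "supp1 (- (2 * R)) (2 * R) (side_cutoff \<sigma> R h)"
    using c(2) by (auto simp: supp1_def side_cutoff_def)
  show "0 \<le> side_cutoff \<sigma> R h x" by (simp add: side_cutoff_def c sstep_simps)
  show "0 < \<sigma> * x" if "side_cutoff \<sigma> R h x \<noteq> 0"
  proof (rule ccontr)
    assume "\<not> 0 < \<sigma> * x"
    then have "0 + (\<sigma> / h) * x \<le> 0" using h by (simp add: divide_nonpos_pos)
    then show False using that by (simp add: side_cutoff_def sstep_simps)
  qed
  have dg: "deriv ?g x = deriv sstep (0 + (\<sigma> / h) * x) * (\<sigma> / h)" for x by (rule deriv_affine[OF smooth1_sstep])
  have sn: "\<sigma> / h \<noteq> 0" "\<bar>\<sigma> / h\<bar> = 1 / h" using \<sigma> h by auto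
  have ig: "integrable lborel (\<lambda>x. \<bar>deriv ?g x\<bar>)"
    unfolding dg using lborel_integrable_real_affine[OF sstep_variation(1) sn(1), of 0] by simp
  have vg: "(\<integral>x. \<bar>deriv ?g x\<bar> \<partial>lborel) = 1"
  proof -
    have "(\<integral>x. \<bar>deriv ?g x\<bar> \<partial>lborel) = (\<integral>x. \<bar>deriv sstep (0 + (\<sigma> / h) * x)\<bar> * (1 / h) \<partial>lborel)"
      unfolding dg abs_mult sn(2) ..
    also have "\<dots> = (\<integral>x. \<bar>deriv sstep (0 + (\<sigma> / h) * x)\<bar> \<partial>lborel) * (1 / h)" by simp
    also have "\<dots> = 1"
      using lborel_integral_real_affine[OF sn(1), of "\<lambda>x. \<bar>deriv sstep x\<bar>" 0]
      unfolding sn(2) sstep_variation(2) real_scaleR_def by (simp only: mult.commute)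
    finally show ?thesis .
  qed
  have df: "deriv (side_cutoff \<sigma> R h) x = deriv (cutoff_at (1 / R) 0) x * ?g x + cutoff_at (1 / R) 0 x * deriv ?g x" for x
  proof (rule DERIV_imp_deriv)
    have "(cutoff_at (1 / R) 0 has_real_derivative deriv (cutoff_at (1 / R) 0) x) (at x)" "(?g has_real_derivative deriv ?g x) (at x)"
      using smooth1D(1)[OF c(1)] smooth1D(1)[OF g] by simp_all
    from DERIV_mult[OF this]
    show "(side_cutoff \<sigma> R h has_real_derivative deriv (cutoff_at (1 / R) 0) x * ?g x + cutoff_at (1 / R) 0 x * deriv ?g x) (at x)"
      by (simp add: side_cutoff_def[abs_def] mult.commute add.commute)
  qed
  have "(\<integral>x. \<bar>deriv (side_cutoff \<sigma> R h) x\<bar> \<partial>lborel) \<le> (\<integral>x. \<bar>deriv (cutoff_at (1 / R) 0) x\<bar> + \<bar>deriv ?g x\<bar> \<partial>lborel)"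
  proof (rule integral_mono)
    show "integrable lborel (\<lambda>x. \<bar>deriv (side_cutoff \<sigma> R h) x\<bar>)" by (rule integrable_smooth1(4)[OF s supp])
    show "integrable lborel (\<lambda>x. \<bar>deriv (cutoff_at (1 / R) 0) x\<bar> + \<bar>deriv ?g x\<bar>)"
      using integrable_smooth1(4)[OF c(1,2)] ig by (rule Bochner_Integration.integrable_add)
    fix x
    have "\<bar>deriv (cutoff_at (1 / R) 0) x * ?g x\<bar> \<le> \<bar>deriv (cutoff_at (1 / R) 0) x\<bar> * 1"
      unfolding abs_mult by (intro mult_left_mono) (auto simp: sstep_simps abs_le_iff intro: order_trans[OF _ sstep_simps(3)])
    moreover have "\<bar>cutoff_at (1 / R) 0 x * deriv ?g x\<bar> \<le> 1 * \<bar>deriv ?g x\<bar>"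
      unfolding abs_mult using c(3,4)[of x] by (intro mult_right_mono) auto
    ultimately show "\<bar>deriv (side_cutoff \<sigma> R h) x\<bar> \<le> \<bar>deriv (cutoff_at (1 / R) 0) x\<bar> + \<bar>deriv ?g x\<bar>"
      unfolding df by linarith
  qed
  also have "\<dots> = cutoff_var + 1"
    using Bochner_Integration.integral_add[OF integrable_smooth1(4)[OF c(1,2)] ig] vg c(6) by simp
  finally show "(\<integral>x. \<bar>deriv (side_cutoff \<sigma> R h) x\<bar> \<partial>lborel) \<le> cutoff_var + 1" .
qed

text \<open>On its own side the initial density 1 - A . m0 is zero, and the source has the
  favourable sign by \<open>AM_nonneg\<close>, so only the flux is left. It amounts to twice the
  bound of \<open>flux_bound\<close>.\<close>

lemma side_rate:
  assumes \<sigma>: "\<sigma> = 1 \<and> A = Ap \<or> \<sigma> = -1 \<and> A = Am" and R: "0 < R" and h: "0 < h" and T: "0 < T"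
  shows "AE t in lborel. 0 < t \<and> t < T \<longrightarrow> slice (side_cutoff \<sigma> R h) A t \<le> 4 * \<epsilon> * (cutoff_var + 1) * sqrt T"
proof -
  have \<sigma>': "\<sigma> = 1 \<or> \<sigma> = -1" and A': "A = Ap \<or> A = Am" and A: "norm A = 1" using \<sigma> nA by auto
  let ?\<psi> = "side_cutoff \<sigma> R h"
  note c = side_cutoff[OF \<sigma>' R h]
  have z: "?\<psi> x * (1 - A \<bullet> step_data Ap Am x) = 0" for x
  proof (cases "?\<psi> x = 0")
    case False
    then have "0 < \<sigma> * x" by (rule c(4))
    then have "step_data Ap Am x = A" using \<sigma> by (auto simp: step_data_def)
    then show ?thesis using A by (simp add: dot_square_norm)
  qed simp
  have s0: "slice0 ?\<psi> A = 0" unfolding slice0_def z by simp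
  have "AE t in lborel. 0 < t \<and> t < T \<longrightarrow> slice ?\<psi> A t \<le> slice0 ?\<psi> A + 4 * \<epsilon> * (cutoff_var + 1) * sqrt T"
  proof (rule slice_bound[OF c(1,2) A])
    fix \<eta> :: "real \<Rightarrow> real" and N c' d
    assume \<eta>: "smooth1 UNIV \<eta>" "\<And>t. 0 \<le> \<eta> t" "\<And>t. \<eta> t \<le> N" "supp1 c' d \<eta>" "0 < c'" "c' \<le> d" "d < T"
    let ?\<phi> = "\<lambda>(x, t). ?\<psi> x * \<eta> t"
    have t\<phi>: "test_fun ?\<phi>" by (rule test_fun_product'(1)[OF c(1,2) \<eta>(1,5,4)])
    have pos: "0 \<le> ?\<phi> z" for z using c(3) \<eta>(2) by (cases z) simp
    have out: "?\<phi> z = 0" if "\<not> 0 < snd z" for z using supp1D[OF \<eta>(4), of "snd z"] that \<eta>(5) by (cases z) auto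
    note fb = flux_bound[OF c(1,2) \<eta>(1,2,3,4,5,7,6) c(5)]
    have i1: "integrable lborel (\<lambda>z. ?\<phi> z * ((norm (W z))\<^sup>2 * (- (A \<bullet> M z))))"
      by (intro integrable_test_real t\<phi> lbdd_intros lbdd_M lbdd_W)
    have "- (\<integral>z. dt ?\<phi> z * (1 - A \<bullet> M z) \<partial>lborel) \<le>
       (\<integral>z. \<alpha> * (?\<phi> z * ((norm (W z))\<^sup>2 * (- (A \<bullet> M z)))) + 2 * (\<bar>dx ?\<phi> z\<bar> * norm (W z)) \<partial>lborel)"
      by (rule const_ineq[OF t\<phi> pos A])
    also have "\<dots> \<le> (\<integral>z. 2 * (\<bar>dx ?\<phi> z\<bar> * norm (W z)) \<partial>lborel)"
    proof (rule integral_mono_AE)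
      show "AE z in lborel. \<alpha> * (?\<phi> z * ((norm (W z))\<^sup>2 * (- (A \<bullet> M z)))) + 2 * (\<bar>dx ?\<phi> z\<bar> * norm (W z)) \<le> 2 * (\<bar>dx ?\<phi> z\<bar> * norm (W z))"
        using AM_nonneg[OF A']
      proof eventually_elim
        case (elim z)
        have "0 \<le> \<alpha> * (?\<phi> z * ((norm (W z))\<^sup>2 * (A \<bullet> M z)))"
        proof (cases "0 < snd z")
          case True
          then show ?thesis using elim pos[of z] \<alpha> by (intro mult_nonneg_nonneg) auto
        next
          case False
          then show ?thesis unfolding out[OF False] by simp
        qed
        then show ?case by simp
      qed
    qed (use i1 fb(1) in auto)
    also have "\<dots> = 2 * (\<integral>z. \<bar>dx ?\<phi> z\<bar> * norm (W z) \<partial>lborel)" by simp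
    also have "\<dots> \<le> 2 * (N * (2 * \<epsilon> * (cutoff_var + 1) * sqrt T))" by (rule mult_left_mono[OF fb(2)]) simp
    also have "\<dots> = N * (4 * \<epsilon> * (cutoff_var + 1) * sqrt T)" by (simp add: algebra_simps)
    finally show "- (\<integral>z. dt ?\<phi> z * (1 - A \<bullet> M z) \<partial>lborel) \<le> N * (4 * \<epsilon> * (cutoff_var + 1) * sqrt T)" .
  qed
  then show ?thesis by (simp add: s0)
qed

text \<open>The width of the switch at the origin tends to 0 by dominated convergence, with the full
  cutoff as majorant; the bound is uniform in that width. Countably many \<open>T\<close>,
  \<open>R\<close> and widths share one null set of times.\<close>

lemma half_rate:
  assumes \<sigma>: "\<sigma> = 1 \<and> A = Ap \<or> \<sigma> = -1 \<and> A = Am"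
  shows "AE t in lborel. 0 < t \<longrightarrow> (\<forall>R::nat. 0 < R \<longrightarrow>
     (\<integral>x. cutoff_at (1 / real R) 0 x * (indicator {x. 0 < \<sigma> * x} x * (1 - A \<bullet> M (x, t))) \<partial>lborel) \<le> 8 * \<epsilon> * (cutoff_var + 1) * sqrt t)"
proof -
  have \<sigma>': "\<sigma> = 1 \<or> \<sigma> = -1" and A: "norm A = 1" using \<sigma> nA by auto
  have "AE t in lborel. \<forall>T\<in>\<rat>. \<forall>R k::nat. 0 < T \<longrightarrow> 0 < R \<longrightarrow> 0 < t \<and> t < T \<longrightarrow>
     slice (side_cutoff \<sigma> (real R) (1 / real (Suc k))) A t \<le> 4 * \<epsilon> * (cutoff_var + 1) * sqrt T"
  proof (rule AE_ball_countable'[OF _ countable_rat], unfold AE_all_countable, intro allI)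
    fix T :: real and R k :: nat
    show "AE t in lborel. 0 < T \<longrightarrow> 0 < R \<longrightarrow> 0 < t \<and> t < T \<longrightarrow>
       slice (side_cutoff \<sigma> (real R) (1 / real (Suc k))) A t \<le> 4 * \<epsilon> * (cutoff_var + 1) * sqrt T"
      using side_rate[OF \<sigma>, of "real R" "1 / real (Suc k)" T] by (cases "0 < T \<and> 0 < R") auto
  qed
  then show ?thesis
  proof eventually_elim
    case (elim t)
    show ?case
    proof (intro impI allI)
      fix R :: nat assume t: "0 < t" and R: "0 < R"
      \<comment> \<open>The estimate holds for times before a rational \<open>T\<close>. Staying
        below 4 t loses a factor of 2, as sqrt T <= 2 sqrt t.\<close>
      obtain T where T: "T \<in> \<rat>" "t < T" "T < 4 * t" using Rats_dense_in_real[of t "4 * t"] t by auto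
      let ?c = "cutoff_at (1 / real R) 0"
      let ?e = "\<lambda>x. 1 - A \<bullet> M (x, t)"
      have R': "0 < real R" using R by simp
      have k: "0 < 1 / real R" using R by simp
      note c = cutoff_at[OF k, of 0]
      have le: "slice (side_cutoff \<sigma> (real R) (1 / real (Suc k))) A t \<le> 4 * \<epsilon> * (cutoff_var + 1) * sqrt T" for k
        using elim T R t by auto
      have ie: "integrable lborel (\<lambda>x. ?c x * ?e x)" by (rule slice_int(1)[OF c(1,2) A])
      have e0: "0 \<le> ?e x" for x using AM_bound[OF A, of "(x, t)"] by auto
      have meas: "{x. 0 < \<sigma> * x} \<in> sets borel" by measurable
      have "(\<lambda>k. slice (side_cutoff \<sigma> (real R) (1 / real (Suc k))) A t) \<longlonglongrightarrow> (\<integral>x. ?c x * (indicator {x. 0 < \<sigma> * x} x * ?e x) \<partial>lborel)"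
        unfolding slice_def
      proof (rule integral_dominated_convergence[where w="\<lambda>x. ?c x * ?e x"])
        show "(\<lambda>x. ?c x * (indicator {x. 0 < \<sigma> * x} x * ?e x)) \<in> borel_measurable lborel"
        proof -
          have "(indicator {x. 0 < \<sigma> * x} :: real \<Rightarrow> real) \<in> borel_measurable lborel"
            using meas by (simp add: borel_measurable_indicator)
          from borel_measurable_times[OF this borel_measurable_integrable[OF ie]]
          show ?thesis by (simp add: mult.left_commute)
        qed
        show "(\<lambda>x. side_cutoff \<sigma> (real R) (1 / real (Suc k)) x * ?e x) \<in> borel_measurable lborel" for k
          using slice_int(1)[OF side_cutoff(1,2)[OF \<sigma>' R', of "1 / real (Suc k)"] A, of t] by auto
        show "AE x in lborel. (\<lambda>k. side_cutoff \<sigma> (real R) (1 / real (Suc k)) x * ?e x) \<longlonglongrightarrow> ?c x * (indicator {x. 0 < \<sigma> * x} x * ?e x)"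
        proof (rule AE_I2)
          fix x
          have "(\<lambda>k. sstep (0 + (\<sigma> / (1 / real (Suc k))) * x)) \<longlonglongrightarrow> indicator {x. 0 < \<sigma> * x} x"
          proof (cases "0 < \<sigma> * x")
            case True
            obtain n where n: "1 / (\<sigma> * x) < real n" using reals_Archimedean2 by blast
            have "\<forall>\<^sub>F k in sequentially. sstep (0 + (\<sigma> / (1 / real (Suc k))) * x) = indicator {x. 0 < \<sigma> * x} x"
              using eventually_ge_at_top[of n]
            proof eventually_elim
              case (elim k)
              then have "1 / (\<sigma> * x) < real (Suc k)" using n by linarith
              then have "1 < real (Suc k) * (\<sigma> * x)" using True by (simp add: pos_divide_less_eq)
              then show ?case using True by (simp add: sstep_simps mult_ac)
            qed
            then show ?thesis by (rule tendsto_eventually)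
          next
            case False
            then have "sstep (0 + (\<sigma> / (1 / real (Suc k))) * x) = 0" for k
              by (intro sstep_simps(1)) (simp add: mult_nonneg_nonpos mult.commute[of \<sigma>] mult.assoc mult.left_commute[of _ "real _"] not_less)
            then show ?thesis using False by simp
          qed
          then show "(\<lambda>k. side_cutoff \<sigma> (real R) (1 / real (Suc k)) x * ?e x) \<longlonglongrightarrow> ?c x * (indicator {x. 0 < \<sigma> * x} x * ?e x)"
            unfolding side_cutoff_def mult.assoc by (intro tendsto_mult tendsto_const)
        qed
        have "norm (side_cutoff \<sigma> (real R) (1 / real (Suc k)) x * ?e x) \<le> ?c x * ?e x" for k x
        proof -
          have "side_cutoff \<sigma> (real R) (1 / real (Suc k)) x \<le> ?c x * 1"
            unfolding side_cutoff_def by (intro mult_left_mono sstep_simps c(3))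
          then have "side_cutoff \<sigma> (real R) (1 / real (Suc k)) x * ?e x \<le> ?c x * ?e x" using e0 by (intro mult_right_mono) auto
          moreover have "0 \<le> side_cutoff \<sigma> (real R) (1 / real (Suc k)) x" by (rule side_cutoff(3)[OF \<sigma>' R']) simp
          ultimately show ?thesis using e0[of x] by simp
        qed
        then show "AE x in lborel. norm (side_cutoff \<sigma> (real R) (1 / real (Suc k)) x * ?e x) \<le> ?c x * ?e x" for k by simp
      qed (rule ie)
      then have "(\<integral>x. ?c x * (indicator {x. 0 < \<sigma> * x} x * ?e x) \<partial>lborel) \<le> 4 * \<epsilon> * (cutoff_var + 1) * sqrt T"
        by (rule LIMSEQ_le_const2) (use le in blast)
      also have "\<dots> \<le> 4 * \<epsilon> * (cutoff_var + 1) * (2 * sqrt t)"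
      proof (rule mult_left_mono)
        have "sqrt T \<le> sqrt (4 * t)" using T by simp
        then show "sqrt T \<le> 2 * sqrt t" by (simp add: real_sqrt_mult)
      qed (use \<epsilon> cutoff_var_nonneg in auto)
      finally show "(\<integral>x. ?c x * (indicator {x. 0 < \<sigma> * x} x * ?e x) \<partial>lborel) \<le> 8 * \<epsilon> * (cutoff_var + 1) * sqrt t" by simp
    qed
  qed
qed

text \<open>For unit vectors |A - M|^2 = 2 (1 - A . M), so each half-line contributes twice
  \<open>half_rate\<close>. The origin, where the step data are 0, is a null set.\<close>

lemma rate:
  "AE t in lborel. 0 < t \<longrightarrow> (\<forall>R::nat. 0 < R \<longrightarrow>
     (\<integral>x. cutoff_at (1 / real R) 0 x * (norm (step_data Ap Am x - M (x, t)))\<^sup>2 \<partial>lborel) \<le> 32 * \<epsilon> * (cutoff_var + 1) * sqrt t)"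
  using half_rate[of 1 Ap, simplified] half_rate[of "-1" Am, simplified]
proof eventually_elim
  case (elim t)
  show ?case
  proof (intro impI allI)
    fix R :: nat assume t: "0 < t" and R: "0 < R"
    let ?c = "cutoff_at (1 / real R) 0"
    have k: "0 < 1 / real R" using R by simp
    note c = cutoff_at[OF k, of 0]
    let ?p = "\<lambda>x. ?c x * (indicator {x. 0 < x} x * (1 - Ap \<bullet> M (x, t)))"
    let ?m = "\<lambda>x. ?c x * (indicator {x. x < 0} x * (1 - Am \<bullet> M (x, t)))"
    have ip: "integrable lborel (\<lambda>x. indicator {x. 0 < x} x * (?c x * (1 - Ap \<bullet> M (x, t))))"
      using integrable_mult_indicator[of "{x. 0 < x}" lborel, OF _ slice_int(1)[OF c(1,2) nA(1)]] by simp
    have im: "integrable lborel (\<lambda>x. indicator {x. x < 0} x * (?c x * (1 - Am \<bullet> M (x, t))))"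
      using integrable_mult_indicator[of "{x. x < 0}" lborel, OF _ slice_int(1)[OF c(1,2) nA(2)]] by simp
    have i: "integrable lborel ?p" "integrable lborel ?m" using ip im by (simp_all add: mult.left_commute)
    have "(\<integral>x. ?c x * (norm (step_data Ap Am x - M (x, t)))\<^sup>2 \<partial>lborel) = (\<integral>x. 2 * ?p x + 2 * ?m x \<partial>lborel)"
    proof (rule integral_cong_AE)
      have sq: "(norm (A - M z))\<^sup>2 = 2 * (1 - A \<bullet> M z)" if "norm A = 1" for A z
      proof -
        have "(norm (A - M z))\<^sup>2 = A \<bullet> A + M z \<bullet> M z - 2 * (A \<bullet> M z)"
          by (simp add: power2_norm_eq_inner inner_diff_left inner_diff_right inner_commute)
        then show ?thesis using that M_norm[of z] by (simp add: dot_square_norm)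
      qed
      show "AE x in lborel. ?c x * (norm (step_data Ap Am x - M (x, t)))\<^sup>2 = 2 * ?p x + 2 * ?m x"
        using AE_lborel_singleton[of 0]
      proof eventually_elim
        case (elim x)
        then consider "0 < x" | "x < 0" by linarith
        then show ?case by cases (simp_all add: step_data_def sq nA)
      qed
      have "?c \<in> borel_measurable borel" using integrable_smooth1(1)[OF c(1,2)] by auto
      moreover have "(\<lambda>x. M (x, t)) \<in> borel_measurable borel" by (rule measurable_slice[OF M_meas])
      ultimately show "(\<lambda>x. ?c x * (norm (step_data Ap Am x - M (x, t)))\<^sup>2) \<in> borel_measurable lborel"
        using step_data_meas by measurable
      show "(\<lambda>x. 2 * ?p x + 2 * ?m x) \<in> borel_measurable lborel" using i by measurable
    qed
    also have "\<dots> = 2 * (\<integral>x. ?p x \<partial>lborel) + 2 * (\<integral>x. ?m x \<partial>lborel)" using i by simp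
    also have "\<dots> \<le> 2 * (8 * \<epsilon> * (cutoff_var + 1) * sqrt t) + 2 * (8 * \<epsilon> * (cutoff_var + 1) * sqrt t)"
      using elim t R by (intro add_mono mult_left_mono) auto
    also have "\<dots> = 32 * \<epsilon> * (cutoff_var + 1) * sqrt t" by (simp add: algebra_simps)
    finally show "(\<integral>x. ?c x * (norm (step_data Ap Am x - M (x, t)))\<^sup>2 \<partial>lborel) \<le> 32 * \<epsilon> * (cutoff_var + 1) * sqrt t" .
  qed
qed

end

section \<open>Relative energy with respect to a smooth solution\<close>

lemma test_mult_deriv:
  assumes "test_fun \<phi>" "smooth2 half_plane g"
  shows "dx (\<lambda>z. \<phi> z * g z) z = dx \<phi> z * g z + \<phi> z * dx g z"
    "dt (\<lambda>z. \<phi> z * g z) z = dt \<phi> z * g z + \<phi> z * dt g z"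
proof -
  obtain a b c d where s: "supp_box a b c d \<phi>" using assms by (auto simp: test_fun_def)
  have sm: "smooth2 UNIV \<phi>" using assms by (simp add: test_fun_def)
  have "dx (\<lambda>z. \<phi> z * g z) z = dx \<phi> z * g z + \<phi> z * dx g z \<and> dt (\<lambda>z. \<phi> z * g z) z = dt \<phi> z * g z + \<phi> z * dt g z"
  proof (cases "z \<in> half_plane")
    case True
    from has_grad_dx_dt[OF has_grad_mult[OF smooth2D(1)[OF sm UNIV_I] smooth2D(1)[OF assms(2) True]]]
    show ?thesis by simp
  next
    case False
    have s': "supp_box a b c d (\<lambda>z. \<phi> z * g z)" using s by (auto simp: supp_box_def)
    have zero: "f z = 0" if "supp_box a b c d f" for f
      using that False by (cases z) (force simp: supp_box_def)
    show ?thesis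
      using zero[OF s] zero[OF supp_box_dx(1)[OF s]] zero[OF supp_box_dx(2)[OF s]] zero[OF supp_box_dx(1)[OF s']] zero[OF supp_box_dx(2)[OF s']]
      by simp
  qed
  then show "dx (\<lambda>z. \<phi> z * g z) z = dx \<phi> z * g z + \<phi> z * dx g z"
    "dt (\<lambda>z. \<phi> z * g z) z = dt \<phi> z * g z + \<phi> z * dt g z" by auto
qed

lemma test_fun_zero: "test_fun \<phi> \<Longrightarrow> \<not> 0 < snd z \<Longrightarrow> \<phi> z = 0"
  by (cases z) (force simp: test_fun_def supp_box_def)

lemma inner_eq_sum: "(x :: real^3) \<bullet> y = (\<Sum>i\<in>UNIV. x $ i * y $ i)"
  by (simp add: inner_vec_def)

lemma cross3_norm_le: "norm (cross3 a b) \<le> norm a * norm b"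
proof (rule power2_le_imp_le)
  show "(norm (cross3 a b))\<^sup>2 \<le> (norm a * norm b)\<^sup>2"
    using norm_cross_dot[of a b] zero_le_power2[of "a \<bullet> b"] by linarith
qed simp

text \<open>
  The relative energy density \<open>1 - n \<bullet> M\<close>: the quasilinear term contributes only
  \<open>(n - M) \<times> n\<^sub>x\<close>, which the dissipation \<open>|n\<^sub>x - W|\<^sup>2\<close> absorbs.
\<close>

lemma relative_energy_pointwise:
  fixes n M nx W :: "real^3"
  assumes \<alpha>: "0 < \<alpha>" "\<alpha> \<le> 1" and \<beta>: "0 \<le> \<beta>" "\<beta> \<le> 1" and n: "norm n = 1" and M: "norm M = 1" and o: "n \<bullet> nx = 0"
    and \<phi>: "0 \<le> \<phi>" and q: "0 \<le> q" "\<phi>x\<^sup>2 \<le> \<phi> * q"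
  defines "F \<equiv> \<beta> *\<^sub>R cross3 n nx + \<alpha> *\<^sub>R nx" and "e \<equiv> 1 - n \<bullet> M"
  shows "\<phi> * (F \<bullet> W) + \<phi>x * (F \<bullet> M) - \<alpha> * (\<phi> * ((norm nx)\<^sup>2 * (n \<bullet> M)))
      + \<beta> * (\<phi>x * (n \<bullet> cross3 M W) + \<phi> * (nx \<bullet> cross3 M W)) + \<alpha> * (\<phi> * (nx \<bullet> W))
      + \<alpha> * (\<phi>xx * e) - \<alpha> * (\<phi>x * (nx \<bullet> M)) - \<alpha> * (\<phi> * ((norm W)\<^sup>2 * (n \<bullet> M)))
    \<le> \<phi> * e * ((norm nx)\<^sup>2 / \<alpha> + \<alpha> * ((norm nx)\<^sup>2 + (norm W)\<^sup>2)) + (2 * q / \<alpha> + 2 * \<bar>\<phi>xx\<bar>)"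
proof -
  define D where "D = nx - W"
  define d where "d = n - M"
  have d2: "(norm d)\<^sup>2 = 2 * e"
  proof -
    have "(norm d)\<^sup>2 = n \<bullet> n + M \<bullet> M - 2 * (n \<bullet> M)"
      by (simp add: d_def power2_norm_eq_inner inner_diff_left inner_diff_right inner_commute)
    then show ?thesis using n M by (simp add: e_def dot_square_norm)
  qed
  have e: "0 \<le> e" "e \<le> 2"
    using Cauchy_Schwarz_ineq2[of n M] n M by (auto simp: e_def)
  \<comment> \<open>The triple product (d x nx) . nx vanishes, which is why the product with
    \<open>W\<close> may be written with \<open>D = nx - W\<close>. In the same way (n x d) . nx in
    the next identity combines with the terms in \<open>n\<close> and \<open>M\<close>.\<close>
  have c1: "cross3 n nx \<bullet> W + nx \<bullet> cross3 M W = - (cross3 d nx \<bullet> D)"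
    by (simp add: cross3_simps d_def D_def forall_3) 
  have c2: "cross3 n nx \<bullet> M + n \<bullet> cross3 M W = cross3 n d \<bullet> D"
    by (simp add: cross3_simps d_def D_def forall_3)
  have D2: "(norm D)\<^sup>2 = (norm nx)\<^sup>2 + (norm W)\<^sup>2 - 2 * (nx \<bullet> W)"
    by (simp add: D_def power2_norm_eq_inner inner_diff_left inner_diff_right inner_commute)
  have "\<phi> * (F \<bullet> W) + \<phi>x * (F \<bullet> M) - \<alpha> * (\<phi> * ((norm nx)\<^sup>2 * (n \<bullet> M)))
      + \<beta> * (\<phi>x * (n \<bullet> cross3 M W) + \<phi> * (nx \<bullet> cross3 M W)) + \<alpha> * (\<phi> * (nx \<bullet> W))
      + \<alpha> * (\<phi>xx * e) - \<alpha> * (\<phi>x * (nx \<bullet> M)) - \<alpha> * (\<phi> * ((norm W)\<^sup>2 * (n \<bullet> M)))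
    = \<phi> * (\<beta> * (cross3 n nx \<bullet> W + nx \<bullet> cross3 M W) + \<alpha> * (2 * (nx \<bullet> W)) - \<alpha> * ((norm nx)\<^sup>2 + (norm W)\<^sup>2) * (1 - e))
      + \<phi>x * (\<beta> * (cross3 n nx \<bullet> M + n \<bullet> cross3 M W)) + \<alpha> * (\<phi>xx * e)"
    by (simp add: F_def e_def inner_add_left algebra_simps)
  \<comment> \<open>By the polarisation \<open>D2\<close> the mixed term 2 nx . W yields - \<alpha>
    |D|^2, the dissipation that everything containing \<open>D\<close> is charged to.\<close>
  also have "\<dots> = \<phi> * (- (\<beta> * (cross3 d nx \<bullet> D)) - \<alpha> * (norm D)\<^sup>2 + \<alpha> * ((norm nx)\<^sup>2 + (norm W)\<^sup>2) * e)
      + \<phi>x * (\<beta> * (cross3 n d \<bullet> D)) + \<alpha> * (\<phi>xx * e)"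
    unfolding c1 c2 D2 by (simp add: algebra_simps)
  also have "\<dots> \<le> \<phi> * ((\<alpha> / 2 * (norm D)\<^sup>2 + (norm nx)\<^sup>2 / \<alpha> * e) - \<alpha> * (norm D)\<^sup>2 + \<alpha> * ((norm nx)\<^sup>2 + (norm W)\<^sup>2) * e)
      + (\<phi> * (\<alpha> / 2 * (norm D)\<^sup>2) + q / \<alpha> * e) + \<bar>\<phi>xx\<bar> * 2"
  proof -
    \<comment> \<open>The weight is chosen so that each of the two terms containing \<open>D\<close>
      uses exactly half of the dissipation \<alpha> |D|^2.\<close>
    have yg: "a * b \<le> \<alpha> / 2 * b\<^sup>2 + a\<^sup>2 / (2 * \<alpha>)" for a b :: real
    proof -
      have "0 \<le> (\<alpha> * b - a)\<^sup>2" by simp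
      then have "2 * \<alpha> * (a * b) \<le> \<alpha>\<^sup>2 * b\<^sup>2 + a\<^sup>2" by (simp add: power2_eq_square algebra_simps)
      then have "a * b \<le> (\<alpha>\<^sup>2 * b\<^sup>2 + a\<^sup>2) / (2 * \<alpha>)" using \<alpha> by (simp add: pos_le_divide_eq mult.commute)
      also have "\<dots> = \<alpha> / 2 * b\<^sup>2 + a\<^sup>2 / (2 * \<alpha>)" using \<alpha> by (simp add: field_simps power2_eq_square)
      finally show ?thesis .
    qed
    have "\<bar>cross3 d nx \<bullet> D\<bar> \<le> norm d * norm nx * norm D"
      using Cauchy_Schwarz_ineq2[of "cross3 d nx" D] mult_right_mono[OF cross3_norm_le[of d nx] norm_ge_zero[of D]] by linarith
    then have "- (\<beta> * (cross3 d nx \<bullet> D)) \<le> 1 * (norm d * norm nx * norm D)"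
      using \<beta> mult_mono[of \<beta> 1 "- (cross3 d nx \<bullet> D)" "norm d * norm nx * norm D"]
      by (cases "0 \<le> - (cross3 d nx \<bullet> D)") (auto intro: order_trans[OF _ mult_nonneg_nonneg] simp: abs_le_iff mult_nonneg_nonneg)
    also have "\<dots> \<le> \<alpha> / 2 * (norm D)\<^sup>2 + (norm d * norm nx)\<^sup>2 / (2 * \<alpha>)" using yg[of "norm d * norm nx" "norm D"] by simp
    also have "(norm d * norm nx)\<^sup>2 / (2 * \<alpha>) = (norm nx)\<^sup>2 / \<alpha> * e" using \<alpha> by (simp add: power_mult_distrib d2 field_simps)
    finally have h1: "- (\<beta> * (cross3 d nx \<bullet> D)) \<le> \<alpha> / 2 * (norm D)\<^sup>2 + (norm nx)\<^sup>2 / \<alpha> * e" .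
    have "\<bar>cross3 n d \<bullet> D\<bar> \<le> norm d * norm D"
      using Cauchy_Schwarz_ineq2[of "cross3 n d" D] mult_right_mono[OF cross3_norm_le[of n d] norm_ge_zero[of D]] n by simp
    \<comment> \<open>The factor sqrt \<phi> is split off the derivative of the cutoff and given to
      \<open>D\<close>. This is where \<phi>_x^2 <= \<phi> q is indispensable: half of \<phi>
      \<alpha> |D|^2 can absorb the result, and what remains no longer contains
      \<open>D\<close>.\<close>
    then have "\<bar>\<phi>x * (\<beta> * (cross3 n d \<bullet> D))\<bar> \<le> sqrt (\<phi> * q) * (1 * (norm d * norm D))"
      unfolding abs_mult using \<beta> q(2) \<phi> q(1) by (intro mult_mono) (auto intro!: real_le_rsqrt)
    also have "\<dots> = (sqrt q * norm d) * (sqrt \<phi> * norm D)" by (simp add: real_sqrt_mult)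
    also have "\<dots> \<le> \<alpha> / 2 * (sqrt \<phi> * norm D)\<^sup>2 + (sqrt q * norm d)\<^sup>2 / (2 * \<alpha>)" by (rule yg)
    also have "\<dots> = \<phi> * (\<alpha> / 2 * (norm D)\<^sup>2) + q / \<alpha> * e" using \<alpha> \<phi> q(1) by (simp add: power_mult_distrib d2 field_simps)
    finally have h2: "\<phi>x * (\<beta> * (cross3 n d \<bullet> D)) \<le> \<phi> * (\<alpha> / 2 * (norm D)\<^sup>2) + q / \<alpha> * e" by linarith
    have "\<alpha> * (\<phi>xx * e) \<le> \<bar>\<alpha> * (\<phi>xx * e)\<bar>" by simp
    also have "\<dots> = \<bar>\<phi>xx\<bar> * (\<alpha> * e)" using \<alpha> e by (simp add: abs_mult)
    also have "\<dots> \<le> \<bar>\<phi>xx\<bar> * (1 * 2)" using \<alpha> e by (intro mult_left_mono mult_mono) auto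
    finally have h3: "\<alpha> * (\<phi>xx * e) \<le> \<bar>\<phi>xx\<bar> * 2" by simp
    show ?thesis
      by (rule add_mono[OF add_mono[OF mult_left_mono[OF _ \<phi>] h2] h3]) (use h1 in linarith)
  qed
  also have "\<dots> = \<phi> * e * ((norm nx)\<^sup>2 / \<alpha> + \<alpha> * ((norm nx)\<^sup>2 + (norm W)\<^sup>2)) + (q / \<alpha> * e + 2 * \<bar>\<phi>xx\<bar>)"
    by (simp add: algebra_simps)
  also have "\<dots> \<le> \<phi> * e * ((norm nx)\<^sup>2 / \<alpha> + \<alpha> * ((norm nx)\<^sup>2 + (norm W)\<^sup>2)) + (q / \<alpha> * 2 + 2 * \<bar>\<phi>xx\<bar>)"
    using e q(1) \<alpha> by (intro add_left_mono add_right_mono mult_left_mono) auto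
  finally show ?thesis by (simp add: mult.commute)
qed

text \<open>The smooth competitor is described by its flux \<open>F\<close>, so that its equation
  reads n_t = F_x + \<alpha> |n_x|^2 n and products with M can be tested without second derivatives
  of either map. The number 1 / 4 in \<open>c_small\<close> makes the Gronwall coefficient at most 1
  / (4 t), matching the weight t^(-1/4) of \<open>energy_bound\<close>.\<close>

locale weak_strong = tame_small +
  fixes n nx nt F Fx :: "real \<times> real \<Rightarrow> real^3" and c Kn :: real
  assumes n_smooth: "\<And>i. smooth2 half_plane (\<lambda>z. n z $ i)" and F_smooth: "\<And>i. smooth2 half_plane (\<lambda>z. F z $ i)"
    and dx_n: "\<And>z i. 0 < snd z \<Longrightarrow> dx (\<lambda>z. n z $ i) z = nx z $ i"
    and dt_n: "\<And>z i. 0 < snd z \<Longrightarrow> dt (\<lambda>z. n z $ i) z = nt z $ i"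
    and dx_F: "\<And>z i. 0 < snd z \<Longrightarrow> dx (\<lambda>z. F z $ i) z = Fx z $ i"
    and pde: "\<And>z. 0 < snd z \<Longrightarrow> nt z = Fx z + (\<alpha> * (norm (nx z))\<^sup>2) *\<^sub>R n z"
    and F_eq: "\<And>z. 0 < snd z \<Longrightarrow> F z = \<beta> *\<^sub>R cross3 (n z) (nx z) + \<alpha> *\<^sub>R nx z"
    and n_norm: "\<And>z. norm (n z) = 1" and n_orth: "\<And>z. 0 < snd z \<Longrightarrow> n z \<bullet> nx z = 0"
    and nx_bound: "\<And>x t. 0 < t \<Longrightarrow> norm (nx (x, t)) \<le> c / sqrt t"
    and lbdd_n: "lbdd n" "lbdd nx" "lbdd nt" "lbdd F" "lbdd Fx"
    and n_rate: "\<And>t R. 0 < t \<Longrightarrow> 0 < R \<Longrightarrow> (\<integral>x. cutoff_at (1 / R) 0 x * (norm (step_data Ap Am x - n (x, t)))\<^sup>2 \<partial>lborel) \<le> Kn * sqrt t"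
    and c_small: "c\<^sup>2 / \<alpha> + \<alpha> * (c\<^sup>2 + \<epsilon>\<^sup>2) \<le> 1 / 4"
begin

lemmas lb = lbdd_n lbdd_M lbdd_W lbdd_intros

text \<open>A variable vector field in place of a constant vector is handled componentwise: the
  products \<phi> G_i are again scalar test functions, and summation over i restores the inner
  products. \<open>eqn_field\<close> treats the equation in the same way.\<close>

lemma weak_field:
  assumes \<phi>: "test_fun \<phi>" and G: "\<And>i. smooth2 half_plane (\<lambda>z. G z $ i)" and Gx: "\<And>z i. 0 < snd z \<Longrightarrow> dx (\<lambda>z. G z $ i) z = Gx z $ i"
    and lG: "lbdd G" "lbdd Gx"
  shows "(\<integral>z. dx \<phi> z * (G z \<bullet> M z) + \<phi> z * (Gx z \<bullet> M z) \<partial>lborel) = - (\<integral>z. \<phi> z * (G z \<bullet> W z) \<partial>lborel)"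
proof -
  have d: "dx (\<lambda>z. \<phi> z * G z $ i) z = dx \<phi> z * G z $ i + \<phi> z * Gx z $ i" for i z
    using test_mult_deriv(1)[OF \<phi> G] Gx test_fun_zero[OF \<phi>, of z] by (cases "0 < snd z") auto
  have ti: "test_fun (\<lambda>z. \<phi> z * G z $ i)" for i by (rule test_fun_mult[OF \<phi> G])
  have w: "(\<integral>z. (dx \<phi> z * G z $ i + \<phi> z * Gx z $ i) * M z $ i \<partial>lborel) = - (\<integral>z. (\<phi> z * G z $ i) * W z $ i \<partial>lborel)" for i
    using weak_inner[OF ti, of i "axis i 1"] by (simp add: d inner_axis' )
  have lbi: "lbdd (\<lambda>z. H z $ i)" if "lbdd H" for H :: "real \<times> real \<Rightarrow> real^3" and i
    using lbdd_inner[OF lbdd_const[of "axis i 1"] that] by (simp add: inner_axis')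
  have i1: "integrable lborel (\<lambda>z. (dx \<phi> z * G z $ i + \<phi> z * Gx z $ i) * M z $ i)" for i
    using integrable_test_real[OF test_fun_dx(1)[OF ti], of "\<lambda>z. M z $ i" i] lbi[OF lbdd_M] by (simp add: d)
  have i2: "integrable lborel (\<lambda>z. (\<phi> z * G z $ i) * W z $ i)" for i
    using integrable_test_real[OF ti, of "\<lambda>z. W z $ i" i] lbi[OF lbdd_W] by simp
  have "(\<integral>z. dx \<phi> z * (G z \<bullet> M z) + \<phi> z * (Gx z \<bullet> M z) \<partial>lborel) = (\<integral>z. (\<Sum>i\<in>UNIV. (dx \<phi> z * G z $ i + \<phi> z * Gx z $ i) * M z $ i) \<partial>lborel)"
    by (simp add: inner_eq_sum sum_distrib_left sum.distrib algebra_simps)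
  also have "\<dots> = (\<Sum>i\<in>UNIV. - (\<integral>z. (\<phi> z * G z $ i) * W z $ i \<partial>lborel))"
    using i1 by (simp add: Bochner_Integration.integral_sum w del: Bochner_Integration.integral_add)
  also have "\<dots> = - (\<integral>z. (\<Sum>i\<in>UNIV. (\<phi> z * G z $ i) * W z $ i) \<partial>lborel)"
    using i2 by (simp add: Bochner_Integration.integral_sum sum_negf)
  also have "\<dots> = - (\<integral>z. \<phi> z * (G z \<bullet> W z) \<partial>lborel)"
    by (simp add: inner_eq_sum sum_distrib_left mult.assoc)
  finally show ?thesis .
qed

lemma eqn_field:
  assumes \<phi>: "test_fun \<phi>"
  shows "(\<integral>z. dt \<phi> z * (n z \<bullet> M z) + \<phi> z * (nt z \<bullet> M z) \<partial>lborel) =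
     \<beta> * (\<integral>z. dx \<phi> z * (n z \<bullet> cross3 (M z) (W z)) + \<phi> z * (nx z \<bullet> cross3 (M z) (W z)) \<partial>lborel)
     + \<alpha> * (\<integral>z. dx \<phi> z * (n z \<bullet> W z) + \<phi> z * (nx z \<bullet> W z) \<partial>lborel)
     - \<alpha> * (\<integral>z. \<phi> z * ((norm (W z))\<^sup>2 * (n z \<bullet> M z)) \<partial>lborel)"
proof -
  have d: "dx (\<lambda>z. \<phi> z * n z $ i) z = dx \<phi> z * n z $ i + \<phi> z * nx z $ i"
    "dt (\<lambda>z. \<phi> z * n z $ i) z = dt \<phi> z * n z $ i + \<phi> z * nt z $ i" for i z
    using test_mult_deriv[OF \<phi> n_smooth] dx_n dt_n test_fun_zero[OF \<phi>, of z] by (cases "0 < snd z"; auto)+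
  have ti: "test_fun (\<lambda>z. \<phi> z * n z $ i)" for i by (rule test_fun_mult[OF \<phi> n_smooth])
  let ?C = "\<lambda>z. cross3 (M z) (W z)"
  have w: "(\<integral>z. (dt \<phi> z * n z $ i + \<phi> z * nt z $ i) * M z $ i \<partial>lborel) =
     \<beta> * (\<integral>z. (dx \<phi> z * n z $ i + \<phi> z * nx z $ i) * ?C z $ i \<partial>lborel)
     + \<alpha> * (\<integral>z. (dx \<phi> z * n z $ i + \<phi> z * nx z $ i) * W z $ i \<partial>lborel)
     - \<alpha> * (\<integral>z. (\<phi> z * n z $ i) * ((norm (W z))\<^sup>2 * M z $ i) \<partial>lborel)" for i
    using eqn_inner[OF ti, of i "axis i 1"] by (simp add: d inner_axis')
  have lbi: "lbdd (\<lambda>z. H z $ i)" if "lbdd H" for H :: "real \<times> real \<Rightarrow> real^3" and i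
    using lbdd_inner[OF lbdd_const[of "axis i 1"] that] by (simp add: inner_axis')
  have i1: "integrable lborel (\<lambda>z. (dt \<phi> z * n z $ i + \<phi> z * nt z $ i) * M z $ i)" for i
    using integrable_test_real[OF test_fun_dx(2)[OF ti], of "\<lambda>z. M z $ i" i] lbi[OF lbdd_M] by (simp add: d)
  have i2: "integrable lborel (\<lambda>z. (dx \<phi> z * n z $ i + \<phi> z * nx z $ i) * ?C z $ i)" for i
    using integrable_test_real[OF test_fun_dx(1)[OF ti], of "\<lambda>z. ?C z $ i" i] lbi[OF lbdd_cross[OF lbdd_M lbdd_W]] by (simp add: d)
  have i3: "integrable lborel (\<lambda>z. (dx \<phi> z * n z $ i + \<phi> z * nx z $ i) * W z $ i)" for i
    using integrable_test_real[OF test_fun_dx(1)[OF ti], of "\<lambda>z. W z $ i" i] lbi[OF lbdd_W] by (simp add: d)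
  have i4: "integrable lborel (\<lambda>z. (\<phi> z * n z $ i) * ((norm (W z))\<^sup>2 * M z $ i))" for i
    using integrable_test_real[OF ti, of "\<lambda>z. (norm (W z))\<^sup>2 * M z $ i" i] lbdd_mult[OF lbdd_norm2[OF lbdd_W] lbi[OF lbdd_M]] by simp
  have su: "(\<Sum>i\<in>UNIV. (\<integral>z. f i z \<partial>lborel)) = (\<integral>z. (\<Sum>i\<in>UNIV. f i z) \<partial>lborel)" if "\<And>i. integrable lborel (f i)"
    for f :: "3 \<Rightarrow> real \<times> real \<Rightarrow> real" using that by (simp add: Bochner_Integration.integral_sum)
  have "(\<integral>z. dt \<phi> z * (n z \<bullet> M z) + \<phi> z * (nt z \<bullet> M z) \<partial>lborel) = (\<Sum>i\<in>UNIV. (\<integral>z. (dt \<phi> z * n z $ i + \<phi> z * nt z $ i) * M z $ i \<partial>lborel))"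
    unfolding su[OF i1] by (simp add: inner_eq_sum sum_distrib_left sum.distrib algebra_simps)
  also have "\<dots> = \<beta> * (\<Sum>i\<in>UNIV. (\<integral>z. (dx \<phi> z * n z $ i + \<phi> z * nx z $ i) * ?C z $ i \<partial>lborel))
     + \<alpha> * (\<Sum>i\<in>UNIV. (\<integral>z. (dx \<phi> z * n z $ i + \<phi> z * nx z $ i) * W z $ i \<partial>lborel))
     - \<alpha> * (\<Sum>i\<in>UNIV. (\<integral>z. (\<phi> z * n z $ i) * ((norm (W z))\<^sup>2 * M z $ i) \<partial>lborel))"
    unfolding w by (simp only: sum.distrib sum_subtractf sum_distrib_left)
  also have "(\<Sum>i\<in>UNIV. (\<integral>z. (dx \<phi> z * n z $ i + \<phi> z * nx z $ i) * ?C z $ i \<partial>lborel)) = (\<integral>z. dx \<phi> z * (n z \<bullet> ?C z) + \<phi> z * (nx z \<bullet> ?C z) \<partial>lborel)"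
    unfolding su[OF i2] by (simp add: inner_eq_sum sum_distrib_left sum.distrib algebra_simps)
  also have "(\<Sum>i\<in>UNIV. (\<integral>z. (dx \<phi> z * n z $ i + \<phi> z * nx z $ i) * W z $ i \<partial>lborel)) = (\<integral>z. dx \<phi> z * (n z \<bullet> W z) + \<phi> z * (nx z \<bullet> W z) \<partial>lborel)"
    unfolding su[OF i3] by (simp add: inner_eq_sum sum_distrib_left sum.distrib algebra_simps)
  also have "(\<Sum>i\<in>UNIV. (\<integral>z. (\<phi> z * n z $ i) * ((norm (W z))\<^sup>2 * M z $ i) \<partial>lborel)) = (\<integral>z. \<phi> z * ((norm (W z))\<^sup>2 * (n z \<bullet> M z)) \<partial>lborel)"
    unfolding su[OF i4] by (simp add: inner_eq_sum sum_distrib_left algebra_simps)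
  finally show ?thesis .
qed

end

lemma lbdd_inverse_time: "lbdd (\<lambda>z::real\<times>real. 1 / (4 * snd z))"
  unfolding lbdd_def
proof (intro conjI allI impI)
  show "(\<lambda>z::real\<times>real. 1 / (4 * snd z)) \<in> borel_measurable borel"
    by (intro borel_measurable_divide borel_measurable_const borel_measurable_continuous_onI continuous_intros)
  fix s :: real assume s: "0 < s"
  have "norm (1 / (4 * snd (x :: real, t))) \<le> 1 / (4 * s)" if "s \<le> t" for x t
    using s that by (auto intro!: divide_left_mono)
  then show "\<exists>B. \<forall>x t. s \<le> t \<longrightarrow> norm (1 / (4 * snd (x :: real, t))) \<le> B" by blast
qed

text \<open>The linear bookkeeping of \<open>relative_energy\<close>, with each integral as a
  letter. The equation of n removes n_t, the weak derivative tested with \<open>F\<close> removes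
  F_x, and the one tested with n trades \<phi>_x (n . W) for derivatives on the cutoff. Keeping the
  integrals opaque leaves a problem of pure linear arithmetic.\<close>

lemma balance:
  fixes a b :: real
  assumes "X1 + X2 = b * (X3 + X4) + a * (X5 + X6) - a * X7" "X8 + X9 = - X10" "X11 + X12 = - X5"
    "X2 = X9 + a * X13" "X14 = - X11" "Y = X1"
    "I = X10 + X8 - a * X13 + b * (X3 + X4) + a * X6 + a * X14 - a * X12 - a * X7"
  shows "Y = I"
proof -
  have X5: "X5 = - X11 - X12" using assms(3) by linarith
  have "a * X5 = - (a * X11) - a * X12" "a * X14 = - (a * X11)" unfolding X5 assms(5) by (simp_all add: algebra_simps)
  then show ?thesis using assms(1,2,4,6,7) unfolding distrib_left by linarith
qed

context weak_strong begin

abbreviation "en z \<equiv> 1 - n z \<bullet> M z"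

lemma en_bounds: "0 \<le> en z" "en z \<le> 2" "(norm (n z - M z))\<^sup>2 = 2 * en z"
proof -
  show "0 \<le> en z" "en z \<le> 2" using Cauchy_Schwarz_ineq2[of "n z" "M z"] n_norm[of z] M_norm[of z] by auto
  have "(norm (n z - M z))\<^sup>2 = n z \<bullet> n z + M z \<bullet> M z - 2 * (n z \<bullet> M z)"
    by (simp add: power2_norm_eq_inner inner_diff_left inner_diff_right inner_commute)
  then show "(norm (n z - M z))\<^sup>2 = 2 * en z" using n_norm[of z] M_norm[of z] by (simp add: dot_square_norm)
qed

lemma lbdd_en: "lbdd en" by (intro lb)

lemma en_integrable:
  assumes "smooth1 UNIV \<psi>" "supp1 a b \<psi>"
  shows "integrable lborel (\<lambda>x. \<psi> x * en (x, t))"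
proof -
  have "(\<lambda>x. en (x, t)) \<in> borel_measurable borel" using lbdd_en by (intro measurable_slice) (simp add: lbdd_def)
  moreover have "norm (en (x, t)) \<le> 2" for x
    unfolding real_norm_def using en_bounds(1)[of "(x, t)"] en_bounds(2)[of "(x, t)"] by linarith
  ultimately have "integrable lborel (\<lambda>x. \<psi> x *\<^sub>R en (x, t))"
    by (intro integrable_compact_mult[OF smooth1_continuous[OF assms(1)] compact_Icc[of a b] supp1D[OF assms(2)]])
  then show ?thesis by simp
qed

text \<open>The function \<open>q\<close> stands for \<phi>_x^2 / \<phi>. Passing a majorant instead
  of the quotient avoids dividing where the cutoff vanishes. Both |n_x| and |W| are of order
  t^(-1/2), so the pointwise inequality leaves the coefficient 1 / (4 t).\<close>

lemma relative_energy:
  assumes \<phi>: "test_fun \<phi>" and pos: "\<And>z. 0 \<le> \<phi> z" and q: "\<And>z. 0 \<le> q z" "\<And>z. (dx \<phi> z)\<^sup>2 \<le> \<phi> z * q z"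
    and iq: "integrable lborel q"
  shows "- (\<integral>z. dt \<phi> z * en z \<partial>lborel) \<le>
    (\<integral>z. \<phi> z * en z * (1 / (4 * snd z)) + (2 * q z / \<alpha> + 2 * \<bar>dx (dx \<phi>) z\<bar>) \<partial>lborel)"
proof -
  note it = integrable_test_real test_fun_dx \<phi> lb
  let ?C = "\<lambda>z. cross3 (M z) (W z)"
  have d0: "integrable lborel (dt \<phi>)" "integrable lborel (dx (dx \<phi>))"
    using integrable_test_real[OF test_fun_dx(2)[OF \<phi>] lbdd_const[of 1]] integrable_test_real[OF test_fun_dx(1)[OF test_fun_dx(1)[OF \<phi>]] lbdd_const[of 1]] by simp_all
  have i1: "integrable lborel (\<lambda>z. dt \<phi> z * (n z \<bullet> M z))" by (intro it)
  have i2: "integrable lborel (\<lambda>z. \<phi> z * (nt z \<bullet> M z))" by (intro it)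
  have i3: "integrable lborel (\<lambda>z. dx \<phi> z * (n z \<bullet> ?C z))" by (intro it)
  have i4: "integrable lborel (\<lambda>z. \<phi> z * (nx z \<bullet> ?C z))" by (intro it)
  have i5: "integrable lborel (\<lambda>z. dx \<phi> z * (n z \<bullet> W z))" by (intro it)
  have i6: "integrable lborel (\<lambda>z. \<phi> z * (nx z \<bullet> W z))" by (intro it)
  have i7: "integrable lborel (\<lambda>z. \<phi> z * ((norm (W z))\<^sup>2 * (n z \<bullet> M z)))" by (intro it)
  have i8: "integrable lborel (\<lambda>z. dx \<phi> z * (F z \<bullet> M z))" by (intro it)
  have i9: "integrable lborel (\<lambda>z. \<phi> z * (Fx z \<bullet> M z))" by (intro it)
  have i10: "integrable lborel (\<lambda>z. \<phi> z * (F z \<bullet> W z))" by (intro it)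
  have i11: "integrable lborel (\<lambda>z. dx (dx \<phi>) z * (n z \<bullet> M z))" by (intro it)
  have i12: "integrable lborel (\<lambda>z. dx \<phi> z * (nx z \<bullet> M z))" by (intro it)
  have i13: "integrable lborel (\<lambda>z. \<phi> z * ((norm (nx z))\<^sup>2 * (n z \<bullet> M z)))" by (intro it)
  have i14: "integrable lborel (\<lambda>z. dx (dx \<phi>) z * en z)" by (intro it)
  have e1: "(\<integral>z. dt \<phi> z * (n z \<bullet> M z) \<partial>lborel) + (\<integral>z. \<phi> z * (nt z \<bullet> M z) \<partial>lborel) =
     \<beta> * ((\<integral>z. dx \<phi> z * (n z \<bullet> ?C z) \<partial>lborel) + (\<integral>z. \<phi> z * (nx z \<bullet> ?C z) \<partial>lborel))
     + \<alpha> * ((\<integral>z. dx \<phi> z * (n z \<bullet> W z) \<partial>lborel) + (\<integral>z. \<phi> z * (nx z \<bullet> W z) \<partial>lborel))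
     - \<alpha> * (\<integral>z. \<phi> z * ((norm (W z))\<^sup>2 * (n z \<bullet> M z)) \<partial>lborel)"
    using eqn_field[OF \<phi>] i1 i2 i3 i4 i5 i6 by (simp add: Bochner_Integration.integral_add)
  have e2: "(\<integral>z. dx \<phi> z * (F z \<bullet> M z) \<partial>lborel) + (\<integral>z. \<phi> z * (Fx z \<bullet> M z) \<partial>lborel) = - (\<integral>z. \<phi> z * (F z \<bullet> W z) \<partial>lborel)"
    using weak_field[OF \<phi> F_smooth dx_F lbdd_n(4,5)] i8 i9 by (simp add: Bochner_Integration.integral_add)
  have e3: "(\<integral>z. dx (dx \<phi>) z * (n z \<bullet> M z) \<partial>lborel) + (\<integral>z. dx \<phi> z * (nx z \<bullet> M z) \<partial>lborel) = - (\<integral>z. dx \<phi> z * (n z \<bullet> W z) \<partial>lborel)"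
    using weak_field[OF test_fun_dx(1)[OF \<phi>] n_smooth dx_n lbdd_n(1,2)] i11 i12 by (simp add: Bochner_Integration.integral_add)
  have e4: "(\<integral>z. \<phi> z * (nt z \<bullet> M z) \<partial>lborel) = (\<integral>z. \<phi> z * (Fx z \<bullet> M z) \<partial>lborel) + \<alpha> * (\<integral>z. \<phi> z * ((norm (nx z))\<^sup>2 * (n z \<bullet> M z)) \<partial>lborel)"
  proof -
    have "\<phi> z * (nt z \<bullet> M z) = \<phi> z * (Fx z \<bullet> M z) + \<alpha> * (\<phi> z * ((norm (nx z))\<^sup>2 * (n z \<bullet> M z)))" for z
      using pde[of z] test_fun_zero[OF \<phi>, of z] by (cases "0 < snd z") (simp_all add: inner_add_left algebra_simps)
    then have "(\<integral>z. \<phi> z * (nt z \<bullet> M z) \<partial>lborel) = (\<integral>z. \<phi> z * (Fx z \<bullet> M z) + \<alpha> * (\<phi> z * ((norm (nx z))\<^sup>2 * (n z \<bullet> M z))) \<partial>lborel)"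
      by (simp only:)
    also have "\<dots> = (\<integral>z. \<phi> z * (Fx z \<bullet> M z) \<partial>lborel) + (\<integral>z. \<alpha> * (\<phi> z * ((norm (nx z))\<^sup>2 * (n z \<bullet> M z))) \<partial>lborel)"
      by (rule Bochner_Integration.integral_add) (use i9 i13 in auto)
    finally show ?thesis by simp
  qed
  have e5: "(\<integral>z. dx (dx \<phi>) z * en z \<partial>lborel) = - (\<integral>z. dx (dx \<phi>) z * (n z \<bullet> M z) \<partial>lborel)"
    using d0(2) i11 integral_dt_zero(2)[OF test_fun_dx(1)[OF \<phi>]] by (simp add: right_diff_distrib)
  have e6: "- (\<integral>z. dt \<phi> z * en z \<partial>lborel) = (\<integral>z. dt \<phi> z * (n z \<bullet> M z) \<partial>lborel)"
    using d0(1) i1 integral_dt_zero(1)[OF \<phi>] by (simp add: right_diff_distrib)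
  let ?I = "\<lambda>z. \<phi> z * (F z \<bullet> W z) + dx \<phi> z * (F z \<bullet> M z) - \<alpha> * (\<phi> z * ((norm (nx z))\<^sup>2 * (n z \<bullet> M z)))
      + \<beta> * (dx \<phi> z * (n z \<bullet> ?C z) + \<phi> z * (nx z \<bullet> ?C z)) + \<alpha> * (\<phi> z * (nx z \<bullet> W z))
      + \<alpha> * (dx (dx \<phi>) z * en z) - \<alpha> * (dx \<phi> z * (nx z \<bullet> M z)) - \<alpha> * (\<phi> z * ((norm (W z))\<^sup>2 * (n z \<bullet> M z)))"
  have iI: "integrable lborel ?I"
    by (intro Bochner_Integration.integrable_add Bochner_Integration.integrable_diff integrable_mult_right i3 i4 i6 i7 i8 i10 i12 i13 i14)
  have "(\<integral>z. ?I z \<partial>lborel) = (\<integral>z. \<phi> z * (F z \<bullet> W z) \<partial>lborel) + (\<integral>z. dx \<phi> z * (F z \<bullet> M z) \<partial>lborel) - \<alpha> * (\<integral>z. \<phi> z * ((norm (nx z))\<^sup>2 * (n z \<bullet> M z)) \<partial>lborel)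
      + \<beta> * ((\<integral>z. dx \<phi> z * (n z \<bullet> ?C z) \<partial>lborel) + (\<integral>z. \<phi> z * (nx z \<bullet> ?C z) \<partial>lborel)) + \<alpha> * (\<integral>z. \<phi> z * (nx z \<bullet> W z) \<partial>lborel)
      + \<alpha> * (\<integral>z. dx (dx \<phi>) z * en z \<partial>lborel) - \<alpha> * (\<integral>z. dx \<phi> z * (nx z \<bullet> M z) \<partial>lborel) - \<alpha> * (\<integral>z. \<phi> z * ((norm (W z))\<^sup>2 * (n z \<bullet> M z)) \<partial>lborel)"
    using i3 i4 i6 i7 i8 i10 i12 i13 i14 by (simp only: Bochner_Integration.integral_add Bochner_Integration.integral_diff integral_mult_right_zero
      Bochner_Integration.integrable_add Bochner_Integration.integrable_diff integrable_mult_right)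
  note int_I = this
  have "- (\<integral>z. dt \<phi> z * en z \<partial>lborel) = (\<integral>z. ?I z \<partial>lborel)"
    by (rule balance[OF e1 e2 e3 e4 e5 e6 int_I])
  also have "\<dots> \<le> (\<integral>z. \<phi> z * en z * (1 / (4 * snd z)) + (2 * q z / \<alpha> + 2 * \<bar>dx (dx \<phi>) z\<bar>) \<partial>lborel)"
  proof (rule integral_mono[OF iI])
    have "integrable lborel (\<lambda>z. \<phi> z * (en z * (1 / (4 * snd z))))" by (intro integrable_test_real[OF \<phi>] lbdd_mult lbdd_en lbdd_inverse_time)
    then show "integrable lborel (\<lambda>z. \<phi> z * en z * (1 / (4 * snd z)) + (2 * q z / \<alpha> + 2 * \<bar>dx (dx \<phi>) z\<bar>))"
      using iq d0(2) by (simp add: mult.assoc)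
    fix z :: "real \<times> real"
    show "?I z \<le> \<phi> z * en z * (1 / (4 * snd z)) + (2 * q z / \<alpha> + 2 * \<bar>dx (dx \<phi>) z\<bar>)"
    proof (cases "0 < snd z")
      case True
      obtain x t where z: "z = (x, t)" and t: "0 < t" using True by (cases z) auto
      have "?I z \<le> \<phi> z * en z * ((norm (nx z))\<^sup>2 / \<alpha> + \<alpha> * ((norm (nx z))\<^sup>2 + (norm (W z))\<^sup>2)) + (2 * q z / \<alpha> + 2 * \<bar>dx (dx \<phi>) z\<bar>)"
        unfolding F_eq[OF True]
        by (rule relative_energy_pointwise[OF \<alpha> \<beta>01(1,2) n_norm M_norm n_orth[OF True] pos q])
      also have "\<dots> \<le> \<phi> z * en z * (1 / (4 * snd z)) + (2 * q z / \<alpha> + 2 * \<bar>dx (dx \<phi>) z\<bar>)"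
      proof (intro add_right_mono mult_left_mono mult_nonneg_nonneg pos en_bounds(1))
        have b: "(norm (nx z))\<^sup>2 \<le> c\<^sup>2 / t" "(norm (W z))\<^sup>2 \<le> \<epsilon>\<^sup>2 / t"
          using power_mono[OF nx_bound[OF t, of x] norm_ge_zero, of 2] power_mono[OF W_bound[OF t, of x] norm_ge_zero, of 2] t
          by (simp_all add: z power_divide)
        have "(norm (nx z))\<^sup>2 / \<alpha> + \<alpha> * ((norm (nx z))\<^sup>2 + (norm (W z))\<^sup>2) \<le> (c\<^sup>2 / t) / \<alpha> + \<alpha> * (c\<^sup>2 / t + \<epsilon>\<^sup>2 / t)"
          using b \<alpha> by (intro add_mono divide_right_mono mult_left_mono) auto
        also have "\<dots> = (c\<^sup>2 / \<alpha> + \<alpha> * (c\<^sup>2 + \<epsilon>\<^sup>2)) / t" using t \<alpha> by (simp add: field_simps)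
        also have "\<dots> \<le> (1 / 4) / t" using c_small t by (intro divide_right_mono) auto
        finally show "(norm (nx z))\<^sup>2 / \<alpha> + \<alpha> * ((norm (nx z))\<^sup>2 + (norm (W z))\<^sup>2) \<le> 1 / (4 * snd z)" by (simp add: z)
      qed
      finally show ?thesis .
    next
      case False
      have "\<phi> z = 0" "dx \<phi> z = 0" "dx (dx \<phi>) z = 0"
        using test_fun_zero[OF _ False] \<phi> test_fun_dx(1) by blast+
      then show ?thesis using q(1)[of z] \<alpha> by simp
    qed
  qed
  finally show ?thesis .
qed

text \<open>The time cutoff is multiplied by t^(-1/4): differentiating that weight produces - 1 / (4
  t), which cancels the growth term exactly, and only the errors of the spatial cutoff remain. Two
  derivatives of a cutoff of width R over a support of length 4 R leave 1 / R.\<close>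

lemma energy_bound:
  obtains K where "\<And>R::nat. 0 < R \<Longrightarrow>
    AE t in lborel. 0 < t \<and> t < T \<longrightarrow> (\<integral>x. cutoff_at (1 / real R) 0 x * en (x, t) \<partial>lborel) \<le> t powr (1 / 4) * (K / real R)"
proof (cases "0 < T")
  case False
  then show ?thesis using that[of 0] by auto
next
  case T: True
  obtain K0 where K0: "0 < K0" "\<And>x. (deriv cutoff x)\<^sup>2 \<le> K0 * cutoff x" "\<And>x. \<bar>deriv cutoff x\<bar> \<le> K0" "\<And>x. \<bar>deriv (deriv cutoff) x\<bar> \<le> K0"
    using cutoff_bounds by metis
  \<comment> \<open>The factor 2 / \<alpha> + 2 comes from the two cutoff errors of
    \<open>relative_energy\<close>, 4 from the length 4 R of the support, and the last factor is the
    integral of t^(-1/4) over (0, T).\<close>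
  define K where "K = K0 * (2 / \<alpha> + 2) * 4 * (T powr (3 / 4) / (3 / 4))"
  have "AE t in lborel. 0 < t \<and> t < T \<longrightarrow> (\<integral>x. cutoff_at (1 / real R) 0 x * en (x, t) \<partial>lborel) \<le> t powr (1 / 4) * (K / real R)"
    if R: "0 < R" for R :: nat
  proof -
    have R': "0 < real R" and k: "0 < 1 / real R" using R by auto
    let ?\<psi> = "cutoff_at (1 / real R) 0"
    note cc = cutoff_at[OF k, of 0]
    have supp: "supp1 (- (2 * R)) (2 * R) ?\<psi>" using cc(2) by simp
    have d1: "deriv ?\<psi> x = deriv cutoff (- (1 / real R * 0) + 1 / real R * x) * (1 / real R)" for x
      unfolding cutoff_at_def[abs_def] by (rule deriv_affine[OF smooth1_cutoff])
    have d2: "deriv (deriv ?\<psi>) x = deriv (deriv cutoff) (- (1 / real R * 0) + 1 / real R * x) * (1 / real R) * (1 / real R)" for x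
    proof -
      have "deriv (deriv ?\<psi>) x = deriv (\<lambda>x. deriv cutoff (- (1 / real R * 0) + 1 / real R * x) * (1 / real R)) x" unfolding d1[abs_def] ..
      also have "\<dots> = deriv (deriv cutoff) (- (1 / real R * 0) + 1 / real R * x) * (1 / real R) * (1 / real R)"
      proof (rule DERIV_imp_deriv)
        have sd: "smooth1 UNIV (\<lambda>x. deriv cutoff (- (1 / real R * 0) + 1 / real R * x))" by (rule smooth1_affine[OF smooth1D(2)[OF smooth1_cutoff]])
        have "((\<lambda>x. deriv cutoff (- (1 / real R * 0) + 1 / real R * x)) has_real_derivative
            deriv (deriv cutoff) (- (1 / real R * 0) + 1 / real R * x) * (1 / real R)) (at x)"
          using smooth1D(1)[OF sd UNIV_I, of x] unfolding deriv_affine[OF smooth1D(2)[OF smooth1_cutoff]] .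
        from DERIV_cmult_right[OF this, of "1 / real R"]
        show "((\<lambda>x. deriv cutoff (- (1 / real R * 0) + 1 / real R * x) * (1 / real R)) has_real_derivative
            deriv (deriv cutoff) (- (1 / real R * 0) + 1 / real R * x) * (1 / real R) * (1 / real R)) (at x)" .
      qed
      finally show ?thesis .
    qed
    let ?I = "indicator {- (2 * real R)..2 * real R} :: real \<Rightarrow> real"
    have b1: "(deriv ?\<psi> x)\<^sup>2 \<le> ?\<psi> x * (K0 / (real R)\<^sup>2 * ?I x)" for x
    proof (cases "x \<in> {- (2 * real R)..2 * real R}")
      case True
      then show ?thesis unfolding d1 using K0(2)[of "- (1 / real R * 0) + 1 / real R * x"] R'
        by (simp add: cutoff_at_def power_mult_distrib power_divide divide_right_mono mult.commute)
    next
      case False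
      then show ?thesis using supp1D[OF supp1_deriv[OF cc(1) supp], of x] by simp
    qed
    have b2: "\<bar>deriv (deriv ?\<psi>) x\<bar> \<le> K0 / (real R)\<^sup>2 * ?I x" for x
    proof (cases "x \<in> {- (2 * real R)..2 * real R}")
      case True
      then show ?thesis unfolding d2 using K0(4)[of "- (1 / real R * 0) + 1 / real R * x"] R'
        by (simp add: abs_mult power2_eq_square divide_right_mono)
    next
      case False
      then show ?thesis using supp1D[OF supp1_deriv[OF smooth1D(2)[OF cc(1)] supp1_deriv[OF cc(1) supp]], of x] by simp
    qed
    let ?E = "\<lambda>t. (\<integral>x. ?\<psi> x * en (x, t) \<partial>lborel)"
    have Em: "?E \<in> borel_measurable borel"
    proof -
      have "(\<lambda>z. ?\<psi> (fst z)) \<in> borel_measurable (borel :: (real \<times> real) measure)"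
        by (intro borel_measurable_continuous_onI continuous_on_compose2[OF smooth1_continuous[OF cc(1)]] continuous_intros) auto
      moreover have "en \<in> borel_measurable borel" using lbdd_en by (simp add: lbdd_def)
      ultimately have "(\<lambda>z. ?\<psi> (fst z) * en z) \<in> borel_measurable borel" by (rule borel_measurable_times)
      from measurable_integral_slice[OF this] show ?thesis by simp
    qed
    have ie: "integrable lborel (\<lambda>x. ?\<psi> x * en (x, t))" for t by (rule en_integrable[OF cc(1) supp])
    have E0: "0 \<le> ?E t" for t by (intro Bochner_Integration.integral_nonneg mult_nonneg_nonneg cc(3) en_bounds)
    have E1: "?E t \<le> 2 * (cutoff_int * real R)" for t
    proof -
      have "?E t \<le> (\<integral>x. ?\<psi> x * 2 \<partial>lborel)"
        by (rule integral_mono[OF ie]) (use integrable_smooth1(1)[OF cc(1,2)] cc(3) en_bounds(2) in \<open>auto intro!: mult_left_mono\<close>)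
      then show ?thesis by (simp add: cc(5))
    qed
    \<comment> \<open>The weighted energy tends to 0 at t = 0, as a quantity of order sqrt t times
      t^(-1/4). So the initial value in \<open>time_lemma\<close> is 0.\<close>
    let ?e = "\<lambda>t. t powr (- 1 / 4) * ?E t"
    have "AE t in lborel. 0 < t \<and> t < T \<longrightarrow> ?e t \<le> 0 + K / real R"
    proof (rule time_lemma)
      show "?e \<in> borel_measurable borel" using Em by measurable
      show "\<exists>B. \<forall>t. s \<le> t \<and> t < T \<longrightarrow> \<bar>?e t\<bar> \<le> B" if s: "0 < s" for s
      proof (intro exI allI impI)
        fix t assume t: "s \<le> t \<and> t < T"
        have "t powr (- 1 / 4) \<le> s powr (- 1 / 4)" using s t by (intro powr_mono2') auto
        then show "\<bar>?e t\<bar> \<le> s powr (- 1 / 4) * (2 * (cutoff_int * real R))"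
          using E0[of t] E1[of t] by (auto simp: abs_mult intro!: mult_mono)
      qed
    next
      fix \<delta> :: real assume \<delta>: "0 < \<delta>"
      define C where "C = Kn + 32 * \<epsilon> * (cutoff_var + 1)"
      \<comment> \<open>The fourth power inverts the bound (|C| + 1) t^(1/4) for the weighted
        energy; the added 1 covers the case C = 0.\<close>
      define s0 where "s0 = (\<delta> / (\<bar>C\<bar> + 1)) ^ 4"
      have s0: "0 < s0" using \<delta> by (simp add: s0_def)
      have "AE t in lborel. 0 < t \<and> t < s0 \<longrightarrow> ?e t \<le> 0 + \<delta>"
        using rate
      proof eventually_elim
        case (elim t)
        show ?case
        proof
          assume t: "0 < t \<and> t < s0"
          have ii: "integrable lborel (\<lambda>x. ?\<psi> x * (norm (step_data Ap Am x - u (x, t)))\<^sup>2)" if "u \<in> borel_measurable borel" "\<And>z. norm (u z) = 1" for u :: "real \<times> real \<Rightarrow> real^3"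
          proof -
            have "(\<lambda>x. (norm (step_data Ap Am x - u (x, t)))\<^sup>2) \<in> borel_measurable borel"
              using measurable_slice[OF that(1), of t] step_data_meas by measurable
            moreover have "norm ((norm (step_data Ap Am x - u (x, t)))\<^sup>2) \<le> 2\<^sup>2" for x
              using norm_triangle_ineq4[of "step_data Ap Am x" "u (x, t)"] step_data_norm[of x] that(2)[of "(x, t)"]
              unfolding real_norm_def abs_power2 by (intro power_mono) auto
            ultimately show ?thesis
              using integrable_compact_mult[OF smooth1_continuous[OF cc(1)] compact_Icc[of "- (2 * real R)" "2 * real R"],
                  where e="\<lambda>x. (norm (step_data Ap Am x - u (x, t)))\<^sup>2" and B="2\<^sup>2"] supp1D[OF supp] by simp
          qed
          have i_n: "integrable lborel (\<lambda>x. ?\<psi> x * (norm (step_data Ap Am x - n (x, t)))\<^sup>2)"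
          proof (rule ii[OF _ n_norm])
            show "n \<in> borel_measurable borel" using lbdd_n(1) by (simp add: lbdd_def)
          qed
          have i_M: "integrable lborel (\<lambda>x. ?\<psi> x * (norm (step_data Ap Am x - M (x, t)))\<^sup>2)" by (rule ii[OF M_meas M_norm])
          have "?E t \<le> (\<integral>x. ?\<psi> x * (norm (step_data Ap Am x - n (x, t)))\<^sup>2 + ?\<psi> x * (norm (step_data Ap Am x - M (x, t)))\<^sup>2 \<partial>lborel)"
          proof (rule integral_mono[OF ie])
            show "integrable lborel (\<lambda>x. ?\<psi> x * (norm (step_data Ap Am x - n (x, t)))\<^sup>2 + ?\<psi> x * (norm (step_data Ap Am x - M (x, t)))\<^sup>2)"
              using i_n i_M by (rule Bochner_Integration.integrable_add)
            fix x
            have par: "(norm (a - b))\<^sup>2 \<le> 2 * (norm (m - a))\<^sup>2 + 2 * (norm (m - b))\<^sup>2" for a b m :: "real^3"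
            proof -
              have "norm (a - b) \<le> norm (m - a) + norm (m - b)" using norm_triangle_ineq4[of "m - b" "m - a"] by simp
              then have "(norm (a - b))\<^sup>2 \<le> (norm (m - a) + norm (m - b))\<^sup>2" by (intro power_mono) auto
              also have "\<dots> \<le> 2 * (norm (m - a))\<^sup>2 + 2 * (norm (m - b))\<^sup>2"
                using zero_le_power2[of "norm (m - a) - norm (m - b)"] by (simp add: power2_eq_square algebra_simps)
              finally show ?thesis .
            qed
            have "en (x, t) \<le> (norm (step_data Ap Am x - n (x, t)))\<^sup>2 + (norm (step_data Ap Am x - M (x, t)))\<^sup>2"
            proof -
              have half: "2 * a \<le> 2 * b + 2 * d \<Longrightarrow> a \<le> b + d" for a b d :: real by linarith
              show ?thesis by (rule half) (use par[of "n (x, t)" "M (x, t)" "step_data Ap Am x"] in \<open>simp only: en_bounds(3)\<close>)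
            qed
            from mult_left_mono[OF this cc(3)[of x]]
            show "?\<psi> x * en (x, t) \<le> ?\<psi> x * (norm (step_data Ap Am x - n (x, t)))\<^sup>2 + ?\<psi> x * (norm (step_data Ap Am x - M (x, t)))\<^sup>2"
              by (simp add: distrib_left)
          qed
          also have "\<dots> = (\<integral>x. ?\<psi> x * (norm (step_data Ap Am x - n (x, t)))\<^sup>2 \<partial>lborel) + (\<integral>x. ?\<psi> x * (norm (step_data Ap Am x - M (x, t)))\<^sup>2 \<partial>lborel)"
            by (rule Bochner_Integration.integral_add[OF i_n i_M])
          also have "\<dots> \<le> Kn * sqrt t + 32 * \<epsilon> * (cutoff_var + 1) * sqrt t"
            using n_rate[of t "real R"] elim t R by (intro add_mono) auto
          also have "\<dots> = C * sqrt t" by (simp add: C_def algebra_simps)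
          also have "\<dots> \<le> (\<bar>C\<bar> + 1) * sqrt t" using t by (intro mult_right_mono) auto
          finally have "?e t \<le> t powr (- 1 / 4) * ((\<bar>C\<bar> + 1) * t powr (1 / 2))" using t by (intro mult_left_mono) (auto simp: powr_half_sqrt)
          also have "\<dots> = (\<bar>C\<bar> + 1) * t powr (1 / 4)" using t by (simp add: powr_add[symmetric] mult.left_commute)
          also have "\<dots> \<le> (\<bar>C\<bar> + 1) * s0 powr (1 / 4)" using t by (intro mult_left_mono powr_mono2) auto
          also have "s0 powr (1 / 4) = \<delta> / (\<bar>C\<bar> + 1)"
          proof -
            have "s0 = (\<delta> / (\<bar>C\<bar> + 1)) powr 4" using \<delta> by (simp add: s0_def powr_numeral)
            then have "s0 powr (1 / 4) = (\<delta> / (\<bar>C\<bar> + 1)) powr (4 * (1 / 4))" by (simp only: powr_powr)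
            then show ?thesis using \<delta> by simp
          qed
          finally show "?e t \<le> 0 + \<delta>" by simp
        qed
      qed
      then show "\<exists>s0>0. AE s in lborel. 0 < s \<and> s < s0 \<longrightarrow> ?e s \<le> 0 + \<delta>" using s0 by blast
    next
      fix \<eta> :: "real \<Rightarrow> real" and N c' d
      assume \<eta>: "smooth1 UNIV \<eta>" "\<And>t. 0 \<le> \<eta> t" "\<And>t. \<eta> t \<le> N" "supp1 c' d \<eta>" "0 < c'" "c' \<le> d" "d < T"
      \<comment> \<open>The weight belongs to the test function and not to the solution, so no
        differentiability in time of the energy is ever needed.\<close>
      define \<zeta> where "\<zeta> t = t powr (- 1 / 4) * \<eta> t" for t
      have s\<zeta>: "smooth1 UNIV \<zeta>"
      proof (rule smooth1_extend[OF _ \<eta>(5)])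
        show "smooth1 {0<..} \<zeta>" unfolding \<zeta>_def[abs_def]
          by (intro smooth1_intros open_greaterThan smooth1_powr smooth1_subset[OF subset_UNIV \<eta>(1)])
        show "\<zeta> t = 0" if "t < c'" for t using supp1D[OF \<eta>(4), of t] that by (simp add: \<zeta>_def)
      qed
      have supp\<zeta>: "supp1 c' d \<zeta>" using \<eta>(4) by (auto simp: supp1_def \<zeta>_def)
      have \<zeta>0: "0 \<le> \<zeta> t" for t using \<eta>(2) by (simp add: \<zeta>_def)
      have d\<zeta>: "deriv \<zeta> t + \<zeta> t * (1 / (4 * t)) = t powr (- 1 / 4) * deriv \<eta> t" for t
      proof (cases "t \<in> {c'..d}")
        case True
        then have t: "0 < t" using \<eta>(5) by auto
        have "((\<lambda>t. t powr (- 1 / 4)) has_real_derivative (- 1 / 4) * t powr (- 1 / 4 - 1)) (at t)"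
          using has_real_derivative_powr[OF t, of "- 1 / 4"] .
        from DERIV_mult[OF this smooth1D(1)[OF \<eta>(1) UNIV_I]]
        have "deriv \<zeta> t = (- 1 / 4) * t powr (- 1 / 4 - 1) * \<eta> t + deriv \<eta> t * t powr (- 1 / 4)"
          unfolding \<zeta>_def[abs_def] by (rule DERIV_imp_deriv)
        moreover have pw: "t powr (- 1 / 4 - 1) = t powr (- 1 / 4) / t" using powr_diff[of t "- 1 / 4" 1] t by simp
        ultimately have eq: "deriv \<zeta> t = (- 1 / 4) * (t powr (- 1 / 4) / t) * \<eta> t + deriv \<eta> t * t powr (- 1 / 4)" by (simp only: pw)
        have alg: "(- 1 / 4) * (P / t) * e + d * P + P * e * (1 / (4 * t)) = P * d" for P e d :: real
          using t by (simp add: field_simps)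
        show ?thesis unfolding eq unfolding \<zeta>_def by (rule alg)
      next
        case False
        then show ?thesis
          using supp1D[OF supp\<zeta>] supp1D[OF supp1_deriv[OF s\<zeta> supp\<zeta>]] supp1D[OF supp1_deriv[OF \<eta>(1,4)]] by simp
      qed
      let ?\<phi> = "\<lambda>(x, t). ?\<psi> x * \<zeta> t"
      note p = test_fun_product'[OF cc(1) supp s\<zeta> \<eta>(5) supp\<zeta>]
      have dxx: "dx (dx ?\<phi>) = (\<lambda>(x, t). deriv (deriv ?\<psi>) x * \<zeta> t)"
        unfolding p(2) by (rule test_fun_product'(2)[OF smooth1D(2)[OF cc(1)] supp1_deriv[OF cc(1) supp] s\<zeta> \<eta>(5) supp\<zeta>])
      \<comment> \<open>One function dominates both errors: multiplied by the cutoff it bounds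
        \<phi>_x^2, and by itself it bounds |\<phi>_xx|.\<close>
      let ?q = "\<lambda>z. (K0 / (real R)\<^sup>2 * ?I (fst z)) * \<zeta> (snd z)"
      have i\<zeta>: "integrable lborel \<zeta>" by (rule integrable_smooth1(1)[OF s\<zeta> supp\<zeta>])
      have iI: "integrable lborel (\<lambda>x. K0 / (real R)\<^sup>2 * ?I x)" by simp
      have iq: "integrable lborel ?q" by (rule integrable_product(1)[OF iI i\<zeta>])
      have N0: "0 \<le> N" using \<eta>(2)[of 0] \<eta>(3)[of 0] by linarith
      have int\<zeta>: "(\<integral>t. \<zeta> t \<partial>lborel) \<le> N * (T powr (3 / 4) / (3 / 4))"
      proof -
        have "(\<integral>t. \<zeta> t \<partial>lborel) \<le> (\<integral>t. N * (indicator {0<..<T} t * t powr (- 1 / 4)) \<partial>lborel)"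
        proof (rule integral_mono[OF i\<zeta>])
          show "integrable lborel (\<lambda>t. N * (indicator {0<..<T} t * t powr (- 1 / 4)))"
            using integral_powr(1)[of "- 1 / 4" T] T by simp
          show "\<zeta> t \<le> N * (indicator {0<..<T} t * t powr (- 1 / 4))" for t
          proof (cases "t \<in> {c'..d}")
            case True
            then have "t \<in> {0<..<T}" using \<eta>(5,7) by auto
            then show ?thesis using mult_right_mono[OF \<eta>(3)[of t], of "t powr (- 1 / 4)"] by (simp add: \<zeta>_def mult.commute)
          next
            case False
            then show ?thesis using supp1D[OF supp\<zeta> False] N0 by simp
          qed
        qed
        also have "\<dots> = N * (T powr (3 / 4) / (3 / 4))" using integral_powr(2)[of "- 1 / 4" T] T by simp
        finally show ?thesis .
      qed
      have i1: "integrable lborel (\<lambda>z. dt ?\<phi> z * en z)" by (intro integrable_test_real test_fun_dx p lbdd_en)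
      have i2: "integrable lborel (\<lambda>z. ?\<phi> z * (en z * (1 / (4 * snd z))))" by (intro integrable_test_real p lbdd_mult lbdd_en lbdd_inverse_time)
      have i3: "integrable lborel (\<lambda>z. 2 * ?q z / \<alpha> + 2 * \<bar>dx (dx ?\<phi>) z\<bar>)"
      proof (intro Bochner_Integration.integrable_add)
        show "integrable lborel (\<lambda>z. 2 * ?q z / \<alpha>)" by (rule integrable_divide[OF integrable_mult_right[OF iq]])
        have "integrable lborel (dx (dx ?\<phi>))"
          using integrable_test_real[OF test_fun_dx(1)[OF test_fun_dx(1)[OF p(1)]] lbdd_const[of 1]] by simp
        then show "integrable lborel (\<lambda>z. 2 * \<bar>dx (dx ?\<phi>) z\<bar>)" by (rule integrable_mult_right[OF integrable_abs])
      qed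
      have split: "(\<integral>z. dt ?\<phi> z * en z \<partial>lborel) + (\<integral>z. ?\<phi> z * (en z * (1 / (4 * snd z))) \<partial>lborel) = (\<integral>t. deriv \<eta> t * ?e t \<partial>lborel)"
      proof -
        have "(\<integral>z. dt ?\<phi> z * en z \<partial>lborel) + (\<integral>z. ?\<phi> z * (en z * (1 / (4 * snd z))) \<partial>lborel)
          = (\<integral>z. dt ?\<phi> z * en z + ?\<phi> z * (en z * (1 / (4 * snd z))) \<partial>lborel)"
          by (rule Bochner_Integration.integral_add[OF i1 i2, symmetric])
        also have "\<dots> = (\<integral>t. (\<integral>x. dt ?\<phi> (x, t) * en (x, t) + ?\<phi> (x, t) * (en (x, t) * (1 / (4 * snd (x, t)))) \<partial>lborel) \<partial>lborel)"
          by (rule fubini_time(1)[OF Bochner_Integration.integrable_add[OF i1 i2]])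
        also have "\<dots> = (\<integral>t. deriv \<eta> t * ?e t \<partial>lborel)"
        proof (rule Bochner_Integration.integral_cong[OF refl])
          fix t
          have eq: "dt ?\<phi> (x, t) * en (x, t) + ?\<phi> (x, t) * (en (x, t) * (1 / (4 * snd (x, t)))) = (t powr (- 1 / 4) * deriv \<eta> t) * (?\<psi> x * en (x, t))" for x
            unfolding p(3) d\<zeta>[symmetric] by (simp add: algebra_simps)
          show "(\<integral>x. dt ?\<phi> (x, t) * en (x, t) + ?\<phi> (x, t) * (en (x, t) * (1 / (4 * snd (x, t)))) \<partial>lborel) = deriv \<eta> t * ?e t"
            unfolding eq integral_mult_right_zero by (simp only: mult_ac)
        qed
        finally show ?thesis .
      qed
      have "- (\<integral>z. dt ?\<phi> z * en z \<partial>lborel) \<le> (\<integral>z. ?\<phi> z * en z * (1 / (4 * snd z)) + (2 * ?q z / \<alpha> + 2 * \<bar>dx (dx ?\<phi>) z\<bar>) \<partial>lborel)"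
      proof (rule relative_energy[OF p(1) _ _ _ iq])
        fix z :: "real \<times> real"
        show "0 \<le> ?\<phi> z" "0 \<le> ?q z" using cc(3) \<zeta>0 K0(1) by (cases z; simp)+
        show "(dx ?\<phi> z)\<^sup>2 \<le> ?\<phi> z * ?q z"
        proof (cases z)
          case (Pair x t)
          have "(deriv ?\<psi> x)\<^sup>2 * (\<zeta> t)\<^sup>2 \<le> (?\<psi> x * (K0 / (real R)\<^sup>2 * ?I x)) * (\<zeta> t)\<^sup>2" by (intro mult_right_mono b1) simp
          then show ?thesis unfolding Pair p(2) by (simp add: power_mult_distrib power2_eq_square mult_ac)
        qed
      qed
      also have "\<dots> = (\<integral>z. ?\<phi> z * (en z * (1 / (4 * snd z))) \<partial>lborel) + (\<integral>z. 2 * ?q z / \<alpha> + 2 * \<bar>dx (dx ?\<phi>) z\<bar> \<partial>lborel)"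
        unfolding mult.assoc[of "?\<phi> _"] by (rule Bochner_Integration.integral_add[OF i2 i3])
      finally have "- (\<integral>t. deriv \<eta> t * ?e t \<partial>lborel) \<le> (\<integral>z. 2 * ?q z / \<alpha> + 2 * \<bar>dx (dx ?\<phi>) z\<bar> \<partial>lborel)"
        using split by linarith
      also have "\<dots> \<le> (\<integral>z. (2 / \<alpha> + 2) * ?q z \<partial>lborel)"
      proof (rule integral_mono[OF i3])
        show "integrable lborel (\<lambda>z. (2 / \<alpha> + 2) * ?q z)" by (rule integrable_mult_right[OF iq])
        fix z :: "real \<times> real"
        obtain x t where z: "z = (x, t)" by (cases z)
        have g: "2 * y / \<alpha> + 2 * x \<le> (2 / \<alpha> + 2) * y" if "x \<le> y" for x y :: real
          using that by (simp add: distrib_right)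
        have "\<bar>dx (dx ?\<phi>) z\<bar> \<le> ?q z"
          using mult_right_mono[OF b2[of x] \<zeta>0[of t]] \<zeta>0[of t] unfolding z dxx by (simp add: abs_mult)
        then show "2 * ?q z / \<alpha> + 2 * \<bar>dx (dx ?\<phi>) z\<bar> \<le> (2 / \<alpha> + 2) * ?q z" by (rule g)
      qed
      also have "\<dots> = (2 / \<alpha> + 2) * ((\<integral>x. K0 / (real R)\<^sup>2 * ?I x \<partial>lborel) * (\<integral>t. \<zeta> t \<partial>lborel))"
        by (simp only: integral_mult_right_zero integrable_product(2)[OF iI i\<zeta>])
      also have "(\<integral>x. K0 / (real R)\<^sup>2 * ?I x \<partial>lborel) = K0 / (real R)\<^sup>2 * (4 * real R)" by simp
      also have "(2 / \<alpha> + 2) * (K0 / (real R)\<^sup>2 * (4 * real R) * (\<integral>t. \<zeta> t \<partial>lborel))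
        \<le> (2 / \<alpha> + 2) * (K0 / (real R)\<^sup>2 * (4 * real R) * (N * (T powr (3 / 4) / (3 / 4))))"
        using \<alpha> K0(1) by (intro mult_left_mono int\<zeta>) auto
      also have "\<dots> = N * (K / real R)" using R' by (simp add: K_def power2_eq_square field_simps)
      finally show "- (\<integral>t. deriv \<eta> t * ?e t \<partial>lborel) \<le> N * (K / real R)" .
    qed
    then show ?thesis
    proof eventually_elim
      case (elim t)
      show ?case
      proof
        assume t: "0 < t \<and> t < T"
        then have "t powr (1 / 4) * (t powr (- 1 / 4) * ?E t) \<le> t powr (1 / 4) * (K / real R)" using elim by (intro mult_left_mono) auto
        moreover have "t powr (1 / 4) * t powr (- 1 / 4) = 1" using t by (simp add: powr_add[symmetric])
        ultimately show "?E t \<le> t powr (1 / 4) * (K / real R)" by (simp add: mult.assoc[symmetric])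
      qed
    qed
  qed
  then show ?thesis using that by blast
qed

text \<open>The localised energies increase with the cutoff scale while their bound tends to 0 like
  1 / R, so all of them vanish. As the density is nonnegative and equals half of |n - M|^2, the maps
  agree on almost every time slice, and then almost everywhere by Fubini.\<close>

lemma weak_strong_uniqueness: "AE z in lborel. 0 < snd z \<longrightarrow> M z = n z"
proof -
  have slice: "AE t in lborel. 0 < t \<and> t < T \<longrightarrow> (AE x in lborel. en (x, t) = 0)" for T
  proof -
    have "\<exists>K. \<forall>R::nat. 0 < R \<longrightarrow>
      (AE t in lborel. 0 < t \<and> t < T \<longrightarrow> (\<integral>x. cutoff_at (1 / real R) 0 x * en (x, t) \<partial>lborel) \<le> t powr (1 / 4) * (K / real R))"
    proof (rule energy_bound[of T])
      fix K assume "\<And>R::nat. 0 < R \<Longrightarrow>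
        AE t in lborel. 0 < t \<and> t < T \<longrightarrow> (\<integral>x. cutoff_at (1 / real R) 0 x * en (x, t) \<partial>lborel) \<le> t powr (1 / 4) * (K / real R)"
      then show ?thesis by (intro exI[of _ K]) simp
    qed
    then obtain K where K: "\<forall>R::nat. 0 < R \<longrightarrow>
      (AE t in lborel. 0 < t \<and> t < T \<longrightarrow> (\<integral>x. cutoff_at (1 / real R) 0 x * en (x, t) \<partial>lborel) \<le> t powr (1 / 4) * (K / real R))" ..
    have "AE t in lborel. \<forall>R::nat. 0 < R \<longrightarrow> 0 < t \<and> t < T \<longrightarrow> (\<integral>x. cutoff_at (1 / real R) 0 x * en (x, t) \<partial>lborel) \<le> t powr (1 / 4) * (K / real R)"
      unfolding AE_all_countable
    proof
      fix R :: nat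
      show "AE t in lborel. 0 < R \<longrightarrow> 0 < t \<and> t < T \<longrightarrow> (\<integral>x. cutoff_at (1 / real R) 0 x * en (x, t) \<partial>lborel) \<le> t powr (1 / 4) * (K / real R)"
        using K by (cases "0 < R") simp_all
    qed
    then show ?thesis
    proof eventually_elim
      case (elim t)
      show ?case
      proof
        assume t: "0 < t \<and> t < T"
        let ?E = "\<lambda>R::nat. (\<integral>x. cutoff_at (1 / real R) 0 x * en (x, t) \<partial>lborel)"
        have ie: "integrable lborel (\<lambda>x. cutoff_at (1 / real R) 0 x * en (x, t))" if R: "0 < R" for R :: nat
        proof -
          have k: "0 < 1 / real R" using R by simp
          show ?thesis by (rule en_integrable[OF cutoff_at(1,2)[OF k, of 0]])
        qed
        have nn: "0 \<le> cutoff_at (1 / real R) 0 x * en (x, t)" for R x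
          by (intro mult_nonneg_nonneg en_bounds) (simp add: cutoff_at_def cutoff_simps)
        have zero: "?E R = 0" if R: "0 < R" for R
        proof (rule antisym)
          show "0 \<le> ?E R" by (intro Bochner_Integration.integral_nonneg nn)
          \<comment> \<open>For k >= 2 R the wider cutoff is 1 on the whole support of the narrower
            one, so it dominates it without any monotonicity of the profile.\<close>
          have "?E R \<le> t powr (1 / 4) * (K / real k)" if k: "2 * R \<le> k" for k
          proof -
            have k0: "0 < k" using k R by simp
            have "?E R \<le> ?E k"
            proof (rule integral_mono[OF ie[OF R] ie[OF k0]])
              fix x
              have "cutoff_at (1 / real R) 0 x \<le> cutoff_at (1 / real k) 0 x"
              proof (cases "\<bar>x\<bar> \<le> 2 * real R")
                case True
                then have "\<bar>x\<bar> \<le> real k" using k by linarith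
                then have "cutoff_at (1 / real k) 0 x = 1" using k0 by (simp add: cutoff_at_def cutoff_simps)
                then show ?thesis by (simp add: cutoff_at_def cutoff_simps)
              next
                case False
                then have "1 / real R * x \<notin> {-2..2}" using R by (auto simp: field_simps abs_le_iff)
                then have "cutoff_at (1 / real R) 0 x = 0" by (simp add: cutoff_at_def cutoff_simps)
                then show ?thesis by (simp add: cutoff_at_def cutoff_simps)
              qed
              then show "cutoff_at (1 / real R) 0 x * en (x, t) \<le> cutoff_at (1 / real k) 0 x * en (x, t)"
                using en_bounds(1) by (intro mult_right_mono) auto
            qed
            also have "\<dots> \<le> t powr (1 / 4) * (K / real k)" using elim k0 t by blast
            finally show ?thesis .
          qed
          moreover have "(\<lambda>k. t powr (1 / 4) * (K / real k)) \<longlonglongrightarrow> t powr (1 / 4) * 0"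
            by (intro tendsto_mult tendsto_const lim_const_over_n)
          ultimately show "?E R \<le> 0" by (intro LIMSEQ_le_const[of "\<lambda>k. t powr (1 / 4) * (K / real k)"]) auto
        qed
        have "AE x in lborel. \<forall>R::nat. 0 < R \<longrightarrow> cutoff_at (1 / real R) 0 x * en (x, t) = 0"
          unfolding AE_all_countable
        proof
          fix R :: nat
          show "AE x in lborel. 0 < R \<longrightarrow> cutoff_at (1 / real R) 0 x * en (x, t) = 0"
          proof (cases "0 < R")
            case True
            then show ?thesis using integral_nonneg_eq_0_iff_AE[OF ie[OF True]] nn zero[OF True] by simp
          qed simp
        qed
        then show "AE x in lborel. en (x, t) = 0"
        proof eventually_elim
          case (elim x)
          obtain R :: nat where R: "\<bar>x\<bar> < real R" using reals_Archimedean2 by blast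
          then have R0: "0 < R" by (cases R) auto
          have c1: "cutoff_at (1 / real R) 0 x = 1" using R by (simp add: cutoff_at_def cutoff_simps)
          show ?case using elim[rule_format, OF R0] unfolding c1 mult_1_left .
        qed
      qed
    qed
  qed
  \<comment> \<open>The constant in \<open>energy_bound\<close> depends on the final time, so all
    times are reached through a countable exhaustion.\<close>
  have "AE t in lborel. \<forall>T::nat. 0 < t \<and> t < real T \<longrightarrow> (AE x in lborel. en (x, t) = 0)"
    unfolding AE_all_countable by (rule allI) (rule slice)
  then have 1: "AE t in lborel. AE x in lborel. 0 < t \<longrightarrow> en (x, t) = 0"
  proof eventually_elim
    case (elim t)
    obtain T :: nat where "t < real T" using reals_Archimedean2 by blast
    then show ?case using elim by (cases "0 < t") auto
  qed
  have "en \<in> borel_measurable borel" using lbdd_en by (simp add: lbdd_def)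
  moreover have "snd \<in> borel_measurable (borel :: (real \<times> real) measure)"
    by (intro borel_measurable_continuous_onI continuous_intros)
  ultimately have "Measurable.pred borel (\<lambda>z. 0 < snd z \<longrightarrow> en z = 0)" by measurable
  then have "{z \<in> space borel. 0 < snd z \<longrightarrow> en z = 0} \<in> sets (borel :: (real \<times> real) measure)" by (rule predE)
  then have meas: "{z \<in> space ((lborel :: real measure) \<Otimes>\<^sub>M (lborel :: real measure)). 0 < snd z \<longrightarrow> en z = 0} \<in> sets ((lborel :: real measure) \<Otimes>\<^sub>M (lborel :: real measure))"
    by (simp only: lborel_prod sets_lborel space_lborel space_borel)
  then have meas': "{z \<in> space ((lborel :: real measure) \<Otimes>\<^sub>M (lborel :: real measure)). 0 < snd z \<longrightarrow> en (fst z, snd z) = 0} \<in> sets ((lborel :: real measure) \<Otimes>\<^sub>M (lborel :: real measure))"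
    by (simp only: prod.collapse)
  have "AE x in lborel. AE t in lborel. 0 < t \<longrightarrow> en (x, t) = 0"
    using lborel_pair.AE_commute[where P="\<lambda>x t. 0 < t \<longrightarrow> en (x, t) = 0", OF meas'] 1 by (rule iffD2)
  then have 2: "AE x in lborel. AE t in lborel. 0 < snd (x, t) \<longrightarrow> en (x, t) = 0" by (simp only: snd_conv)
  have "AE z in (lborel :: real measure) \<Otimes>\<^sub>M (lborel :: real measure). 0 < snd z \<longrightarrow> en z = 0"
    by (rule lborel_pair.AE_pair_measure[where P="\<lambda>z. 0 < snd z \<longrightarrow> en z = 0", OF meas 2])
  moreover have "(lborel :: real measure) \<Otimes>\<^sub>M (lborel :: real measure) = lborel" by (rule lborel_prod)
  ultimately have "AE z in (lborel :: (real \<times> real) measure). 0 < snd z \<longrightarrow> en z = 0" by (simp only:)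
  then show ?thesis
  proof eventually_elim
    case (elim z)
    then show ?case using en_bounds(3)[of z] by auto
  qed
qed

end

section \<open>The Serret--Frenet system\<close>

text \<open>Completing the square. The exponential majorant has an elementary primitive and is all
  the decay that is used later; its constant exp (1 / \<alpha>) runs through every estimate on the
  profile.\<close>

lemma gaussian_le_exp:
  fixes \<alpha> s :: real
  assumes "0 < \<alpha>"
  shows "exp (- \<alpha> * s\<^sup>2 / 4) \<le> exp (1 / \<alpha>) * exp (- \<bar>s\<bar>)"
proof -
  have "0 \<le> (\<alpha> * \<bar>s\<bar> / 2 - 1)\<^sup>2 / \<alpha>" using assms by simp
  also have "\<dots> = \<alpha> * s\<^sup>2 / 4 - \<bar>s\<bar> + 1 / \<alpha>" using assms by (simp add: power2_eq_square field_simps)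
  finally have "- \<alpha> * s\<^sup>2 / 4 \<le> 1 / \<alpha> + - \<bar>s\<bar>" by simp
  then show ?thesis by (simp only: exp_add[symmetric] exp_le_cancel_iff)
qed

lemma decay_bound:
  fixes G :: "real \<Rightarrow> 'a::real_normed_vector"
  assumes G: "\<And>s. (G has_vector_derivative g s) (at s)" and b: "\<And>s. norm (g s) \<le> K * exp (- \<bar>s\<bar>)"
  shows "0 \<le> s \<Longrightarrow> s \<le> t \<Longrightarrow> norm (G t - G s) \<le> K * (exp (- s) - exp (- t))"
    "s \<le> t \<Longrightarrow> t \<le> 0 \<Longrightarrow> norm (G t - G s) \<le> K * (exp t - exp s)"
proof -
  have c: "continuous_on S G" for S
    using G has_vector_derivative_continuous continuous_at_imp_continuous_on by blast
  show "norm (G t - G s) \<le> K * (exp (- s) - exp (- t))" if "0 \<le> s" "s \<le> t"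
  proof (cases "s = t")
    case False
    then have st: "s < t" using that by simp
    have "norm (G t - G s) \<le> (\<lambda>u. - K * exp (- u)) t - (\<lambda>u. - K * exp (- u)) s"
    proof (rule differentiable_bound_general[OF st c _ G])
      show "continuous_on {s..t} (\<lambda>u. - K * exp (- u))" by (intro continuous_intros)
      show "((\<lambda>u. - K * exp (- u)) has_vector_derivative K * exp (- u)) (at u)" for u
        unfolding has_real_derivative_iff_has_vector_derivative[symmetric] by (auto intro!: derivative_eq_intros)
      show "norm (g u) \<le> K * exp (- u)" if "s < u" for u using b[of u] that \<open>0 \<le> s\<close> by simp
    qed
    then show ?thesis by (simp add: algebra_simps)
  qed simp
  show "norm (G t - G s) \<le> K * (exp t - exp s)" if "s \<le> t" "t \<le> 0"
  proof (cases "s = t")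
    case False
    then have st: "s < t" using that by simp
    have "norm (G t - G s) \<le> (\<lambda>u. K * exp u) t - (\<lambda>u. K * exp u) s"
    proof (rule differentiable_bound_general[OF st c _ G])
      show "continuous_on {s..t} (\<lambda>u. K * exp u)" by (intro continuous_intros)
      show "((\<lambda>u. K * exp u) has_vector_derivative K * exp u) (at u)" for u
        unfolding has_real_derivative_iff_has_vector_derivative[symmetric] by (auto intro!: derivative_eq_intros)
      show "norm (g u) \<le> K * exp u" if "u < t" for u using b[of u] that \<open>t \<le> 0\<close> by simp
    qed
    then show ?thesis by (simp add: algebra_simps)
  qed simp
qed

text \<open>The increments on a half-line are Cauchy with a rate, and the limit inherits the rate.
  The end at minus infinity is the same statement for the reflected curve.\<close>

lemma decay_limit:
  fixes G :: "real \<Rightarrow> 'a::banach"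
  assumes G: "\<And>s. (G has_vector_derivative g s) (at s)" and b: "\<And>s. norm (g s) \<le> K * exp (- \<bar>s\<bar>)"
  obtains L L' where "\<And>s. 0 \<le> s \<Longrightarrow> norm (G s - L) \<le> K * exp (- s)" "\<And>s. s \<le> 0 \<Longrightarrow> norm (G s - L') \<le> K * exp s"
proof -
  have K: "0 \<le> K" using order_trans[OF norm_ge_zero b[of 0]] by simp
  have ex: "\<exists>L. \<forall>s\<ge>0. norm (H s - L) \<le> K * exp (- s)"
    if H: "\<And>s t. 0 \<le> s \<Longrightarrow> s \<le> t \<Longrightarrow> norm (H t - H s) \<le> K * (exp (- s) - exp (- t))" for H :: "real \<Rightarrow> 'a"
  proof -
    have le: "norm (H t - H s) \<le> K * exp (- s)" if "0 \<le> s" "s \<le> t" for s t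
      using H[OF that] K by (simp add: algebra_simps) (smt (verit) exp_ge_zero mult_nonneg_nonneg)
    have "Cauchy (\<lambda>n. H (real n))"
    proof (rule metric_CauchyI)
      fix e :: real assume e: "0 < e"
      have "(\<lambda>n. K * exp (- real n)) \<longlonglongrightarrow> K * 0"
        by (intro tendsto_mult tendsto_const filterlim_compose[OF exp_at_bot] filterlim_compose[OF filterlim_uminus_at_bot_at_top filterlim_real_sequentially])
      then have "\<forall>\<^sub>F n in sequentially. K * exp (- real n) < e / 2" using e by (intro order_tendstoD(2)) auto
      then obtain N where N: "\<And>n. N \<le> n \<Longrightarrow> K * exp (- real n) < e / 2" by (auto simp: eventually_sequentially)
      have "dist (H (real m)) (H (real n)) < e" if "N \<le> m" "N \<le> n" for m n
      proof -
        have "norm (H (real m) - H (real N)) \<le> K * exp (- real N)" "norm (H (real n) - H (real N)) \<le> K * exp (- real N)"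
          using le[of "real N"] that by auto
        then show ?thesis
          using norm_triangle_ineq4[of "H (real m) - H (real N)" "H (real n) - H (real N)"] N[of N] by (simp add: dist_norm)
      qed
      then show "\<exists>M. \<forall>m\<ge>M. \<forall>n\<ge>M. dist (H (real m)) (H (real n)) < e" by blast
    qed
    then obtain L where L: "(\<lambda>n. H (real n)) \<longlonglongrightarrow> L" using Cauchy_convergent convergent_def by blast
    have "norm (H s - L) \<le> K * exp (- s)" if s: "0 \<le> s" for s
    proof (rule LIMSEQ_le_const2)
      show "(\<lambda>n. norm (H s - H (real n))) \<longlonglongrightarrow> norm (H s - L)" by (intro tendsto_intros L)
      obtain N :: nat where "s \<le> real N" using real_arch_simple by blast
      then have "norm (H s - H (real n)) \<le> K * exp (- s)" if "N \<le> n" for n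
        using le[OF s, of "real n"] that by (simp add: norm_minus_commute[of "H s"])
      then show "\<exists>N. \<forall>n\<ge>N. norm (H s - H (real n)) \<le> K * exp (- s)" by blast
    qed
    then show ?thesis by blast
  qed
  obtain L where L: "\<And>s. 0 \<le> s \<Longrightarrow> norm (G s - L) \<le> K * exp (- s)" using ex[of G] decay_bound(1)[OF G b] by blast
  have "\<exists>L. \<forall>s\<ge>0. norm (G (- s) - L) \<le> K * exp (- s)"
  proof (rule ex[of "\<lambda>s. G (- s)"])
    show "norm (G (- t) - G (- s)) \<le> K * (exp (- s) - exp (- t))" if "0 \<le> s" "s \<le> t" for s t
      using decay_bound(2)[OF G b, of "- t" "- s"] that by (simp add: norm_minus_commute[of "G (- t)"])
  qed
  then obtain L' where L': "\<And>s. 0 \<le> s \<Longrightarrow> norm (G (- s) - L') \<le> K * exp (- s)" by blast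
  show ?thesis
  proof (rule that[of L L'])
    show "norm (G s - L') \<le> K * exp s" if "s \<le> 0" for s using L'[of "- s"] that by simp
  qed (rule L)
qed

lemma antiderivative_ex:
  fixes g :: "real \<Rightarrow> 'a::banach"
  assumes "continuous_on UNIV g"
  shows "\<exists>G. (\<forall>s. (G has_vector_derivative g s) (at s)) \<and> G 0 = 0"
proof (rule antiderivative[OF assms])
  fix G assume "\<And>s. (G has_vector_derivative g s) (at s)" "G 0 = 0"
  then show ?thesis by (intro exI[of _ G]) simp
qed

text \<open>This is the right side of the system, divided by c, for Y = (f, P, Q), where p = cos
  \<theta> P + sin \<theta> Q and q = - sin \<theta> P + cos \<theta> Q. Since \<theta>' = \<beta> s
  / 2, the unbounded torsion terms disappear and every coefficient carries the Gaussian.\<close>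

definition frame_op :: "real \<Rightarrow> real \<Rightarrow> real \<Rightarrow> (real^3) \<times> (real^3) \<times> (real^3) \<Rightarrow> (real^3) \<times> (real^3) \<times> (real^3)" where
  "frame_op \<alpha> \<beta> s Y = (let E = exp (- \<alpha> * s\<^sup>2 / 4); \<theta> = \<beta> * s\<^sup>2 / 4; f = fst Y; P = fst (snd Y); Q = snd (snd Y) in
     ((E * cos \<theta>) *\<^sub>R P + (E * sin \<theta>) *\<^sub>R Q, (- (E * cos \<theta>)) *\<^sub>R f, (- (E * sin \<theta>)) *\<^sub>R f))"

lemma frame_op_bound:
  assumes "0 < \<alpha>"
  shows "norm (frame_op \<alpha> \<beta> s Y) \<le> 4 * exp (1 / \<alpha>) * norm Y * exp (- \<bar>s\<bar>)"
proof -
  let ?E = "exp (- \<alpha> * s\<^sup>2 / 4)" and ?\<theta> = "\<beta> * s\<^sup>2 / 4"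
  obtain f P Q where Y: "Y = (f, P, Q)" by (cases Y) auto
  have n: "norm f \<le> norm Y" "norm P \<le> norm Y" "norm Q \<le> norm Y"
  proof -
    have "norm (P, Q) \<le> norm Y" using norm_snd_le[of "(P, Q)" f] by (simp add: Y)
    then show "norm f \<le> norm Y" "norm P \<le> norm Y" "norm Q \<le> norm Y"
      using norm_fst_le[of f "(P, Q)"] norm_fst_le[of P Q] norm_snd_le[of Q P] by (auto simp: Y)
  qed
  have s: "norm ((?E * k) *\<^sub>R v) \<le> ?E * norm Y" if "\<bar>k\<bar> \<le> 1" "norm v \<le> norm Y" for k and v :: "real^3"
  proof -
    have "\<bar>k\<bar> * norm v \<le> 1 * norm Y" using that by (intro mult_mono) auto
    then show ?thesis by (simp add: abs_mult)
  qed
  have s': "norm ((- (?E * k)) *\<^sub>R v) \<le> ?E * norm Y" if "\<bar>k\<bar> \<le> 1" "norm v \<le> norm Y" for k and v :: "real^3"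
    using s[OF that] by simp
  have "norm (frame_op \<alpha> \<beta> s Y) \<le> norm ((?E * cos ?\<theta>) *\<^sub>R P + (?E * sin ?\<theta>) *\<^sub>R Q) + (norm ((- (?E * cos ?\<theta>)) *\<^sub>R f) + norm ((- (?E * sin ?\<theta>)) *\<^sub>R f))"
    unfolding frame_op_def Let_def Y fst_conv snd_conv by (rule order_trans[OF norm_Pair_le add_left_mono[OF norm_Pair_le]])
  also have "\<dots> \<le> (?E * norm Y + ?E * norm Y) + (?E * norm Y + ?E * norm Y)"
    by (intro add_mono order_trans[OF norm_triangle_ineq] s s' abs_cos_le_one abs_sin_le_one n)
  also have "\<dots> = 4 * norm Y * ?E" by simp
  also have "\<dots> \<le> 4 * norm Y * (exp (1 / \<alpha>) * exp (- \<bar>s\<bar>))" by (intro mult_left_mono gaussian_le_exp assms) simp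
  finally show ?thesis by (simp add: mult_ac)
qed

lemma frame_op_diff: "frame_op \<alpha> \<beta> s (Y - Z) = frame_op \<alpha> \<beta> s Y - frame_op \<alpha> \<beta> s Z"
  by (simp add: frame_op_def Let_def algebra_simps)

lemma frame_op_continuous:
  assumes "continuous_on UNIV Y"
  shows "continuous_on UNIV (\<lambda>s. frame_op \<alpha> \<beta> s (Y s))"
proof -
  have Y: "continuous_on UNIV (\<lambda>s. fst (Y s))" "continuous_on UNIV (\<lambda>s. fst (snd (Y s)))" "continuous_on UNIV (\<lambda>s. snd (snd (Y s)))"
    by (rule continuous_on_fst continuous_on_snd assms)+
  have c: "continuous_on UNIV (\<lambda>s. exp (- \<alpha> * s\<^sup>2 / 4) * cos (\<beta> * s\<^sup>2 / 4))"
    "continuous_on UNIV (\<lambda>s. exp (- \<alpha> * s\<^sup>2 / 4) * sin (\<beta> * s\<^sup>2 / 4))"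
    by (auto intro!: continuous_at_imp_continuous_on continuous_intros)
  show ?thesis unfolding frame_op_def Let_def
    by (intro continuous_on_Pair continuous_on_add continuous_on_scaleR continuous_on_minus c Y)
qed

text \<open>
  In the frame rotated by the angle \<open>\<beta> s\<^sup>2 / 4\<close> the coefficients become integrable, so for small \<open>c\<close>
  the integral equation is a contraction on all bounded continuous functions of the line.
\<close>

lemma frame_exists:
  assumes \<alpha>: "0 < \<alpha>" and c: "0 \<le> c" "c * (4 * exp (1 / \<alpha>)) \<le> 1 / 2"
  obtains Y where "\<And>s. (Y has_vector_derivative c *\<^sub>R frame_op \<alpha> \<beta> s (Y s)) (at s)" "Y 0 = Y0"
proof -
  \<comment> \<open>The primitive vanishing at 0, chosen as a function of the curve, so that the
    integral equation reads y = Y0 + c adv y.\<close>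
  define adv where "adv y = (SOME G. (\<forall>s. (G has_vector_derivative frame_op \<alpha> \<beta> s (apply_bcontfun y s)) (at s)) \<and> G 0 = 0)"
    for y :: "real \<Rightarrow>\<^sub>C ((real^3) \<times> (real^3) \<times> (real^3))"
  have adv: "\<And>s. (adv y has_vector_derivative frame_op \<alpha> \<beta> s (apply_bcontfun y s)) (at s)" "adv y 0 = 0" for y
  proof -
    have "continuous_on UNIV (\<lambda>s. frame_op \<alpha> \<beta> s (apply_bcontfun y s))"
      by (intro frame_op_continuous continuous_on_apply_bcontfun) 
    then have "\<exists>G. (\<forall>s. (G has_vector_derivative frame_op \<alpha> \<beta> s (apply_bcontfun y s)) (at s)) \<and> G 0 = 0"
      by (rule antiderivative_ex)
    then have "(\<forall>s. (adv y has_vector_derivative frame_op \<alpha> \<beta> s (apply_bcontfun y s)) (at s)) \<and> adv y 0 = 0"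
      unfolding adv_def by (rule someI_ex)
    then show "\<And>s. (adv y has_vector_derivative frame_op \<alpha> \<beta> s (apply_bcontfun y s)) (at s)" "adv y 0 = 0" by auto
  qed
  let ?k = "4 * exp (1 / \<alpha>)"
  have global: "norm (G s) \<le> K" if G: "\<And>s. (G has_vector_derivative g s) (at s)" "G 0 = 0" and b: "\<And>s. norm (g s) \<le> K * exp (- \<bar>s\<bar>)"
    for G g :: "real \<Rightarrow> (real^3) \<times> (real^3) \<times> (real^3)" and K s
  proof -
    have K: "0 \<le> K" using order_trans[OF norm_ge_zero b[of 0]] by simp
    show ?thesis
    proof (cases "0 \<le> s")
      case True
      have "norm (G s) \<le> K * (1 - exp (- s))" using decay_bound(1)[OF G(1) b, of 0 s] True G(2) by simp
      also have "\<dots> \<le> K * 1" using K by (intro mult_left_mono) auto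
      finally show ?thesis by simp
    next
      case False
      have "norm (G s) \<le> K * (1 - exp s)" using decay_bound(2)[OF G(1) b, of s 0] False G(2) by simp
      also have "\<dots> \<le> K * 1" using K by (intro mult_left_mono) auto
      finally show ?thesis by simp
    qed
  qed
  define T where "T y = Bcontfun (\<lambda>s. Y0 + c *\<^sub>R adv y s)" for y
  have mem: "(\<lambda>s. Y0 + c *\<^sub>R adv y s) \<in> bcontfun" for y
  proof (rule bcontfun_normI)
    show "continuous_on UNIV (\<lambda>s. Y0 + c *\<^sub>R adv y s)"
      using adv(1)[of y] by (intro continuous_intros) (auto intro!: continuous_at_imp_continuous_on has_vector_derivative_continuous)
    have "norm (frame_op \<alpha> \<beta> s (apply_bcontfun y s)) \<le> (?k * norm y) * exp (- \<bar>s\<bar>)" for s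
    proof -
      have "?k * norm (apply_bcontfun y s) * exp (- \<bar>s\<bar>) \<le> ?k * norm y * exp (- \<bar>s\<bar>)"
        by (intro mult_right_mono mult_left_mono norm_bounded) auto
      then show ?thesis using frame_op_bound[OF \<alpha>, of \<beta> s "apply_bcontfun y s"] by linarith
    qed
    from global[OF adv this] have "norm (adv y s) \<le> ?k * norm y" for s .
    then have "norm (Y0 + c *\<^sub>R adv y s) \<le> norm Y0 + c * (?k * norm y)" for s
      using c(1) by (intro order_trans[OF norm_triangle_ineq]) (auto intro!: mult_left_mono)
    then show "norm (Y0 + c *\<^sub>R adv y s) \<le> norm Y0 + c * (?k * norm y)" for s .
  qed
  have ap: "apply_bcontfun (T y) s = Y0 + c *\<^sub>R adv y s" for y s
    unfolding T_def by (simp add: Bcontfun_inverse[OF mem])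
  have "\<exists>!y. T y = y"
  \<comment> \<open>A difference of two primitives is bounded on the whole line by 4 exp (1 /
    \<alpha>) times the distance of the curves, and the hypothesis on c turns this into the factor 1
    / 2.\<close>
  proof (rule banach_fix_type[of "1 / 2"])
    show "\<forall>y z. dist (T y) (T z) \<le> 1 / 2 * dist y z"
    proof (intro allI dist_bound)
      fix y z s
      have "norm (frame_op \<alpha> \<beta> s (apply_bcontfun y s) - frame_op \<alpha> \<beta> s (apply_bcontfun z s)) \<le> (?k * dist y z) * exp (- \<bar>s\<bar>)" for s
      proof -
        have "?k * norm (apply_bcontfun y s - apply_bcontfun z s) * exp (- \<bar>s\<bar>) \<le> ?k * dist y z * exp (- \<bar>s\<bar>)"
          using dist_bounded[of y s z] by (intro mult_right_mono mult_left_mono) (auto simp: dist_norm)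
        then show ?thesis using frame_op_bound[OF \<alpha>, of \<beta> s "apply_bcontfun y s - apply_bcontfun z s"] unfolding frame_op_diff by linarith
      qed
      from global[OF has_vector_derivative_diff[OF adv(1) adv(1)] _ this] have "norm (adv y s - adv z s) \<le> ?k * dist y z"
        by (simp add: adv(2))
      then have "c * norm (adv y s - adv z s) \<le> c * (?k * dist y z)" using c(1) by (rule mult_left_mono)
      also have "\<dots> \<le> 1 / 2 * dist y z" using mult_right_mono[OF c(2), of "dist y z"] by (simp add: mult.assoc)
      finally show "dist (apply_bcontfun (T y) s) (apply_bcontfun (T z) s) \<le> 1 / 2 * dist y z"
        using c(1) by (simp add: ap dist_norm scaleR_diff_right[symmetric])
    qed
  qed auto
  then obtain y where y: "T y = y" by blast
  have eq: "apply_bcontfun y s = Y0 + c *\<^sub>R adv y s" for s using ap[of y s] by (simp add: y)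
  have "(apply_bcontfun y has_vector_derivative c *\<^sub>R frame_op \<alpha> \<beta> s (apply_bcontfun y s)) (at s)" for s
  proof -
    have "((\<lambda>s. Y0 + c *\<^sub>R adv y s) has_vector_derivative c *\<^sub>R frame_op \<alpha> \<beta> s (apply_bcontfun y s)) (at s)"
      by (auto intro!: derivative_eq_intros adv(1))
    then show ?thesis by (simp only: eq[symmetric])
  qed
  moreover have "apply_bcontfun y 0 = Y0" using eq[of 0] adv(2)[of y] by simp
  ultimately show ?thesis using that by blast
qed

lemma rotation_identity:
  fixes f P Q :: "real^3"
  assumes "a\<^sup>2 + b\<^sup>2 = 1"
  shows "(a *\<^sub>R ((- (k * a)) *\<^sub>R f) + (- b * m) *\<^sub>R P) + (b *\<^sub>R ((- (k * b)) *\<^sub>R f) + (a * m) *\<^sub>R Q)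
    = (- k) *\<^sub>R f + m *\<^sub>R ((- b) *\<^sub>R P + a *\<^sub>R Q)"
proof -
  have "(a * (- (k * a) * x) + (- b * m) * y) + (b * (- (k * b) * x) + (a * m) * z) = - k * x + m * (- b * y + a * z)" for x y z
    using assms by algebra
  then show ?thesis unfolding vec_eq_iff by (simp add: mult.assoc)
qed

text \<open>Undoing the rotation of P and Q: differentiating cos \<theta> and sin \<theta> restores
  the torsion terms, and the rest recombines by cos^2 + sin^2 = 1.\<close>

lemma serret_frenet_exists:
  assumes \<alpha>: "0 < \<alpha>" and c: "0 \<le> c" "c * (4 * exp (1 / \<alpha>)) \<le> 1 / 2"
  obtains f p q where "serret_frenet \<alpha> c f p q"
proof -
  define \<beta> where "\<beta> = sqrt (1 - \<alpha>\<^sup>2)"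
  obtain Y where Y: "\<And>s. (Y has_vector_derivative c *\<^sub>R frame_op \<alpha> \<beta> s (Y s)) (at s)"
    "Y 0 = (vector [1, 0, 0], vector [0, 1, 0], vector [0, 0, 1])"
    using frame_exists[OF assms] by metis
  define f P Q where "f s = fst (Y s)" and "P s = fst (snd (Y s))" and "Q s = snd (snd (Y s))" for s
  let ?E = "\<lambda>s. exp (- \<alpha> * s\<^sup>2 / 4)" and ?\<theta> = "\<lambda>s. \<beta> * s\<^sup>2 / 4"
  have dY: "(Y has_derivative (\<lambda>h. h *\<^sub>R (c *\<^sub>R frame_op \<alpha> \<beta> s (Y s)))) (at s)" for s
    using Y(1) by (simp add: has_vector_derivative_def)
  have df: "(f has_vector_derivative (c * ?E s) *\<^sub>R (cos (?\<theta> s) *\<^sub>R P s + sin (?\<theta> s) *\<^sub>R Q s)) (at s)" for s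
    unfolding has_vector_derivative_def f_def[abs_def]
    by (rule has_derivative_eq_rhs[OF has_derivative_fst[OF dY]])
      (simp add: frame_op_def Let_def P_def Q_def algebra_simps)
  have dP: "(P has_vector_derivative (- (c * ?E s * cos (?\<theta> s))) *\<^sub>R f s) (at s)" for s
    unfolding has_vector_derivative_def P_def[abs_def]
    by (rule has_derivative_eq_rhs[OF has_derivative_fst[OF has_derivative_snd[OF dY]]])
      (simp add: frame_op_def Let_def f_def algebra_simps)
  have dQ: "(Q has_vector_derivative (- (c * ?E s * sin (?\<theta> s))) *\<^sub>R f s) (at s)" for s
    unfolding has_vector_derivative_def Q_def[abs_def]
    by (rule has_derivative_eq_rhs[OF has_derivative_snd[OF has_derivative_snd[OF dY]]])
      (simp add: frame_op_def Let_def f_def algebra_simps)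
  have dc: "((\<lambda>s. cos (?\<theta> s)) has_real_derivative - sin (?\<theta> s) * (\<beta> * s / 2)) (at s)"
    and ds: "((\<lambda>s. sin (?\<theta> s)) has_real_derivative cos (?\<theta> s) * (\<beta> * s / 2)) (at s)" for s
    by (auto intro!: derivative_eq_intros)
  define p where "p s = cos (?\<theta> s) *\<^sub>R P s + sin (?\<theta> s) *\<^sub>R Q s" for s
  define q where "q s = (- sin (?\<theta> s)) *\<^sub>R P s + cos (?\<theta> s) *\<^sub>R Q s" for s
  have dp: "(p has_vector_derivative (- (c * ?E s)) *\<^sub>R f s + (\<beta> * s / 2) *\<^sub>R q s) (at s)" for s
  proof -
    have "(p has_vector_derivative (cos (?\<theta> s) *\<^sub>R ((- (c * ?E s * cos (?\<theta> s))) *\<^sub>R f s) + (- sin (?\<theta> s) * (\<beta> * s / 2)) *\<^sub>R P s)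
      + (sin (?\<theta> s) *\<^sub>R ((- (c * ?E s * sin (?\<theta> s))) *\<^sub>R f s) + (cos (?\<theta> s) * (\<beta> * s / 2)) *\<^sub>R Q s)) (at s)"
      unfolding p_def[abs_def] by (intro has_vector_derivative_add has_vector_derivative_scaleR dc ds dP dQ)
    then show ?thesis unfolding q_def rotation_identity[OF sin_cos_squared_add2] .
  qed
  have dq: "(q has_vector_derivative (- (\<beta> * s / 2)) *\<^sub>R p s) (at s)" for s
  proof -
    have ds': "((\<lambda>s. - sin (?\<theta> s)) has_real_derivative - (cos (?\<theta> s) * (\<beta> * s / 2))) (at s)" by (rule DERIV_minus[OF ds])
    have "(q has_vector_derivative ((- sin (?\<theta> s)) *\<^sub>R ((- (c * ?E s * cos (?\<theta> s))) *\<^sub>R f s) + (- (cos (?\<theta> s) * (\<beta> * s / 2))) *\<^sub>R P s)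
      + (cos (?\<theta> s) *\<^sub>R ((- (c * ?E s * sin (?\<theta> s))) *\<^sub>R f s) + (- sin (?\<theta> s) * (\<beta> * s / 2)) *\<^sub>R Q s)) (at s)"
      unfolding q_def[abs_def] by (intro has_vector_derivative_add has_vector_derivative_scaleR dc ds' dP dQ)
    then show ?thesis by (simp add: p_def algebra_simps)
  qed
  have "serret_frenet \<alpha> c f p q"
    unfolding serret_frenet_def \<beta>_def[symmetric]
  proof (intro conjI allI)
    show "f 0 = vector [1, 0, 0]" "p 0 = vector [0, 1, 0]" "q 0 = vector [0, 0, 1]"
      by (simp_all add: f_def p_def q_def P_def Q_def Y(2))
    show "(f has_vector_derivative (c * exp (- \<alpha> * s\<^sup>2 / 4)) *\<^sub>R p s) (at s)" for s using df by (simp add: p_def)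
    show "(p has_vector_derivative - (c * exp (- \<alpha> * s\<^sup>2 / 4)) *\<^sub>R f s + (\<beta> * s / 2) *\<^sub>R q s) (at s)" for s using dp by simp
    show "(q has_vector_derivative - (\<beta> * s / 2) *\<^sub>R p s) (at s)" for s using dq by simp
  qed
  then show ?thesis using that by blast
qed

lemma has_vector_derivative_inner:
  assumes "(u has_vector_derivative u') (at s)" "(v has_vector_derivative v') (at s)"
  shows "((\<lambda>s. u s \<bullet> v s) has_real_derivative u s \<bullet> v' + u' \<bullet> v s) (at s)"
  using bounded_bilinear.has_vector_derivative[OF bounded_bilinear_inner assms]
  by (simp add: has_real_derivative_iff_has_vector_derivative)

lemma has_vector_derivative_cross3:
  assumes "(u has_vector_derivative u') (at s)" "(v has_vector_derivative v') (at s)"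
  shows "((\<lambda>s. cross3 (u s) (v s)) has_vector_derivative cross3 (u s) v' + cross3 u' (v s)) (at s)"
  by (rule bounded_bilinear.has_vector_derivative[OF bounded_bilinear_cross3 assms])

lemma has_vector_derivative_component:
  fixes u :: "real \<Rightarrow> real^3"
  assumes "(u has_vector_derivative u') (at s)"
  shows "((\<lambda>s. u s $ i) has_real_derivative u' $ i) (at s)"
  using has_vector_derivative_inner[OF has_vector_derivative_const[of "axis i 1"] assms] by (simp add: inner_axis')

locale frenet =
  fixes \<alpha> c :: real and f p q :: "real \<Rightarrow> real^3"
  assumes \<alpha>: "0 < \<alpha>" "\<alpha> \<le> 1" and c: "0 \<le> c" and sf: "serret_frenet \<alpha> c f p q"
begin

definition \<beta> :: real where "\<beta> = sqrt (1 - \<alpha>\<^sup>2)"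
definition w :: "real \<Rightarrow> real" where "w s = c * exp (- \<alpha> * s\<^sup>2 / 4)"

lemma w_bound: "0 \<le> w s" "w s \<le> c" "w s \<le> c * exp (1 / \<alpha>) * exp (- \<bar>s\<bar>)"
proof -
  show "0 \<le> w s" using c by (simp add: w_def)
  have "exp (- \<alpha> * s\<^sup>2 / 4) \<le> 1" using \<alpha> by simp
  from mult_left_mono[OF this c] show "w s \<le> c" by (simp add: w_def)
  from mult_left_mono[OF gaussian_le_exp[OF \<alpha>(1), of s] c] show "w s \<le> c * exp (1 / \<alpha>) * exp (- \<bar>s\<bar>)" by (simp add: w_def mult.assoc)
qed

lemma dfpq:
  "(f has_vector_derivative w s *\<^sub>R p s) (at s)"
  "(p has_vector_derivative (- w s) *\<^sub>R f s + (\<beta> * s / 2) *\<^sub>R q s) (at s)"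
  "(q has_vector_derivative (- (\<beta> * s / 2)) *\<^sub>R p s) (at s)"
  "f 0 = vector [1, 0, 0]" "p 0 = vector [0, 1, 0]" "q 0 = vector [0, 0, 1]"
  using sf unfolding serret_frenet_def w_def \<beta>_def by blast+

lemma dw: "(w has_real_derivative - (\<alpha> * s / 2) * w s) (at s)"
  unfolding w_def[abs_def] by (auto intro!: derivative_eq_intros)

text \<open>The system has a skew-symmetric coefficient matrix, so the Gram matrix minus the
  identity evolves by a commutator with it and its Frobenius norm is conserved. \<open>S\<close> is
  the square of this norm, the off-diagonal entries counted twice, and it vanishes at 0.\<close>

lemma orthonormal: "f s \<bullet> f s = 1" "p s \<bullet> p s = 1" "q s \<bullet> q s = 1" "f s \<bullet> p s = 0" "f s \<bullet> q s = 0" "p s \<bullet> q s = 0"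
proof -
  define S where "S s = (f s \<bullet> f s - 1)\<^sup>2 + (p s \<bullet> p s - 1)\<^sup>2 + (q s \<bullet> q s - 1)\<^sup>2
      + 2 * (f s \<bullet> p s)\<^sup>2 + 2 * (f s \<bullet> q s)\<^sup>2 + 2 * (p s \<bullet> q s)\<^sup>2" for s
  have "(S has_real_derivative 0) (at s)" for s
  proof -
    let ?t = "\<beta> * s / 2"
    have ff: "((\<lambda>s. f s \<bullet> f s) has_real_derivative 2 * w s * (f s \<bullet> p s)) (at s)"
      by (rule DERIV_cong[OF has_vector_derivative_inner[OF dfpq(1) dfpq(1)]]) (simp add: inner_commute)
    have pp: "((\<lambda>s. p s \<bullet> p s) has_real_derivative 2 * (?t * (p s \<bullet> q s) - w s * (f s \<bullet> p s))) (at s)"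
      by (rule DERIV_cong[OF has_vector_derivative_inner[OF dfpq(2) dfpq(2)]])
        (simp add: inner_add_left inner_add_right inner_commute algebra_simps)
    have qq: "((\<lambda>s. q s \<bullet> q s) has_real_derivative - 2 * ?t * (p s \<bullet> q s)) (at s)"
      by (rule DERIV_cong[OF has_vector_derivative_inner[OF dfpq(3) dfpq(3)]]) (simp add: inner_commute)
    have fp: "((\<lambda>s. f s \<bullet> p s) has_real_derivative w s * (p s \<bullet> p s) - w s * (f s \<bullet> f s) + ?t * (f s \<bullet> q s)) (at s)"
      by (rule DERIV_cong[OF has_vector_derivative_inner[OF dfpq(1) dfpq(2)]])
        (simp add: inner_add_left inner_add_right inner_commute algebra_simps)
    have fq: "((\<lambda>s. f s \<bullet> q s) has_real_derivative w s * (p s \<bullet> q s) - ?t * (f s \<bullet> p s)) (at s)"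
      by (rule DERIV_cong[OF has_vector_derivative_inner[OF dfpq(1) dfpq(3)]]) (simp add: inner_commute algebra_simps)
    have pq: "((\<lambda>s. p s \<bullet> q s) has_real_derivative - w s * (f s \<bullet> q s) + ?t * (q s \<bullet> q s) - ?t * (p s \<bullet> p s)) (at s)"
      by (rule DERIV_cong[OF has_vector_derivative_inner[OF dfpq(2) dfpq(3)]])
        (simp add: inner_add_left inner_add_right inner_commute algebra_simps)
    have sq: "((\<lambda>s. (g s - k)\<^sup>2) has_real_derivative 2 * (g s - k) * g') (at s)" if "(g has_real_derivative g') (at s)" for g g' k
      using that by (auto intro!: derivative_eq_intros)
    have sq0: "((\<lambda>s. 2 * (g s)\<^sup>2) has_real_derivative 2 * (2 * g s * g')) (at s)" if "(g has_real_derivative g') (at s)" for g g'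
      using that by (auto intro!: derivative_eq_intros)
    show ?thesis unfolding S_def[abs_def]
      by (rule DERIV_cong[OF DERIV_add[OF DERIV_add[OF DERIV_add[OF DERIV_add[OF DERIV_add[OF
        sq[OF ff] sq[OF pp]] sq[OF qq]] sq0[OF fp]] sq0[OF fq]] sq0[OF pq]]]) algebra
  qed
  then have "S s = S 0" using DERIV_isconst_all by blast
  also have "S 0 = 0" unfolding S_def dfpq(4-6) by (simp add: inner_vec_def sum_3 vector_3)
  finally have "S s = 0" .
  then have z: "(f s \<bullet> f s - 1)\<^sup>2 = 0 \<and> (p s \<bullet> p s - 1)\<^sup>2 = 0 \<and> (q s \<bullet> q s - 1)\<^sup>2 = 0 \<and> (f s \<bullet> p s)\<^sup>2 = 0 \<and> (f s \<bullet> q s)\<^sup>2 = 0 \<and> (p s \<bullet> q s)\<^sup>2 = 0"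
    unfolding S_def
    using zero_le_power2[of "f s \<bullet> f s - 1"] zero_le_power2[of "p s \<bullet> p s - 1"] zero_le_power2[of "q s \<bullet> q s - 1"]
      zero_le_power2[of "f s \<bullet> p s"] zero_le_power2[of "f s \<bullet> q s"] zero_le_power2[of "p s \<bullet> q s"]
    by linarith
  then show "f s \<bullet> f s = 1" "p s \<bullet> p s = 1" "q s \<bullet> q s = 1" "f s \<bullet> p s = 0" "f s \<bullet> q s = 0" "p s \<bullet> q s = 0" by auto
qed

lemma norms: "norm (f s) = 1" "norm (p s) = 1" "norm (q s) = 1"
  using orthonormal[of s] by (auto simp: norm_eq_1)

text \<open>The deviations of p x q, q x f and f x p from f, p and q satisfy the same skew-symmetric
  system as the frame itself. Their total square is therefore constant, and it is 0 at the start,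
  which fixes the orientation.\<close>

lemma frame_cross: "cross3 (f s) (p s) = q s"
proof -
  define a where "a s = cross3 (p s) (q s) - f s" for s
  define b where "b s = cross3 (q s) (f s) - p s" for s
  define d where "d s = cross3 (f s) (p s) - q s" for s
  let ?t = "\<lambda>s. \<beta> * s / 2"
  note cr = cross_add_left cross_add_right cross_mult_left cross_mult_right cross_minus_left cross_minus_right
    bounded_bilinear.diff_left[OF bounded_bilinear_cross3] bounded_bilinear.diff_right[OF bounded_bilinear_cross3]
  have da: "(a has_vector_derivative w s *\<^sub>R b s) (at s)" for s
  proof -
    have "(a has_vector_derivative (cross3 (p s) ((- ?t s) *\<^sub>R p s) + cross3 ((- w s) *\<^sub>R f s + ?t s *\<^sub>R q s) (q s)) - w s *\<^sub>R p s) (at s)"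
      unfolding a_def[abs_def] by (intro has_vector_derivative_diff has_vector_derivative_cross3 dfpq)
    moreover have "(cross3 (p s) ((- ?t s) *\<^sub>R p s) + cross3 ((- w s) *\<^sub>R f s + ?t s *\<^sub>R q s) (q s)) - w s *\<^sub>R p s = w s *\<^sub>R b s"
      using cross_skew[of "f s" "q s"] by (simp add: b_def cr algebra_simps)
    ultimately show ?thesis by simp
  qed
  have db: "(b has_vector_derivative ?t s *\<^sub>R d s - w s *\<^sub>R a s) (at s)" for s
  proof -
    have "(b has_vector_derivative (cross3 (q s) (w s *\<^sub>R p s) + cross3 ((- ?t s) *\<^sub>R p s) (f s)) - ((- w s) *\<^sub>R f s + ?t s *\<^sub>R q s)) (at s)"
      unfolding b_def[abs_def] by (intro has_vector_derivative_diff has_vector_derivative_cross3 dfpq)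
    moreover have "(cross3 (q s) (w s *\<^sub>R p s) + cross3 ((- ?t s) *\<^sub>R p s) (f s)) - ((- w s) *\<^sub>R f s + ?t s *\<^sub>R q s) = ?t s *\<^sub>R d s - w s *\<^sub>R a s"
      using cross_skew[of "q s" "p s"] cross_skew[of "p s" "f s"] by (simp add: a_def d_def cr algebra_simps)
    ultimately show ?thesis by simp
  qed
  have dd: "(d has_vector_derivative (- ?t s) *\<^sub>R b s) (at s)" for s
  proof -
    have "(d has_vector_derivative (cross3 (f s) ((- w s) *\<^sub>R f s + ?t s *\<^sub>R q s) + cross3 (w s *\<^sub>R p s) (p s)) - (- (?t s)) *\<^sub>R p s) (at s)"
      unfolding d_def[abs_def] by (intro has_vector_derivative_diff has_vector_derivative_cross3 dfpq)
    moreover have "(cross3 (f s) ((- w s) *\<^sub>R f s + ?t s *\<^sub>R q s) + cross3 (w s *\<^sub>R p s) (p s)) - (- (?t s)) *\<^sub>R p s = (- ?t s) *\<^sub>R b s"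
      using cross_skew[of "f s" "q s"] by (simp add: b_def cr algebra_simps)
    ultimately show ?thesis by simp
  qed
  define S where "S s = a s \<bullet> a s + b s \<bullet> b s + d s \<bullet> d s" for s
  have "(S has_real_derivative 0) (at s)" for s
    unfolding S_def[abs_def]
    by (rule DERIV_cong[OF DERIV_add[OF DERIV_add[OF has_vector_derivative_inner[OF da da] has_vector_derivative_inner[OF db db]]
          has_vector_derivative_inner[OF dd dd]]])
      (simp add: inner_diff_left inner_diff_right inner_commute algebra_simps)
  then have "S s = S 0" using DERIV_isconst_all by blast
  also have "S 0 = 0" unfolding S_def a_def b_def d_def dfpq(4-6)
    by (simp add: inner_vec_def sum_3 vector_3 cross3_def)
  finally have "a s \<bullet> a s + b s \<bullet> b s + d s \<bullet> d s = 0" by (simp add: S_def)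
  then have "d s \<bullet> d s = 0" using inner_ge_zero[of "a s"] inner_ge_zero[of "b s"] inner_ge_zero[of "d s"] by linarith
  then show ?thesis by (simp add: d_def)
qed

lemma f_limits:
  obtains A A' where "\<And>s. 0 \<le> s \<Longrightarrow> norm (f s - A) \<le> c * exp (1 / \<alpha>) * exp (- s)"
    "\<And>s. s \<le> 0 \<Longrightarrow> norm (f s - A') \<le> c * exp (1 / \<alpha>) * exp s"
proof (rule decay_limit[OF dfpq(1)])
  show "norm (w s *\<^sub>R p s) \<le> (c * exp (1 / \<alpha>)) * exp (- \<bar>s\<bar>)" for s
    using w_bound(1,3)[of s] by (simp add: norms)
qed (use that in blast)

text \<open>Each derivative of one frame vector involves the others, so the order of
  differentiability is raised for all three together.\<close>

lemma smooth_frame: "smooth1 UNIV (\<lambda>s. f s $ i)" "smooth1 UNIV (\<lambda>s. p s $ i)" "smooth1 UNIV (\<lambda>s. q s $ i)" "smooth1 UNIV w"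
proof -
  have "smooth1 UNIV (\<lambda>s. c * exp ((- \<alpha> / 4) * (s * s)))"
    by (intro smooth1_intros open_UNIV smooth1_comp[OF open_UNIV open_UNIV _ smooth1_exp]) auto
  then show w: "smooth1 UNIV w" by (simp add: w_def[abs_def] power2_eq_square)
  have t: "smooth1 UNIV (\<lambda>s. \<beta> / 2 * s)" by (intro smooth1_intros open_UNIV)
  note d = dfpq(1)[THEN has_vector_derivative_component[where i=i], simplified] dfpq(2)[THEN has_vector_derivative_component[where i=i], simplified] dfpq(3)[THEN has_vector_derivative_component[where i=i], simplified]
  have "Dk k UNIV (\<lambda>s. f s $ i) \<and> Dk k UNIV (\<lambda>s. p s $ i) \<and> Dk k UNIV (\<lambda>s. q s $ i)" for k
  proof (induction k)
    case (Suc k)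
    have w': "Dk k UNIV w" "Dk k UNIV (\<lambda>s. \<beta> / 2 * s)" using w t by (auto simp: smooth1_def)
    have "Dk (Suc k) UNIV (\<lambda>s. f s $ i)"
      by (rule Dk_SucI[where f'="\<lambda>s. w s * p s $ i"]) (use d(1) Suc w' in \<open>auto intro!: Dk_mult\<close>)
    moreover have "Dk (Suc k) UNIV (\<lambda>s. p s $ i)"
    proof (rule Dk_SucI[where f'="\<lambda>s. (- 1) * (w s * f s $ i) + (\<beta> / 2 * s) * q s $ i"])
      show "((\<lambda>s. p s $ i) has_real_derivative (- 1) * (w s * f s $ i) + (\<beta> / 2 * s) * q s $ i) (at s)" for s using d(2)[of s] by simp
      show "Dk k UNIV (\<lambda>s. (- 1) * (w s * f s $ i) + (\<beta> / 2 * s) * q s $ i)"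
        using Suc w' by (intro Dk_add Dk_mult Dk_const Dk_id open_UNIV) auto
    qed simp
    moreover have "Dk (Suc k) UNIV (\<lambda>s. q s $ i)"
    proof (rule Dk_SucI[where f'="\<lambda>s. (- 1) * ((\<beta> / 2 * s) * p s $ i)"])
      show "((\<lambda>s. q s $ i) has_real_derivative (- 1) * ((\<beta> / 2 * s) * p s $ i)) (at s)" for s using d(3)[of s] by simp
      show "Dk k UNIV (\<lambda>s. (- 1) * ((\<beta> / 2 * s) * p s $ i))"
        using Suc w' by (intro Dk_mult Dk_const Dk_id open_UNIV) auto
    qed simp
    ultimately show ?case by blast
  qed simp
  then show "smooth1 UNIV (\<lambda>s. f s $ i)" "smooth1 UNIV (\<lambda>s. p s $ i)" "smooth1 UNIV (\<lambda>s. q s $ i)" by (auto simp: smooth1_def)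
qed

end

text \<open>With equal constants this is uniqueness of the frame.\<close>

lemma frenet_compare:
  assumes "frenet \<alpha> c1 f1 p1 q1" "frenet \<alpha> c2 f2 p2 q2"
  shows "(norm (f1 s - f2 s))\<^sup>2 \<le> 8 * \<bar>c1 - c2\<bar> * exp (1 / \<alpha>)"
proof -
  interpret F1: frenet \<alpha> c1 f1 p1 q1 by fact
  interpret F2: frenet \<alpha> c2 f2 p2 q2 by fact
  let ?E = "\<lambda>s. exp (- \<alpha> * s\<^sup>2 / 4)" and ?t = "\<lambda>s. F1.\<beta> * s / 2"
  define S where "S s = (f1 s - f2 s) \<bullet> (f1 s - f2 s) + (p1 s - p2 s) \<bullet> (p1 s - p2 s) + (q1 s - q2 s) \<bullet> (q1 s - q2 s)" for s
  \<comment> \<open>In the derivative of the squared distance the skew-symmetric parts cancel. Only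
    the difference of the two curvatures acts, and it decays exponentially, so the bound is uniform
    on the whole line although the torsion is unbounded.\<close>
  let ?g = "\<lambda>s. 2 * (c1 - c2) * ?E s * ((f1 s - f2 s) \<bullet> p2 s - (p1 s - p2 s) \<bullet> f2 s)"
  have dS: "(S has_real_derivative ?g s) (at s)" for s
  proof -
    let ?k = "(c1 - c2) * ?E s"
    let ?u = "f1 s - f2 s" and ?v = "p1 s - p2 s" and ?y = "q1 s - q2 s"
    have k: "F1.w s - F2.w s = ?k" by (simp add: F1.w_def F2.w_def left_diff_distrib)
    have "F1.w s *\<^sub>R p1 s - F2.w s *\<^sub>R p2 s = F1.w s *\<^sub>R ?v + (F1.w s - F2.w s) *\<^sub>R p2 s"
      by (simp add: scaleR_diff_left scaleR_diff_right)
    then have u: "((\<lambda>s. f1 s - f2 s) has_vector_derivative F1.w s *\<^sub>R ?v + ?k *\<^sub>R p2 s) (at s)"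
      using has_vector_derivative_diff[OF F1.dfpq(1) F2.dfpq(1), of s] k by simp
    have "((- F1.w s) *\<^sub>R f1 s + ?t s *\<^sub>R q1 s) - ((- F2.w s) *\<^sub>R f2 s + ?t s *\<^sub>R q2 s)
        = (- F1.w s) *\<^sub>R ?u - (F1.w s - F2.w s) *\<^sub>R f2 s + ?t s *\<^sub>R ?y"
      by (simp add: scaleR_diff_left scaleR_diff_right)
    then have v: "((\<lambda>s. p1 s - p2 s) has_vector_derivative (- F1.w s) *\<^sub>R ?u - ?k *\<^sub>R f2 s + ?t s *\<^sub>R ?y) (at s)"
      using has_vector_derivative_diff[OF F1.dfpq(2) F2.dfpq(2), of s] k by simp
    have "(- ?t s) *\<^sub>R p1 s - (- ?t s) *\<^sub>R p2 s = (- ?t s) *\<^sub>R ?v" by (simp only: scaleR_diff_right)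
    then have y: "((\<lambda>s. q1 s - q2 s) has_vector_derivative (- ?t s) *\<^sub>R ?v) (at s)"
      using has_vector_derivative_diff[OF F1.dfpq(3) F2.dfpq(3), of s] by simp
    have id: "u \<bullet> (a *\<^sub>R v + k *\<^sub>R b') + (a *\<^sub>R v + k *\<^sub>R b') \<bullet> u
        + (v \<bullet> ((- a) *\<^sub>R u - k *\<^sub>R a' + t *\<^sub>R y) + ((- a) *\<^sub>R u - k *\<^sub>R a' + t *\<^sub>R y) \<bullet> v)
        + (y \<bullet> ((- t) *\<^sub>R v) + ((- t) *\<^sub>R v) \<bullet> y) = 2 * k * (u \<bullet> b' - v \<bullet> a')" for a k t :: real and u v y a' b' :: "real^3"
      by (simp add: inner_add_left inner_add_right inner_diff_left inner_diff_right inner_commute[of v u] inner_commute[of y v]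
        inner_commute[of b' u] inner_commute[of a' v] right_diff_distrib)
    show ?thesis unfolding S_def[abs_def]
      by (rule DERIV_cong[OF DERIV_add[OF DERIV_add[OF has_vector_derivative_inner[OF u u] has_vector_derivative_inner[OF v v]]
        has_vector_derivative_inner[OF y y]]]) (simp only: id mult.assoc)
  qed
  have bg: "norm (?g s) \<le> (8 * \<bar>c1 - c2\<bar> * exp (1 / \<alpha>)) * exp (- \<bar>s\<bar>)" for s
  proof -
    have "\<bar>(f1 s - f2 s) \<bullet> p2 s\<bar> \<le> 2" "\<bar>(p1 s - p2 s) \<bullet> f2 s\<bar> \<le> 2"
      using Cauchy_Schwarz_ineq2[of "f1 s - f2 s" "p2 s"] Cauchy_Schwarz_ineq2[of "p1 s - p2 s" "f2 s"]
        norm_triangle_ineq4[of "f1 s" "f2 s"] norm_triangle_ineq4[of "p1 s" "p2 s"] by (simp_all add: F1.norms F2.norms)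
    then have "\<bar>(f1 s - f2 s) \<bullet> p2 s - (p1 s - p2 s) \<bullet> f2 s\<bar> \<le> 4" by linarith
    then have "norm (?g s) \<le> 2 * \<bar>c1 - c2\<bar> * ?E s * 4" unfolding real_norm_def abs_mult by (intro mult_mono) auto
    also have "\<dots> \<le> 2 * \<bar>c1 - c2\<bar> * (exp (1 / \<alpha>) * exp (- \<bar>s\<bar>)) * 4"
      by (intro mult_right_mono mult_left_mono gaussian_le_exp F1.\<alpha>) auto
    finally show ?thesis by (simp add: mult_ac)
  qed
  note dS' = dS[unfolded has_real_derivative_iff_has_vector_derivative]
  have S0: "S 0 = 0" by (simp add: S_def F1.dfpq(4-6) F2.dfpq(4-6))
  have "norm (S s - S 0) \<le> 8 * \<bar>c1 - c2\<bar> * exp (1 / \<alpha>) * 1"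
  proof (cases "0 \<le> s")
    case True
    have "norm (S s - S 0) \<le> 8 * \<bar>c1 - c2\<bar> * exp (1 / \<alpha>) * (exp (- 0) - exp (- s))" by (rule decay_bound(1)[OF dS' bg]) (use True in auto)
    also have "\<dots> \<le> 8 * \<bar>c1 - c2\<bar> * exp (1 / \<alpha>) * 1" by (intro mult_left_mono) auto
    finally show ?thesis .
  next
    case False
    have "norm (S 0 - S s) \<le> 8 * \<bar>c1 - c2\<bar> * exp (1 / \<alpha>) * (exp 0 - exp s)" by (rule decay_bound(2)[OF dS' bg]) (use False in auto)
    also have "\<dots> \<le> 8 * \<bar>c1 - c2\<bar> * exp (1 / \<alpha>) * 1" by (intro mult_left_mono) auto
    finally show ?thesis by (simp add: norm_minus_commute)
  qed
  then have "S s \<le> 8 * \<bar>c1 - c2\<bar> * exp (1 / \<alpha>)" by (simp add: S0)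
  moreover have "(norm (f1 s - f2 s))\<^sup>2 \<le> S s" by (simp add: S_def power2_norm_eq_inner)
  ultimately show ?thesis by linarith
qed

lemma (in frenet) profile_eq: "profile \<alpha> c = f"
  unfolding profile_def
proof (rule the_equality)
  show "\<exists>p q. serret_frenet \<alpha> c f p q" using sf by blast
  fix g assume "\<exists>p q. serret_frenet \<alpha> c g p q"
  then obtain p' q' where "frenet \<alpha> c g p' q'" using \<alpha> c by (auto simp: frenet_def)
  then have "(norm (g s - f s))\<^sup>2 \<le> 0" for s
    using frenet_compare[of \<alpha> c g p' q' c f p q s] frenet_axioms by simp
  then have "g s = f s" for s by (metis eq_iff_diff_eq_0 norm_eq_zero power_eq_0_iff power2_less_eq_zero_iff zero_neq_numeral)
  then show "g = f" by blast
qed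

section \<open>Integration by parts against general test functions\<close>

lemma integrable_cont_supp:
  fixes u :: "real \<times> real \<Rightarrow> 'a::{banach, second_countable_topology}"
  assumes "continuous_on UNIV \<phi>" "supp_box a b c d \<phi>" "lbdd u"
  shows "integrable lborel (\<lambda>z. \<phi> z *\<^sub>R u z)"
proof -
  have "0 < c" using assms(2) by (simp add: supp_box_def)
  with assms(3) obtain B where B: "\<forall>x t. c \<le> t \<longrightarrow> norm (u (x, t)) \<le> B" unfolding lbdd_def by blast
  show ?thesis
  proof (rule integrable_compact_mult[OF assms(1)])
    show "compact ({a..b} \<times> {c..d})" by (intro compact_Times compact_Icc)
    show "\<phi> z = 0" if "z \<notin> {a..b} \<times> {c..d}" for z using assms(2) that by (cases z) (force simp: supp_box_def)
    show "u \<in> borel_measurable borel" using assms(3) by (simp add: lbdd_def)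
    show "norm (u z) \<le> B" if "z \<in> {a..b} \<times> {c..d}" for z using B that by (cases z) auto
  qed
qed

text \<open>\<open>test_function\<close> speaks of the derivatives taken in one order only, while a
  proof that something is a weak solution has to accept every such function. This class asks for a
  gradient everywhere and for continuity of just the one partial derivative \<open>D\<close> that is
  going to be integrated; it is stable under products with functions smooth for t > 0.\<close>

definition c1_supp :: "((real \<times> real \<Rightarrow> real) \<Rightarrow> real \<times> real \<Rightarrow> real) \<Rightarrow> (real \<times> real \<Rightarrow> real) \<Rightarrow> bool" where
  "c1_supp D \<phi> \<longleftrightarrow> (\<forall>z. has_grad \<phi> (dx \<phi> z) (dt \<phi> z) z) \<and> continuous_on UNIV (D \<phi>)
     \<and> (\<exists>a b c d. supp_box a b c d \<phi>)"

lemma c1_integral_zero: "c1_supp dt \<phi> \<Longrightarrow> (\<integral>z. dt \<phi> z \<partial>lborel) = 0" "c1_supp dx \<phi> \<Longrightarrow> (\<integral>z. dx \<phi> z \<partial>lborel) = 0"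
proof -
  show "(\<integral>z. dx \<phi> z \<partial>lborel) = 0" if assms: "c1_supp dx \<phi>"
  proof -
    obtain a b c d where s: "supp_box a b c d \<phi>" using assms by (auto simp: c1_supp_def)
    have g: "((\<lambda>y. \<phi> (y, t)) has_real_derivative dx \<phi> (x, t)) (at x)" for x t
      using has_grad_partial[of \<phi> "dx \<phi> (x, t)" "dt \<phi> (x, t)"] assms by (auto simp: c1_supp_def)
    have cd: "continuous_on UNIV (dx \<phi>)" using assms by (auto simp: c1_supp_def)
    have c: "continuous_on UNIV (\<lambda>x. dx \<phi> (x, t))" for t
      by (rule continuous_on_compose2[OF cd]; auto intro!: continuous_intros)
    have i: "integrable lborel (dx \<phi>)"
      using integrable_cont_supp[OF cd supp_box_dx(1)[OF s] lbdd_const[of "1::real"]] by auto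
    have z: "\<phi> (x, t) = 0" if "x < a \<or> b < x" for x t
      using s that unfolding supp_box_def by (metis not_le)
    have "(\<integral>x. dx \<phi> (x, t) \<partial>lborel) = \<phi> (max a b + 1, t) - \<phi> (min a b - 1, t)" for t
      by (rule integral_deriv[OF g c]) (use supp_box_dx(1)[OF s] in \<open>force simp: supp_box_def\<close>)+
    also have "\<phi> (max a b + 1, t) - \<phi> (min a b - 1, t) = 0" for t
    proof -
      have "b < max a b + 1" "min a b - 1 < a" by linarith+
      then show ?thesis using z by simp
    qed
    finally show ?thesis using fubini_time(1)[OF i] by simp
  qed
  show "(\<integral>z. dt \<phi> z \<partial>lborel) = 0" if assms: "c1_supp dt \<phi>"
  proof -
    obtain a b c d where s: "supp_box a b c d \<phi>" using assms by (auto simp: c1_supp_def)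
    have g: "((\<lambda>r. \<phi> (x, r)) has_real_derivative dt \<phi> (x, t)) (at t)" for x t
      using has_grad_partial[of \<phi> "dx \<phi> (x, t)" "dt \<phi> (x, t)"] assms by (auto simp: c1_supp_def)
    have cd: "continuous_on UNIV (dt \<phi>)" using assms by (auto simp: c1_supp_def)
    have c: "continuous_on UNIV (\<lambda>t. dt \<phi> (x, t))" for x
      by (rule continuous_on_compose2[OF cd]; auto intro!: continuous_intros)
    have i: "integrable lborel (dt \<phi>)"
      using integrable_cont_supp[OF cd supp_box_dx(2)[OF s] lbdd_const[of "1::real"]] by auto
    have z: "\<phi> (x, t) = 0" if "t < c \<or> d < t" for x t
      using s that unfolding supp_box_def by (metis not_le)
    have "(\<integral>t. dt \<phi> (x, t) \<partial>lborel) = \<phi> (x, max c d + 1) - \<phi> (x, min c d - 1)" for x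
      by (rule integral_deriv[OF g c]) (use supp_box_dx(2)[OF s] in \<open>force simp: supp_box_def\<close>)+
    also have "\<phi> (x, max c d + 1) - \<phi> (x, min c d - 1) = 0" for x
    proof -
      have "d < max c d + 1" "min c d - 1 < c" by linarith+
      then show ?thesis using z by simp
    qed
    finally have "(\<integral>t. dt \<phi> (x, t) \<partial>lborel) = 0" for x .
    moreover have "integrable (lborel \<Otimes>\<^sub>M lborel) (\<lambda>(x, y). dt \<phi> (x, y))" using i by (simp add: lborel_prod)
    ultimately show ?thesis
      using lborel_pair.integral_fst[of "\<lambda>x t. dt \<phi> (x, t)"] by (simp add: lborel_prod)
  qed
qed

lemma supp_box_zero: "supp_box a b c d \<phi> \<Longrightarrow> snd z < c \<Longrightarrow> \<phi> z = 0"
  by (cases z) (force simp: supp_box_def)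

lemma c1_continuous: assumes "c1_supp D \<phi>" shows "continuous_on UNIV \<phi>"
proof (intro continuous_at_imp_continuous_on ballI)
  fix z have "has_grad \<phi> (dx \<phi> z) (dt \<phi> z) z" using assms unfolding c1_supp_def by blast
  then show "isCont \<phi> z" by (rule has_derivative_continuous)
qed

text \<open>Below the support in time the product vanishes on an open set, whatever \<open>v\<close>
  is there. This covers the points t <= 0, where \<open>v\<close> need not even be continuous, and
  continuity is glued from the two open sets.\<close>

lemma c1_mult:
  assumes \<phi>: "c1_supp D \<phi>" and v: "smooth2 half_plane v"
  shows "c1_supp dx \<phi> \<Longrightarrow> c1_supp dx (\<lambda>z. \<phi> z * v z)" "c1_supp dt \<phi> \<Longrightarrow> c1_supp dt (\<lambda>z. \<phi> z * v z)"
    "dx (\<lambda>z. \<phi> z * v z) z = dx \<phi> z * v z + \<phi> z * dx v z"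
    "dt (\<lambda>z. \<phi> z * v z) z = dt \<phi> z * v z + \<phi> z * dt v z"
proof -
  obtain a b c d where s: "supp_box a b c d \<phi>" using \<phi> by (auto simp: c1_supp_def)
  have c0: "0 < c" using s by (simp add: supp_box_def)
  have g: "has_grad (\<lambda>z. \<phi> z * v z) (dx \<phi> z * v z + \<phi> z * dx v z) (dt \<phi> z * v z + \<phi> z * dt v z) z" for z
  proof (cases "z \<in> half_plane")
    case True
    have "\<forall>z. has_grad \<phi> (dx \<phi> z) (dt \<phi> z) z" using \<phi> unfolding c1_supp_def by blast
    from has_grad_mult[OF spec[OF this] smooth2D(1)[OF v True]] show ?thesis .
  next
    case False
    then have sz: "snd z < c" using c0 by simp
    have o: "open {z::real\<times>real. snd z < c}" by (intro open_Collect_less continuous_intros)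
    have "has_grad (\<lambda>z. \<phi> z * v z) 0 0 z"
      by (rule has_derivative_transform_within_open[of "\<lambda>_. 0", OF _ o]) (use sz supp_box_zero[OF s] in auto)
    then show ?thesis
      using supp_box_zero[OF s sz] supp_box_zero[OF supp_box_dx(1)[OF s] sz] supp_box_zero[OF supp_box_dx(2)[OF s] sz] by simp
  qed
  show d: "dx (\<lambda>z. \<phi> z * v z) z = dx \<phi> z * v z + \<phi> z * dx v z"
    "dt (\<lambda>z. \<phi> z * v z) z = dt \<phi> z * v z + \<phi> z * dt v z" for z
    using has_grad_dx_dt[OF g] by auto
  note c\<phi> = c1_continuous[OF \<phi>]
  have cont: "continuous_on UNIV (\<lambda>z. k z * v z + \<phi> z * v' z)"
    if k: "continuous_on UNIV k" "supp_box a b c d k" and v': "continuous_on half_plane v'" for k v'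
  proof -
    have o: "open {z::real\<times>real. snd z < c}" by (intro open_Collect_less continuous_intros)
    have "continuous_on half_plane (\<lambda>z. k z * v z + \<phi> z * v' z)"
      using continuous_on_subset[OF k(1)] continuous_on_subset[OF c\<phi>]
      by (intro continuous_on_add continuous_on_mult v' smooth2_continuous[OF v]) auto
    moreover have "continuous_on {z. snd z < c} (\<lambda>z. k z * v z + \<phi> z * v' z)"
    proof (rule continuous_on_eq[of _ "\<lambda>_. 0"])
      show "0 = k z * v z + \<phi> z * v' z" if "z \<in> {z. snd z < c}" for z
        using supp_box_zero[OF s, of z] supp_box_zero[OF k(2), of z] that by simp
    qed simp
    ultimately have "continuous_on (half_plane \<union> {z. snd z < c}) (\<lambda>z. k z * v z + \<phi> z * v' z)"
      by (rule continuous_on_open_Un[OF open_half_plane o])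
    moreover have "half_plane \<union> {z. snd z < c} = UNIV" using c0 by auto
    ultimately show ?thesis by simp
  qed
  have "supp_box a b c d (\<lambda>z. \<phi> z * v z)" using s by (auto simp: supp_box_def)
  moreover have "continuous_on UNIV (dx (\<lambda>z. \<phi> z * v z))" if "c1_supp dx \<phi>"
    unfolding d[abs_def]
    using cont[OF _ supp_box_dx(1)[OF s] smooth2_continuous[OF smooth2D(2)[OF v]]] that by (auto simp: c1_supp_def)
  moreover have "continuous_on UNIV (dt (\<lambda>z. \<phi> z * v z))" if "c1_supp dt \<phi>"
    unfolding d[abs_def]
    using cont[OF _ supp_box_dx(2)[OF s] smooth2_continuous[OF smooth2D(3)[OF v]]] that by (auto simp: c1_supp_def)
  ultimately show "c1_supp dx \<phi> \<Longrightarrow> c1_supp dx (\<lambda>z. \<phi> z * v z)" "c1_supp dt \<phi> \<Longrightarrow> c1_supp dt (\<lambda>z. \<phi> z * v z)"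
    using g unfolding c1_supp_def d by blast+
qed

lemma integrable_c1:
  fixes u :: "real \<times> real \<Rightarrow> 'a::{banach, second_countable_topology}"
  assumes "c1_supp D \<phi>" "lbdd u"
  shows "integrable lborel (\<lambda>z. \<phi> z *\<^sub>R u z)" "c1_supp dx \<phi> \<Longrightarrow> integrable lborel (\<lambda>z. dx \<phi> z *\<^sub>R u z)"
    "c1_supp dt \<phi> \<Longrightarrow> integrable lborel (\<lambda>z. dt \<phi> z *\<^sub>R u z)"
proof -
  obtain a b c d where s: "supp_box a b c d \<phi>" using assms by (auto simp: c1_supp_def)
  show "integrable lborel (\<lambda>z. \<phi> z *\<^sub>R u z)" "c1_supp dx \<phi> \<Longrightarrow> integrable lborel (\<lambda>z. dx \<phi> z *\<^sub>R u z)"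
    "c1_supp dt \<phi> \<Longrightarrow> integrable lborel (\<lambda>z. dt \<phi> z *\<^sub>R u z)"
    using integrable_cont_supp[OF c1_continuous[OF assms(1)] s assms(2)] integrable_cont_supp[OF _ supp_box_dx(1)[OF s] assms(2)]
      integrable_cont_supp[OF _ supp_box_dx(2)[OF s] assms(2)] by (auto simp: c1_supp_def)
qed

lemma c1_zero:
  assumes "c1_supp D \<phi>" "\<not> 0 < snd z" shows "\<phi> z = 0" "dx \<phi> z = 0" "dt \<phi> z = 0"
proof -
  obtain a b c d where s: "supp_box a b c d \<phi>" using assms(1) by (auto simp: c1_supp_def)
  have z: "snd z < c" using s assms(2) by (simp add: supp_box_def)
  show "\<phi> z = 0" "dx \<phi> z = 0" "dt \<phi> z = 0"
    using supp_box_zero[OF s z] supp_box_zero[OF supp_box_dx(1)[OF s] z] supp_box_zero[OF supp_box_dx(2)[OF s] z] by auto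
qed

lemma lbdd_nth:
  fixes u :: "real \<times> real \<Rightarrow> real^3"
  shows "lbdd u \<Longrightarrow> lbdd (\<lambda>z. u z $ i)"
  using lbdd_inner[OF lbdd_const[of "axis i 1"], of u] by (simp add: inner_axis')

lemma integral_nth:
  fixes u :: "'a \<Rightarrow> real^3"
  assumes "integrable M u" shows "(\<integral>z. u z \<partial>M) $ i = (\<integral>z. u z $ i \<partial>M)"
  using integral_inner_right[of "axis i 1" M u] assms by (simp add: inner_axis')

lemma by_parts_dx:
  fixes v vx :: "real \<times> real \<Rightarrow> real^3"
  assumes \<phi>: "c1_supp dx \<phi>" and v: "\<And>i. smooth2 half_plane (\<lambda>z. v z $ i)" and l: "lbdd v"
    and lx: "lbdd vx" and d: "\<And>z i. 0 < snd z \<Longrightarrow> dx (\<lambda>z. v z $ i) z = vx z $ i"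
  shows "(\<integral>z. dx \<phi> z *\<^sub>R v z \<partial>lborel) = - (\<integral>z. \<phi> z *\<^sub>R vx z \<partial>lborel)"
proof -
  have r: "integrable lborel (\<lambda>z. \<phi> z * u z)" "integrable lborel (\<lambda>z. dx \<phi> z * u z)" if "lbdd u" for u :: "real \<times> real \<Rightarrow> real"
    using integrable_c1(1)[OF \<phi> that] integrable_c1(2)[OF \<phi> that \<phi>] by simp_all
  have "(\<integral>z. dx \<phi> z * v z $ i \<partial>lborel) + (\<integral>z. \<phi> z * vx z $ i \<partial>lborel) = 0" for i
  proof -
    have "dx (\<lambda>z. \<phi> z * v z $ i) z = dx \<phi> z * v z $ i + \<phi> z * vx z $ i" for z
      using c1_mult(3)[OF \<phi> v, of i z] d[of z i] c1_zero[OF \<phi>, of z] by (cases "0 < snd z") auto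
    then have "(\<integral>z. dx \<phi> z * v z $ i + \<phi> z * vx z $ i \<partial>lborel) = 0"
      using c1_integral_zero(2)[OF c1_mult(1)[OF \<phi> v \<phi>], of i] by simp
    then show ?thesis using Bochner_Integration.integral_add[OF r(2)[OF lbdd_nth[OF l]] r(1)[OF lbdd_nth[OF lx]], of i i] by simp
  qed
  then have "(\<integral>z. dx \<phi> z *\<^sub>R v z \<partial>lborel) $ i = (- (\<integral>z. \<phi> z *\<^sub>R vx z \<partial>lborel)) $ i" for i
    using integral_nth[OF integrable_c1(2)[OF \<phi> l \<phi>], of i] integral_nth[OF integrable_c1(1)[OF \<phi> lx], of i] by (simp add: eq_neg_iff_add_eq_0)
  then show ?thesis by (simp add: vec_eq_iff)
qed

lemma by_parts_dt:
  fixes v vt :: "real \<times> real \<Rightarrow> real^3"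
  assumes \<phi>: "c1_supp dt \<phi>" and v: "\<And>i. smooth2 half_plane (\<lambda>z. v z $ i)" and l: "lbdd v"
    and lx: "lbdd vt" and d: "\<And>z i. 0 < snd z \<Longrightarrow> dt (\<lambda>z. v z $ i) z = vt z $ i"
  shows "(\<integral>z. dt \<phi> z *\<^sub>R v z \<partial>lborel) = - (\<integral>z. \<phi> z *\<^sub>R vt z \<partial>lborel)"
proof -
  have r: "integrable lborel (\<lambda>z. \<phi> z * u z)" "integrable lborel (\<lambda>z. dt \<phi> z * u z)" if "lbdd u" for u :: "real \<times> real \<Rightarrow> real"
    using integrable_c1(1)[OF \<phi> that] integrable_c1(3)[OF \<phi> that \<phi>] by simp_all
  have "(\<integral>z. dt \<phi> z * v z $ i \<partial>lborel) + (\<integral>z. \<phi> z * vt z $ i \<partial>lborel) = 0" for i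
  proof -
    have "dt (\<lambda>z. \<phi> z * v z $ i) z = dt \<phi> z * v z $ i + \<phi> z * vt z $ i" for z
      using c1_mult(4)[OF \<phi> v, of i z] d[of z i] c1_zero[OF \<phi>, of z] by (cases "0 < snd z") auto
    then have "(\<integral>z. dt \<phi> z * v z $ i + \<phi> z * vt z $ i \<partial>lborel) = 0"
      using c1_integral_zero(1)[OF c1_mult(2)[OF \<phi> v \<phi>], of i] by simp
    then show ?thesis using Bochner_Integration.integral_add[OF r(2)[OF lbdd_nth[OF l]] r(1)[OF lbdd_nth[OF lx]], of i i] by simp
  qed
  then have "(\<integral>z. dt \<phi> z *\<^sub>R v z \<partial>lborel) $ i = (- (\<integral>z. \<phi> z *\<^sub>R vt z \<partial>lborel)) $ i" for i
    using integral_nth[OF integrable_c1(3)[OF \<phi> l \<phi>], of i] integral_nth[OF integrable_c1(1)[OF \<phi> lx], of i] by (simp add: eq_neg_iff_add_eq_0)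
  then show ?thesis by (simp add: vec_eq_iff)
qed

lemma compact_half_plane_box:
  fixes K :: "(real \<times> real) set"
  assumes K: "compact K" "K \<subseteq> half_plane" shows "\<exists>a b c d. 0 < c \<and> K \<subseteq> {a..b} \<times> {c..d}"
proof (cases "K = {}")
  case True
  then show ?thesis by (intro exI[of _ 1]) auto
next
  case False
  obtain B where B: "\<And>z. z \<in> K \<Longrightarrow> norm z \<le> B" using compact_imp_bounded[OF K(1)] by (auto simp: bounded_iff)
  obtain z0 where z0: "z0 \<in> K" "\<And>z. z \<in> K \<Longrightarrow> snd z0 \<le> snd z"
    using continuous_attains_inf[OF K(1) False continuous_on_snd[OF continuous_on_id]] by blast
  have "K \<subseteq> {- B..B} \<times> {snd z0..B}"
  proof
    fix z assume k: "z \<in> K"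
    obtain x t where z: "z = (x, t)" by (cases z)
    have "\<bar>x\<bar> \<le> B" "\<bar>t\<bar> \<le> B" using B[OF k] norm_fst_le[of x t] norm_snd_le[of t x] z by auto
    then show "z \<in> {- B..B} \<times> {snd z0..B}" using z0(2)[OF k] z by auto
  qed
  moreover have "0 < snd z0" using z0(1) K(2) by auto
  ultimately show ?thesis by blast
qed

lemma test_function_c1:
  assumes "test_function \<phi>" shows "c1_supp dx \<phi>" "c1_supp dt \<phi>" "c1_supp dx (dx \<phi>)"
proof -
  have df: "(dx ^^ i) ((dt ^^ j) \<phi>) differentiable_on UNIV" for i j using assms by (simp add: test_function_def)
  have d: "g differentiable_on UNIV \<Longrightarrow> (\<forall>z. has_grad g (dx g z) (dt g z) z) \<and> continuous_on UNIV g" for g :: "real \<times> real \<Rightarrow> real"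
    using differentiable_has_grad[of g] by (auto simp: differentiable_on_def intro!: differentiable_imp_continuous_on)
  have d00: "\<phi> differentiable_on UNIV" and d10: "dx \<phi> differentiable_on UNIV" and d01: "dt \<phi> differentiable_on UNIV" and d20: "dx (dx \<phi>) differentiable_on UNIV"
    using df[of 0 0] df[of 1 0] df[of 0 1] df[of 2 0] by (simp_all add: numeral_2_eq_2)
  have "compact (closure {z. \<phi> z \<noteq> 0})" "closure {z. \<phi> z \<noteq> 0} \<subseteq> half_plane" using assms by (auto simp: test_function_def)
  from compact_half_plane_box[OF this] obtain a b c d' where b: "0 < c" "closure {z. \<phi> z \<noteq> 0} \<subseteq> {a..b} \<times> {c..d'}" by (elim exE conjE)
  have s: "supp_box a b c d' \<phi>" unfolding supp_box_def
  proof (intro conjI allI impI b(1))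
    fix x t assume "\<phi> (x, t) \<noteq> 0"
    then have "(x, t) \<in> {a..b} \<times> {c..d'}" using closure_subset[of "{z. \<phi> z \<noteq> 0}"] b(2) by fast
    then show "a \<le> x" "x \<le> b" "c \<le> t" "t \<le> d'" by auto
  qed
  show "c1_supp dx \<phi>" "c1_supp dt \<phi>" unfolding c1_supp_def using d[OF d00] d[OF d10] d[OF d01] s by blast+
  show "c1_supp dx (dx \<phi>)" unfolding c1_supp_def using d[OF d10] d[OF d20] supp_box_dx(1)[OF s] by blast
qed

lemma nn_exp_abs:
  assumes k: "0 < k" shows "(\<integral>\<^sup>+x. ennreal (exp (- \<bar>x\<bar> / k)) \<partial>lborel) \<le> ennreal (2 * k)"
proof -
  let ?f = "\<lambda>x::real. ennreal (exp (- \<bar>x\<bar>))"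
  have "(\<integral>\<^sup>+x. ennreal (exp (- x)) * indicator {0..} x \<partial>lborel) = ennreal (0 - (- exp (- 0)))"
  proof (rule nn_integral_FTC_atLeast)
    show "((\<lambda>x::real. - exp (- x)) \<longlongrightarrow> 0) at_top"
      using tendsto_minus[OF filterlim_compose[OF exp_at_bot filterlim_uminus_at_bot_at_top]] by simp
  qed (auto intro!: derivative_eq_intros)
  moreover have "(\<integral>\<^sup>+x. ennreal (exp (- x)) * indicator {0..} x \<partial>lborel) = (\<integral>\<^sup>+x. ?f x * indicator {0..} x \<partial>lborel)"
    by (intro nn_integral_cong) (auto simp: indicator_def)
  ultimately have p: "(\<integral>\<^sup>+x. ?f x * indicator {0..} x \<partial>lborel) = 1" by simp
  have "(\<integral>\<^sup>+x. ?f x * indicator {..0} x \<partial>lborel) = (\<integral>\<^sup>+x. ?f (0 + - 1 * x) * indicator {..0} (0 + - 1 * x) \<partial>lborel)"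
    using nn_integral_real_affine[of "\<lambda>x. ?f x * indicator {..0} x" "-1" 0] by simp
  also have "\<dots> = (\<integral>\<^sup>+x. ?f x * indicator {0..} x \<partial>lborel)"
    by (intro nn_integral_cong) (auto simp: indicator_def)
  finally have m: "(\<integral>\<^sup>+x. ?f x * indicator {..0} x \<partial>lborel) = 1" using p by simp
  have "(\<integral>\<^sup>+x. ?f x \<partial>lborel) \<le> (\<integral>\<^sup>+x. ?f x * indicator {0..} x + ?f x * indicator {..0} x \<partial>lborel)"
    by (intro nn_integral_mono) (auto simp: indicator_def)
  also have "\<dots> = 1 + 1" by (subst nn_integral_add) (auto simp: p m)
  finally have I: "(\<integral>\<^sup>+x. ?f x \<partial>lborel) \<le> 2" by simp
  have "(\<integral>\<^sup>+x. ennreal (exp (- \<bar>x\<bar> / k)) \<partial>lborel) = ennreal k * (\<integral>\<^sup>+x. ennreal (exp (- \<bar>0 + k * x\<bar> / k)) \<partial>lborel)"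
    using nn_integral_real_affine[of "\<lambda>x. ennreal (exp (- \<bar>x\<bar> / k))" k 0] k by simp
  also have "(\<integral>\<^sup>+x. ennreal (exp (- \<bar>0 + k * x\<bar> / k)) \<partial>lborel) = (\<integral>\<^sup>+x. ?f x \<partial>lborel)"
    using k by (intro nn_integral_cong) (simp add: abs_mult)
  also have "ennreal k * \<dots> \<le> ennreal k * 2" using I by (intro mult_left_mono) auto
  also have "\<dots> = ennreal (2 * k)" using k by (simp add: ennreal_mult mult.commute)
  finally show ?thesis .
qed

lemma ennsqrt_le: "a \<le> ennreal (b\<^sup>2) \<Longrightarrow> 0 \<le> b \<Longrightarrow> ennsqrt a \<le> ennreal b"
proof -
  assume a: "a \<le> ennreal (b\<^sup>2)" and b: "0 \<le> b"
  then have t: "a \<noteq> \<infinity>" using neq_top_trans[of "ennreal (b\<^sup>2)" a] by simp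
  have "enn2real a \<le> b\<^sup>2" using a by (simp add: enn2real_leI)
  then have "sqrt (enn2real a) \<le> b" using b by (simp add: real_le_lsqrt)
  then show ?thesis using t by (simp add: ennsqrt_def ennreal_leI)
qed

lemma set_integral_half_plane:
  fixes h :: "real \<times> real \<Rightarrow> real^3"
  assumes "\<And>z. \<not> 0 < snd z \<Longrightarrow> h z = 0"
  shows "(LINT z:half_plane|lborel. h z) = (\<integral>z. h z \<partial>lborel)"
  unfolding set_lebesgue_integral_def
  by (intro Bochner_Integration.integral_cong) (use assms in \<open>auto simp: indicator_def\<close>)

lemma lbddI:
  assumes m: "u \<in> borel_measurable borel" and b: "\<And>x t. 0 < t \<Longrightarrow> norm (u (x, t)) \<le> A + B / t" and B: "0 \<le> B"
  shows "lbdd u"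
  unfolding lbdd_def
proof (intro conjI m allI impI)
  fix c :: real assume c: "0 < c"
  have "norm (u (x, t)) \<le> A + B / c" if "c \<le> t" for x t
    using order_trans[OF b[of t x]] frac_le[OF B order_refl c that] that c by simp
  then show "\<exists>K. \<forall>x t. c \<le> t \<longrightarrow> norm (u (x, t)) \<le> K" by blast
qed

section \<open>Self-similar waves\<close>

abbreviation scale :: "real \<times> real \<Rightarrow> real" where "scale z \<equiv> fst z / sqrt (snd z)"

lemma has_grad_rsqrt: "0 < snd z \<Longrightarrow> has_grad (\<lambda>z. inverse (sqrt (snd z))) 0 (- (inverse (sqrt (snd z)) / (2 * snd z))) z"
proof -
  assume t: "0 < snd z"
  have s: "has_grad snd 0 1 z" by (auto intro!: derivative_eq_intros)
  have d: "((\<lambda>t. inverse (sqrt t)) has_real_derivative - (inverse (sqrt t) / (2 * t))) (at t)" if "0 < t" for t :: real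
  proof -
    have e: "sqrt t ^ 2 = t" using that by simp
    have "((\<lambda>t. inverse (sqrt t)) has_real_derivative - (inverse (sqrt t) * (inverse (sqrt t) / 2) * inverse (sqrt t))) (at t)"
      by (rule DERIV_inverse'[OF DERIV_real_sqrt[OF that]]) (use that in simp)
    moreover have "inverse (sqrt t) * (inverse (sqrt t) / 2) * inverse (sqrt t) = inverse (sqrt t) / (2 * t)"
      by (subst (4) e[symmetric]) (simp add: field_simps power2_eq_square)
    ultimately show ?thesis by (simp only:)
  qed
  show ?thesis using has_grad_comp[OF s d[OF t]] by simp
qed

lemma has_grad_scale: "0 < snd z \<Longrightarrow> has_grad scale (inverse (sqrt (snd z))) (- (scale z / (2 * snd z))) z"
proof -
  assume t: "0 < snd z"
  have f: "has_grad fst 1 0 z" by (auto intro!: derivative_eq_intros)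
  have a: "1 * inverse (sqrt (snd z)) + fst z * 0 = inverse (sqrt (snd z))" by simp
  have b: "0 * inverse (sqrt (snd z)) + fst z * - (inverse (sqrt (snd z)) / (2 * snd z)) = - (scale z / (2 * snd z))"
    unfolding divide_inverse by simp
  show ?thesis using has_grad_mult[OF f has_grad_rsqrt[OF t]] unfolding a b unfolding divide_inverse .
qed

lemma smooth2_rsqrt: "smooth2 half_plane (\<lambda>z. inverse (sqrt (snd z)))"
proof -
  have "smooth2 half_plane (\<lambda>z. snd z powr (- (1/2)))"
    by (rule smooth2_comp[OF open_half_plane open_greaterThan[of 0] _ smooth1_powr]) (auto intro: smooth2_intros open_half_plane)
  moreover have "snd z powr (- (1/2)) = inverse (sqrt (snd z))" if "z \<in> half_plane" for z
    using that by (simp add: powr_minus powr_half_sqrt)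
  ultimately show ?thesis using Ck_cong[OF open_half_plane, of "\<lambda>z. snd z powr (- (1/2))" "\<lambda>z. inverse (sqrt (snd z))"]
    by (simp add: smooth2_def)
qed

lemma smooth2_scale: "smooth1 UNIV g \<Longrightarrow> smooth2 half_plane (\<lambda>z. g (scale z))"
proof -
  assume g: "smooth1 UNIV g"
  have "smooth2 half_plane (\<lambda>z. fst z * inverse (sqrt (snd z)))"
    by (intro smooth2_intros open_half_plane smooth2_rsqrt)
  then have "smooth2 half_plane scale" unfolding divide_inverse .
  then show ?thesis by (intro smooth2_comp[OF open_half_plane open_UNIV _ g]) auto
qed

lemma scale_measurable: "scale \<in> borel_measurable borel"
  by (intro borel_measurable_divide borel_measurable_continuous_onI continuous_intros)

lemma compose_scale_measurable:
  fixes g :: "real \<Rightarrow> 'a::topological_space"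
  assumes "continuous_on UNIV g" shows "(\<lambda>z. g (scale z)) \<in> borel_measurable borel"
  using measurable_compose[OF scale_measurable borel_measurable_continuous_onI[OF assms]] .

text \<open>The properties of a frame that survive a rotation. The initial values of
  \<open>serret_frenet\<close> do not survive, so they are replaced by orthonormality, orientation
  and the two limits. The constant \<open>\<kappa>\<close> is exp (1 / \<alpha>) in the
  application.\<close>

locale wave =
  fixes \<alpha> \<beta> c \<kappa> :: real and w :: "real \<Rightarrow> real" and u v y :: "real \<Rightarrow> real^3" and Ap Am :: "real^3"
  assumes \<alpha>: "0 < \<alpha>" "\<alpha> \<le> 1" and \<beta>: "\<beta> = sqrt (1 - \<alpha>\<^sup>2)" and c: "0 \<le> c" and \<kappa>: "0 \<le> \<kappa>"
    and w_bound: "\<And>s. 0 \<le> w s" "\<And>s. w s \<le> c" "\<And>s. w s \<le> c * \<kappa> * exp (- \<bar>s\<bar>)"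
    and dw: "\<And>s. (w has_real_derivative - (\<alpha> * s / 2) * w s) (at s)"
    and duvy: "\<And>s. (u has_vector_derivative w s *\<^sub>R v s) (at s)"
      "\<And>s. (v has_vector_derivative (- w s) *\<^sub>R u s + (\<beta> * s / 2) *\<^sub>R y s) (at s)"
      "\<And>s. (y has_vector_derivative (- (\<beta> * s / 2)) *\<^sub>R v s) (at s)"
    and norms: "\<And>s. norm (u s) = 1" "\<And>s. norm (v s) = 1" "\<And>s. norm (y s) = 1"
    and uv: "\<And>s. u s \<bullet> v s = 0" and cross_uv: "\<And>s. cross3 (u s) (v s) = y s"
    and smooth_uvy: "\<And>i. smooth1 UNIV (\<lambda>s. u s $ i)" "\<And>i. smooth1 UNIV (\<lambda>s. v s $ i)" "\<And>i. smooth1 UNIV (\<lambda>s. y s $ i)" "smooth1 UNIV w"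
    and lim: "\<And>s. 0 \<le> s \<Longrightarrow> norm (u s - Ap) \<le> c * \<kappa> * exp (- s)" "\<And>s. s \<le> 0 \<Longrightarrow> norm (u s - Am) \<le> c * \<kappa> * exp s"
begin

definition n :: "real \<times> real \<Rightarrow> real^3" where "n z = u (scale z)"
definition nx :: "real \<times> real \<Rightarrow> real^3" where "nx z = (inverse (sqrt (snd z)) * w (scale z)) *\<^sub>R v (scale z)"
definition nt :: "real \<times> real \<Rightarrow> real^3" where "nt z = (- (scale z / (2 * snd z)) * w (scale z)) *\<^sub>R v (scale z)"
definition F :: "real \<times> real \<Rightarrow> real^3" where
  "F z = (inverse (sqrt (snd z)) * w (scale z)) *\<^sub>R (\<beta> *\<^sub>R y (scale z) + \<alpha> *\<^sub>R v (scale z))"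
definition Fx :: "real \<times> real \<Rightarrow> real^3" where
  "Fx z = inverse (snd z) *\<^sub>R ((- (scale z / 2 * w (scale z))) *\<^sub>R v (scale z) - (\<alpha> * (w (scale z))\<^sup>2) *\<^sub>R u (scale z))"

lemma \<beta>01: "0 \<le> \<beta>" "\<beta> \<le> 1" "\<beta>\<^sup>2 = 1 - \<alpha>\<^sup>2"
proof -
  have "0 \<le> 1 - \<alpha>\<^sup>2" "1 - \<alpha>\<^sup>2 \<le> 1" using \<alpha> by (simp_all add: power_le_one)
  then show "0 \<le> \<beta>" "\<beta> \<le> 1" "\<beta>\<^sup>2 = 1 - \<alpha>\<^sup>2" by (simp_all add: \<beta>)
qed

lemma n_smooth: "smooth2 half_plane (\<lambda>z. n z $ i)"
  unfolding n_def by (rule smooth2_scale[OF smooth_uvy(1)])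

lemma F_smooth: "smooth2 half_plane (\<lambda>z. F z $ i)"
proof -
  have "smooth1 UNIV (\<lambda>s. w s * (\<beta> * y s $ i + \<alpha> * v s $ i))" by (intro smooth1_intros open_UNIV smooth_uvy)
  from smooth2_intros(5)[OF open_half_plane smooth2_rsqrt smooth2_scale[OF this]] show ?thesis
    by (simp add: F_def mult.assoc)
qed

lemma dx_n: "0 < snd z \<Longrightarrow> dx (\<lambda>z. n z $ i) z = nx z $ i" and dt_n: "0 < snd z \<Longrightarrow> dt (\<lambda>z. n z $ i) z = nt z $ i"
proof -
  assume t: "0 < snd z"
  from has_grad_dx_dt[OF has_grad_comp[OF has_grad_scale[OF t] has_vector_derivative_component[OF duvy(1), where i=i]]]
  show "dx (\<lambda>z. n z $ i) z = nx z $ i" "dt (\<lambda>z. n z $ i) z = nt z $ i"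
    by (simp_all add: n_def nx_def nt_def)
qed

text \<open>The heart of the fact that the profile solves the equation. The drift term - (s / 2) w v
  appears with weight \<beta>^2 from the derivative of \<open>y\<close> and with weight \<alpha>^2
  from that of the Gaussian \<open>w\<close>; since \<alpha>^2 + \<beta>^2 = 1 the sum is exactly
  n_t, apart from the curvature term.\<close>

lemma dx_F: "0 < snd z \<Longrightarrow> dx (\<lambda>z. F z $ i) z = Fx z $ i"
proof -
  assume t: "0 < snd z"
  let ?g = "\<lambda>s. w s * (\<beta> * y s $ i + \<alpha> * v s $ i)"
  have id: "w * (\<beta> * (- (\<beta> * s / 2) * v) + \<alpha> * (- w * u + \<beta> * s / 2 * y)) + - (\<alpha> * s / 2) * w * (\<beta> * y + \<alpha> * v)
      = - (s / 2 * w) * v - \<alpha> * w\<^sup>2 * u" for w s u v y :: real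
  proof -
    have "w * (\<beta> * (- (\<beta> * s / 2) * v) + \<alpha> * (- w * u + \<beta> * s / 2 * y)) + - (\<alpha> * s / 2) * w * (\<beta> * y + \<alpha> * v)
      = - (s / 2 * w) * v * (\<beta>\<^sup>2 + \<alpha>\<^sup>2) - \<alpha> * w\<^sup>2 * u" by (simp add: field_simps power2_eq_square)
    then show ?thesis using \<beta>01(3) by simp
  qed
  have g: "(?g has_real_derivative - (s / 2 * w s) * v s $ i - \<alpha> * (w s)\<^sup>2 * u s $ i) (at s)" for s
  proof -
    have "(?g has_real_derivative w s * (\<beta> * (((- (\<beta> * s / 2)) *\<^sub>R v s) $ i) + \<alpha> * (((- w s) *\<^sub>R u s + (\<beta> * s / 2) *\<^sub>R y s) $ i))
        + (- (\<alpha> * s / 2) * w s) * (\<beta> * y s $ i + \<alpha> * v s $ i)) (at s)"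
      by (rule DERIV_mult'[OF dw DERIV_add[OF DERIV_cmult[OF has_vector_derivative_component[OF duvy(3)]] DERIV_cmult[OF has_vector_derivative_component[OF duvy(2)]]]])
    then show ?thesis using id[of "w s" s "v s $ i" "u s $ i" "y s $ i"] by simp
  qed
  have e: "inverse (sqrt (snd z)) * (inverse (sqrt (snd z)) * a) = inverse (snd z) * a" for a
    using t by (simp add: field_simps)
  from has_grad_dx_dt(1)[OF has_grad_mult[OF has_grad_rsqrt[OF t] has_grad_comp[OF has_grad_scale[OF t] g]]]
  have "dx (\<lambda>z. inverse (sqrt (snd z)) * ?g (scale z)) z
      = inverse (snd z) * (- (scale z / 2 * w (scale z)) * v (scale z) $ i - \<alpha> * (w (scale z))\<^sup>2 * u (scale z) $ i)"
    using e[of "- (scale z / 2 * w (scale z)) * v (scale z) $ i - \<alpha> * (w (scale z))\<^sup>2 * u (scale z) $ i"] by (simp add: mult.commute)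
  then show ?thesis by (simp add: F_def[abs_def] Fx_def mult.assoc)
qed

lemma norm_nx: "0 < snd z \<Longrightarrow> norm (nx z) = w (scale z) / sqrt (snd z)"
  using w_bound(1)[of "scale z"] unfolding nx_def divide_inverse by (simp add: norms abs_mult)

lemma pde: "0 < snd z \<Longrightarrow> nt z = Fx z + (\<alpha> * (norm (nx z))\<^sup>2) *\<^sub>R n z"
proof -
  assume t: "0 < snd z"
  have "(norm (nx z))\<^sup>2 = (w (scale z))\<^sup>2 / snd z" using t by (simp add: norm_nx power_divide)
  then have "(norm (nx z))\<^sup>2 = inverse (snd z) * (w (scale z))\<^sup>2" by (metis divide_inverse mult.commute)
  moreover have "- (scale z / (2 * snd z)) * w (scale z) = inverse (snd z) * (- (scale z / 2 * w (scale z)))"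
    unfolding divide_inverse by simp
  ultimately show ?thesis by (simp add: nt_def Fx_def n_def scaleR_diff_right mult.left_commute)
qed

lemma F_eq: "F z = \<beta> *\<^sub>R cross3 (n z) (nx z) + \<alpha> *\<^sub>R nx z"
  by (simp add: F_def n_def nx_def cross_mult_right cross_uv scaleR_add_right mult_ac)

lemma n_norm: "norm (n z) = 1" by (simp add: n_def norms)

lemma n_orth: "n z \<bullet> nx z = 0" by (simp add: n_def nx_def uv)

lemma nx_bound: "0 < t \<Longrightarrow> norm (nx (x, t)) \<le> c / sqrt t"
  using w_bound(2)[of "scale (x, t)"] by (simp add: norm_nx divide_right_mono)

lemma cont_uvy: "continuous_on UNIV u" "continuous_on UNIV v" "continuous_on UNIV y" "continuous_on UNIV w"
  using duvy dw by (auto intro!: continuous_at_imp_continuous_on has_vector_derivative_continuous DERIV_isCont)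

lemma meas: "n \<in> borel_measurable borel" "nx \<in> borel_measurable borel" "nt \<in> borel_measurable borel" "F \<in> borel_measurable borel" "Fx \<in> borel_measurable borel"
proof -
  note m = cont_uvy[THEN compose_scale_measurable]
  have r: "(\<lambda>z :: real \<times> real. fst z) \<in> borel_measurable borel" "(\<lambda>z :: real \<times> real. snd z) \<in> borel_measurable borel"
    "(\<lambda>z :: real \<times> real. sqrt (snd z)) \<in> borel_measurable borel"
    by (intro borel_measurable_continuous_onI continuous_intros)+
  note intros = borel_measurable_scaleR borel_measurable_times borel_measurable_uminus borel_measurable_divide borel_measurable_inverse
    borel_measurable_diff borel_measurable_add borel_measurable_power borel_measurable_const r m
  show "n \<in> borel_measurable borel" "nx \<in> borel_measurable borel" "nt \<in> borel_measurable borel" "F \<in> borel_measurable borel" "Fx \<in> borel_measurable borel"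
    unfolding n_def[abs_def] nx_def[abs_def] nt_def[abs_def] F_def[abs_def] Fx_def[abs_def] by (intro intros)+
qed

lemma sw_bound: "\<bar>s\<bar> * w s \<le> c * \<kappa>"
proof -
  have "\<bar>s\<bar> \<le> exp \<bar>s\<bar>" using exp_ge_add_one_self[of "\<bar>s\<bar>"] by linarith
  then have "\<bar>s\<bar> * exp (- \<bar>s\<bar>) \<le> 1" by (simp add: exp_minus divide_simps)
  then have "(c * \<kappa>) * (\<bar>s\<bar> * exp (- \<bar>s\<bar>)) \<le> (c * \<kappa>) * 1" using c \<kappa> by (intro mult_left_mono) auto
  moreover have "\<bar>s\<bar> * w s \<le> \<bar>s\<bar> * (c * \<kappa> * exp (- \<bar>s\<bar>))" by (intro mult_left_mono w_bound) auto
  ultimately show ?thesis by (simp add: mult_ac)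
qed

lemma inv_sqrt_le: "0 < t \<Longrightarrow> 1 / sqrt t \<le> 1 + 1 / t"
proof -
  assume t: "0 < t"
  have "0 \<le> (1 / sqrt t - 1)\<^sup>2 + 1 / sqrt t" using t by simp
  also have "\<dots> = 1 / t - 1 / sqrt t + 1" using t by (simp add: power2_diff power_divide)
  finally show ?thesis by simp
qed

lemma lbdd_all: "lbdd n" "lbdd nx" "lbdd nt" "lbdd F" "lbdd Fx"
proof -
  have cs: "c / sqrt t \<le> c + c / t" if "0 < t" for t
    using mult_left_mono[OF inv_sqrt_le[OF that] c] by (simp add: distrib_left)
  show n: "lbdd n" by (rule lbddI[OF meas(1), of 1 0]) (simp_all add: n_norm)
  show nx: "lbdd nx" by (rule lbddI[OF meas(2), of c c]) (use nx_bound cs c order_trans in blast)+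
  have "lbdd (\<lambda>z. \<beta> *\<^sub>R cross3 (n z) (nx z) + \<alpha> *\<^sub>R nx z)" by (intro lbdd_intros n nx)
  then show "lbdd F" using F_eq by (simp add: F_eq[abs_def])
  show nt: "lbdd nt"
  proof (rule lbddI[OF meas(3), of 0 "c * \<kappa> / 2"])
    fix x t :: real assume t: "0 < t"
    have "norm (nt (x, t)) = (\<bar>scale (x, t)\<bar> * w (scale (x, t))) / 2 / t"
      using t w_bound(1)[of "scale (x, t)"] by (simp add: nt_def norms abs_mult)
    also have "\<dots> \<le> c * \<kappa> / 2 / t" using sw_bound[of "scale (x, t)"] t by (intro divide_right_mono) auto
    finally show "norm (nt (x, t)) \<le> 0 + c * \<kappa> / 2 / t" by simp
  qed (use c \<kappa> in simp)
  show "lbdd Fx"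
  proof (rule lbddI[OF meas(5), of 0 "c * \<kappa> + c\<^sup>2"])
    fix x t :: real assume t: "0 < t"
    let ?s = "scale (x, t)"
    have "norm ((- (?s / 2 * w ?s)) *\<^sub>R v ?s - (\<alpha> * (w ?s)\<^sup>2) *\<^sub>R u ?s) \<le> \<bar>?s\<bar> * w ?s / 2 + \<alpha> * (w ?s)\<^sup>2"
      by (rule order_trans[OF norm_triangle_ineq4]) (use \<alpha> w_bound(1)[of ?s] in \<open>simp add: norms abs_mult\<close>)
    also have "\<dots> \<le> c * \<kappa> + 1 * c\<^sup>2"
    proof (rule add_mono)
      have "0 \<le> c * \<kappa>" using c \<kappa> by simp
      moreover have "a / 2 \<le> k" if "a \<le> k" "0 \<le> k" for a k :: real using that by linarith
      ultimately show "\<bar>?s\<bar> * w ?s / 2 \<le> c * \<kappa>" using sw_bound[of ?s] by blast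
      show "\<alpha> * (w ?s)\<^sup>2 \<le> 1 * c\<^sup>2" by (intro mult_mono power_mono w_bound \<alpha>) auto
    qed
    finally have b: "norm ((- (?s / 2 * w ?s)) *\<^sub>R v ?s - (\<alpha> * (w ?s)\<^sup>2) *\<^sub>R u ?s) \<le> c * \<kappa> + c\<^sup>2" by simp
    have "norm (Fx (x, t)) = norm ((- (?s / 2 * w ?s)) *\<^sub>R v ?s - (\<alpha> * (w ?s)\<^sup>2) *\<^sub>R u ?s) / t"
      using t by (simp only: Fx_def snd_conv norm_scaleR divide_inverse mult.commute[of "\<bar>inverse t\<bar>"]) simp
    then show "norm (Fx (x, t)) \<le> 0 + (c * \<kappa> + c\<^sup>2) / t" using divide_right_mono[OF b, of t] t by simp
  qed (use c \<kappa> in simp)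
qed

lemma step_diff: "x \<noteq> 0 \<Longrightarrow> 0 < t \<Longrightarrow> norm (step_data Ap Am x - n (x, t)) \<le> c * \<kappa> * exp (- \<bar>x\<bar> / sqrt t)"
proof -
  assume x: "x \<noteq> 0" and t: "0 < t"
  show ?thesis
  proof (cases "0 < x")
    case True
    then show ?thesis using lim(1)[of "x / sqrt t"] t by (simp add: step_data_def n_def norm_minus_commute)
  next
    case False
    then have "x < 0" using x by simp
    then show ?thesis using lim(2)[of "x / sqrt t"] t by (simp add: step_data_def n_def norm_minus_commute divide_nonpos_pos)
  qed
qed

text \<open>The spatial scale is sqrt t, which is where the rate sqrt t of all comparisons with the
  step data comes from. The point x = 0 is left out because the step data are 0 there.\<close>

lemma step_integral:
  assumes t: "0 < t" and B: "0 \<le> B" and g: "\<And>x. x \<noteq> 0 \<Longrightarrow> g x \<le> B * exp (- \<bar>x\<bar> / sqrt t)"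
  shows "(\<integral>\<^sup>+x. ennreal (g x) \<partial>lborel) \<le> ennreal (2 * B * sqrt t)"
proof -
  have "(\<integral>\<^sup>+x. ennreal (g x) \<partial>lborel) \<le> (\<integral>\<^sup>+x. ennreal B * ennreal (exp (- \<bar>x\<bar> / sqrt t)) \<partial>lborel)"
    by (rule nn_integral_mono_AE, rule eventually_mono[OF AE_lborel_singleton[of 0]]) (use g B in \<open>simp add: ennreal_mult[symmetric] ennreal_leI\<close>)
  also have "\<dots> = ennreal B * (\<integral>\<^sup>+x. ennreal (exp (- \<bar>x\<bar> / sqrt t)) \<partial>lborel)" by (rule nn_integral_cmult) measurable
  also have "\<dots> \<le> ennreal B * ennreal (2 * sqrt t)" using nn_exp_abs[of "sqrt t"] t by (intro mult_left_mono) auto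
  also have "\<dots> = ennreal (2 * B * sqrt t)" using B t by (simp add: ennreal_mult[symmetric] mult_ac)
  finally show ?thesis .
qed

text \<open>The counterpart of \<open>rate\<close> for the explicit wave. One of the two exponential
  factors of the square is simply bounded by 1.\<close>

lemma n_rate:
  assumes t: "0 < t" and R: "0 < R"
  shows "(\<integral>x. cutoff_at (1 / R) 0 x * (norm (step_data Ap Am x - n (x, t)))\<^sup>2 \<partial>lborel) \<le> (2 * (c * \<kappa>)\<^sup>2) * sqrt t"
proof (rule integral_real_bounded)
  show "0 \<le> 2 * (c * \<kappa>)\<^sup>2 * sqrt t" using t by simp
  have k: "0 < 1 / R" using R by simp
  show "(\<integral>\<^sup>+x. ennreal (cutoff_at (1 / R) 0 x * (norm (step_data Ap Am x - n (x, t)))\<^sup>2) \<partial>lborel) \<le> ennreal (2 * (c * \<kappa>)\<^sup>2 * sqrt t)"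
  proof (rule step_integral[OF t])
    fix x :: real assume x: "x \<noteq> 0"
    have e: "exp (- \<bar>x\<bar> / sqrt t) \<le> 1" using t by simp
    have "(norm (step_data Ap Am x - n (x, t)))\<^sup>2 \<le> (c * \<kappa> * exp (- \<bar>x\<bar> / sqrt t))\<^sup>2"
      using step_diff[OF x t] by (rule power_mono) simp
    also have "\<dots> = (c * \<kappa>)\<^sup>2 * (exp (- \<bar>x\<bar> / sqrt t) * exp (- \<bar>x\<bar> / sqrt t))" by (simp add: power2_eq_square)
    also have "\<dots> \<le> (c * \<kappa>)\<^sup>2 * (1 * exp (- \<bar>x\<bar> / sqrt t))" by (intro mult_left_mono mult_right_mono e) auto
    finally have "(norm (step_data Ap Am x - n (x, t)))\<^sup>2 \<le> (c * \<kappa>)\<^sup>2 * exp (- \<bar>x\<bar> / sqrt t)" by simp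
    moreover have "cutoff_at (1 / R) 0 x * (norm (step_data Ap Am x - n (x, t)))\<^sup>2 \<le> 1 * (norm (step_data Ap Am x - n (x, t)))\<^sup>2"
      by (intro mult_right_mono cutoff_at(4)[OF k]) auto
    ultimately show "cutoff_at (1 / R) 0 x * (norm (step_data Ap Am x - n (x, t)))\<^sup>2 \<le> (c * \<kappa>)\<^sup>2 * exp (- \<bar>x\<bar> / sqrt t)" by simp
  qed simp
qed

end

lemma L1_loc_lbdd: "lbdd v \<Longrightarrow> L1_loc v"
  unfolding L1_loc_def
proof (intro allI impI)
  fix K assume v: "lbdd v" and K: "compact K" "K \<subseteq> half_plane"
  from compact_half_plane_box[OF K] obtain a b c d where b: "0 < c" "K \<subseteq> {a..b} \<times> {c..d}" by (elim exE conjE)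
  show "set_integrable lborel K v"
    by (rule set_integrable_subset[OF lbdd_set_integrable[OF v b(1)] _ b(2)]) (use K(1) in \<open>simp add: borel_compact\<close>)
qed

context wave begin

lemma n_weak_dx: "weak_dx n nx"
  unfolding weak_dx_def
proof (intro conjI L1_loc_lbdd lbdd_all allI impI)
  fix \<phi> assume \<phi>: "test_function \<phi>"
  note c1 = test_function_c1[OF \<phi>]
  have "(LINT z:half_plane|lborel. dx \<phi> z *\<^sub>R n z) = (\<integral>z. dx \<phi> z *\<^sub>R n z \<partial>lborel)"
    "(LINT z:half_plane|lborel. \<phi> z *\<^sub>R nx z) = (\<integral>z. \<phi> z *\<^sub>R nx z \<partial>lborel)"
    using c1_zero[OF c1(1)] by (auto intro!: set_integral_half_plane)
  then show "(LINT z:half_plane|lborel. dx \<phi> z *\<^sub>R n z) = - (LINT z:half_plane|lborel. \<phi> z *\<^sub>R nx z)"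
    using by_parts_dx[OF c1(1) n_smooth lbdd_all(1,2) dx_n] by simp
qed

lemma equation:
  assumes \<phi>: "test_function \<phi>"
  shows "- (LINT z:half_plane|lborel. dt \<phi> z *\<^sub>R n z) =
     - \<beta> *\<^sub>R (LINT z:half_plane|lborel. dx \<phi> z *\<^sub>R cross3 (n z) (nx z))
     + \<alpha> *\<^sub>R (LINT z:half_plane|lborel. dx (dx \<phi>) z *\<^sub>R n z)
     + \<alpha> *\<^sub>R (LINT z:half_plane|lborel. \<phi> z *\<^sub>R ((norm (nx z))\<^sup>2 *\<^sub>R n z))"
proof -
  note c1 = test_function_c1[OF \<phi>]
  let ?g = "\<lambda>z. (norm (nx z))\<^sup>2 *\<^sub>R n z"
  have lc: "lbdd (\<lambda>z. cross3 (n z) (nx z))" and lg: "lbdd ?g" by (intro lbdd_intros lbdd_all)+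
  have h: "(LINT z:half_plane|lborel. dt \<phi> z *\<^sub>R n z) = (\<integral>z. dt \<phi> z *\<^sub>R n z \<partial>lborel)"
    "(LINT z:half_plane|lborel. dx \<phi> z *\<^sub>R cross3 (n z) (nx z)) = (\<integral>z. dx \<phi> z *\<^sub>R cross3 (n z) (nx z) \<partial>lborel)"
    "(LINT z:half_plane|lborel. dx (dx \<phi>) z *\<^sub>R n z) = (\<integral>z. dx (dx \<phi>) z *\<^sub>R n z \<partial>lborel)"
    "(LINT z:half_plane|lborel. \<phi> z *\<^sub>R ?g z) = (\<integral>z. \<phi> z *\<^sub>R ?g z \<partial>lborel)"
    using c1_zero[OF c1(1)] c1_zero[OF c1(3)] by (auto intro!: set_integral_half_plane)
  have i: "integrable lborel (\<lambda>z. dx \<phi> z *\<^sub>R cross3 (n z) (nx z))" "integrable lborel (\<lambda>z. dx \<phi> z *\<^sub>R nx z)"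
    "integrable lborel (\<lambda>z. \<phi> z *\<^sub>R Fx z)" "integrable lborel (\<lambda>z. \<phi> z *\<^sub>R ?g z)"
    using integrable_c1(2)[OF c1(1) lc c1(1)] integrable_c1(2)[OF c1(1) lbdd_all(2) c1(1)]
      integrable_c1(1)[OF c1(1) lbdd_all(5)] integrable_c1(1)[OF c1(1) lg] by simp_all
  have "- (\<integral>z. dt \<phi> z *\<^sub>R n z \<partial>lborel) = (\<integral>z. \<phi> z *\<^sub>R nt z \<partial>lborel)"
    using by_parts_dt[OF c1(2) n_smooth lbdd_all(1,3) dt_n] by simp
  also have "\<dots> = (\<integral>z. \<phi> z *\<^sub>R Fx z + \<alpha> *\<^sub>R (\<phi> z *\<^sub>R ?g z) \<partial>lborel)"
  proof (rule Bochner_Integration.integral_cong)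
    fix z show "\<phi> z *\<^sub>R nt z = \<phi> z *\<^sub>R Fx z + \<alpha> *\<^sub>R (\<phi> z *\<^sub>R ?g z)"
      using pde[of z] c1_zero(1)[OF c1(1), of z] by (cases "0 < snd z") (auto simp: scaleR_add_right mult_ac)
  qed simp
  also have "\<dots> = (\<integral>z. \<phi> z *\<^sub>R Fx z \<partial>lborel) + \<alpha> *\<^sub>R (\<integral>z. \<phi> z *\<^sub>R ?g z \<partial>lborel)"
    by (simp only: Bochner_Integration.integral_add[OF i(3) integrable_scaleR_right[OF i(4)]] integral_scaleR_right i)
  also have "(\<integral>z. \<phi> z *\<^sub>R Fx z \<partial>lborel) = - (\<integral>z. dx \<phi> z *\<^sub>R F z \<partial>lborel)"
    using by_parts_dx[OF c1(1) F_smooth lbdd_all(4,5) dx_F] by simp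
  also have "(\<integral>z. dx \<phi> z *\<^sub>R F z \<partial>lborel) = (\<integral>z. \<beta> *\<^sub>R (dx \<phi> z *\<^sub>R cross3 (n z) (nx z)) + \<alpha> *\<^sub>R (dx \<phi> z *\<^sub>R nx z) \<partial>lborel)"
    by (intro Bochner_Integration.integral_cong) (simp_all add: F_eq scaleR_add_right mult_ac)
  also have "\<dots> = \<beta> *\<^sub>R (\<integral>z. dx \<phi> z *\<^sub>R cross3 (n z) (nx z) \<partial>lborel) + \<alpha> *\<^sub>R (\<integral>z. dx \<phi> z *\<^sub>R nx z \<partial>lborel)"
    by (simp only: Bochner_Integration.integral_add[OF integrable_scaleR_right[OF i(1)] integrable_scaleR_right[OF i(2)]] integral_scaleR_right i)
  also have "(\<integral>z. dx \<phi> z *\<^sub>R nx z \<partial>lborel) = - (\<integral>z. dx (dx \<phi>) z *\<^sub>R n z \<partial>lborel)"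
    using by_parts_dx[OF c1(3) n_smooth lbdd_all(1,2) dx_n] by simp
  finally show ?thesis unfolding h by simp
qed

lemma local_energy:
  assumes "0 < a" shows "\<exists>C::real. AE t in lborel. a \<le> t \<and> t \<le> b \<longrightarrow>
    (\<integral>\<^sup>+ x \<in> {-r..r}. ennreal ((norm (n (x, t)))\<^sup>2 + (norm (nx (x, t)))\<^sup>2) \<partial>lborel) \<le> ennreal C"
proof (intro exI AE_I2 impI)
  fix t assume "a \<le> t \<and> t \<le> b"
  then have t: "0 < t" "a \<le> t" using assms by auto
  have "(norm (nx (x, t)))\<^sup>2 \<le> c\<^sup>2 / a" for x
  proof -
    have "(norm (nx (x, t)))\<^sup>2 \<le> (c / sqrt t)\<^sup>2" by (intro power_mono nx_bound t) simp
    also have "\<dots> = c\<^sup>2 / t" using t by (simp add: power_divide)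
    also have "\<dots> \<le> c\<^sup>2 / a" using t assms by (intro divide_left_mono) auto
    finally show ?thesis .
  qed
  then have "(\<integral>\<^sup>+ x \<in> {-r..r}. ennreal ((norm (n (x, t)))\<^sup>2 + (norm (nx (x, t)))\<^sup>2) \<partial>lborel)
      \<le> (\<integral>\<^sup>+ x. ennreal (1 + c\<^sup>2 / a) * indicator {-r..r} x \<partial>lborel)"
    by (intro nn_integral_mono mult_right_mono ennreal_leI) (auto simp: n_norm)
  also have "\<dots> = ennreal (1 + c\<^sup>2 / a) * emeasure lborel {-r..r}" by (rule nn_integral_cmult_indicator) simp
  also have "\<dots> \<le> ennreal (1 + c\<^sup>2 / a) * ennreal (2 * \<bar>r\<bar>)" by (intro mult_left_mono) (auto intro!: ennreal_leI simp: emeasure_lborel_Icc_eq)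
  also have "\<dots> = ennreal ((1 + c\<^sup>2 / a) * (2 * \<bar>r\<bar>))" by (rule ennreal_mult[symmetric]) (use assms in auto)
  finally show "(\<integral>\<^sup>+ x \<in> {-r..r}. ennreal ((norm (n (x, t)))\<^sup>2 + (norm (nx (x, t)))\<^sup>2) \<partial>lborel) \<le> ennreal ((1 + c\<^sup>2 / a) * (2 * \<bar>r\<bar>))" .
qed

lemma initial:
  assumes \<phi>: "test_function_line \<phi>"
  shows "((\<lambda>t. \<integral>\<^sup>+ x. ennreal (norm (\<phi> x *\<^sub>R (n (x, t) - step_data Ap Am x))) \<partial>lborel) \<longlongrightarrow> 0) (at_right 0)"
proof -
  have d: "\<phi> differentiable_on UNIV" using \<phi> unfolding test_function_line_def by (metis funpow_0)
  have "compact (\<phi> ` closure {x. \<phi> x \<noteq> 0})"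
    using \<phi> continuous_on_subset[OF differentiable_imp_continuous_on[OF d]] by (intro compact_continuous_image) (auto simp: test_function_line_def)
  from compact_imp_bounded[OF this] obtain B where B: "\<forall>x\<in>closure {x. \<phi> x \<noteq> 0}. norm (\<phi> x) \<le> B" by (auto simp: bounded_iff)
  have b: "\<bar>\<phi> x\<bar> \<le> \<bar>B\<bar>" for x
  proof (cases "\<phi> x = 0")
    case False
    then have "x \<in> closure {x. \<phi> x \<noteq> 0}" using closure_subset[of "{x. \<phi> x \<noteq> 0}"] by auto
    then show ?thesis using B by force
  qed simp
  have "((\<lambda>t. 2 * (\<bar>B\<bar> * (c * \<kappa>)) * sqrt t) \<longlongrightarrow> 2 * (\<bar>B\<bar> * (c * \<kappa>)) * sqrt 0) (at_right 0)"
    by (intro tendsto_intros)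
  then have lim: "((\<lambda>t. ennreal (2 * (\<bar>B\<bar> * (c * \<kappa>)) * sqrt t)) \<longlongrightarrow> 0) (at_right 0)"
    using tendsto_ennrealI by fastforce
  show ?thesis
  proof (rule tendsto_sandwich[OF _ _ tendsto_const lim])
    show "\<forall>\<^sub>F t in at_right 0. (\<integral>\<^sup>+ x. ennreal (norm (\<phi> x *\<^sub>R (n (x, t) - step_data Ap Am x))) \<partial>lborel) \<le> ennreal (2 * (\<bar>B\<bar> * (c * \<kappa>)) * sqrt t)"
      using eventually_at_right_less[of 0]
    proof eventually_elim
      case (elim t)
      show ?case
      proof (rule step_integral[OF elim])
        fix x :: real assume x: "x \<noteq> 0"
        have "\<bar>\<phi> x\<bar> * norm (n (x, t) - step_data Ap Am x) \<le> \<bar>B\<bar> * (c * \<kappa> * exp (- \<bar>x\<bar> / sqrt t))"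
          using step_diff[OF x elim] by (intro mult_mono b) (simp_all add: norm_minus_commute)
        then show "norm (\<phi> x *\<^sub>R (n (x, t) - step_data Ap Am x)) \<le> \<bar>B\<bar> * (c * \<kappa>) * exp (- \<bar>x\<bar> / sqrt t)" by (simp add: mult_ac)
      qed (use c \<kappa> in simp)
    qed
  qed simp
qed

lemma n_llg_solution: "llg_solution \<alpha> (step_data Ap Am) n"
  unfolding llg_solution_def
proof (intro conjI allI impI exI[of _ nx] n_weak_dx local_energy initial)
  show "set_borel_measurable lborel half_plane n"
    using meas(1) open_half_plane unfolding set_borel_measurable_def by (intro borel_measurable_scaleR borel_measurable_indicator) auto
  show "AE z in lborel. z \<in> half_plane \<longrightarrow> norm (n z) = 1" by (simp add: n_norm)
qed (use equation \<beta> in blast)+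

text \<open>Integrating |n_x|^2 over all of space already gives at most 2 (c \<kappa>)^2 t^(-1/2),
  because the exponential profile has width sqrt t. The time integral up to r^2 then contributes 2
  r, the scaling required by the seminorm.\<close>

lemma carleson_bound:
  assumes r: "0 < r"
  shows "(\<integral>\<^sup>+ z \<in> {x - r<..<x + r} \<times> {0..r\<^sup>2}. ennreal ((norm (nx z))\<^sup>2) \<partial>lborel) \<le> ennreal (4 * (c * \<kappa>)\<^sup>2 * r)"
proof -
  note [measurable] = meas(2)
  let ?K = "(c * \<kappa>)\<^sup>2"
  let ?f = "\<lambda>z. ennreal ((norm (nx z))\<^sup>2) * indicator {0..r\<^sup>2} (snd z)"
  have m: "?f \<in> borel_measurable (lborel \<Otimes>\<^sub>M (lborel :: real measure))"
  proof -
    have s: "(snd :: real \<times> real \<Rightarrow> real) \<in> borel_measurable borel" by (intro borel_measurable_continuous_onI continuous_intros)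
    have "(\<lambda>z :: real \<times> real. indicator {0..r\<^sup>2} (snd z) :: ennreal) \<in> borel_measurable borel" 
      by (rule measurable_compose[OF s, where g="indicator {0..r\<^sup>2} :: real \<Rightarrow> ennreal"]) (rule borel_measurable_indicator, simp)
    moreover have "(\<lambda>z. ennreal ((norm (nx z))\<^sup>2)) \<in> borel_measurable borel" by measurable
    ultimately have "?f \<in> borel_measurable borel" by (intro borel_measurable_times_ennreal)
    then show ?thesis unfolding lborel_prod by simp
  qed
  have "(\<integral>\<^sup>+ z \<in> {x - r<..<x + r} \<times> {0..r\<^sup>2}. ennreal ((norm (nx z))\<^sup>2) \<partial>lborel) \<le> (\<integral>\<^sup>+ z. ?f z \<partial>lborel)"
    by (intro nn_integral_mono mult_left_mono) (auto simp: indicator_def)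
  also have "\<dots> = (\<integral>\<^sup>+ t. \<integral>\<^sup>+ y. ?f (y, t) \<partial>lborel \<partial>lborel)"
    using lborel_pair.nn_integral_snd[OF m] by (simp add: lborel_prod)
  also have "\<dots> \<le> (\<integral>\<^sup>+ t. ennreal (2 * ?K * (indicator {0<..<r\<^sup>2} t * t powr (- (1/2)))) \<partial>lborel)"
  proof (rule nn_integral_mono_AE, rule eventually_mono[OF eventually_conj[OF AE_lborel_singleton[of 0] AE_lborel_singleton[of "r\<^sup>2"]]])
    fix t :: real assume t: "t \<noteq> 0 \<and> t \<noteq> r\<^sup>2"
    show "(\<integral>\<^sup>+ y. ?f (y, t) \<partial>lborel) \<le> ennreal (2 * ?K * (indicator {0<..<r\<^sup>2} t * t powr (- (1/2))))"
    proof (cases "0 < t \<and> t < r\<^sup>2")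
      case True
      then have t: "0 < t" by simp
      have "(\<integral>\<^sup>+ y. ennreal ((norm (nx (y, t)))\<^sup>2) \<partial>lborel) \<le> ennreal (2 * (?K / t) * sqrt t)"
      proof (rule step_integral[OF t])
        fix x :: real
        have e: "exp (- \<bar>x\<bar> / sqrt t) \<le> 1" using t by simp
        have "norm (nx (x, t)) \<le> c * \<kappa> * exp (- \<bar>x\<bar> / sqrt t) / sqrt t"
          using w_bound(3)[of "scale (x, t)"] t by (simp add: norm_nx divide_right_mono)
        then have "(norm (nx (x, t)))\<^sup>2 \<le> (c * \<kappa> * exp (- \<bar>x\<bar> / sqrt t) / sqrt t)\<^sup>2" by (rule power_mono) simp
        also have "\<dots> = ?K / t * (exp (- \<bar>x\<bar> / sqrt t) * exp (- \<bar>x\<bar> / sqrt t))"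
          using t by (simp add: power2_eq_square)
        also have "\<dots> \<le> ?K / t * (1 * exp (- \<bar>x\<bar> / sqrt t))" using t by (intro mult_left_mono mult_right_mono e) auto
        finally show "(norm (nx (x, t)))\<^sup>2 \<le> ?K / t * exp (- \<bar>x\<bar> / sqrt t)" by simp
      qed (use t in simp)
      moreover have "2 * (?K / t) * sqrt t = 2 * ?K * t powr (- (1/2))"
      proof -
        have "sqrt t / t = t powr (- (1/2))" using t by (simp add: powr_minus powr_half_sqrt real_div_sqrt field_simps)
        then show ?thesis by (metis times_divide_eq_left times_divide_eq_right mult.assoc)
      qed
      ultimately show ?thesis using True by simp
    qed (use t in \<open>auto simp: indicator_def\<close>)
  qed
  also have "\<dots> = ennreal (\<integral>t. 2 * ?K * (indicator {0<..<r\<^sup>2} t * t powr (- (1/2))) \<partial>lborel)"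
    using integral_powr(1)[of "- (1/2)" "r\<^sup>2"] r by (intro nn_integral_eq_integral) auto
  also have "(\<integral>t. 2 * ?K * (indicator {0<..<r\<^sup>2} t * t powr (- (1/2))) \<partial>lborel) = 2 * ?K * (2 * r)"
  proof -
    have "(r\<^sup>2) powr (1/2) = r" using r by (simp add: powr_half_sqrt)
    then show ?thesis using integral_powr(2)[of "- (1/2)" "r\<^sup>2"] r by simp
  qed
  finally show ?thesis by (simp add: mult_ac)
qed

text \<open>The sup half is at most c by the bound on \<open>w\<close>, and the integral half is 2 c
  \<kappa>, the root of the constant in \<open>carleson_bound\<close>. Linearity in c is what gives
  the constant \<open>L2\<close> of the theorem.\<close>

lemma X_bound: "X_seminorm n \<le> ennreal ((1 + 2 * \<kappa>) * c)"
proof -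
  note [measurable] = meas(2)
  have "X_seminorm n \<le> (SUP t\<in>{0<..}. ennreal (sqrt t) * esssup lborel (\<lambda>x. ennreal (norm (nx (x, t))))) +
     (SUP x. SUP r\<in>{0<..}. ennsqrt (ennreal (1 / r) *
        (\<integral>\<^sup>+ z \<in> {x - r<..<x + r} \<times> {0..r\<^sup>2}. ennreal ((norm (nx z))\<^sup>2) \<partial>lborel)))"
    unfolding X_seminorm_def by (rule INF_lower) (simp add: n_weak_dx)
  also have "\<dots> \<le> ennreal c + ennreal (2 * (c * \<kappa>))"
  proof (intro add_mono SUP_least)
    fix t :: real assume "t \<in> {0<..}"
    then have t: "0 < t" by simp
    have "esssup lborel (\<lambda>x. ennreal (norm (nx (x, t)))) \<le> ennreal (c / sqrt t)"
      using nx_bound[OF t] by (intro esssup_I) (auto intro!: AE_I2 ennreal_leI)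
    then have "ennreal (sqrt t) * esssup lborel (\<lambda>x. ennreal (norm (nx (x, t)))) \<le> ennreal (sqrt t) * ennreal (c / sqrt t)"
      by (rule mult_left_mono) simp
    also have "\<dots> = ennreal c" using t c by (simp add: ennreal_mult[symmetric])
    finally show "ennreal (sqrt t) * esssup lborel (\<lambda>x. ennreal (norm (nx (x, t)))) \<le> ennreal c" .
  next
    fix x r :: real assume "r \<in> {0<..}"
    then have r: "0 < r" by simp
    show "ennsqrt (ennreal (1 / r) * (\<integral>\<^sup>+ z \<in> {x - r<..<x + r} \<times> {0..r\<^sup>2}. ennreal ((norm (nx z))\<^sup>2) \<partial>lborel)) \<le> ennreal (2 * (c * \<kappa>))"
    proof (rule ennsqrt_le)
      have "ennreal (1 / r) * (\<integral>\<^sup>+ z \<in> {x - r<..<x + r} \<times> {0..r\<^sup>2}. ennreal ((norm (nx z))\<^sup>2) \<partial>lborel) \<le> ennreal (1 / r) * ennreal (4 * (c * \<kappa>)\<^sup>2 * r)"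
        by (intro mult_left_mono carleson_bound r) simp
      also have "\<dots> = ennreal ((2 * (c * \<kappa>))\<^sup>2)" using r by (simp add: ennreal_mult[symmetric] power_mult_distrib)
      finally show "ennreal (1 / r) * (\<integral>\<^sup>+ z \<in> {x - r<..<x + r} \<times> {0..r\<^sup>2}. ennreal ((norm (nx z))\<^sup>2) \<partial>lborel) \<le> ennreal ((2 * (c * \<kappa>))\<^sup>2)" .
    qed (use c \<kappa> in simp)
  qed
  also have "\<dots> = ennreal ((1 + 2 * \<kappa>) * c)" using c \<kappa> by (simp add: ennreal_plus[symmetric] algebra_simps del: ennreal_plus)
  finally show ?thesis .
qed

lemma third_component:
  assumes "0 \<le> Ap $ 3" "0 \<le> Am $ 3" shows "- (c * \<kappa>) \<le> n z $ 3"
proof -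
  let ?s = "scale z"
  have near: "- (c * \<kappa>) \<le> n z $ 3" if "norm (u ?s - A) \<le> c * \<kappa> * e" "e \<le> 1" "0 \<le> A $ 3" for A e
  proof -
    have "\<bar>(u ?s - A) $ 3\<bar> \<le> norm (u ?s - A)" by (rule component_le_norm_cart)
    moreover have "c * \<kappa> * e \<le> c * \<kappa> * 1" using that(2) c \<kappa> by (intro mult_left_mono) auto
    ultimately show ?thesis using that(1,3) by (simp add: n_def)
  qed
  show ?thesis
  proof (cases "0 \<le> ?s")
    case True
    then show ?thesis by (intro near[OF lim(1)] assms) auto
  next
    case False
    then show ?thesis by (intro near[OF lim(2)] assms) auto
  qed
qed

text \<open>The wave is plugged in as the smooth competitor; its rate constant 2 (c \<kappa>)^2 is
  the one from \<open>n_rate\<close>.\<close>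

lemma unique:
  assumes "tame_small \<alpha> \<beta> \<epsilon> Ap Am M W" and "c\<^sup>2 / \<alpha> + \<alpha> * (c\<^sup>2 + \<epsilon>\<^sup>2) \<le> 1 / 4"
  shows "AE z in lborel. 0 < snd z \<longrightarrow> M z = n z"
proof -
  interpret T: tame_small \<alpha> \<beta> \<epsilon> Ap Am M W by fact
  interpret weak_strong \<alpha> \<beta> \<epsilon> Ap Am M W n nx nt F Fx c "2 * (c * \<kappa>)\<^sup>2"
    by unfold_locales (rule n_smooth F_smooth dx_n dt_n dx_F pde F_eq n_norm n_orth nx_bound lbdd_all n_rate assms(2); assumption)+
  show ?thesis by (rule weak_strong_uniqueness)
qed

end

section \<open>Good representatives of weak solutions\<close>

lemma ennsqrt_leD:
  assumes "ennsqrt a \<le> ennreal b" "0 \<le> b" shows "a \<le> ennreal (b\<^sup>2)"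
proof (cases "a = \<infinity>")
  case True
  then show ?thesis using assms(1) by (simp add: ennsqrt_def top_unique)
next
  case False
  then have "sqrt (enn2real a) \<le> b" using assms by (simp add: ennsqrt_def)
  then have "enn2real a \<le> b\<^sup>2" using sqrt_le_D by blast
  then have "ennreal (enn2real a) \<le> ennreal (b\<^sup>2)" by (rule ennreal_leI)
  moreover have "ennreal (enn2real a) = a" using False by (simp add: less_top)
  ultimately show ?thesis by simp
qed

lemma half_plane_measurable: "half_plane \<in> sets borel" using open_half_plane by simp

text \<open>Local integrability gives measurability on each compact set only. The half-plane is
  exhausted by the rectangles \<open>?K i\<close>, and at each point the truncated functions are
  eventually constant in i.\<close>

lemma L1_loc_measurable:
  assumes "L1_loc v" shows "(\<lambda>z. indicator half_plane z *\<^sub>R v z) \<in> borel_measurable borel"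
proof (rule borel_measurable_LIMSEQ_metric)
  let ?K = "\<lambda>i::nat. {- real i..real i} \<times> {1 / real (Suc i)..real i}"
  have K: "compact (?K i)" "?K i \<subseteq> half_plane" for i
  proof -
    show "compact (?K i)" by (intro compact_Times compact_Icc)
    show "?K i \<subseteq> half_plane"
    proof
      fix z assume "z \<in> ?K i"
      then have "1 / real (Suc i) \<le> snd z" by auto
      moreover have "0 < 1 / real (Suc i)" by simp
      ultimately show "z \<in> half_plane" unfolding half_plane_iff by (rule less_le_trans[rotated])
    qed
  qed
  show "(\<lambda>z. indicator (?K i) z *\<^sub>R v z) \<in> borel_measurable borel" for i
  proof -
    have "set_integrable lborel (?K i) v" using assms K unfolding L1_loc_def by blast
    then have "(\<lambda>z. indicator (?K i) z *\<^sub>R v z) \<in> borel_measurable lborel" unfolding set_integrable_def by (rule borel_measurable_integrable)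
    then show ?thesis by simp
  qed
  fix z :: "real \<times> real"
  show "(\<lambda>i. indicator (?K i) z *\<^sub>R v z) \<longlonglongrightarrow> indicator half_plane z *\<^sub>R v z"
  proof (cases "z \<in> half_plane")
    case True
    obtain x t where z: "z = (x, t)" by (cases z)
    have t: "0 < t" using True z by simp
    obtain N1 where N1: "\<bar>x\<bar> + t \<le> real N1" using real_arch_simple by blast
    obtain N2 where N2: "1 / t \<le> real N2" using real_arch_simple by blast
    have "\<forall>\<^sub>F i in sequentially. indicator (?K i) z *\<^sub>R v z = indicator half_plane z *\<^sub>R v z"
    proof (rule eventually_sequentiallyI[of "max N1 N2"])
      fix i assume "max N1 N2 \<le> i"
      then have i: "real N1 \<le> real i" "real N2 \<le> real i" by auto
      have "1 / t \<le> real (Suc i)" using N2 i by simp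
      then have "1 / real (Suc i) \<le> t" using t by (simp add: divide_simps mult.commute)
      moreover have "\<bar>x\<bar> \<le> real i" "t \<le> real i" using N1 i t by linarith+
      ultimately have "z \<in> ?K i" using z by auto
      then show "indicator (?K i) z *\<^sub>R v z = indicator half_plane z *\<^sub>R v z" using True by simp
    qed
    then show ?thesis by (rule tendsto_eventually)
  next
    case False
    have "z \<notin> ?K i" for i using K(2)[of i] False by blast
    then have i0: "indicator (?K i) z = (0 :: real)" for i by (rule indicator_simps(2))
    have h0: "indicator half_plane z = (0 :: real)" using False by simp
    show ?thesis unfolding i0 h0 by simp
  qed
qed

lemma half_plane_integral_AE:
  fixes h H :: "real \<times> real \<Rightarrow> real^3"
  assumes g: "g \<in> borel_measurable borel" "\<And>z. \<not> 0 < snd z \<Longrightarrow> g z = 0"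
    and m: "(\<lambda>z. indicator half_plane z *\<^sub>R h z) \<in> borel_measurable borel" "H \<in> borel_measurable borel"
    and eq: "AE z in lborel. 0 < snd z \<longrightarrow> h z = H z"
  shows "(LINT z:half_plane|lborel. g z *\<^sub>R h z) = (\<integral>z. g z *\<^sub>R H z \<partial>lborel)"
  unfolding set_lebesgue_integral_def
proof (rule integral_cong_AE)
  have "(\<lambda>z. g z *\<^sub>R (indicator half_plane z *\<^sub>R h z)) \<in> borel_measurable borel" using g(1) m(1) by (rule borel_measurable_scaleR)
  then show "(\<lambda>z. indicator half_plane z *\<^sub>R g z *\<^sub>R h z) \<in> borel_measurable lborel" by (simp add: mult.commute)
  show "(\<lambda>z. g z *\<^sub>R H z) \<in> borel_measurable lborel" using borel_measurable_scaleR[OF g(1) m(2)] by simp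
  show "AE z in lborel. indicator half_plane z *\<^sub>R g z *\<^sub>R h z = g z *\<^sub>R H z"
    using eq by eventually_elim (use g(2) in \<open>auto simp: indicator_def\<close>)
qed

lemma weak_dxD:
  assumes "weak_dx v w" shows "L1_loc w"
    "test_function \<phi> \<Longrightarrow> (LINT z:half_plane|lborel. dx \<phi> z *\<^sub>R v z) = - (LINT z:half_plane|lborel. \<phi> z *\<^sub>R w z)"
  using assms by (simp_all add: weak_dx_def)

lemma L1_locD: "L1_loc v \<Longrightarrow> compact K \<Longrightarrow> K \<subseteq> half_plane \<Longrightarrow> set_integrable lborel K v"
  by (simp add: L1_loc_def)

text \<open>The seminorm and the equation each come with their own version of the x-derivative, and
  both have to be replaced by one function. The proof tests the components of the difference, in
  both orders, with products of bumps.\<close>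

lemma weak_dx_unique:
  assumes a: "weak_dx v w1" and b: "weak_dx v w2"
  shows "AE z in lborel. 0 < snd z \<longrightarrow> w1 z = w2 z"
proof -
  have one: "AE z in lborel. 0 < snd z \<longrightarrow> w1 z $ i - w2 z $ i \<le> 0" if a: "weak_dx v w1" and b: "weak_dx v w2" for w1 w2 i
  proof (rule AE_nonpos_half_plane)
    have box: "compact ({a..b} \<times> {c..d})" "{a..b} \<times> {c..d} \<subseteq> half_plane" if "0 < c" for a b c d :: real
      using that by (auto intro: compact_Times compact_Icc)
    have nth: "set_integrable lborel K (\<lambda>z. w z $ i)" if "set_integrable lborel K w" for K and w :: "real \<times> real \<Rightarrow> real^3"
    proof -
      have "integrable lborel (\<lambda>z. axis i 1 \<bullet> (indicator K z *\<^sub>R w z))"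
        using that unfolding set_integrable_def by (rule integrable_inner_right)
      then show ?thesis unfolding set_integrable_def by (simp add: inner_axis')
    qed
    show "set_integrable lborel ({a..b} \<times> {c..d}) (\<lambda>z. w1 z $ i - w2 z $ i)" if "0 < c" for a b c d
      using assms a b box[OF that] unfolding weak_dx_def L1_loc_def by (intro set_integral_diff(1) nth) auto
    fix \<psi> \<eta> and a' b' c d :: real
    assume \<psi>: "smooth1 UNIV \<psi>" "\<And>t. t \<notin> {a'..b'} \<Longrightarrow> \<psi> t = 0" and \<eta>: "smooth1 UNIV \<eta>" "\<And>t. t \<notin> {c..d} \<Longrightarrow> \<eta> t = 0" and c: "0 < c"
    let ?\<phi> = "\<lambda>z. \<psi> (fst z) * \<eta> (snd z)"
    have s: "supp1 a' b' \<psi>" "supp1 c d \<eta>" using \<psi>(2) \<eta>(2) by (auto simp: supp1_def)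
    have e: "(\<lambda>(x, t). \<psi> x * \<eta> t) = ?\<phi>" by (simp add: fun_eq_iff)
    have tf: "test_fun ?\<phi>" using test_fun_product'(1)[OF \<psi>(1) s(1) \<eta>(1) c s(2)] unfolding e .
    then have t: "test_function ?\<phi>" by (rule test_fun_test_function)
    have z: "?\<phi> z = 0" if "\<not> 0 < snd z" for z using s(2) c that by (auto simp: supp1_def)
    have "continuous_on UNIV ?\<phi>" using tf smooth2_continuous unfolding test_fun_def by blast
    then have m: "?\<phi> \<in> borel_measurable borel" by (rule borel_measurable_continuous_onI)
    have eq: "(LINT z:half_plane|lborel. ?\<phi> z *\<^sub>R w1 z) = (LINT z:half_plane|lborel. ?\<phi> z *\<^sub>R w2 z)"
      using trans[OF sym[OF weak_dxD(2)[OF a t]] weak_dxD(2)[OF b t]] by (simp only: neg_equal_iff_equal)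
    let ?K = "{a'..b'} \<times> {c..d}"
    have zK: "?\<phi> z = 0" if "z \<notin> ?K" for z using \<psi>(2)[of "fst z"] \<eta>(2)[of "snd z"] that by (cases z) auto
    obtain B where B: "\<And>z. \<bar>?\<phi> z\<bar> \<le> B"
    proof -
      have "compact (?\<phi> ` ?K)" using continuous_on_subset[OF \<open>continuous_on UNIV ?\<phi>\<close>] box[OF c] by (intro compact_continuous_image) auto
      then have "bounded (?\<phi> ` ?K)" by (rule compact_imp_bounded)
      then obtain B where B: "\<forall>y\<in>?\<phi> ` ?K. norm y \<le> B" unfolding bounded_iff by blast
      have "\<bar>?\<phi> z\<bar> \<le> \<bar>B\<bar>" for z
      proof (cases "z \<in> ?K")
        case True
        from bspec[OF B imageI[OF True]] show ?thesis unfolding real_norm_def by linarith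
      next
        case False
        show ?thesis by (subst zK[OF False]) simp
      qed
      then show ?thesis by (rule that)
    qed
    have int: "integrable lborel (\<lambda>z. ?\<phi> z *\<^sub>R w z)" if "weak_dx v w" for w
    proof (rule Bochner_Integration.integrable_bound)
      have "set_integrable lborel ?K w" by (rule L1_locD[OF weak_dxD(1)[OF that] box[OF c]])
      then have i: "integrable lborel (\<lambda>z. indicator ?K z *\<^sub>R w z)" unfolding set_integrable_def .
      then show "integrable lborel (\<lambda>z. B *\<^sub>R (indicator ?K z *\<^sub>R w z))" by (rule integrable_scaleR_right)
      have "(\<lambda>z. ?\<phi> z *\<^sub>R (indicator ?K z *\<^sub>R w z)) \<in> borel_measurable lborel"
        by (rule borel_measurable_scaleR[OF _ borel_measurable_integrable[OF i]]) (use m in simp)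
      moreover have "?\<phi> z *\<^sub>R (indicator ?K z *\<^sub>R w z) = ?\<phi> z *\<^sub>R w z" for z using zK[of z] by (cases "z \<in> ?K") auto
      ultimately show "(\<lambda>z. ?\<phi> z *\<^sub>R w z) \<in> borel_measurable lborel" by (simp only:)
      show "AE z in lborel. norm (?\<phi> z *\<^sub>R w z) \<le> norm (B *\<^sub>R (indicator ?K z *\<^sub>R w z))"
      proof (rule AE_I2)
        fix z
        have "\<bar>?\<phi> z\<bar> * norm (w z) \<le> \<bar>B\<bar> * norm (w z)" using B[of z] by (intro mult_right_mono) auto
        then show "norm (?\<phi> z *\<^sub>R w z) \<le> norm (B *\<^sub>R (indicator ?K z *\<^sub>R w z))" using zK[of z] by (cases "z \<in> ?K") auto
      qed
    qed
    have h: "(LINT z:half_plane|lborel. ?\<phi> z *\<^sub>R w z) = (\<integral>z. ?\<phi> z *\<^sub>R w z \<partial>lborel)" for w :: "real \<times> real \<Rightarrow> real^3"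
      by (rule set_integral_half_plane) (simp add: z)
    have "(\<integral>z. ?\<phi> z *\<^sub>R w1 z \<partial>lborel) $ i = (\<integral>z. ?\<phi> z *\<^sub>R w2 z \<partial>lborel) $ i" using eq unfolding h by simp
    then have "(\<integral>z. ?\<phi> z * w1 z $ i \<partial>lborel) = (\<integral>z. ?\<phi> z * w2 z $ i \<partial>lborel)"
      unfolding integral_nth[OF int[OF a]] integral_nth[OF int[OF b]] by simp
    moreover have "integrable lborel (\<lambda>z. ?\<phi> z * w z $ i)" if "weak_dx v w" for w
      using integrable_inner_right[OF int[OF that], of "axis i 1"] by (simp add: inner_axis')
    ultimately show "(\<integral>z. ?\<phi> z * (w1 z $ i - w2 z $ i) \<partial>lborel) \<le> 0"
      using a b by (simp add: right_diff_distrib)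
  qed
  have "AE z in lborel. \<forall>i. 0 < snd z \<longrightarrow> w1 z $ i = w2 z $ i"
    unfolding AE_finite_all[OF finite_class.finite_UNIV, simplified]
  proof (rule allI)
    fix i show "AE z in lborel. 0 < snd z \<longrightarrow> w1 z $ i = w2 z $ i"
      using one[OF a b, of i] one[OF b a, of i] by eventually_elim auto
  qed
  then show ?thesis by eventually_elim (simp add: vec_eq_iff)
qed

text \<open>The seminorm gives a bound for every time, with an exceptional set in x that depends on
  it. Measurability of the set of good points is what makes these exceptional sets add up to a null
  set of the plane.\<close>

lemma AE_slices:
  assumes m: "{z :: real \<times> real. P z} \<in> sets borel" and s: "\<And>t. AE x in lborel. P (x, t)"
  shows "AE z in lborel. P z"
proof -
  have meas: "{z \<in> space ((lborel::real measure) \<Otimes>\<^sub>M (lborel::real measure)). P z} \<in> sets ((lborel::real measure) \<Otimes>\<^sub>M (lborel::real measure))"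
    unfolding lborel_prod using m by simp
  have meas': "{z \<in> space ((lborel::real measure) \<Otimes>\<^sub>M (lborel::real measure)). P (fst z, snd z)} \<in> sets ((lborel::real measure) \<Otimes>\<^sub>M (lborel::real measure))"
    using meas by simp
  have "AE t in (lborel::real measure). AE x in (lborel::real measure). P (x, t)" using s by simp
  then have 2: "AE x in (lborel::real measure). AE t in (lborel::real measure). P (x, t)"
    using lborel_pair.AE_commute[where P="\<lambda>x t. P (x, t)", OF meas'] by (rule iffD2[rotated])
  have "AE z in (lborel::real measure) \<Otimes>\<^sub>M (lborel::real measure). P z"
    by (rule lborel_pair.AE_pair_measure[where P=P, OF meas 2])
  then show ?thesis unfolding lborel_prod .
qed

lemma AE_slices':
  assumes m: "{z :: real \<times> real. P z} \<in> sets borel" and s: "AE z in lborel. P z"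
  shows "AE t in lborel. AE x in lborel. P (x, t)"
proof -
  have meas': "{z \<in> space ((lborel::real measure) \<Otimes>\<^sub>M (lborel::real measure)). P (fst z, snd z)} \<in> sets ((lborel::real measure) \<Otimes>\<^sub>M (lborel::real measure))"
    unfolding lborel_prod using m by simp
  have "AE z in (lborel::real measure) \<Otimes>\<^sub>M (lborel::real measure). P z" using s unfolding lborel_prod .
  then have "AE x in (lborel::real measure). AE t in (lborel::real measure). P (x, t)" by (rule lborel_pair.AE_pair)
  then show ?thesis using lborel_pair.AE_commute[where P="\<lambda>x t. P (x, t)", OF meas'] by (rule iffD1[rotated])
qed

lemma smooth1_test_function_line:
  assumes "smooth1 UNIV \<psi>" "supp1 a b \<psi>" shows "test_function_line \<psi>"
  unfolding test_function_line_def
proof (intro conjI allI smooth1_iterated_deriv assms(1))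
  have "{x. \<psi> x \<noteq> 0} \<subseteq> {a..b}" using assms(2) by (auto simp: supp1_def)
  then have "closure {x. \<psi> x \<noteq> 0} \<subseteq> {a..b}" by (intro closure_minimal) auto
  then show "compact (closure {x. \<psi> x \<noteq> 0})" using bounded_subset[OF bounded_closed_interval] by (auto simp: compact_eq_bounded_closed)
qed

text \<open>The strict inequality is needed because the seminorm is an infimum over versions of the
  derivative: it yields one version for which both halves lie below \<epsilon>. Modification on a
  null set then makes all bounds hold everywhere.\<close>

lemma tame_representative:
  assumes \<alpha>: "0 < \<alpha>" "\<alpha> \<le> 1" and nA: "norm Ap = 1" "norm Am = 1" and \<epsilon>: "0 < \<epsilon>"
    and sol: "llg_solution \<alpha> (step_data Ap Am) m" and X: "X_seminorm m < ennreal \<epsilon>"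
  shows "\<exists>M W. tame \<alpha> (sqrt (1 - \<alpha>\<^sup>2)) \<epsilon> Ap Am M W \<and> (AE z in lborel. 0 < snd z \<longrightarrow> m z = M z)"
proof -
  \<comment> \<open>This version comes from the seminorm, whereas \<open>w0\<close> below comes from
    the equation; they are identified by \<open>W0eq\<close>.\<close>
  obtain w where w: "weak_dx m w"
    and S: "(SUP t\<in>{0<..}. ennreal (sqrt t) * esssup lborel (\<lambda>x. ennreal (norm (w (x, t))))) +
     (SUP x. SUP r\<in>{0<..}. ennsqrt (ennreal (1 / r) *
        (\<integral>\<^sup>+ z \<in> {x - r<..<x + r} \<times> {0..r\<^sup>2}. ennreal ((norm (w z))\<^sup>2) \<partial>lborel))) < ennreal \<epsilon>"
    using X unfolding X_seminorm_def INF_less_iff by (elim bexE) (simp only: mem_Collect_eq)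
  obtain w0 where w0: "weak_dx m w0" and eq: "\<And>\<phi>. test_function \<phi> \<Longrightarrow>
           - (LINT z:half_plane|lborel. dt \<phi> z *\<^sub>R m z) =
             - sqrt (1 - \<alpha>\<^sup>2) *\<^sub>R (LINT z:half_plane|lborel. dx \<phi> z *\<^sub>R cross3 (m z) (w0 z))
             + \<alpha> *\<^sub>R (LINT z:half_plane|lborel. dx (dx \<phi>) z *\<^sub>R m z)
             + \<alpha> *\<^sub>R (LINT z:half_plane|lborel. \<phi> z *\<^sub>R ((norm (w0 z))\<^sup>2 *\<^sub>R m z))"
    using sol unfolding llg_solution_def by (elim conjE exE) (rule that, assumption, blast)
  have mm: "(\<lambda>z. indicator half_plane z *\<^sub>R m z) \<in> borel_measurable borel" and m1: "AE z in lborel. z \<in> half_plane \<longrightarrow> norm (m z) = 1"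
    and init: "\<And>\<phi>. test_function_line \<phi> \<Longrightarrow>
      ((\<lambda>t. \<integral>\<^sup>+ x. ennreal (norm (\<phi> x *\<^sub>R (m (x, t) - step_data Ap Am x))) \<partial>lborel) \<longlongrightarrow> 0) (at_right 0)"
    using sol unfolding llg_solution_def set_borel_measurable_def by simp_all
  have sup: "AE x in lborel. norm (w (x, t)) \<le> \<epsilon> / sqrt t" if t: "0 < t" for t
  proof -
    have "ennreal (sqrt t) * esssup lborel (\<lambda>x. ennreal (norm (w (x, t)))) \<le> (SUP t\<in>{0<..}. ennreal (sqrt t) * esssup lborel (\<lambda>x. ennreal (norm (w (x, t)))))"
      using t by (intro SUP_upper) simp
    also have "\<dots> \<le> ennreal \<epsilon>" using S by (meson add_increasing2 le_less_trans less_imp_le order_refl order_trans zero_le)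
    finally have le: "ennreal (sqrt t) * esssup lborel (\<lambda>x. ennreal (norm (w (x, t)))) \<le> ennreal \<epsilon>" .
    show ?thesis using esssup_AE[of "\<lambda>x. ennreal (norm (w (x, t)))" lborel]
    proof eventually_elim
      case (elim x)
      have "ennreal (sqrt t * norm (w (x, t))) = ennreal (sqrt t) * ennreal (norm (w (x, t)))" using t by (simp add: ennreal_mult)
      also have "\<dots> \<le> ennreal (sqrt t) * esssup lborel (\<lambda>x. ennreal (norm (w (x, t))))" using elim by (intro mult_left_mono) auto
      also note le
      finally have "sqrt t * norm (w (x, t)) \<le> \<epsilon>" using \<epsilon> by (simp add: ennreal_le_iff)
      then show ?case using t by (simp add: pos_le_divide_eq mult.commute)
    qed
  qed
  have carl: "(\<integral>\<^sup>+ z \<in> {x - r<..<x + r} \<times> {0..r\<^sup>2}. ennreal ((norm (w z))\<^sup>2) \<partial>lborel) \<le> ennreal (\<epsilon>\<^sup>2 * r)" if r: "0 < r" for x r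
  proof -
    let ?I = "\<lambda>x r. \<integral>\<^sup>+ z \<in> {x - r<..<x + r} \<times> {0..r\<^sup>2}. ennreal ((norm (w z))\<^sup>2) \<partial>lborel"
    have "ennsqrt (ennreal (1 / r) * ?I x r) \<le> (SUP r\<in>{0<..}. ennsqrt (ennreal (1 / r) * ?I x r))"
      using r by (intro SUP_upper) simp
    also have "\<dots> \<le> (SUP x. SUP r\<in>{0<..}. ennsqrt (ennreal (1 / r) * ?I x r))" by (rule SUP_upper) simp
    also have "\<dots> \<le> ennreal \<epsilon>" using S by (meson add_increasing le_less_trans less_imp_le order_refl order_trans zero_le)
    finally have "ennreal (1 / r) * ?I x r \<le> ennreal (\<epsilon>\<^sup>2)" using \<epsilon> by (intro ennsqrt_leD) auto
    then have "ennreal r * (ennreal (1 / r) * ?I x r) \<le> ennreal r * ennreal (\<epsilon>\<^sup>2)" by (rule mult_left_mono) simp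
    moreover have "ennreal r * (ennreal (1 / r) * ?I x r) = ?I x r" using r by (simp add: mult.assoc[symmetric] ennreal_mult[symmetric])
    moreover have "ennreal r * ennreal (\<epsilon>\<^sup>2) = ennreal (\<epsilon>\<^sup>2 * r)" using r by (simp add: ennreal_mult[symmetric] mult.commute)
    ultimately show ?thesis by (simp only:)
  qed
  have Lw: "L1_loc w" "L1_loc w0" using w w0 by (simp_all add: weak_dx_def)
  define g where "g z = indicator half_plane z *\<^sub>R m z" for z
  define gw where "gw z = indicator half_plane z *\<^sub>R w z" for z
  define gw0 where "gw0 z = indicator half_plane z *\<^sub>R w0 z" for z
  note [measurable] = half_plane_measurable
  have gm[measurable]: "g \<in> borel_measurable borel" "gw \<in> borel_measurable borel" "gw0 \<in> borel_measurable borel"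
    unfolding g_def[abs_def] gw_def[abs_def] gw0_def[abs_def] using mm L1_loc_measurable[OF Lw(1)] L1_loc_measurable[OF Lw(2)] by simp_all
  \<comment> \<open>The default has to be a unit vector, because |M| = 1 is demanded at all points
    including t <= 0. For \<open>W\<close> below, the default 0 satisfies every bound.\<close>
  define M where "M z = (if z \<in> half_plane \<and> norm (g z) = 1 then g z else axis 1 1)" for z
  define W where "W z = (if z \<in> half_plane \<and> norm (gw z) \<le> \<epsilon> / sqrt (snd z) then gw z else 0)" for z
  have sndm[measurable]: "(snd :: real \<times> real \<Rightarrow> real) \<in> borel_measurable borel"
    by (intro borel_measurable_continuous_onI continuous_intros)
  have Mm[measurable]: "M \<in> borel_measurable borel" unfolding M_def[abs_def] by measurable
  have Wm[measurable]: "W \<in> borel_measurable borel" unfolding W_def[abs_def] by measurable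
  have Meq: "AE z in lborel. 0 < snd z \<longrightarrow> m z = M z"
    using m1 by eventually_elim (simp add: M_def g_def)
  have Weq: "AE z in lborel. 0 < snd z \<longrightarrow> w z = W z"
  proof -
    have "AE z in lborel. 0 < snd z \<longrightarrow> norm (gw z) \<le> \<epsilon> / sqrt (snd z)"
    proof (rule AE_slices)
      show "{z. 0 < snd z \<longrightarrow> norm (gw z) \<le> \<epsilon> / sqrt (snd z)} \<in> sets borel" by measurable
      show "AE x in lborel. 0 < snd (x, t) \<longrightarrow> norm (gw (x, t)) \<le> \<epsilon> / sqrt (snd (x, t))" for t
      proof (cases "0 < t")
        case True
        from sup[OF True] show ?thesis by eventually_elim (simp add: gw_def indicator_def)
      qed simp
    qed
    then show ?thesis by eventually_elim (simp add: W_def gw_def)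
  qed
  have W0eq: "AE z in lborel. 0 < snd z \<longrightarrow> w0 z = W z"
    using Weq weak_dx_unique[OF w w0] by eventually_elim auto
  have test: "g' \<in> borel_measurable borel" "\<not> 0 < snd z \<Longrightarrow> g' z = 0"
    if \<phi>: "test_fun \<phi>" and g': "g' = \<phi> \<or> g' = dx \<phi> \<or> g' = dt \<phi> \<or> g' = dx (dx \<phi>)" for \<phi> g' z
  proof -
    have t: "test_fun g'" using g' \<phi> test_fun_dx by blast
    then have "continuous_on UNIV g'" using smooth2_continuous unfolding test_fun_def by blast
    then show "g' \<in> borel_measurable borel" by (rule borel_measurable_continuous_onI)
    show "g' z = 0" if "\<not> 0 < snd z"
      using c1_zero(1)[OF test_function_c1(1)[OF test_fun_test_function[OF t]] that] .
  qed
  have cm: "(\<lambda>z. indicator half_plane z *\<^sub>R cross3 (m z) (w0 z)) \<in> borel_measurable borel"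
  proof -
    have "(\<lambda>z. cross3 (g z) (gw0 z)) \<in> borel_measurable borel"
      using gm by (intro borel_measurable_continuous_Pair[OF _ _ bounded_bilinear.continuous_on[OF bounded_bilinear_cross3]] continuous_intros) auto
    moreover have "cross3 (g z) (gw0 z) = indicator half_plane z *\<^sub>R cross3 (m z) (w0 z)" for z
      by (cases "z \<in> half_plane") (auto simp: g_def gw0_def)
    ultimately show ?thesis by (simp only:)
  qed
  have nm: "(\<lambda>z. indicator half_plane z *\<^sub>R ((norm (w0 z))\<^sup>2 *\<^sub>R m z)) \<in> borel_measurable borel"
  proof -
    have "(\<lambda>z. (norm (gw0 z))\<^sup>2 *\<^sub>R g z) \<in> borel_measurable borel" by measurable
    moreover have "(norm (gw0 z))\<^sup>2 *\<^sub>R g z = indicator half_plane z *\<^sub>R ((norm (w0 z))\<^sup>2 *\<^sub>R m z)" for z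
      by (cases "z \<in> half_plane") (auto simp: g_def gw0_def)
    ultimately show ?thesis by (simp only:)
  qed
  have cM: "(\<lambda>z. cross3 (M z) (W z)) \<in> borel_measurable borel"
    using Mm Wm by (intro borel_measurable_continuous_Pair[OF _ _ bounded_bilinear.continuous_on[OF bounded_bilinear_cross3]] continuous_intros) auto
  have nM: "(\<lambda>z. (norm (W z))\<^sup>2 *\<^sub>R M z) \<in> borel_measurable borel" by measurable
  have ceq: "AE z in lborel. 0 < snd z \<longrightarrow> cross3 (m z) (w0 z) = cross3 (M z) (W z)"
    and neq: "AE z in lborel. 0 < snd z \<longrightarrow> (norm (w0 z))\<^sup>2 *\<^sub>R m z = (norm (W z))\<^sup>2 *\<^sub>R M z"
    using Meq W0eq by (eventually_elim, simp)+
  have wm: "(\<lambda>z. indicator half_plane z *\<^sub>R w z) \<in> borel_measurable borel" using L1_loc_measurable[OF Lw(1)] .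
  have "tame \<alpha> (sqrt (1 - \<alpha>\<^sup>2)) \<epsilon> Ap Am M W"
  proof
    show "0 < \<alpha>" "\<alpha> \<le> 1" "sqrt (1 - \<alpha>\<^sup>2) = sqrt (1 - \<alpha>\<^sup>2)" "0 \<le> \<epsilon>" "norm Ap = 1" "norm Am = 1"
      "M \<in> borel_measurable borel" "W \<in> borel_measurable borel" using \<alpha> nA \<epsilon> Mm Wm by simp_all
    show "norm (M z) = 1" for z by (simp add: M_def)
    show "norm (W (x, t)) \<le> \<epsilon> / sqrt t" if "0 < t" for x t using that \<epsilon> by (simp add: W_def)
    show "(\<integral>z. dx \<phi> z *\<^sub>R M z \<partial>lborel) = - (\<integral>z. \<phi> z *\<^sub>R W z \<partial>lborel)" if \<phi>: "test_fun \<phi>" for \<phi>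
      using w test_fun_test_function[OF \<phi>] half_plane_integral_AE[OF test[OF \<phi>, of "dx \<phi>"] mm Mm Meq]
        half_plane_integral_AE[OF test[OF \<phi>, of \<phi>] wm Wm Weq] unfolding weak_dx_def by simp
    show "- (\<integral>z. dt \<phi> z *\<^sub>R M z \<partial>lborel) =
       - sqrt (1 - \<alpha>\<^sup>2) *\<^sub>R (\<integral>z. dx \<phi> z *\<^sub>R cross3 (M z) (W z) \<partial>lborel)
       + \<alpha> *\<^sub>R (\<integral>z. dx (dx \<phi>) z *\<^sub>R M z \<partial>lborel)
       + \<alpha> *\<^sub>R (\<integral>z. \<phi> z *\<^sub>R ((norm (W z))\<^sup>2 *\<^sub>R M z) \<partial>lborel)" if \<phi>: "test_fun \<phi>" for \<phi>
      using eq[OF test_fun_test_function[OF \<phi>]]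
        half_plane_integral_AE[OF test[OF \<phi>, of "dt \<phi>"] mm Mm Meq]
        half_plane_integral_AE[OF test[OF \<phi>, of "dx \<phi>"] cm cM ceq]
        half_plane_integral_AE[OF test[OF \<phi>, of "dx (dx \<phi>)"] mm Mm Meq]
        half_plane_integral_AE[OF test[OF \<phi>, of \<phi>] nm nM neq] by simp
    fix x r :: real assume r: "0 < r"
    let ?h = "\<lambda>z. indicator ({x - r<..<x + r} \<times> {0<..<r\<^sup>2}) z * (norm (W z))\<^sup>2"
    have hm: "?h \<in> borel_measurable borel"
    proof -
      have "open ({x - r<..<x + r} \<times> {0<..<r\<^sup>2})" by (intro open_Times) auto
      then have [measurable]: "{x - r<..<x + r} \<times> {0<..<r\<^sup>2} \<in> sets borel" by simp
      show ?thesis by measurable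
    qed
    have "(\<integral>\<^sup>+ z. ennreal (?h z) \<partial>lborel) \<le> (\<integral>\<^sup>+ z \<in> {x - r<..<x + r} \<times> {0..r\<^sup>2}. ennreal ((norm (w z))\<^sup>2) \<partial>lborel)"
    proof (intro nn_integral_mono)
      fix z
      have "norm (W z) \<le> norm (w z)" by (auto simp: W_def gw_def)
      then have "ennreal ((norm (W z))\<^sup>2) \<le> ennreal ((norm (w z))\<^sup>2)" by (intro ennreal_leI power_mono) auto
      then show "ennreal (?h z) \<le> ennreal ((norm (w z))\<^sup>2) * indicator ({x - r<..<x + r} \<times> {0..r\<^sup>2}) z"
        by (auto simp: indicator_def)
    qed
    also note carl[OF r]
    finally have le: "(\<integral>\<^sup>+ z. ennreal (?h z) \<partial>lborel) \<le> ennreal (\<epsilon>\<^sup>2 * r)" .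
    show "(\<integral>z. ?h z \<partial>lborel) \<le> \<epsilon>\<^sup>2 * r" using le r by (intro integral_real_bounded) auto
    show "integrable lborel ?h"
    proof (rule integrableI_nonneg)
      show "(\<integral>\<^sup>+ z. ennreal (?h z) \<partial>lborel) < \<infinity>" using le by (rule le_less_trans) simp
    qed (use hm in auto)
  next
    fix \<psi> :: "real \<Rightarrow> real" and a b \<delta> :: real
    assume \<psi>: "smooth1 UNIV \<psi>" "supp1 a b \<psi>" and \<delta>: "0 < \<delta>"
    have "\<forall>\<^sub>F t in at_right 0. (\<integral>\<^sup>+ x. ennreal (norm (\<psi> x *\<^sub>R (m (x, t) - step_data Ap Am x))) \<partial>lborel) < ennreal \<delta>"
      using order_tendstoD(2)[OF init[OF smooth1_test_function_line[OF \<psi>]], of "ennreal \<delta>"] \<delta> by simp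
    then obtain s0 where s0: "0 < s0" "\<And>t. 0 < t \<Longrightarrow> t < s0 \<Longrightarrow> (\<integral>\<^sup>+ x. ennreal (norm (\<psi> x *\<^sub>R (m (x, t) - step_data Ap Am x))) \<partial>lborel) < ennreal \<delta>"
      unfolding eventually_at_right_field by auto
    \<comment> \<open>The initial condition for m speaks of each single time, while M agrees with m
      on almost every slice only. Therefore the condition for M is stated for almost every
      time.\<close>
    have "AE t in lborel. AE x in lborel. 0 < snd (x, t) \<longrightarrow> g (x, t) = M (x, t)"
    proof (rule AE_slices')
      show "{z. 0 < snd z \<longrightarrow> g z = M z} \<in> sets borel" by measurable
      show "AE z in lborel. 0 < snd z \<longrightarrow> g z = M z" using Meq by eventually_elim (simp add: g_def indicator_def)
    qed
    then have "AE t in lborel. 0 < t \<and> t < s0 \<longrightarrow> (\<integral>x. \<bar>\<psi> x\<bar> * norm (M (x, t) - step_data Ap Am x) \<partial>lborel) \<le> \<delta>"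
    proof eventually_elim
      case (elim t)
      show ?case
      proof (intro impI integral_real_bounded)
        assume t: "0 < t \<and> t < s0"
        have "(\<integral>\<^sup>+ x. ennreal (\<bar>\<psi> x\<bar> * norm (M (x, t) - step_data Ap Am x)) \<partial>lborel)
            = (\<integral>\<^sup>+ x. ennreal (norm (\<psi> x *\<^sub>R (m (x, t) - step_data Ap Am x))) \<partial>lborel)"
          by (rule nn_integral_cong_AE, use elim in eventually_elim) (use t in \<open>simp add: g_def indicator_def\<close>)
        then show "(\<integral>\<^sup>+ x. ennreal (\<bar>\<psi> x\<bar> * norm (M (x, t) - step_data Ap Am x)) \<partial>lborel) \<le> ennreal \<delta>"
          using s0(2)[of t] t by simp
      qed (use \<delta> in simp)
    qed
    then show "\<exists>s0>0. AE t in lborel. 0 < t \<and> t < s0 \<longrightarrow> (\<integral>x. \<bar>\<psi> x\<bar> * norm (M (x, t) - step_data Ap Am x) \<partial>lborel) \<le> \<delta>"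
      using s0(1) by blast
  qed
  then show ?thesis using Meq by blast
qed

section \<open>Rotations and the ends of the profile\<close>

lemma rotation_isometry:
  assumes "rotation_matrix (R :: real^3^3)"
  shows "(R *v x) \<bullet> (R *v y) = x \<bullet> y" "norm (R *v x) = norm x" "R *v (transpose R *v x) = x" "transpose R *v (R *v x) = x"
proof -
  have o: "orthogonal_matrix R" using assms by (simp add: rotation_matrix_def)
  then have "orthogonal_transformation ((*v) R)" by (simp add: orthogonal_transformation_matrix)
  then show i: "(R *v x) \<bullet> (R *v y) = x \<bullet> y" for x y by (simp add: orthogonal_transformation_def)
  show "norm (R *v x) = norm x" using i[of x x] by (simp add: norm_eq_sqrt_inner)
  show "R *v (transpose R *v x) = x" "transpose R *v (R *v x) = x"
    using o unfolding orthogonal_matrix_def by (simp_all only: matrix_vector_mul_assoc matrix_vector_mul_lid)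
qed

text \<open>Two rotations carry the first basis vector to a and to a'. In these coordinates b and b'
  have the same first component, so it remains to turn one into the other about the first
  axis.\<close>

lemma rotation_pair:
  fixes a b a' b' :: "real^3"
  assumes n: "norm a = 1" "norm b = 1" "norm a' = 1" "norm b' = 1" and i: "a \<bullet> b = a' \<bullet> b'"
  shows "\<exists>R. rotation_matrix R \<and> R *v a = a' \<and> R *v b = b'"
proof -
  have two: "2 \<le> CARD(3)" by simp
  obtain P where P: "rotation_matrix P" "P *v (axis 1 1) = a"
    using rotation_matrix_exists_basis[OF two n(1), where k=1] by metis
  obtain P' where P': "rotation_matrix P'" "P' *v (axis 1 1) = a'"
    using rotation_matrix_exists_basis[OF two n(3), where k=1] by metis
  define u where "u = transpose P *v b"
  define u' where "u' = transpose P' *v b'"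
  have Pu: "P *v u = b" "P' *v u' = b'" unfolding u_def u'_def using rotation_isometry(3) P P' by auto
  have u1: "u $ 1 = u' $ 1"
    using rotation_isometry(1)[OF P(1), of "axis 1 1" u] rotation_isometry(1)[OF P'(1), of "axis 1 1" u'] i P P' Pu
    by (simp add: inner_axis')
  have nu: "norm u = 1" "norm u' = 1"
    using rotation_isometry(2)[OF P(1), of u] rotation_isometry(2)[OF P'(1), of u'] Pu n by simp_all
  have sq: "(u $ 2)\<^sup>2 + (u $ 3)\<^sup>2 = (u' $ 2)\<^sup>2 + (u' $ 3)\<^sup>2"
  proof -
    have "u \<bullet> u = u' \<bullet> u'" using nu by (simp add: norm_eq_1)
    then show ?thesis using u1 by (simp add: inner_vec_def sum_3 power2_eq_square)
  qed
  define \<rho> where "\<rho> = (u $ 2)\<^sup>2 + (u $ 3)\<^sup>2"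
  define k where "k = (if \<rho> = 0 then 1 else (u $ 2 * u' $ 2 + u $ 3 * u' $ 3) / \<rho>)"
  define l where "l = (if \<rho> = 0 then 0 else (u $ 2 * u' $ 3 - u $ 3 * u' $ 2) / \<rho>)"
  have kl: "k * k + l * l = 1"
  proof (cases "\<rho> = 0")
    case False
    have "(u $ 2 * u' $ 2 + u $ 3 * u' $ 3)\<^sup>2 + (u $ 2 * u' $ 3 - u $ 3 * u' $ 2)\<^sup>2 = \<rho> * ((u' $ 2)\<^sup>2 + (u' $ 3)\<^sup>2)"
      unfolding \<rho>_def by algebra
    also have "\<dots> = \<rho>\<^sup>2" using sq by (simp add: \<rho>_def power2_eq_square)
    finally show ?thesis using False by (simp add: k_def l_def power2_eq_square add_divide_distrib[symmetric])
  qed (simp add: k_def l_def)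
  have rot: "k * u $ 2 - l * u $ 3 = u' $ 2" "l * u $ 2 + k * u $ 3 = u' $ 3"
  proof -
    have "k * u $ 2 - l * u $ 3 = u' $ 2 \<and> l * u $ 2 + k * u $ 3 = u' $ 3"
    proof (cases "\<rho> = 0")
      case True
      then have "u $ 2 = 0" "u $ 3 = 0" by (auto simp: \<rho>_def sum_power2_eq_zero_iff)
      moreover from this have "u' $ 2 = 0" "u' $ 3 = 0" using sq by (auto simp: sum_power2_eq_zero_iff)
      ultimately show ?thesis by simp
    next
      case False
      have k: "k * x = (u $ 2 * u' $ 2 + u $ 3 * u' $ 3) * x / \<rho>" and l: "l * x = (u $ 2 * u' $ 3 - u $ 3 * u' $ 2) * x / \<rho>" for x
        using False by (simp_all add: k_def l_def)
      have "(u $ 2 * u' $ 2 + u $ 3 * u' $ 3) * u $ 2 - (u $ 2 * u' $ 3 - u $ 3 * u' $ 2) * u $ 3 = \<rho> * u' $ 2"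
        "(u $ 2 * u' $ 3 - u $ 3 * u' $ 2) * u $ 2 + (u $ 2 * u' $ 2 + u $ 3 * u' $ 3) * u $ 3 = \<rho> * u' $ 3"
        unfolding \<rho>_def by algebra+
      moreover have "k * u $ 2 - l * u $ 3 = ((u $ 2 * u' $ 2 + u $ 3 * u' $ 3) * u $ 2 - (u $ 2 * u' $ 3 - u $ 3 * u' $ 2) * u $ 3) / \<rho>"
        "l * u $ 2 + k * u $ 3 = ((u $ 2 * u' $ 3 - u $ 3 * u' $ 2) * u $ 2 + (u $ 2 * u' $ 2 + u $ 3 * u' $ 3) * u $ 3) / \<rho>"
        by (simp_all only: k l diff_divide_distrib add_divide_distrib)
      ultimately show ?thesis using False by (simp only: nonzero_mult_div_cancel_left simp_thms)
    qed
    then show "k * u $ 2 - l * u $ 3 = u' $ 2" "l * u $ 2 + k * u $ 3 = u' $ 3" by auto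
  qed
  define Q :: "real^3^3" where "Q = vector [vector [1, 0, 0], vector [0, k, - l], vector [0, l, k]]"
  have Q: "rotation_matrix Q"
    unfolding rotation_matrix_def orthogonal_matrix Q_def
    using kl by (simp add: det_3 vec_eq_iff forall_3 matrix_matrix_mult_def sum_3 mat_def transpose_def vector_3 algebra_simps)
  have Qa: "Q *v axis 1 1 = axis 1 1" and Qu: "Q *v u = u'"
    using u1 rot by (simp_all add: Q_def vec_eq_iff forall_3 matrix_vector_mult_def sum_3 axis_def vector_3)
  have rmul: "rotation_matrix (A ** B)" if "rotation_matrix A" "rotation_matrix B" for A B :: "real^3^3"
    using that by (simp add: rotation_matrix_def orthogonal_matrix_mul det_mul)
  have ta: "transpose P *v a = axis 1 1" using rotation_isometry(4)[OF P(1), of "axis 1 1"] unfolding P(2) .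
  have "rotation_matrix (transpose P)" using P(1) by (simp add: rotation_matrix_def orthogonal_matrix_transpose det_transpose)
  then have "rotation_matrix (P' ** (Q ** transpose P))" by (intro rmul P' Q)
  moreover have "(P' ** (Q ** transpose P)) *v a = a'" "(P' ** (Q ** transpose P)) *v b = b'"
    by (simp_all only: matrix_vector_mul_assoc[symmetric] ta u_def[symmetric] Qa Qu P'(2) Pu)
  ultimately show ?thesis by blast
qed

context frenet begin

text \<open>The two limits of the profile together with their rate. Unit length is included since it
  passes from \<open>f\<close> to the limits.\<close>

definition ends :: "real^3 \<Rightarrow> real^3 \<Rightarrow> bool" where
  "ends A A' \<longleftrightarrow> norm A = 1 \<and> norm A' = 1 \<and> (\<forall>s\<ge>0. norm (f s - A) \<le> c * exp (1 / \<alpha>) * exp (- s))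
     \<and> (\<forall>s\<le>0. norm (f s - A') \<le> c * exp (1 / \<alpha>) * exp s)"

lemma exp_small: "0 < e \<Longrightarrow> \<exists>s\<ge>0. K * exp (- s) < (e :: real)"
proof -
  assume e: "0 < e"
  have "((\<lambda>s. K * exp (- s)) \<longlongrightarrow> K * 0) at_top"
    by (intro tendsto_mult tendsto_const filterlim_compose[OF exp_at_bot filterlim_uminus_at_bot_at_top])
  then have "\<forall>\<^sub>F s in at_top. K * exp (- s) < e" using e by (auto dest: order_tendstoD(2))
  then have "\<forall>\<^sub>F s in at_top. 0 \<le> s \<and> K * exp (- s) < e" using eventually_ge_at_top[of 0] by eventually_elim simp
  then show ?thesis by (auto simp: eventually_at_top_linorder)
qed

lemma ends_exist: "\<exists>A A'. ends A A'"
proof (rule f_limits)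
  fix A A' assume a: "\<And>s. 0 \<le> s \<Longrightarrow> norm (f s - A) \<le> c * exp (1 / \<alpha>) * exp (- s)"
    and b: "\<And>s. s \<le> 0 \<Longrightarrow> norm (f s - A') \<le> c * exp (1 / \<alpha>) * exp s"
  have "norm B = 1" if "\<And>e. 0 < e \<Longrightarrow> \<exists>s. norm (f s - B) < e" for B
  proof (rule ccontr)
    assume "norm B \<noteq> 1"
    then have "0 < \<bar>norm B - 1\<bar>" by simp
    from that[OF this] obtain s where "norm (f s - B) < \<bar>norm B - 1\<bar>" by blast
    then show False using norm_triangle_ineq3[of "f s" B] by (simp add: norms)
  qed
  note n = this
  have "norm A = 1"
  proof (rule n)
    fix e :: real assume "0 < e"
    then obtain s where "0 \<le> s" "c * exp (1 / \<alpha>) * exp (- s) < e" using exp_small by blast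
    then show "\<exists>s. norm (f s - A) < e" using a[of s] by (intro exI[of _ s]) linarith
  qed
  moreover have "norm A' = 1"
  proof (rule n)
    fix e :: real assume "0 < e"
    then obtain s where "0 \<le> s" "c * exp (1 / \<alpha>) * exp (- s) < e" using exp_small by blast
    then show "\<exists>s. norm (f s - A') < e" using b[of "- s"] by (intro exI[of _ "- s"]) simp
  qed
  ultimately show ?thesis using a b unfolding ends_def by blast
qed

lemma ends_close: "ends A A' \<Longrightarrow> norm (A - A') \<le> 2 * (c * exp (1 / \<alpha>))"
proof -
  assume e: "ends A A'"
  have "norm (f 0 - A) \<le> c * exp (1 / \<alpha>)" "norm (f 0 - A') \<le> c * exp (1 / \<alpha>)" using e unfolding ends_def by (auto dest: spec[of _ 0])
  then show ?thesis using norm_triangle_ineq4[of "f 0 - A'" "f 0 - A"] by simp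
qed

text \<open>A rotation preserves inner products and, by its determinant, also cross products, so
  every relation of the frame is carried over and only the limits are moved.\<close>

lemma wave:
  assumes R: "rotation_matrix R" and e: "ends A A'"
  shows "wave \<alpha> \<beta> c (exp (1 / \<alpha>)) w (\<lambda>s. R *v f s) (\<lambda>s. R *v p s) (\<lambda>s. R *v q s) (R *v A) (R *v A')"
proof
  note d = bounded_linear.has_vector_derivative[OF matrix_vector_mul_bounded_linear[of R]]
  note l = matrix_vector_mult_diff_distrib[of R] matrix_vector_right_distrib[of R] matrix_vector_mult_scaleR[of R]
  note n = rotation_isometry(2)[OF R]
  show "0 < \<alpha>" "\<alpha> \<le> 1" "\<beta> = sqrt (1 - \<alpha>\<^sup>2)" "0 \<le> c" "0 \<le> exp (1 / \<alpha>)" using \<alpha> c by (auto simp: \<beta>_def)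
  fix s :: real
  show "0 \<le> w s" "w s \<le> c" "w s \<le> c * exp (1 / \<alpha>) * exp (- \<bar>s\<bar>)" by (fact w_bound)+
  show "(w has_real_derivative - (\<alpha> * s / 2) * w s) (at s)" by (fact dw)
  show "((\<lambda>s. R *v f s) has_vector_derivative w s *\<^sub>R (R *v p s)) (at s)" using d[OF dfpq(1)] unfolding l .
  show "((\<lambda>s. R *v p s) has_vector_derivative (- w s) *\<^sub>R (R *v f s) + (\<beta> * s / 2) *\<^sub>R (R *v q s)) (at s)" using d[OF dfpq(2)] unfolding l .
  show "((\<lambda>s. R *v q s) has_vector_derivative (- (\<beta> * s / 2)) *\<^sub>R (R *v p s)) (at s)" using d[OF dfpq(3)] unfolding l .
  show "norm (R *v f s) = 1" "norm (R *v p s) = 1" "norm (R *v q s) = 1" by (simp_all add: n norms)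
  show "(R *v f s) \<bullet> (R *v p s) = 0" by (simp add: rotation_isometry(1)[OF R] orthonormal)
  show "cross3 (R *v f s) (R *v p s) = R *v q s" by (simp add: cross_rotation_matrix[OF R] frame_cross)
  show "norm (R *v f s - R *v A) \<le> c * exp (1 / \<alpha>) * exp (- s)" if "0 \<le> s"
    using e that unfolding ends_def l[symmetric] n by blast
  show "norm (R *v f s - R *v A') \<le> c * exp (1 / \<alpha>) * exp s" if "s \<le> 0"
    using e that unfolding ends_def l[symmetric] n by blast
next
  fix i
  have "smooth1 UNIV (\<lambda>s. R $ i $ 1 * g s $ 1 + R $ i $ 2 * g s $ 2 + R $ i $ 3 * g s $ 3)"
    if "\<And>j. smooth1 UNIV (\<lambda>s. g s $ j)" for g :: "real \<Rightarrow> real^3"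
    using that by (intro smooth1_intros open_UNIV)
  then show "smooth1 UNIV (\<lambda>s. (R *v f s) $ i)" "smooth1 UNIV (\<lambda>s. (R *v p s) $ i)" "smooth1 UNIV (\<lambda>s. (R *v q s) $ i)"
    using smooth_frame by (simp_all add: matrix_vector_mult_def sum_3)
  show "smooth1 UNIV w" by (fact smooth_frame)
qed

text \<open>
  If both ends agreed, the constant map would be a second solution with the same initial value,
  so uniqueness would force the profile to be constant.
\<close>

lemma ends_distinct:
  assumes e: "ends A A'" and c: "0 < c" and small: "2 * \<epsilon>\<^sup>2 + 8 * cutoff_var * \<epsilon> + 2 * \<epsilon> \<le> 1" "0 \<le> \<epsilon>"
    "c\<^sup>2 / \<alpha> + \<alpha> * (c\<^sup>2 + \<epsilon>\<^sup>2) \<le> 1 / 4"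
  shows "A \<noteq> A'"
proof
  assume eq: "A = A'"
  have R: "rotation_matrix (mat 1 :: real^3^3)" by (simp add: rotation_matrix_def orthogonal_matrix_id)
  interpret W: wave \<alpha> \<beta> c "exp (1 / \<alpha>)" w "\<lambda>s. f s" "\<lambda>s. p s" "\<lambda>s. q s" A A
    using wave[OF R e] unfolding matrix_vector_mul_lid eq[symmetric] .
  have nA: "norm A = 1" using e by (simp add: ends_def)
  \<comment> \<open>A constant map solves the equation with derivative 0, and by the assumed
    equality of the ends its initial data are those of the wave.\<close>
  have "tame_small \<alpha> \<beta> \<epsilon> A A (\<lambda>_. A) (\<lambda>_. 0)"
  proof
    show "norm (A - A) + 2 * \<epsilon>\<^sup>2 + 8 * cutoff_var * \<epsilon> + 2 * \<epsilon> \<le> 1" using small by simp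
    show "norm (0 :: real^3) \<le> \<epsilon> / sqrt t" if "0 < t" for t using that small by simp
    fix \<phi> assume "test_fun \<phi>"
    then have t: "test_function \<phi>" by (rule test_fun_test_function)
    note c1 = test_function_c1[OF t]
    have i: "integrable lborel (dx \<phi>)" "integrable lborel (dt \<phi>)" "integrable lborel (dx (dx \<phi>))"
      using integrable_c1(2)[OF c1(1) lbdd_const[of "1::real"] c1(1)] integrable_c1(3)[OF c1(2) lbdd_const[of "1::real"] c1(2)]
        integrable_c1(2)[OF c1(3) lbdd_const[of "1::real"] c1(3)] by simp_all
    have zero: "(\<integral>z. g z *\<^sub>R A \<partial>lborel) = 0" if "integrable lborel g" "(\<integral>z. g z \<partial>lborel) = 0" for g :: "real \<times> real \<Rightarrow> real"
      using that by (simp add: integral_scaleR_left)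
    note z = zero[OF i(1) c1_integral_zero(2)[OF c1(1)]] zero[OF i(2) c1_integral_zero(1)[OF c1(2)]] zero[OF i(3) c1_integral_zero(2)[OF c1(3)]]
    show "(\<integral>z. dx \<phi> z *\<^sub>R A \<partial>lborel) = - (\<integral>z. \<phi> z *\<^sub>R 0 \<partial>lborel)" unfolding z by simp
    show "- (\<integral>z. dt \<phi> z *\<^sub>R A \<partial>lborel) = - \<beta> *\<^sub>R (\<integral>z. dx \<phi> z *\<^sub>R cross3 A 0 \<partial>lborel)
       + \<alpha> *\<^sub>R (\<integral>z. dx (dx \<phi>) z *\<^sub>R A \<partial>lborel) + \<alpha> *\<^sub>R (\<integral>z. \<phi> z *\<^sub>R ((norm (0 :: real^3))\<^sup>2 *\<^sub>R A) \<partial>lborel)" unfolding z by simp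
  next
    fix \<psi> :: "real \<Rightarrow> real" and a b \<delta> :: real assume \<delta>: "0 < \<delta>"
    have "AE x in lborel. \<bar>\<psi> x\<bar> * norm (A - step_data A A x) = 0"
      using AE_lborel_singleton[of 0] by eventually_elim (simp add: step_data_def indicator_def)
    then have z: "(\<integral>x. \<bar>\<psi> x\<bar> * norm (A - step_data A A x) \<partial>lborel) = 0" by (rule integral_eq_zero_AE)
    show "\<exists>s0>0. AE t in (lborel :: real measure). 0 < t \<and> t < s0 \<longrightarrow> (\<integral>x. \<bar>\<psi> x\<bar> * norm (A - step_data A A x) \<partial>lborel) \<le> \<delta>"
      unfolding z by (rule exI[of _ "1::real"]) (use \<delta> in simp)
  next
    show "0 < \<alpha>" "\<alpha> \<le> 1" "\<beta> = sqrt (1 - \<alpha>\<^sup>2)" "0 \<le> \<epsilon>" "norm A = 1" "norm A = 1" by (fact W.\<alpha> W.\<beta> small(2) nA)+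
    show "(\<lambda>_ :: real \<times> real. A) \<in> borel_measurable borel" "(\<lambda>_ :: real \<times> real. 0 :: real^3) \<in> borel_measurable borel" by simp_all
    show "integrable lborel (\<lambda>z. indicator ({x - r<..<x + r} \<times> {0<..<r\<^sup>2}) z * (norm (0 :: real^3))\<^sup>2)" for x r :: real by simp
    show "(\<integral>z. indicator ({x - r<..<x + r} \<times> {0<..<r\<^sup>2}) z * (norm (0 :: real^3))\<^sup>2 \<partial>lborel) \<le> \<epsilon>\<^sup>2 * r" if "0 < r" for x r :: real
      using that by simp
  qed ((simp_all add: nA)?)
  from W.unique[OF this small(3)] have ae: "AE z in lborel. 0 < snd z \<longrightarrow> A = f (scale z)" unfolding W.n_def .
  \<comment> \<open>Equality almost everywhere becomes equality everywhere because both maps are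
    continuous: the set where they differ is open and null, hence empty. Constancy of
    \<open>f\<close> would then force w(0) = c to be 0.\<close>
  let ?N = "half_plane \<inter> (\<lambda>z. f (scale z) - A) -` (- {0})"
  have "continuous_on half_plane (\<lambda>z. f (scale z) - A)"
    by (intro continuous_intros continuous_on_compose2[OF W.cont_uvy(1)]) auto
  then have o: "open ?N" by (rule continuous_open_preimage[OF _ open_half_plane]) auto
  have "?N \<in> null_sets lborel"
    using ae o by (subst AE_iff_null_sets) (auto elim: eventually_mono)
  then have "negligible ?N" by (auto simp: negligible_iff_null_sets intro: null_sets_completionI)
  then have empty: "?N = {}" using o open_not_negligible by blast
  have const: "f s = A" for s
  proof -
    have "(s, 1) \<notin> ?N" using empty by blast
    then show ?thesis by simp
  qed
  have "f = (\<lambda>_. A)" using const by (rule ext)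
  then have "((\<lambda>_. A) has_vector_derivative w 0 *\<^sub>R p 0) (at 0)" using dfpq(1)[of 0] by (simp only:)
  from vector_derivative_unique_at[OF this has_vector_derivative_const] have "w 0 *\<^sub>R p 0 = 0" .
  then have "norm (w 0 *\<^sub>R p 0) = 0" by simp
  then show False using c by (simp add: norms w_def)
qed

end

text \<open>The comparison of the profiles is uniform in s, so it passes to the limits at both
  ends.\<close>

lemma ends_compare:
  assumes F: "frenet \<alpha> c1 f1 p1 q1" "frenet \<alpha> c2 f2 p2 q2"
    and e: "frenet.ends \<alpha> c1 f1 A1 A1'" "frenet.ends \<alpha> c2 f2 A2 A2'"
  shows "(norm (A1 - A2))\<^sup>2 \<le> 8 * \<bar>c1 - c2\<bar> * exp (1 / \<alpha>)" "(norm (A1' - A2'))\<^sup>2 \<le> 8 * \<bar>c1 - c2\<bar> * exp (1 / \<alpha>)"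
proof -
  interpret F1: frenet \<alpha> c1 f1 p1 q1 by fact
  interpret F2: frenet \<alpha> c2 f2 p2 q2 by fact
  let ?D = "sqrt (8 * \<bar>c1 - c2\<bar> * exp (1 / \<alpha>))" and ?k = "exp (1 / \<alpha>)"
  have d: "norm (f1 s - f2 s) \<le> ?D" for s using frenet_compare[OF F, of s] by (simp add: real_le_rsqrt)
  have tri: "norm (B1 - B2) \<le> ?D + norm (f1 s - B1) + norm (f2 s - B2)" for s B1 B2
  proof -
    have "B1 - B2 = (f1 s - f2 s) - (f1 s - B1) + (f2 s - B2)" by simp
    also have "norm \<dots> \<le> norm (f1 s - f2 s) + norm (f1 s - B1) + norm (f2 s - B2)"
      by (meson norm_triangle_ineq norm_triangle_ineq4 add_right_mono order_trans)
    finally show ?thesis using d[of s] by linarith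
  qed
  have "norm (A1 - A2) \<le> ?D"
  proof (rule field_le_epsilon)
    fix \<eta> :: real assume "0 < \<eta>"
    then obtain s where s: "0 \<le> s" "(c1 * ?k + c2 * ?k) * exp (- s) < \<eta>" using F1.exp_small by blast
    have "norm (f1 s - A1) \<le> c1 * ?k * exp (- s)" "norm (f2 s - A2) \<le> c2 * ?k * exp (- s)"
      using e s(1) unfolding F1.ends_def F2.ends_def by blast+
    then show "norm (A1 - A2) \<le> ?D + \<eta>" using tri[of A1 A2 s] s(2) by (simp add: distrib_right)
  qed
  moreover have "norm (A1' - A2') \<le> ?D"
  proof (rule field_le_epsilon)
    fix \<eta> :: real assume "0 < \<eta>"
    then obtain s where s: "0 \<le> s" "(c1 * ?k + c2 * ?k) * exp (- s) < \<eta>" using F1.exp_small by blast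
    have "norm (f1 (- s) - A1') \<le> c1 * ?k * exp (- s)" "norm (f2 (- s) - A2') \<le> c2 * ?k * exp (- s)"
      using e s(1) unfolding F1.ends_def F2.ends_def by (auto dest: spec[of _ "- s"])
    then show "norm (A1' - A2') \<le> ?D + \<eta>" using tri[of A1' A2' "- s"] s(2) by (simp add: distrib_right)
  qed
  moreover have "a\<^sup>2 \<le> 8 * \<bar>c1 - c2\<bar> * ?k" if "a \<le> ?D" "0 \<le> a" for a
    using power_mono[OF that, of 2] by simp
  ultimately show "(norm (A1 - A2))\<^sup>2 \<le> 8 * \<bar>c1 - c2\<bar> * ?k" "(norm (A1' - A2'))\<^sup>2 \<le> 8 * \<bar>c1 - c2\<bar> * ?k" by simp_all
qed

text \<open>The comparison estimate bounds the square of the distance linearly, that is, it gives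
  Hoelder exponent 1 / 2 in c, which is enough for the intermediate value theorem.\<close>

lemma holder_continuous:
  fixes A :: "real \<Rightarrow> 'a::real_normed_vector"
  assumes h: "\<And>x y. x \<in> S \<Longrightarrow> y \<in> S \<Longrightarrow> (norm (A x - A y))\<^sup>2 \<le> K * \<bar>x - y\<bar>" and K: "0 < K"
  shows "continuous_on S A"
  unfolding continuous_on_iff
proof (intro ballI allI impI)
  fix x e :: real assume x: "x \<in> S" and e: "0 < e"
  have "dist (A y) (A x) < e" if y: "y \<in> S" "dist y x < e\<^sup>2 / K" for y
  proof -
    have "K * \<bar>y - x\<bar> < e\<^sup>2" using y(2) K by (simp add: dist_real_def pos_less_divide_eq mult.commute)
    then have "(norm (A y - A x))\<^sup>2 < e\<^sup>2" using h[OF y(1) x] by linarith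
    then show ?thesis using e by (simp add: dist_norm power_less_imp_less_base)
  qed
  then show "\<exists>d>0. \<forall>x'\<in>S. dist x' x < d \<longrightarrow> dist (A x') (A x) < e" using e K by (intro exI[of _ "e\<^sup>2 / K"]) auto
qed

section \<open>Choice of the constants and conclusion\<close>

theorem theorem3p3:
  fixes \<alpha> :: real
  assumes "0 < \<alpha>" and "\<alpha> \<le> 1"
  shows "\<exists>L1 L2 \<delta> \<theta> :: real. \<exists>Rot :: real^3 \<Rightarrow> real^3 \<Rightarrow> real \<Rightarrow> real^3^3.
    0 < L1 \<and> 0 < L2 \<and> -1 < \<delta> \<and> \<delta> < 0 \<and> 0 < \<theta> \<and>
    (\<forall>Ap Am :: real^3.
       norm Ap = 1 \<longrightarrow> norm Am = 1 \<longrightarrow>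
       0 < sphere_angle Ap Am \<longrightarrow> sphere_angle Ap Am \<le> \<theta> \<longrightarrow>
       (\<exists>m. llg_solution \<alpha> (step_data Ap Am) m \<and>
         (\<exists>c. 0 < c \<and> c < sqrt \<alpha> / (2 * sqrt pi) \<and>
            rotation_matrix (Rot Ap Am c) \<and>
            (\<forall>z\<in>half_plane. m z = Rot Ap Am c *v self_similar \<alpha> c z) \<and>
            X_seminorm m \<le> ennreal (L1 + L2 * c) \<and>
            (0 \<le> Ap $ 3 \<and> 0 \<le> Am $ 3 \<longrightarrow> third_component_ge \<delta> m) \<and>
            (\<forall>m'. llg_solution \<alpha> (step_data Ap Am) m' \<and>
               third_component_ge \<delta> m' \<and> X_seminorm m' \<le> ennreal (L1 + L2 * c) \<longrightarrow>
               (AE z in lborel. z \<in> half_plane \<longrightarrow> m' z = m z)))))"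
proof -
  let ?\<beta> = "sqrt (1 - \<alpha>\<^sup>2)" and ?k = "exp (1 / \<alpha>)"
  \<comment> \<open>The normalisation V \<epsilon> = 1 / 2 gives 8 \<open>cutoff_var\<close>
    \<epsilon> = 1 / 2 - 4 \<epsilon>. The reserve 4 \<epsilon> pays for the other two terms of the
    smallness condition, and V >= 4 gives \<epsilon> <= 1 / 8.\<close>
  define V where "V = 4 + 8 * cutoff_var"
  have V: "4 \<le> V" using cutoff_var_nonneg by (simp add: V_def)
  define \<epsilon> where "\<epsilon> = 1 / (2 * V)"
  have \<epsilon>: "0 < \<epsilon>" "\<epsilon> \<le> 1 / 8" "V * \<epsilon> = 1 / 2" using V by (simp_all add: \<epsilon>_def field_simps)
  have e8: "\<epsilon>\<^sup>2 \<le> 1 / 8 * \<epsilon>" using mult_right_mono[OF \<epsilon>(2), of \<epsilon>] \<epsilon>(1) by (simp add: power2_eq_square)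
  then have \<epsilon>2: "\<epsilon>\<^sup>2 \<le> 1 / 8 * \<epsilon>" "\<epsilon>\<^sup>2 \<le> 1 / 64" using \<epsilon>(2) by linarith+
  have small0: "2 * \<epsilon>\<^sup>2 + 8 * cutoff_var * \<epsilon> + 2 * \<epsilon> \<le> 1 / 2"
  proof -
    have "8 * cutoff_var * \<epsilon> = 1 / 2 - 4 * \<epsilon>" using \<epsilon>(3) by (simp add: V_def distrib_right)
    then show ?thesis using \<epsilon>2 \<epsilon>(1) by linarith
  qed
  \<comment> \<open>The first bound serves \<open>c_small\<close> and the upper bound on c in the
    theorem. The second gives existence of the frame by contraction, ends at distance at most 1 / 4,
    and a third component above - 1 / 8. The third keeps \<open>L1 + L2 * c\<close> at most
    \<epsilon> / 2.\<close>
  define c0 where "c0 = min (\<alpha> / 8) (min (1 / (8 * ?k)) (\<epsilon> / (4 * (1 + 2 * ?k))))"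
  have c0: "0 < c0" "c0 \<le> \<alpha> / 8" "c0 * ?k \<le> 1 / 8" "(1 + 2 * ?k) * c0 \<le> \<epsilon> / 4"
  proof -
    have k: "0 < 1 + 2 * ?k" by (simp add: add_pos_pos)
    show "0 < c0" using assms \<epsilon> k by (auto simp: c0_def)
    show "c0 \<le> \<alpha> / 8" unfolding c0_def by (rule min.cobounded1)
    have "c0 \<le> 1 / (8 * ?k)" "c0 \<le> \<epsilon> / (4 * (1 + 2 * ?k))" by (simp_all add: c0_def)
    then have "c0 * (8 * ?k) \<le> 1" "c0 * (4 * (1 + 2 * ?k)) \<le> \<epsilon>" using k by (simp_all add: pos_le_divide_eq)
    then show "c0 * ?k \<le> 1 / 8" "(1 + 2 * ?k) * c0 \<le> \<epsilon> / 4" by (simp_all add: algebra_simps)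
  qed
  have cb: "c * ?k \<le> 1 / 8" "(1 + 2 * ?k) * c \<le> \<epsilon> / 4" "c\<^sup>2 / \<alpha> + \<alpha> * (c\<^sup>2 + \<epsilon>\<^sup>2) \<le> 1 / 4" "c < sqrt \<alpha> / (2 * sqrt pi)"
    if c: "0 \<le> c" "c \<le> c0" for c
  proof -
    show "c * ?k \<le> 1 / 8" using mult_right_mono[OF c(2) exp_ge_zero[of "1 / \<alpha>"]] c0(3) by linarith
    have "(1 + 2 * ?k) * c \<le> (1 + 2 * ?k) * c0" using c by (intro mult_left_mono) (auto simp: add_pos_pos less_imp_le)
    then show "(1 + 2 * ?k) * c \<le> \<epsilon> / 4" using c0(4) by linarith
    have ca: "c \<le> \<alpha> / 8" using c c0 by linarith
    have "c\<^sup>2 \<le> (\<alpha> / 8)\<^sup>2" using ca c by (intro power_mono) auto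
    then have c2: "c\<^sup>2 \<le> \<alpha> * \<alpha> / 64" by (simp add: power2_eq_square)
    then have "c\<^sup>2 / \<alpha> \<le> \<alpha> / 64" using assms by (simp add: pos_divide_le_eq)
    then have e1: "c\<^sup>2 / \<alpha> \<le> 1 / 64" by (rule order_trans) (use assms in simp)
    have "\<alpha> * \<alpha> \<le> 1" using assms by (simp add: mult_le_one)
    then have e2: "\<alpha> * (c\<^sup>2 + \<epsilon>\<^sup>2) \<le> 1 * (1 / 64 + 1 / 64)" using c2 \<epsilon>2 assms by (intro mult_mono add_mono) auto
    show "c\<^sup>2 / \<alpha> + \<alpha> * (c\<^sup>2 + \<epsilon>\<^sup>2) \<le> 1 / 4" by (rule order_trans[OF add_mono[OF e1 e2]]) simp
    have "\<alpha> \<le> sqrt \<alpha>" using assms by (simp add: real_le_rsqrt power2_eq_square mult_left_le)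
    then have "c \<le> sqrt \<alpha> / 8" using ca by linarith
    also have "sqrt \<alpha> / 8 < sqrt \<alpha> / (2 * sqrt pi)"
    proof -
      have "sqrt pi < sqrt 4" using pi_less_4 by (intro real_sqrt_less_mono)
      then have "2 * sqrt pi < 8" by simp
      then show ?thesis using assms by (intro divide_strict_left_mono) auto
    qed
    finally show "c < sqrt \<alpha> / (2 * sqrt pi)" .
  qed
  have "\<forall>c\<in>{0..c0}. \<exists>f p q A A'. frenet \<alpha> c f p q \<and> frenet.ends \<alpha> c f A A'"
  proof
    fix c assume "c \<in> {0..c0}"
    then have c: "0 \<le> c" "c \<le> c0" by auto
    have c4: "c * (4 * ?k) \<le> 1 / 2" using cb(1)[OF c] by simp
    obtain f p q where "serret_frenet \<alpha> c f p q" by (rule serret_frenet_exists[OF assms(1) c(1) c4])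
    then interpret frenet \<alpha> c f p q using assms c by unfold_locales
    show "\<exists>f p q A A'. frenet \<alpha> c f p q \<and> frenet.ends \<alpha> c f A A'" using ends_exist frenet_axioms by blast
  qed
  then obtain f p q A A' where fr: "\<And>c. c \<in> {0..c0} \<Longrightarrow> frenet \<alpha> c (f c) (p c) (q c)"
    and en: "\<And>c. c \<in> {0..c0} \<Longrightarrow> frenet.ends \<alpha> c (f c) (A c) (A' c)" unfolding bchoice_iff by blast
  have nA: "norm (A c) = 1" "norm (A' c) = 1" if "c \<in> {0..c0}" for c
    using en[OF that] unfolding frenet.ends_def[OF fr[OF that]] by auto
  have contA: "continuous_on {0..c0} A" "continuous_on {0..c0} A'"
    using ends_compare[OF fr fr en en] by (intro holder_continuous[where K="8 * ?k"]; simp add: mult_ac)+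
  have ang: "\<bar>A c \<bullet> A' c\<bar> \<le> 1" if "c \<in> {0..c0}" for c using Cauchy_Schwarz_ineq2[of "A c" "A' c"] nA[OF that] by simp
  let ?g = "\<lambda>c. arccos (A c \<bullet> A' c)"
  have cont: "continuous_on {0..c0} ?g"
    by (intro continuous_on_arccos continuous_on_inner contA) (use ang in \<open>auto simp: abs_le_iff\<close>)
  have g0: "?g 0 = 0"
  proof -
    have z: "0 \<in> {0..c0}" using c0 by simp
    interpret frenet \<alpha> 0 "f 0" "p 0" "q 0" by (rule fr[OF z])
    have "norm (A 0 - A' 0) \<le> 0" using ends_close[OF en[OF z]] by simp
    then have "A 0 = A' 0" by simp
    then show ?thesis using nA[OF z] by (simp add: norm_eq_1)
  qed
  have gc: "0 < ?g c0"
  proof -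
    have m: "c0 \<in> {0..c0}" using c0 by simp
    interpret frenet \<alpha> c0 "f c0" "p c0" "q c0" by (rule fr[OF m])
    \<comment> \<open>Distinctness of the ends is needed at the single value c0: it makes the angle
      there positive, and smaller angles are then reached by continuity from the angle 0 at c =
      0.\<close>
    have "A c0 \<noteq> A' c0" by (rule ends_distinct[OF en[OF m] c0(1) _ _ cb(3)]) (use small0 \<epsilon> c0 in auto)
    then have "A c0 \<bullet> A' c0 \<noteq> 1" 
    proof -
      have "(A c0 - A' c0) \<bullet> (A c0 - A' c0) = 2 - 2 * (A c0 \<bullet> A' c0)"
        using nA[OF m] by (simp add: inner_diff_left inner_diff_right inner_commute norm_eq_1)
      moreover have "(A c0 - A' c0) \<bullet> (A c0 - A' c0) \<noteq> 0" using \<open>A c0 \<noteq> A' c0\<close> by simp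
      ultimately show ?thesis by linarith
    qed
    then have "A c0 \<bullet> A' c0 < 1" using ang[OF m] by (simp add: abs_le_iff)
    then show ?thesis using arccos_less_arccos[of "A c0 \<bullet> A' c0" 1] ang[OF m] by (simp add: abs_le_iff)
  qed
  \<comment> \<open>The ends \<open>A c\<close> and \<open>A' c\<close> were fixed once for all as
    functions of c. So a choice operator gives a rotation that depends on the given data only
    through Ap, Am and c, with \<alpha> fixed throughout.\<close>
  define Rot where "Rot Ap Am c = (SOME R. rotation_matrix R \<and> R *v A c = Ap \<and> R *v A' c = Am)" for Ap Am c
  show ?thesis
  \<comment> \<open>\<open>L1\<close> may be any positive number that leaves room below \<epsilon>,
    \<open>L2\<close> is the slope in \<open>X_bound\<close>, the lower bound - 1 / 2 lies below - c
    exp (1 / \<alpha>), and the largest admissible angle is the one attained at c0.\<close>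
  proof (rule exI[of _ "\<epsilon> / 4"], rule exI[of _ "1 + 2 * ?k"], rule exI[of _ "- (1 / 2)"], rule exI[of _ "?g c0"],
      rule exI[of _ Rot], intro conjI allI impI)
    show "0 < \<epsilon> / 4" "0 < 1 + 2 * ?k" "- 1 < - (1 / 2 :: real)" "- (1 / 2) < (0 :: real)" "0 < ?g c0" using \<epsilon> gc by (simp_all add: add_pos_pos)
    fix Ap Am :: "real^3"
    assume nAp: "norm Ap = 1" "norm Am = 1" and a: "0 < sphere_angle Ap Am" "sphere_angle Ap Am \<le> ?g c0"
    \<comment> \<open>The angle as a function of c is continuous, vanishes at 0 and reaches the
      largest admissible value at c0. No monotonicity is claimed; any c with the right angle will
      do.\<close>
    have "\<exists>c\<ge>0. c \<le> c0 \<and> ?g c = sphere_angle Ap Am"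
      using IVT'[of ?g 0 "sphere_angle Ap Am" c0] a g0 c0(1) cont by simp
    then obtain c where c: "0 \<le> c" "c \<le> c0" and gA: "?g c = sphere_angle Ap Am" by blast
    have cp: "0 < c"
    proof (rule ccontr)
      assume "\<not> 0 < c"
      then have "c = 0" using c by simp
      then show False using gA g0 a by simp
    qed
    have cm: "c \<in> {0..c0}" using c by simp
    have "\<bar>Ap \<bullet> Am\<bar> \<le> 1" using Cauchy_Schwarz_ineq2[of Ap Am] nAp by simp
    then have "A c \<bullet> A' c = Ap \<bullet> Am" using gA ang[OF cm] arccos_eq_iff unfolding sphere_angle_def by blast
    then have "\<exists>R. rotation_matrix R \<and> R *v A c = Ap \<and> R *v A' c = Am" using nA[OF cm] nAp by (intro rotation_pair) auto
    from someI_ex[OF this] have R: "rotation_matrix (Rot Ap Am c)" "Rot Ap Am c *v A c = Ap" "Rot Ap Am c *v A' c = Am"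
      unfolding Rot_def by auto
    interpret F: frenet \<alpha> c "f c" "p c" "q c" by (rule fr[OF cm])
    interpret W: wave \<alpha> F.\<beta> c ?k F.w "\<lambda>s. Rot Ap Am c *v f c s" "\<lambda>s. Rot Ap Am c *v p c s" "\<lambda>s. Rot Ap Am c *v q c s" Ap Am
      using F.wave[OF R(1) en[OF cm]] unfolding R(2,3) .
    have \<beta>: "F.\<beta> = ?\<beta>" by (simp add: F.\<beta>_def)
    \<comment> \<open>Rotations preserve distances, so the bound 2 c exp (1 / \<alpha>) for the ends
      of the profile applies to Ap and Am. Together with \<open>small0\<close> the smallness
      condition holds with 3 / 4 in place of 1.\<close>
    have close: "norm (Ap - Am) \<le> 1 / 4"
    proof -
      have "norm (Ap - Am) = norm (A c - A' c)"
        using rotation_isometry(2)[OF R(1), of "A c - A' c"] R by (simp add: matrix_vector_mult_diff_distrib)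
      also have "\<dots> \<le> 2 * (c * ?k)" by (rule F.ends_close[OF en[OF cm]])
      finally show ?thesis using cb(1)[OF c] by linarith
    qed
    show "\<exists>m. llg_solution \<alpha> (step_data Ap Am) m \<and>
         (\<exists>c. 0 < c \<and> c < sqrt \<alpha> / (2 * sqrt pi) \<and>
            rotation_matrix (Rot Ap Am c) \<and>
            (\<forall>z\<in>half_plane. m z = Rot Ap Am c *v self_similar \<alpha> c z) \<and>
            X_seminorm m \<le> ennreal (\<epsilon> / 4 + (1 + 2 * ?k) * c) \<and>
            (0 \<le> Ap $ 3 \<and> 0 \<le> Am $ 3 \<longrightarrow> third_component_ge (- (1 / 2)) m) \<and>
            (\<forall>m'. llg_solution \<alpha> (step_data Ap Am) m' \<and>
               third_component_ge (- (1 / 2)) m' \<and> X_seminorm m' \<le> ennreal (\<epsilon> / 4 + (1 + 2 * ?k) * c) \<longrightarrow>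
               (AE z in lborel. z \<in> half_plane \<longrightarrow> m' z = m z)))"
    proof (intro exI[of _ W.n] exI[of _ c] conjI allI impI ballI)
      show "llg_solution \<alpha> (step_data Ap Am) W.n" by (rule W.n_llg_solution)
      show "0 < c" "c < sqrt \<alpha> / (2 * sqrt pi)" "rotation_matrix (Rot Ap Am c)" by (fact cp cb(4)[OF c] R(1))+
      show "W.n z = Rot Ap Am c *v self_similar \<alpha> c z" for z
        by (cases z) (simp add: W.n_def self_similar_def F.profile_eq)
      show "X_seminorm W.n \<le> ennreal (\<epsilon> / 4 + (1 + 2 * ?k) * c)"
        using \<epsilon> by (intro order_trans[OF W.X_bound] ennreal_leI) simp
      show "third_component_ge (- (1 / 2)) W.n" if "0 \<le> Ap $ 3 \<and> 0 \<le> Am $ 3"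
        unfolding third_component_ge_def
      proof (intro AE_I2 impI)
        fix z show "- (1 / 2) \<le> W.n z $ 3" using W.third_component[of z] that cb(1)[OF c] by linarith
      qed
      fix m' assume m': "llg_solution \<alpha> (step_data Ap Am) m' \<and>
               third_component_ge (- (1 / 2)) m' \<and> X_seminorm m' \<le> ennreal (\<epsilon> / 4 + (1 + 2 * ?k) * c)"
      \<comment> \<open>Strictness is what \<open>tame_representative\<close> requires in order to
        select a version from the infimum.\<close>
      have "ennreal (\<epsilon> / 4 + (1 + 2 * ?k) * c) < ennreal \<epsilon>" using cb(2)[OF c] \<epsilon> by (intro ennreal_lessI) auto
      then have X: "X_seminorm m' < ennreal \<epsilon>" using m' by (meson le_less_trans)
      from tame_representative[OF assms nAp \<epsilon>(1) conjunct1[OF m'] X]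
      obtain M W where t: "tame \<alpha> ?\<beta> \<epsilon> Ap Am M W" and ae: "AE z in lborel. 0 < snd z \<longrightarrow> m' z = M z" by (elim exE conjE)
      have "tame_small \<alpha> F.\<beta> \<epsilon> Ap Am M W"
        unfolding tame_small_def tame_small_axioms_def \<beta> using t close small0 by linarith
      from ae W.unique[OF this cb(3)[OF c]] show "AE z in lborel. z \<in> half_plane \<longrightarrow> m' z = W.n z"
        by eventually_elim simp
    qed
  qed
qed

end
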